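(* Let $p,q\ge1$, $n=p+q$, and let $\gamma$ be a $(p,q)$-clan. Then $$\Upsilon_\gamma(x;y)=\sum_{w\in S_n}c_{\gamma,w}(y)\,\mathfrak{S}_w(x;y),$$ where, writing $\gamma'=w*\gamma$, $c_{\gamma,w}(y)=\mathfrak{s}_{\gamma'}(y_1,\ldots,y_n)$ if $v_{\gamma'}=\mathsf{id}$ and $\ell(\gamma')-\ell(\gamma)=\ell(w)$, and $c_{\gamma,w}(y)=0$ otherwise.
   Context: Clans. A $(p,q)$-clan $\gamma$ consists of nodes $1,\ldots,n$, a set of pairwise disjoint pairs $(i,j)$, $1\le i<j\le n$, called arcs ($i$ left endpoint, $j$ right endpoint), and a sign $+$ or $-$ on each node not on an arc, with $\#\{+\}-\#\{-\}=p-q$. Arcs $(i,j),(k,l)$ cross if $i<k<j<l$. Matchless means no arcs. $v_\gamma\in S_n$: label nodes that are $+$ or left endpoints by $1,\ldots,p$ left to right, and nodes that are $-$ or right endpoints by $p+1,\ldots,n$ left to right; $v_\gamma(i)$ = label of node $i$. $u_\gamma\in S_n$: label nodes that are $-$ or left endpoints by $1,\ldots,q$ left to right, nodes that are $+$ or right endpoints by $q+1,\ldots,n$ left to right; $u_\gamma(i)$ = label of node $i$. $\mathsf{id}$ is the identity permutation. Young diagram and BPD fragments. Boxes $(i,j)$ of the $p\times q$ rectangle: row $i$ from top, column $j$ from left. Take the lattice path from the NE to the SW corner whose $k$-th step is down if node $k$ is $+$ or a left endpoint and left if node $k$ is $-$ or a right endpoint; $\lambda(\gamma)$ is the set of boxes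 northwest of it; its $k$-th step is the $k$-th boundary edge. A BPD fragment of $\gamma$ fills each box of $\lambda(\gamma)$ with one of six tiles (empty; horizontal segment; vertical segment; cross; elbow joining west and north edges; elbow joining south and east edges) so that segments match across edges shared by boxes of $\lambda(\gamma)$; no segment touches the north edge of a row-1 box or the west edge of a column-1 box; hence pipes each join two boundary edges, entering through a horizontal edge and leaving through a vertical one; any two pipes cross at most once; boundary edges $k<l$ are joined by a pipe iff $(k,l)$ is an arc of $\gamma$. $\mathfrak{s}_\gamma(x_1,\ldots,x_n)=\sum_{\pi}\prod_{(i,j)\text{ empty in }\pi}(x_i-x_{n-j+1})$, sum over BPD fragments $\pi$ of $\gamma$. Double Schubert polynomials: $\mathfrak{S}_{w_0}(x;y)=\prod_{i+j\le n}(x_i-y_j)$, $\mathfrak{S}_{ws_i}=\partial_i\mathfrak{S}_w$ if $\ell(ws_i)<\ell(w)$, with $\partial_if=(f-f|_{x_i\leftrightarrow x_{i+1}})/(x_i-x_{i+1})$. Length and 0-Hecke action: $\ell(\gamma)=\sum_{\text{arcs }(i,j)}(j-i)-\#\{\text{crossing pairs}\}$. For $1\le i\le n-1$: if nodes $i,i+1$ have opposite signs, $s_i*\gamma$ adds the arc $(i,i+1)$; otherwise let $\gamma'$ be $\gamma$ with nodes $i,i+1$ swapped; $s_i*\gamma=\gamma'$ if $\ell(\gamma')>\ell(\gamma)$ and $s_i*\gamma=\gamma$ otherwise. For $w\in S_n$, $w*\gamma=s_{i_1}*\cdots*s_{i_l}*\gamma$ for a reduced word $(i_1,\ldots,i_l)$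 of $w$ (independent of the reduced word). $\Upsilon_\gamma(x;y)$ (Wyser–Yong): $\Upsilon_\gamma=\mathfrak{S}_{u_\gamma}(x;y_n,\ldots,y_1)\mathfrak{S}_{v_\gamma}(x;y)$ for $\gamma$ matchless, and $\Upsilon_{s_i*\gamma}=\partial_i\Upsilon_\gamma$ whenever $\ell(s_i*\gamma)>\ell(\gamma)$; it represents the torus-equivariant class of the closure of the corresponding $GL_p\times GL_q$-orbit in $Fl_n$. *)

theory Defs
  imports
    "HOL-Library.Poly_Mapping"
    "HOL-Library.FuncSet"
    "HOL-Combinatorics.Permutations"
begin

section \<open>Polynomials in the variables x and y\<close>

text \<open>
  Integer polynomials are finitely supported functions from monomials to coefficients, and
  monomials are finitely supported exponent functions on variables. The linear order on variables
  has no mathematical role: the library only derives the class \<^class>\<open>idom\<close> for this type from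
  linearly ordered monomials.
\<close>

datatype var = XVar nat | YVar nat

instantiation var :: linorder
begin

fun less_eq_var :: "var \<Rightarrow> var \<Rightarrow> bool" where
  "XVar i \<le> XVar j \<longleftrightarrow> i \<le> j"
| "XVar i \<le> YVar j \<longleftrightarrow> True"
| "YVar i \<le> XVar j \<longleftrightarrow> False"
| "YVar i \<le> YVar j \<longleftrightarrow> i \<le> j"

definition less_var :: "var \<Rightarrow> var \<Rightarrow> bool" where
  "v < w \<longleftrightarrow> v \<le> w \<and> \<not> w \<le> (v :: var)"

instance
proof
  fix u v w :: var
  show "v \<le> v" by (cases v) auto
  show "u \<le> v \<Longrightarrow> v \<le> w \<Longrightarrow> u \<le> w" by (cases u; cases v; cases w) auto
  show "u \<le> v \<Longrightarrow> v \<le> u \<Longrightarrow> u = v" by (cases u; cases v) auto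
  show "u \<le> v \<or> v \<le> u" by (cases u; cases v) auto
qed (simp add: less_var_def)

end

type_synonym xypoly = "(var \<Rightarrow>\<^sub>0 nat) \<Rightarrow>\<^sub>0 int"

definition Var :: "var \<Rightarrow> xypoly" where
  "Var v = Poly_Mapping.single (Poly_Mapping.single v 1) 1"

abbreviation X :: "nat \<Rightarrow> xypoly" where "X i \<equiv> Var (XVar i)"
abbreviation Y :: "nat \<Rightarrow> xypoly" where "Y j \<equiv> Var (YVar j)"

text \<open>
  The coefficient of a monomial m in \<open>swap_x i f\<close> is the coefficient in f of m with the exponents
  of the i-th and the (i+1)-st x-variable exchanged.
\<close>
definition swap_x :: "nat \<Rightarrow> xypoly \<Rightarrow> xypoly" where
  "swap_x i f =
     Poly_Mapping.map_key (Poly_Mapping.map_key (transpose (XVar i) (XVar (Suc i)))) f"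

text \<open>
  Exact division by a nonzero element of a domain: there is at most one quotient, and
  \<open>f - swap_x i f\<close> is always divisible.
\<close>
definition divided_diff :: "nat \<Rightarrow> xypoly \<Rightarrow> xypoly" where
  "divided_diff i f = (THE g. (X i - X (Suc i)) * g = f - swap_x i f)"


section \<open>Permutations and double Schubert polynomials\<close>

text \<open>
  Elements of \<open>S\<^sub>n\<close> are functions w with \<open>w permutes {1..n}\<close>, multiplied by composition; so
  \<open>w \<circ> simple_refl i\<close> exchanges the values at the positions i and i+1.
\<close>

definition simple_refl :: "nat \<Rightarrow> nat \<Rightarrow> nat" where
  "simple_refl i = transpose i (Suc i)"

definition perm_length :: "nat \<Rightarrow> (nat \<Rightarrow> nat) \<Rightarrow> nat" where
  "perm_length n w = card {(i, j). 1 \<le> i \<and> i < j \<and> j \<le> n \<and> w j < w i}"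

definition reduced_word :: "nat \<Rightarrow> (nat \<Rightarrow> nat) \<Rightarrow> nat list \<Rightarrow> bool" where
  "reduced_word n w is \<longleftrightarrow>
     set is \<subseteq> {1..<n} \<and> foldr (\<circ>) (map simple_refl is) id = w \<and> length is = perm_length n w"

definition longest_perm :: "nat \<Rightarrow> nat \<Rightarrow> nat" where
  "longest_perm n i = (if i \<in> {1..n} then Suc n - i else i)"

text \<open>
  The second alphabet is a parameter, so that \<open>\<SS>\<^sub>w(x; y\<^sub>n, \<dots>, y\<^sub>1)\<close> is
  \<open>dschubert n (\<lambda>j. Y (Suc n - j)) w\<close>.
\<close>
inductive is_dschubert :: "nat \<Rightarrow> (nat \<Rightarrow> xypoly) \<Rightarrow> (nat \<Rightarrow> nat) \<Rightarrow> xypoly \<Rightarrow> bool"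
  for n :: nat and y :: "nat \<Rightarrow> xypoly" where
  longest: "is_dschubert n y (longest_perm n)
     (\<Prod>(i, j) \<in> {(i, j). 1 \<le> i \<and> 1 \<le> j \<and> i + j \<le> n}. X i - y j)"
| descent: "is_dschubert n y w f \<Longrightarrow> 1 \<le> i \<Longrightarrow> i < n \<Longrightarrow>
     perm_length n (w \<circ> simple_refl i) < perm_length n w \<Longrightarrow>
     is_dschubert n y (w \<circ> simple_refl i) (divided_diff i f)"

definition dschubert :: "nat \<Rightarrow> (nat \<Rightarrow> xypoly) \<Rightarrow> (nat \<Rightarrow> nat) \<Rightarrow> xypoly" where
  "dschubert n y w = (THE f. is_dschubert n y w f)"


section \<open>Clans\<close>

record clan =
  arcs :: "(nat \<times> nat) set"
  pluses :: "nat set"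
  minuses :: "nat set"

definition lefts :: "clan \<Rightarrow> nat set" where "lefts \<gamma> = fst ` arcs \<gamma>"
definition rights :: "clan \<Rightarrow> nat set" where "rights \<gamma> = snd ` arcs \<gamma>"

definition is_clan :: "nat \<Rightarrow> nat \<Rightarrow> clan \<Rightarrow> bool" where
  "is_clan p q \<gamma> \<longleftrightarrow>
     (\<forall>(i, j) \<in> arcs \<gamma>. 1 \<le> i \<and> i < j \<and> j \<le> p + q) \<and>
     (\<forall>a \<in> arcs \<gamma>. \<forall>b \<in> arcs \<gamma>. a \<noteq> b \<longrightarrow> {fst a, snd a} \<inter> {fst b, snd b} = {}) \<and>
     pluses \<gamma> \<inter> minuses \<gamma> = {} \<and>
     pluses \<gamma> \<union> minuses \<gamma> = {1..p + q} - (lefts \<gamma> \<union> rights \<gamma>) \<and>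
     int (card (pluses \<gamma>)) - int (card (minuses \<gamma>)) = int p - int q"

definition matchless :: "clan \<Rightarrow> bool" where
  "matchless \<gamma> \<longleftrightarrow> arcs \<gamma> = {}"

definition crossings :: "clan \<Rightarrow> ((nat \<times> nat) \<times> (nat \<times> nat)) set" where
  "crossings \<gamma> =
     {((i, j), (k, l)). (i, j) \<in> arcs \<gamma> \<and> (k, l) \<in> arcs \<gamma> \<and> i < k \<and> k < j \<and> j < l}"

definition clan_length :: "clan \<Rightarrow> int" where
  "clan_length \<gamma> = (\<Sum>(i, j) \<in> arcs \<gamma>. int j - int i) - int (card (crossings \<gamma>))"

definition v_perm :: "nat \<Rightarrow> nat \<Rightarrow> clan \<Rightarrow> nat \<Rightarrow> nat" where
  "v_perm p q \<gamma> i =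
     (if i \<in> pluses \<gamma> \<union> lefts \<gamma> then card {k \<in> pluses \<gamma> \<union> lefts \<gamma>. k \<le> i}
      else if i \<in> minuses \<gamma> \<union> rights \<gamma> then p + card {k \<in> minuses \<gamma> \<union> rights \<gamma>. k \<le> i}
      else i)"

definition u_perm :: "nat \<Rightarrow> nat \<Rightarrow> clan \<Rightarrow> nat \<Rightarrow> nat" where
  "u_perm p q \<gamma> i =
     (if i \<in> minuses \<gamma> \<union> lefts \<gamma> then card {k \<in> minuses \<gamma> \<union> lefts \<gamma>. k \<le> i}
      else if i \<in> pluses \<gamma> \<union> rights \<gamma> then q + card {k \<in> pluses \<gamma> \<union> rights \<gamma>. k \<le> i}
      else i)"

definition swap_nodes :: "nat \<Rightarrow> clan \<Rightarrow> clan" where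
  "swap_nodes i \<gamma> =
     (let t = simple_refl i in
        \<lparr>arcs = (\<lambda>(a, b). (min (t a) (t b), max (t a) (t b))) ` arcs \<gamma>,
         pluses = t ` pluses \<gamma>,
         minuses = t ` minuses \<gamma>\<rparr>)"

definition s_act :: "nat \<Rightarrow> clan \<Rightarrow> clan" where
  "s_act i \<gamma> =
     (if i \<in> pluses \<gamma> \<and> Suc i \<in> minuses \<gamma> \<or> i \<in> minuses \<gamma> \<and> Suc i \<in> pluses \<gamma>
      then \<lparr>arcs = insert (i, Suc i) (arcs \<gamma>),
            pluses = pluses \<gamma> - {i, Suc i},
            minuses = minuses \<gamma> - {i, Suc i}\<rparr>
      else if clan_length (swap_nodes i \<gamma>) > clan_length \<gamma> then swap_nodes i \<gamma>
      else \<gamma>)"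

text \<open>The result does not depend on which reduced word of w is chosen.\<close>
definition hecke_act :: "nat \<Rightarrow> (nat \<Rightarrow> nat) \<Rightarrow> clan \<Rightarrow> clan" where
  "hecke_act n w \<gamma> = foldr s_act (SOME is. reduced_word n w is) \<gamma>"


section \<open>BPD fragments\<close>

text \<open>
  \<open>HEdge i j\<close> is the south edge of box (i, j), which is the north edge of box (i+1, j);
  \<open>VEdge i j\<close> is the east edge of box (i, j), which is the west edge of box (i, j+1).
  An index 0 marks the edges on the north and the west side of the rectangle.
\<close>
datatype edge = HEdge nat nat | VEdge nat nat

fun north :: "nat \<times> nat \<Rightarrow> edge" where "north (i, j) = HEdge (i - 1) j"
fun south :: "nat \<times> nat \<Rightarrow> edge" where "south (i, j) = HEdge i j"
fun west :: "nat \<times> nat \<Rightarrow> edge" where "west (i, j) = VEdge i (j - 1)"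
fun east :: "nat \<times> nat \<Rightarrow> edge" where "east (i, j) = VEdge i j"

text \<open>
  The k-th step of the lattice path from the NE corner (0, q) to the SW corner (p, 0): d is the
  number of down steps among the first k steps, c the horizontal position before step k. A down
  step is the segment of the column line c next to row d, a left step the segment of the row line d
  under column c.
\<close>
definition boundary_edge :: "nat \<Rightarrow> clan \<Rightarrow> nat \<Rightarrow> edge" where
  "boundary_edge q \<gamma> k =
     (let d = card {m \<in> pluses \<gamma> \<union> lefts \<gamma>. m \<le> k};
          c = q - card {m \<in> minuses \<gamma> \<union> rights \<gamma>. m < k}
      in if k \<in> pluses \<gamma> \<union> lefts \<gamma> then VEdge d c else HEdge d c)"

text \<open>
  A box of row i is northwest of the path iff it lies weakly left of the unique vertical boundary
  edge in row i.
\<close>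
definition diagram :: "nat \<Rightarrow> nat \<Rightarrow> clan \<Rightarrow> (nat \<times> nat) set" where
  "diagram p q \<gamma> =
     {(i, j). 1 \<le> i \<and> 1 \<le> j \<and> (\<exists>k \<in> {1..p + q}. \<exists>c. boundary_edge q \<gamma> k = VEdge i c \<and> j \<le> c)}"

datatype tile = Blank | Horizontal | Vertical | Cross | ElbowWN | ElbowSE

text \<open>The pairs of edges of a box joined by the segments of its tile.\<close>
fun segments :: "nat \<times> nat \<Rightarrow> tile \<Rightarrow> (edge \<times> edge) set" where
  "segments b Blank = {}"
| "segments b Horizontal = {(west b, east b)}"
| "segments b Vertical = {(south b, north b)}"
| "segments b Cross = {(west b, east b), (south b, north b)}"
| "segments b ElbowWN = {(west b, north b)}"
| "segments b ElbowSE = {(south b, east b)}"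

definition touches :: "nat \<times> nat \<Rightarrow> tile \<Rightarrow> edge \<Rightarrow> bool" where
  "touches b t e \<longleftrightarrow> e \<in> Field (segments b t)"

text \<open>The pipe through e: all edges connected to e by segments.\<close>
definition pipe :: "(nat \<times> nat) set \<Rightarrow> (nat \<times> nat \<Rightarrow> tile) \<Rightarrow> edge \<Rightarrow> edge set" where
  "pipe \<Lambda> \<pi> e = (let R = \<Union>b \<in> \<Lambda>. segments b (\<pi> b) in (R \<union> R\<inverse>)\<^sup>* `` {e})"

definition bpd_fragments :: "nat \<Rightarrow> nat \<Rightarrow> clan \<Rightarrow> (nat \<times> nat \<Rightarrow> tile) set" where
  "bpd_fragments p q \<gamma> = (let \<Lambda> = diagram p q \<gamma> in
     {\<pi> \<in> \<Lambda> \<rightarrow>\<^sub>E UNIV.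
        (\<forall>i j. (i, j) \<in> \<Lambda> \<and> (i, Suc j) \<in> \<Lambda> \<longrightarrow>
           (touches (i, j) (\<pi> (i, j)) (VEdge i j) \<longleftrightarrow>
            touches (i, Suc j) (\<pi> (i, Suc j)) (VEdge i j))) \<and>
        (\<forall>i j. (i, j) \<in> \<Lambda> \<and> (Suc i, j) \<in> \<Lambda> \<longrightarrow>
           (touches (i, j) (\<pi> (i, j)) (HEdge i j) \<longleftrightarrow>
            touches (Suc i, j) (\<pi> (Suc i, j)) (HEdge i j))) \<and>
        (\<forall>j. (1, j) \<in> \<Lambda> \<longrightarrow> \<not> touches (1, j) (\<pi> (1, j)) (north (1, j))) \<and>
        (\<forall>i. (i, 1) \<in> \<Lambda> \<longrightarrow> \<not> touches (i, 1) (\<pi> (i, 1)) (west (i, 1))) \<and>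
        (\<forall>b \<in> \<Lambda>. \<forall>b' \<in> \<Lambda>. \<pi> b = Cross \<and> \<pi> b' = Cross \<and>
           {pipe \<Lambda> \<pi> (west b), pipe \<Lambda> \<pi> (south b)} =
           {pipe \<Lambda> \<pi> (west b'), pipe \<Lambda> \<pi> (south b')} \<longrightarrow> b = b') \<and>
        (\<forall>k l. 1 \<le> k \<and> k < l \<and> l \<le> p + q \<longrightarrow>
           (boundary_edge q \<gamma> l \<in> pipe \<Lambda> \<pi> (boundary_edge q \<gamma> k) \<longleftrightarrow> (k, l) \<in> arcs \<gamma>))})"

definition frag_poly :: "nat \<Rightarrow> nat \<Rightarrow> clan \<Rightarrow> (nat \<Rightarrow> xypoly) \<Rightarrow> xypoly" where
  "frag_poly p q \<gamma> z =
     (\<Sum>\<pi> \<in> bpd_fragments p q \<gamma>.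
        \<Prod>(i, j) \<in> {b \<in> diagram p q \<gamma>. \<pi> b = Blank}. z i - z (p + q - j + 1))"


section \<open>Wyser--Yong polynomials\<close>

inductive is_Upsilon :: "nat \<Rightarrow> nat \<Rightarrow> clan \<Rightarrow> xypoly \<Rightarrow> bool" for p q :: nat where
  matchless: "is_clan p q \<gamma> \<Longrightarrow> matchless \<gamma> \<Longrightarrow>
     is_Upsilon p q \<gamma>
       (dschubert (p + q) (\<lambda>j. Y (Suc (p + q) - j)) (u_perm p q \<gamma>) *
        dschubert (p + q) Y (v_perm p q \<gamma>))"
| step: "is_Upsilon p q \<gamma> f \<Longrightarrow> 1 \<le> i \<Longrightarrow> i < p + q \<Longrightarrow>
     clan_length (s_act i \<gamma>) > clan_length \<gamma> \<Longrightarrow>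
     is_Upsilon p q (s_act i \<gamma>) (divided_diff i f)"

definition Upsilon :: "nat \<Rightarrow> nat \<Rightarrow> clan \<Rightarrow> xypoly" where
  "Upsilon p q \<gamma> = (THE f. is_Upsilon p q \<gamma> f)"

end

theory Submission
  imports Defs "HOL-Computational_Algebra.Polynomial"
begin

text \<open>
  A polynomial whose degree in \<open>x\<^sub>i\<close> is at most \<open>n - i\<close> is the sum over w of the products of
  \<open>(\<partial>\<^sub>w f)(y; y)\<close> and \<open>\<SS>\<^sub>w(x; y)\<close>. Since \<open>\<partial>\<^sub>w \<Upsilon>\<^sub>\<gamma>\<close> is \<open>\<Upsilon>\<close> of \<open>w * \<gamma>\<close> or 0, according to whether the
  lengths add up, it remains to see that the localization \<open>\<Upsilon>\<^sub>\<gamma>(y; y)\<close> is the fragment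
  polynomial of \<open>\<gamma>\<close> if \<open>v\<^sub>\<gamma>\<close> is the identity, and 0 otherwise. That \<open>\<Upsilon>\<^sub>\<gamma>\<close> is well defined and
  that \<open>\<partial>\<^sub>i\<close> kills it when \<open>s\<^sub>i * \<gamma> = \<gamma>\<close> both follow from a closed formula, \<open>Phi\<close> below.

  The vanishing holds because a permutation that violates a rank condition of \<open>\<gamma>\<close> annihilates
  \<open>\<Upsilon>\<^sub>\<gamma>\<close>. If \<open>v\<^sub>\<gamma>\<close> is the identity, then for \<open>i > p\<close> the symmetry of \<open>\<Upsilon>\<^sub>\<gamma>\<close> in \<open>y\<^sub>i, y\<^sub>i\<^sub>+\<^sub>1\<close> gives
  \<open>(y\<^sub>i - y\<^sub>i\<^sub>+\<^sub>1) F(s\<^sub>i * \<gamma>) = F(\<gamma>) - s\<^sub>i F(\<gamma>)\<close> for the localizations F. Fragments satisfy the same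
  recursion: colouring pipes by the row of their exit turns the fragment polynomial into a
  product of transfer matrices, one for each column, and the recursion is a Yang--Baxter equation
  for two adjacent columns. If the mates of the nodes \<open>p + 1, \<dots>, n\<close> increase, the recursion
  starts: there is a single fragment, and both sides are the same product of linear factors.
\<close>

section \<open>Substitution homomorphisms\<close>

text \<open>Two obstacles shape the proof. \<open>Upsilon\<close> is a definite description over all
  derivations of a clan, so the derivations have to be shown to agree. One canonical chain from a
  matchless clan is fixed for every clan, and each step of the recursion is compared with it. Beyond
  the commutation and braid relations this uses two facts: a divided difference does not distinguish
  \<open>+-\<close> from \<open>-+\<close>, and on \<open>+-+\<close> and \<open>-+-\<close> two
  neighbouring divided differences commute. The other obstacle is that crossing at most once is a
  global condition on a fragment. The exits of the pipes are totally ordered, and a sweep of the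
  rectangle from its east border, where pipes appear in that order, shows that no two pipes cross
  twice iff the vertical pipe has the larger colour at every cross. This condition concerns single
  boxes, so matrices can express it. In the interpolation formula the degree bound enters at one
  place: a polynomial symmetric in \<open>x_1, ..., x_n\<close> and of degree 0 in
  \<open>x_n\<close> does not contain these variables at all.\<close>

definition eval_monom :: "(var \<Rightarrow> 'a::comm_ring_1) \<Rightarrow> (var \<Rightarrow>\<^sub>0 nat) \<Rightarrow> 'a" where
  "eval_monom \<sigma> m = (\<Prod>v\<in>Poly_Mapping.keys m. \<sigma> v ^ Poly_Mapping.lookup m v)"

definition subst :: "(var \<Rightarrow> 'a::comm_ring_1) \<Rightarrow> xypoly \<Rightarrow> 'a" where
  "subst \<sigma> f = (\<Sum>m\<in>Poly_Mapping.keys f. of_int (Poly_Mapping.lookup f m) * eval_monom \<sigma> m)"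

lemma eval_monom_superset:
  assumes "finite A" "Poly_Mapping.keys m \<subseteq> A"
  shows "eval_monom \<sigma> m = (\<Prod>v\<in>A. \<sigma> v ^ Poly_Mapping.lookup m v)"
  unfolding eval_monom_def using assms
  by (intro prod.mono_neutral_left) (auto simp: in_keys_iff)

lemma eval_monom_0 [simp]: "eval_monom \<sigma> 0 = 1"
  by (simp add: eval_monom_def)

lemma eval_monom_add: "eval_monom \<sigma> (m + m') = eval_monom \<sigma> m * eval_monom \<sigma> m'"
proof -
  let ?A = "Poly_Mapping.keys m \<union> Poly_Mapping.keys m'"
  have "Poly_Mapping.keys (m + m') \<subseteq> ?A" by (rule Poly_Mapping.keys_add)
  then show ?thesis
    by (simp add: eval_monom_superset[of ?A] lookup_add power_add prod.distrib)
qed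

lemma subst_superset:
  assumes "finite A" "Poly_Mapping.keys f \<subseteq> A"
  shows "subst \<sigma> f = (\<Sum>m\<in>A. of_int (Poly_Mapping.lookup f m) * eval_monom \<sigma> m)"
  unfolding subst_def using assms
  by (intro sum.mono_neutral_left) (auto simp: in_keys_iff)

lemma subst_0 [simp]: "subst \<sigma> 0 = 0"
  by (simp add: subst_def)

lemma subst_add [simp]: "subst \<sigma> (f + g) = subst \<sigma> f + subst \<sigma> g"
proof -
  let ?A = "Poly_Mapping.keys f \<union> Poly_Mapping.keys g"
  have "Poly_Mapping.keys (f + g) \<subseteq> ?A" by (rule Poly_Mapping.keys_add)
  then show ?thesis
    by (simp add: subst_superset[of ?A] lookup_add distrib_right sum.distrib)
qed

lemma subst_uminus [simp]: "subst \<sigma> (- f) = - subst \<sigma> f"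
proof -
  have "subst \<sigma> (f + - f) = subst \<sigma> f + subst \<sigma> (- f)" by (rule subst_add)
  then show ?thesis by (simp add: minus_unique)
qed

lemma subst_diff [simp]: "subst \<sigma> (f - g) = subst \<sigma> f - subst \<sigma> g"
  using subst_add[of \<sigma> f "- g"] by simp

lemma subst_sum [simp]: "subst \<sigma> (sum f A) = (\<Sum>a\<in>A. subst \<sigma> (f a))"
  by (induction A rule: infinite_finite_induct) auto

lemma subst_single [simp]: "subst \<sigma> (Poly_Mapping.single m c) = of_int c * eval_monom \<sigma> m"
  by (cases "c = 0") (simp_all add: subst_def)

lemma xypoly_eq_sum: "(f :: xypoly) = (\<Sum>m\<in>Poly_Mapping.keys f. Poly_Mapping.single m (Poly_Mapping.lookup f m))"
proof (rule poly_mapping_eqI)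
  fix k
  have "Poly_Mapping.lookup f k = (\<Sum>m\<in>Poly_Mapping.keys f. Poly_Mapping.lookup f m when m = k)"
    by (simp add: when_def in_keys_iff)
  then show "Poly_Mapping.lookup f k =
      Poly_Mapping.lookup (\<Sum>m\<in>Poly_Mapping.keys f. Poly_Mapping.single m (Poly_Mapping.lookup f m)) k"
    by (simp add: lookup_sum lookup_single)
qed

lemma subst_mult [simp]: "subst \<sigma> (f * g) = subst \<sigma> f * subst \<sigma> g"
proof -
  have 1: "subst \<sigma> (Poly_Mapping.single m c * g) = of_int c * eval_monom \<sigma> m * subst \<sigma> g" for m c
  proof -
    have "Poly_Mapping.single m c * g =
        (\<Sum>k\<in>Poly_Mapping.keys g. Poly_Mapping.single m c * Poly_Mapping.single k (Poly_Mapping.lookup g k))"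
      by (subst (1) xypoly_eq_sum[of g]) (simp add: sum_distrib_left)
    then show ?thesis
      by (simp add: mult_single eval_monom_add) (simp add: subst_def sum_distrib_left mult_ac)
  qed
  have "f * g = (\<Sum>m\<in>Poly_Mapping.keys f. Poly_Mapping.single m (Poly_Mapping.lookup f m) * g)"
    by (subst (1) xypoly_eq_sum[of f]) (simp add: sum_distrib_right)
  then show ?thesis
    by (simp add: 1) (simp add: subst_def sum_distrib_right)
qed

lemma subst_1 [simp]: "subst \<sigma> 1 = 1"
  using subst_single[of \<sigma> 0 1] by (simp del: subst_single)

lemma subst_prod [simp]: "subst \<sigma> (prod f A) = (\<Prod>a\<in>A. subst \<sigma> (f a))"
  by (induction A rule: infinite_finite_induct) auto

lemma subst_Var [simp]: "subst \<sigma> (Var v) = \<sigma> v"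
  by (simp add: Var_def eval_monom_def)

lemma subst_of_int [simp]: "subst \<sigma> (of_int c) = of_int c"
proof -
  have "(of_int c :: xypoly) = Poly_Mapping.single 0 c"
    by (metis single_of_int of_int_eq_id id_apply)
  then show ?thesis by simp
qed

lemma single_eq_prod_Var:
  "Poly_Mapping.single m (1::int) = (\<Prod>v\<in>Poly_Mapping.keys m. Var v ^ Poly_Mapping.lookup m v)"
proof -
  have pow: "Var v ^ k = Poly_Mapping.single (Poly_Mapping.single v k) 1" for v k
    by (induction k) (auto simp: Var_def mult_single single_add[symmetric])
  have prd: "(\<Prod>v\<in>A. Poly_Mapping.single (h v) (1::int)) = Poly_Mapping.single (sum h A) 1"
    if "finite A" for A and h :: "var \<Rightarrow> (var \<Rightarrow>\<^sub>0 nat)"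
    using that by (induction A rule: finite_induct) (auto simp: mult_single)
  have "(\<Sum>v\<in>Poly_Mapping.keys m. Poly_Mapping.single v (Poly_Mapping.lookup m v)) = m"
    by (rule poly_mapping_eqI) (simp add: lookup_sum lookup_single when_def in_keys_iff)
  then show ?thesis by (simp add: pow prd)
qed

text \<open>Constants and variables generate the polynomial ring, so identities between
  homomorphisms and the divisibility behind divided differences need no bookkeeping with
  exponents.\<close>

lemma xypoly_induct [case_names const Var add mult]:
  fixes f :: xypoly
  assumes const: "\<And>c. P (of_int c)" and Var: "\<And>v. P (Var v)"
    and add: "\<And>f g. P f \<Longrightarrow> P g \<Longrightarrow> P (f + g)" and mult: "\<And>f g. P f \<Longrightarrow> P g \<Longrightarrow> P (f * g)"
  shows "P f"
proof -
  have pow: "P (Var v ^ k)" for v k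
    by (induction k) (use const[of 1] Var mult in auto)
  have prd: "P (\<Prod>v\<in>A. h v)" if "\<And>v. P (h v)" for A and h :: "var \<Rightarrow> xypoly"
    by (induction A rule: infinite_finite_induct) (use const[of 1] mult that in auto)
  have single: "P (Poly_Mapping.single m c)" for m c
  proof -
    have "Poly_Mapping.single m c = of_int c * Poly_Mapping.single m 1"
      by (simp flip: single_of_int add: mult_single)
    then show ?thesis by (auto intro: mult const prd pow simp: single_eq_prod_Var)
  qed
  have "P (\<Sum>m\<in>A. Poly_Mapping.single m (h m))" for A and h
    by (induction A rule: infinite_finite_induct) (use const[of 0] add single in auto)
  then show ?thesis by (subst xypoly_eq_sum)
qed

text \<open>A unital ring homomorphism respects integers, so it acts on a substituted polynomial
  only through the values at the variables. Composition of substitutions and evaluation of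
  \<open>xsplit\<close> are both instances.\<close>

lemma ring_hom_subst:
  fixes h :: "'a::comm_ring_1 \<Rightarrow> 'b::comm_ring_1"
  assumes add: "\<And>a b. h (a + b) = h a + h b" and mult: "\<And>a b. h (a * b) = h a * h b" and one: "h 1 = 1"
  shows "h (subst \<sigma> f) = subst (h \<circ> \<sigma>) f"
proof -
  have h0: "h 0 = 0" using add[of 0 0] by simp
  have neg: "h (- a) = - h a" for a using add[of a "- a"] h0 by (simp add: minus_unique)
  have nat: "h (of_nat k) = of_nat k" for k by (induction k) (auto simp: h0 add one)
  have int: "h (of_int c) = of_int c" for c
    by (cases c rule: int_cases2) (auto simp: nat neg)
  show ?thesis by (induction f rule: xypoly_induct) (auto simp: int add mult)
qed

lemma subst_subst: "subst \<sigma> (subst \<tau> f) = subst (\<lambda>v. subst \<sigma> (\<tau> v)) f"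
  by (subst ring_hom_subst) (auto simp: o_def)

lemma subst_id [simp]: "subst Var f = f"
  by (induction f rule: xypoly_induct) auto

lemma subst_cong_all: "(\<And>v. \<sigma> v = \<tau> v) \<Longrightarrow> subst \<sigma> f = subst \<tau> f"
  by (simp add: subst_def eval_monom_def)

section \<open>Divided differences\<close>

definition swap_var :: "nat \<Rightarrow> var \<Rightarrow> var" where
  "swap_var i = transpose (XVar i) (XVar (Suc i))"

lemma swap_var_simps [simp]:
  "swap_var i (XVar i) = XVar (Suc i)" "swap_var i (XVar (Suc i)) = XVar i"
  "swap_var i (YVar j) = YVar j"
  "j \<noteq> i \<Longrightarrow> j \<noteq> Suc i \<Longrightarrow> swap_var i (XVar j) = XVar j"
  by (auto simp: swap_var_def transpose_def)

lemma swap_var_XVar: "swap_var i (XVar j) = XVar (simple_refl i j)"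
  by (auto simp: swap_var_def simple_refl_def transpose_def)

lemma swap_var_swap_var [simp]: "swap_var i (swap_var i v) = v"
  by (simp add: swap_var_def)

text \<open>\<open>map_key\<close> pulls a coefficient function back along its argument. The
  transposition is its own inverse, so pulling the exponents back agrees with pushing them forward,
  and the latter is a substitution.\<close>

lemma swap_x_eq_subst: "swap_x i f = subst (\<lambda>v. Var (swap_var i v)) f"
proof -
  let ?t = "swap_var i" and ?k = "Poly_Mapping.map_key :: _ \<Rightarrow> (var \<Rightarrow>\<^sub>0 nat) \<Rightarrow> (var \<Rightarrow>\<^sub>0 nat)"
  have inj: "inj ?t" by (rule inj_on_inverseI[of _ ?t]) simp
  have comp: "?t \<circ> ?t = id" by auto
  have kk: "?k ?t (?k ?t m) = m" for m
    using map_key_compose[OF inj inj, of m] map_key_id[of m] by (simp add: comp id_def)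
  have injk: "inj (?k ?t)" by (rule inj_on_inverseI[of _ "?k ?t"]) (simp add: kk)
  have sw: "swap_x i g = Poly_Mapping.map_key (?k ?t) g" for g
    by (simp add: swap_x_def swap_var_def)
  have single: "swap_x i (Poly_Mapping.single m c) = Poly_Mapping.single (?k ?t m) c" for m c
    using map_key_single[OF injk, of "?k ?t m" c] by (simp add: sw kk)
  have add: "swap_x i (g + h) = swap_x i g + swap_x i h" for g h
    by (simp add: sw map_key_plus[OF injk])
  have sum: "swap_x i (sum h A) = (\<Sum>a\<in>A. swap_x i (h a))" for A and h :: "(var \<Rightarrow>\<^sub>0 nat) \<Rightarrow> xypoly"
  proof (induction A rule: infinite_finite_induct)
    case empty
    then show ?case using map_key_zero[OF injk] by (simp add: sw)
  next
    case infinite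
    then show ?case using map_key_zero[OF injk] by (simp add: sw)
  qed (auto simp: add)
  have em: "eval_monom (\<lambda>v. Var (?t v)) m = Poly_Mapping.single (?k ?t m) 1" for m
  proof -
    have "Poly_Mapping.keys (?k ?t m) = ?t -` Poly_Mapping.keys m" by (rule keys_map_key[OF inj])
    moreover have "bij_betw ?t (?t -` Poly_Mapping.keys m) (Poly_Mapping.keys m)"
      by (rule bij_betw_byWitness[where f' = ?t]) auto
    moreover have "Poly_Mapping.lookup (?k ?t m) v = Poly_Mapping.lookup m (?t v)" for v
      using inj by (simp add: map_key.rep_eq)
    moreover have "(\<Prod>v\<in>Poly_Mapping.keys m. Var (?t v) ^ Poly_Mapping.lookup m v)
        = (\<Prod>v\<in>?t -` Poly_Mapping.keys m. Var (?t (?t v)) ^ Poly_Mapping.lookup m (?t v))"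
      by (rule prod.reindex_bij_betw[symmetric]) fact
    ultimately show ?thesis
      unfolding eval_monom_def single_eq_prod_Var by simp
  qed
  have of_int_single: "of_int c * Poly_Mapping.single m (1::int) = Poly_Mapping.single m c" for m c
    by (simp flip: single_of_int add: mult_single)
  show ?thesis
    by (subst (1) xypoly_eq_sum) (simp add: sum single subst_def em of_int_single)
qed

lemma swap_x_simps [simp]:
  "swap_x i 0 = 0" "swap_x i 1 = 1" "swap_x i (f + g) = swap_x i f + swap_x i g"
  "swap_x i (f - g) = swap_x i f - swap_x i g" "swap_x i (f * g) = swap_x i f * swap_x i g"
  "swap_x i (- f) = - swap_x i f"
  "swap_x i (Var v) = Var (swap_var i v)" "swap_x i (of_int c) = of_int c"
  by (simp_all add: swap_x_eq_subst)

lemma swap_x_prod: "swap_x i (prod h A) = (\<Prod>a\<in>A. swap_x i (h a))"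
  by (simp add: swap_x_eq_subst)

lemma swap_x_swap_x [simp]: "swap_x i (swap_x i f) = f"
  by (simp add: swap_x_eq_subst subst_subst)

lemma Var_inject [simp]: "Var v = Var w \<longleftrightarrow> v = w"
proof
  assume "Var v = Var w"
  then have "Poly_Mapping.single v (1::nat) = Poly_Mapping.single w 1"
    unfolding Var_def by (metis keys_single singleton_inject zero_neq_one)
  then show "v = w" by (metis keys_single singleton_inject zero_neq_one)
qed simp

lemma X_diff_nz [simp]: "X i - X (Suc i) \<noteq> 0"
  by simp

lemma divided_diff_eqI:
  assumes "(X i - X (Suc i)) * g = f - swap_x i f"
  shows "divided_diff i f = g"
  unfolding divided_diff_def
proof (rule the_equality)
  fix g'
  assume "(X i - X (Suc i)) * g' = f - swap_x i f"
  then have "(X i - X (Suc i)) * g' = (X i - X (Suc i)) * g" by (simp only: assms)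
  then show "g' = g" by (simp only: mult_cancel_left X_diff_nz simp_thms)
qed (rule assms)

lemma divided_diff_exists: "\<exists>g. (X i - X (Suc i)) * g = f - swap_x i f"
proof (induction f rule: xypoly_induct)
  case (const c)
  show ?case by (rule exI[of _ 0]) simp
next
  case (Var v)
  consider "v = XVar i" | "v = XVar (Suc i)" | "v \<noteq> XVar i \<and> v \<noteq> XVar (Suc i)" by blast
  then show ?case
  proof cases
    case 1
    then show ?thesis by (intro exI[of _ 1]) simp
  next
    case 2
    then show ?thesis by (intro exI[of _ "-1"]) simp
  next
    case 3
    then have "swap_var i v = v" by (auto simp: swap_var_def transpose_def)
    then show ?thesis by (intro exI[of _ 0]) simp
  qed
next
  case (add f g)
  then obtain a b where ab: "(X i - X (Suc i)) * a = f - swap_x i f" "(X i - X (Suc i)) * b = g - swap_x i g"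
    by blast
  have "(X i - X (Suc i)) * (a + b) = (f - swap_x i f) + (g - swap_x i g)"
    by (simp only: distrib_left ab)
  also have "\<dots> = (f + g) - swap_x i (f + g)" by (simp add: algebra_simps)
  finally show ?case by blast
next
  case (mult f g)
  then obtain a b where ab: "(X i - X (Suc i)) * a = f - swap_x i f" "(X i - X (Suc i)) * b = g - swap_x i g"
    by blast
  \<comment> \<open>The witness is the twisted Leibniz rule, which \<open>divided_diff_mult\<close>
    restates.\<close>
  have "(X i - X (Suc i)) * (a * g + swap_x i f * b)
      = ((X i - X (Suc i)) * a) * g + swap_x i f * ((X i - X (Suc i)) * b)"
    by (simp only: distrib_left mult_ac)
  also have "\<dots> = f * g - swap_x i (f * g)"
    unfolding ab by (simp add: algebra_simps)
  finally show ?case by blast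
qed

lemma divided_diff: "(X i - X (Suc i)) * divided_diff i f = f - swap_x i f"
proof -
  obtain g where g: "(X i - X (Suc i)) * g = f - swap_x i f"
    using divided_diff_exists by blast
  show ?thesis unfolding divided_diff_eqI[OF g] by (rule g)
qed

lemma divided_diff_add: "divided_diff i (f + g) = divided_diff i f + divided_diff i g"
  by (rule divided_diff_eqI) (simp add: distrib_left divided_diff)

lemma divided_diff_diff: "divided_diff i (f - g) = divided_diff i f - divided_diff i g"
  by (rule divided_diff_eqI) (simp add: right_diff_distrib divided_diff)

lemma divided_diff_mult:
  "divided_diff i (f * g) = divided_diff i f * g + swap_x i f * divided_diff i g"
proof (rule divided_diff_eqI)
  have "(X i - X (Suc i)) * (divided_diff i f * g + swap_x i f * divided_diff i g)
      = ((X i - X (Suc i)) * divided_diff i f) * g + swap_x i f * ((X i - X (Suc i)) * divided_diff i g)"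
    by (simp only: distrib_left mult_ac)
  also have "\<dots> = f * g - swap_x i (f * g)"
    unfolding divided_diff by (simp add: algebra_simps)
  finally show "(X i - X (Suc i)) * (divided_diff i f * g + swap_x i f * divided_diff i g)
      = f * g - swap_x i (f * g)" .
qed

lemma divided_diff_sym: "swap_x i f = f \<Longrightarrow> divided_diff i f = 0"
  by (rule divided_diff_eqI) simp

lemma divided_diff_0 [simp]: "divided_diff i 0 = 0"
  by (rule divided_diff_sym) simp

lemma divided_diff_eq_0_iff: "divided_diff i f = 0 \<longleftrightarrow> swap_x i f = f"
  using divided_diff[of i f] divided_diff_sym by auto

lemma divided_diff_scale: "swap_x i f = f \<Longrightarrow> divided_diff i (f * g) = f * divided_diff i g"
  by (simp add: divided_diff_mult divided_diff_sym)

lemma divided_diff_scale': "swap_x i g = g \<Longrightarrow> divided_diff i (f * g) = divided_diff i f * g"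
  by (simp add: divided_diff_mult divided_diff_sym)

lemma divided_diff_sum: "divided_diff i (sum h A) = (\<Sum>a\<in>A. divided_diff i (h a))"
  by (induction A rule: infinite_finite_induct) (auto simp: divided_diff_add)

lemma swap_x_divided_diff [simp]: "swap_x i (divided_diff i f) = divided_diff i f"
proof -
  have "swap_x i ((X i - X (Suc i)) * divided_diff i f) = swap_x i (f - swap_x i f)"
    by (simp only: divided_diff)
  then have "(X i - X (Suc i)) * swap_x i (divided_diff i f) = f - swap_x i f"
    by (simp add: algebra_simps)
  from divided_diff_eqI[OF this] show ?thesis by simp
qed

lemma divided_diff_nil [simp]: "divided_diff i (divided_diff i f) = 0"
  by (rule divided_diff_sym) simp

text \<open>The quotient is unique, so it suffices that the substitution intertwines the two
  exchanges and carries the denominator for \<open>i\<close> to the one for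
  \<open>j\<close>.\<close>

lemma subst_divided_diff:
  assumes "\<And>f. subst \<tau> (swap_x i f) = swap_x j (subst \<tau> f)"
    and "\<tau> (XVar i) = X j" "\<tau> (XVar (Suc i)) = X (Suc j)"
  shows "subst \<tau> (divided_diff i f) = divided_diff j (subst \<tau> f)"
proof (rule sym, rule divided_diff_eqI)
  have "subst \<tau> ((X i - X (Suc i)) * divided_diff i f) = subst \<tau> (f - swap_x i f)"
    by (simp only: divided_diff)
  then show "(X j - X (Suc j)) * subst \<tau> (divided_diff i f) = subst \<tau> f - swap_x j (subst \<tau> f)"
    by (simp add: assms)
qed

lemma subst_swap_xI:
  assumes "\<And>v. \<tau> (swap_var i v) = swap_x j (\<tau> v)"
  shows "subst \<tau> (swap_x i f) = swap_x j (subst \<tau> f)"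
proof -
  have "subst \<tau> (swap_x i f) = subst (\<lambda>v. \<tau> (swap_var i v)) f"
    by (simp add: swap_x_eq_subst subst_subst)
  also have "\<dots> = subst (\<lambda>v. swap_x j (\<tau> v)) f" by (rule subst_cong_all) (rule assms)
  also have "\<dots> = swap_x j (subst \<tau> f)"
    unfolding swap_x_eq_subst by (simp add: subst_subst)
  finally show ?thesis .
qed

lemma swap_x_commute:
  assumes "Suc i < j \<or> Suc j < i"
  shows "swap_x i (swap_x j f) = swap_x j (swap_x i f)"
proof -
  have "swap_var i (swap_var j v) = swap_var j (swap_var i v)" for v
    using assms by (cases v) (auto simp: swap_var_XVar simple_refl_def transpose_def)
  then show ?thesis by (simp add: swap_x_eq_subst subst_subst)
qed

lemma divided_diff_commute:
  assumes "Suc i < j \<or> Suc j < i"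
  shows "divided_diff i (divided_diff j f) = divided_diff j (divided_diff i f)"
proof -
  have "swap_x i (divided_diff j g) = divided_diff j (swap_x i g)" for g
    unfolding swap_x_eq_subst[of i]
    using assms swap_x_commute[OF assms]
    by (intro subst_divided_diff) (auto simp: swap_var_XVar simple_refl_def transpose_def swap_x_eq_subst[symmetric])
  then have "(X i - X (Suc i)) * divided_diff j (divided_diff i f)
      = divided_diff j ((X i - X (Suc i)) * divided_diff i f)
    \<and> divided_diff j (f - swap_x i f) = divided_diff j f - swap_x i (divided_diff j f)"
    using assms by (auto simp: divided_diff_scale divided_diff_diff)
  then show ?thesis
    by (intro divided_diff_eqI) (simp add: divided_diff)
qed

lemma swap_x_braid:
  "swap_x i (swap_x (Suc i) (swap_x i f)) = swap_x (Suc i) (swap_x i (swap_x (Suc i) f))"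
proof -
  have "swap_var i (swap_var (Suc i) (swap_var i v)) = swap_var (Suc i) (swap_var i (swap_var (Suc i) v))" for v
    by (cases v) (auto simp: swap_var_XVar simple_refl_def transpose_def)
  then show ?thesis by (simp add: swap_x_eq_subst subst_subst)
qed

text \<open>Multiplied by the Vandermonde product of the three variables, both sides become the
  antisymmetrization of \<open>f\<close> over the permutations of these variables. The product is
  nonzero and can be cancelled.\<close>

lemma divided_diff_braid:
  "divided_diff i (divided_diff (Suc i) (divided_diff i f))
    = divided_diff (Suc i) (divided_diff i (divided_diff (Suc i) f))"
proof -
  define a b c where "a = X i" and "b = X (Suc i)" and "c = X (Suc (Suc i))"
  define s t where "s = swap_x i" and "t = swap_x (Suc i)"
  have s: "s a = b" "s b = a" "s c = c" and t: "t a = a" "t b = c" "t c = b"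
    by (auto simp: s_def t_def a_def b_def c_def)
  have sh: "s (g * h) = s g * s h" "s (g - h) = s g - s h" "s (s g) = g" for g h by (auto simp: s_def)
  have th: "t (g * h) = t g * t h" "t (g - h) = t g - t h" "t (t g) = g" for g h by (auto simp: t_def)
  have Ds: "(a - b) * divided_diff i g = g - s g" and Dt: "(b - c) * divided_diff (Suc i) g = g - t g" for g
    using divided_diff by (auto simp: a_def b_def c_def s_def t_def)
  have st: "s (t (s g)) = t (s (t g))" for g by (simp add: s_def t_def swap_x_braid)
  have ne: "a - b \<noteq> 0" "a - c \<noteq> 0" "b - c \<noteq> 0" by (auto simp: a_def b_def c_def)
  let ?A = "f - s f - t f + s (t f) + t (s f) - s (t (s f))"
  define g1 where "g1 = divided_diff i f"
  define g2 where "g2 = divided_diff (Suc i) g1"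
  define g3 where "g3 = divided_diff i g2"
  define h1 where "h1 = divided_diff (Suc i) f"
  define h2 where "h2 = divided_diff i h1"
  define h3 where "h3 = divided_diff (Suc i) h2"
  have 1: "(a - b) * g1 = f - s f" by (simp add: g1_def Ds)
  \<comment> \<open>\<open>t\<close> fixes \<open>a\<close> and sends \<open>b\<close> to
    \<open>c\<close>, so it turns the denominator \<open>a - b\<close> into
    \<open>a - c\<close>.\<close>
  then have 2: "(a - c) * t g1 = t f - t (s f)" by (metis t th)
  have 3: "(b - c) * g2 = g1 - t g1" by (simp add: g2_def Dt)
  have 4: "(a - b) * (a - c) * (b - c) * g2 = (a - c) * (f - s f) - (a - b) * (t f - t (s f))"
  proof -
    have "(a - b) * (a - c) * (b - c) * g2 = (a - c) * ((a - b) * g1) - (a - b) * ((a - c) * t g1)"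
      using 3 by (simp add: mult.assoc) (simp add: algebra_simps)
    then show ?thesis by (simp only: 1 2)
  qed
  then have "s ((a - b) * (a - c) * (b - c) * g2) = s ((a - c) * (f - s f) - (a - b) * (t f - t (s f)))"
    by simp
  then have 5: "(b - a) * (b - c) * (a - c) * s g2 = (b - c) * (s f - f) - (b - a) * (s (t f) - s (t (s f)))"
    by (simp only: sh s)
  have 6: "(a - b) * g3 = g2 - s g2" by (simp add: g3_def Ds)
  have "(a - b) * ((a - b) * (a - c) * (b - c) * g3)
      = (a - b) * (a - c) * (b - c) * g2 + (b - a) * (b - c) * (a - c) * s g2"
  proof -
    have "(a - b) * ((a - b) * (a - c) * (b - c) * g3) = (a - b) * (a - c) * (b - c) * ((a - b) * g3)"
      by (simp only: mult_ac)
    then show ?thesis unfolding 6 by (simp add: algebra_simps)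
  qed
  also have "\<dots> = (a - b) * ?A" unfolding 4 5 by (simp add: algebra_simps)
  finally have L: "(a - b) * (a - c) * (b - c) * g3 = ?A" using ne by simp
  have 1: "(b - c) * h1 = f - t f" by (simp add: h1_def Dt)
  then have 2: "(a - c) * s h1 = s f - s (t f)" by (metis s sh)
  have 3: "(a - b) * h2 = h1 - s h1" by (simp add: h2_def Ds)
  have 4: "(a - b) * (a - c) * (b - c) * h2 = (a - c) * (f - t f) - (b - c) * (s f - s (t f))"
  proof -
    have "(a - b) * (a - c) * (b - c) * h2 = (a - c) * (b - c) * ((a - b) * h2)" by (simp only: mult_ac)
    also have "\<dots> = (a - c) * ((b - c) * h1) - (b - c) * ((a - c) * s h1)"
      unfolding 3 by (simp add: algebra_simps)
    finally show ?thesis by (simp only: 1 2)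
  qed
  then have "t ((a - b) * (a - c) * (b - c) * h2) = t ((a - c) * (f - t f) - (b - c) * (s f - s (t f)))"
    by simp
  then have 5: "(a - c) * (a - b) * (c - b) * t h2 = (a - b) * (t f - f) - (c - b) * (t (s f) - t (s (t f)))"
    by (simp only: th t)
  have 6: "(b - c) * h3 = h2 - t h2" by (simp add: h3_def Dt)
  have "(b - c) * ((a - b) * (a - c) * (b - c) * h3)
      = (a - b) * (a - c) * (b - c) * h2 + (a - c) * (a - b) * (c - b) * t h2"
  proof -
    have "(b - c) * ((a - b) * (a - c) * (b - c) * h3) = (a - b) * (a - c) * (b - c) * ((b - c) * h3)"
      by (simp only: mult_ac)
    then show ?thesis unfolding 6 by (simp add: algebra_simps)
  qed
  also have "\<dots> = (b - c) * ?A" unfolding 4 5 st by (simp add: algebra_simps)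
  finally have R: "(a - b) * (a - c) * (b - c) * h3 = ?A" using ne by simp
  have "(a - b) * (a - c) * (b - c) * g3 = (a - b) * (a - c) * (b - c) * h3" by (simp only: L R)
  then have "g3 = h3" using ne by simp
  then show ?thesis by (simp add: g1_def g2_def g3_def h1_def h2_def h3_def)
qed

section \<open>Degree in one x-variable\<close>

text \<open>The coefficients stay in the full ring, although \<open>X i\<close> no longer occurs in
  them: evaluation at \<open>X i\<close> then gives the polynomial back, and degrees add under
  products because the ring is a domain.\<close>

definition xsplit :: "nat \<Rightarrow> xypoly \<Rightarrow> xypoly poly" where
  "xsplit i = subst (\<lambda>v. if v = XVar i then [:0, 1:] else [:Var v:])"

definition xdeg :: "nat \<Rightarrow> xypoly \<Rightarrow> nat" where
  "xdeg i f = degree (xsplit i f)"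

lemma poly_xsplit: "poly (xsplit i f) a = subst (\<lambda>v. if v = XVar i then a else Var v) f"
  unfolding xsplit_def
  by (subst ring_hom_subst[where h = "\<lambda>p. poly p a"])
     (auto simp: o_def intro: subst_cong_all)

lemma xsplit_inj_0: "xsplit i f = 0 \<longleftrightarrow> f = 0"
proof
  assume "xsplit i f = 0"
  then have "subst (\<lambda>v. if v = XVar i then X i else Var v) f = 0"
    by (simp flip: poly_xsplit)
  moreover have "(\<lambda>v. if v = XVar i then X i else Var v) = Var" by auto
  ultimately show "f = 0" by simp
qed (simp add: xsplit_def)

lemma xdeg_0 [simp]: "xdeg i 0 = 0"
  by (simp add: xdeg_def xsplit_def)

lemma xdeg_add: "xdeg i f \<le> k \<Longrightarrow> xdeg i g \<le> k \<Longrightarrow> xdeg i (f + g) \<le> k"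
  unfolding xdeg_def xsplit_def subst_add by (rule degree_add_le)

lemma xdeg_diff: "xdeg i f \<le> k \<Longrightarrow> xdeg i g \<le> k \<Longrightarrow> xdeg i (f - g) \<le> k"
  unfolding xdeg_def xsplit_def subst_diff by (rule degree_diff_le)

lemma xdeg_sum: "(\<And>a. a \<in> A \<Longrightarrow> xdeg i (h a) \<le> k) \<Longrightarrow> xdeg i (sum h A) \<le> k"
  by (induction A rule: infinite_finite_induct) (auto intro: xdeg_add)

lemma xdeg_mult: "f \<noteq> 0 \<Longrightarrow> g \<noteq> 0 \<Longrightarrow> xdeg i (f * g) = xdeg i f + xdeg i g"
  unfolding xdeg_def using xsplit_inj_0[of i f] xsplit_inj_0[of i g]
  by (simp add: xsplit_def degree_mult_eq)

lemma xdeg_mult_le: "xdeg i (f * g) \<le> xdeg i f + xdeg i g"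
  unfolding xdeg_def xsplit_def by (simp add: degree_mult_le)

lemma xdeg_prod_le: "xdeg i (prod h A) \<le> (\<Sum>a\<in>A. xdeg i (h a))"
proof (induction A rule: infinite_finite_induct)
  case (insert a A)
  then show ?case using xdeg_mult_le[of i "h a" "prod h A"] by simp
qed (auto simp: xdeg_def xsplit_def)

lemma xdeg_Var [simp]: "xdeg i (Var v) = (if v = XVar i then 1 else 0)"
  by (simp add: xdeg_def xsplit_def)

text \<open>The hypothesis says that \<open>XVar j\<close> becomes \<open>X i\<close> and every
  other variable a polynomial free of \<open>X i\<close>. The substitution then acts on the
  expansion coefficientwise, by \<open>subst \<rho>\<close>; it may kill a leading coefficient, so
  only an inequality holds.\<close>

lemma xdeg_subst_eq:
  assumes hom: "\<And>v. xsplit i (\<tau> v) = map_poly (subst \<rho>) (if v = XVar j then [:0, 1:] else [:Var v:])"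
  shows "xdeg i (subst \<tau> f) \<le> xdeg j f"
proof -
  have "xsplit i (subst \<tau> f) = subst (\<lambda>v. xsplit i (\<tau> v)) f"
    unfolding xsplit_def by (subst ring_hom_subst) (auto simp: o_def)
  also have "\<dots> = subst (\<lambda>v. map_poly (subst \<rho>) (if v = XVar j then [:0, 1:] else [:Var v:])) f"
    by (rule subst_cong_all) (rule hom)
  also have "\<dots> = map_poly (subst \<rho>) (xsplit j f)"
    unfolding xsplit_def
    by (subst ring_hom_subst[where h = "map_poly (subst \<rho>)"])
       (auto simp: o_def poly_eq_iff coeff_map_poly coeff_mult intro!: subst_cong_all)
  finally show ?thesis unfolding xdeg_def
    by (auto intro!: degree_le simp: coeff_map_poly coeff_eq_0)
qed

lemma xdeg_swap_x: "xdeg (simple_refl i j) (swap_x i f) \<le> xdeg j f"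
  unfolding swap_x_eq_subst
proof (rule xdeg_subst_eq[where \<rho> = "\<lambda>v. Var (swap_var i v)"])
  fix v
  show "xsplit (simple_refl i j) (Var (swap_var i v)) =
    map_poly (subst (\<lambda>v. Var (swap_var i v))) (if v = XVar j then [:0, 1:] else [:Var v:])"
  proof (cases v)
    case (XVar k)
    have "simple_refl i j = simple_refl i k \<longleftrightarrow> j = k"
      unfolding simple_refl_def by (metis transpose_involutory)
    then show ?thesis using XVar
      by (auto simp: xsplit_def swap_var_XVar map_poly_pCons)
  next
    case (YVar k)
    then show ?thesis by (auto simp: xsplit_def map_poly_pCons)
  qed
qed

text \<open>The exchange can raise the degrees in the two variables to the larger of their bounds,
  and division by \<open>X k - X (Suc k)\<close> lowers both by one. The bounds are left open
  because staircase bounds and the sharper ones for Grassmannian factors are propagated in the same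
  way.\<close>

lemma xdeg_divided_diff:
  assumes "\<And>i. 1 \<le> i \<Longrightarrow> i \<le> n \<Longrightarrow> xdeg i f \<le> B i" and k: "1 \<le> k" "k < n"
    and B: "\<And>i. 1 \<le> i \<Longrightarrow> i \<le> n \<Longrightarrow> i \<noteq> k \<Longrightarrow> i \<noteq> Suc k \<Longrightarrow> B i \<le> B' i"
      "max (B k) (B (Suc k)) \<le> Suc (B' k)" "max (B k) (B (Suc k)) \<le> Suc (B' (Suc k))"
    and i: "1 \<le> i" "i \<le> n"
  shows "xdeg i (divided_diff k f) \<le> B' i"
proof (cases "divided_diff k f = 0")
  case False
  have sw: "xdeg i (swap_x k f) \<le> B (simple_refl k i)"
  proof -
    have "simple_refl k (simple_refl k i) = i" by (simp add: simple_refl_def)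
    then have "xdeg i (swap_x k f) \<le> xdeg (simple_refl k i) f"
      using xdeg_swap_x[of k "simple_refl k i" f] by simp
    also have "\<dots> \<le> B (simple_refl k i)"
      using k i by (intro assms) (auto simp: simple_refl_def transpose_def)
    finally show ?thesis .
  qed
  have "xdeg i (f - swap_x k f) \<le> max (B i) (B (simple_refl k i))"
    using sw assms(1)[OF i] by (intro xdeg_diff) auto
  then have "xdeg i (X k - X (Suc k)) + xdeg i (divided_diff k f) \<le> max (B i) (B (simple_refl k i))"
    using False by (simp flip: divided_diff add: xdeg_mult)
  moreover have "xdeg i (X k - X (Suc k)) = (if i = k \<or> i = Suc k then 1 else 0)"
    by (auto simp: xdeg_def xsplit_def)
  ultimately show ?thesis using B(1)[OF i] B(2,3)
    by (cases "i = k"; cases "i = Suc k") (auto simp: simple_refl_def transpose_def max_def split: if_splits)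
qed simp

lemma subst_xdeg_0:
  assumes "xdeg i f = 0"
  shows "subst (\<lambda>v. if v = XVar i then a else Var v) f = f"
proof -
  obtain c where c: "xsplit i f = [:c:]" using assms unfolding xdeg_def by (metis degree_0_id)
  have "(\<lambda>v. if v = XVar i then X i else Var v) = Var" by auto
  then have "f = poly (xsplit i f) (X i)" by (simp add: poly_xsplit)
  then have "f = c" by (simp add: c)
  moreover have "subst (\<lambda>v. if v = XVar i then a else Var v) f = c"
    unfolding poly_xsplit[symmetric] c by simp
  ultimately show ?thesis by simp
qed

section \<open>Divided differences along permutations\<close>

lemma simple_refl_simps [simp]:
  "simple_refl i i = Suc i" "simple_refl i (Suc i) = i"
  "j \<noteq> i \<Longrightarrow> j \<noteq> Suc i \<Longrightarrow> simple_refl i j = j"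
  "simple_refl i (simple_refl i j) = j" "simple_refl i \<circ> simple_refl i = id"
  by (auto simp: simple_refl_def)

lemma comp_simple_refl_twice [simp]: "w \<circ> simple_refl i \<circ> simple_refl i = w"
  by (simp add: comp_assoc)

lemma simple_refl_permutes: "1 \<le> i \<Longrightarrow> i < n \<Longrightarrow> simple_refl i permutes {1..n}"
  unfolding simple_refl_def by (rule permutes_swap_id) auto

lemma comp_simple_refl_permutes:
  "w permutes {1..n} \<Longrightarrow> 1 \<le> i \<Longrightarrow> i < n \<Longrightarrow> w \<circ> simple_refl i permutes {1..n}"
  by (intro permutes_compose simple_refl_permutes)

lemma simple_refl_less:
  "a < b \<Longrightarrow> (a, b) \<noteq> (i, Suc i) \<Longrightarrow> simple_refl i a < simple_refl i b"
  by (cases "a = i"; cases "a = Suc i"; cases "b = i"; cases "b = Suc i") auto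

lemma simple_refl_inj [simp]: "simple_refl i a = simple_refl i b \<longleftrightarrow> a = b"
  by (metis simple_refl_simps(4))

lemma simple_refl_in: "1 \<le> i \<Longrightarrow> i < n \<Longrightarrow> simple_refl i a \<in> {1..n} \<longleftrightarrow> a \<in> {1..n}"
  by (cases "a = i"; cases "a = Suc i") auto

section \<open>Inversions, length and ascents\<close>

definition inversions :: "nat \<Rightarrow> (nat \<Rightarrow> nat) \<Rightarrow> (nat \<times> nat) set" where
  "inversions n w = {(i, j). 1 \<le> i \<and> i < j \<and> j \<le> n \<and> w j < w i}"

lemma perm_length_eq: "perm_length n w = card (inversions n w)"
  by (simp add: perm_length_def inversions_def)

lemma finite_inversions [simp]: "finite (inversions n w)"
  by (rule finite_subset[of _ "{1..n} \<times> {1..n}"]) (auto simp: inversions_def)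

text \<open>Exchanging positions \<open>i\<close> and \<open>Suc i\<close> keeps the order of every
  pair of positions except this one, so the old inversions are merely renamed and one is
  added.\<close>

lemma inversions_ascent:
  assumes "1 \<le> i" "i < n" "w i < w (Suc i)"
  shows "inversions n (w \<circ> simple_refl i)
    = insert (i, Suc i) (map_prod (simple_refl i) (simple_refl i) ` inversions n w)"
    (is "?L = insert _ (?f ` _)")
    and "(i, Suc i) \<notin> map_prod (simple_refl i) (simple_refl i) ` inversions n w"
proof -
  have mem: "1 \<le> simple_refl i c \<and> simple_refl i c \<le> n \<longleftrightarrow> 1 \<le> c \<and> c \<le> n" for c
    using simple_refl_in[OF assms(1,2), of c] by simp
  have L: "?f ab \<in> inversions n w" if "ab \<in> ?L" "ab \<noteq> (i, Suc i)" for ab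
    using that simple_refl_less[of "fst ab" "snd ab" i] mem[of "fst ab"] mem[of "snd ab"]
    by (cases ab) (auto simp: inversions_def)
  have R: "?f ab \<in> ?L" if ab: "ab \<in> inversions n w" for ab
  proof -
    have "ab \<noteq> (i, Suc i)" using ab assms by (auto simp: inversions_def)
    then show ?thesis
      using ab simple_refl_less[of "fst ab" "snd ab" i] mem[of "fst ab"] mem[of "snd ab"]
      by (cases ab) (auto simp: inversions_def)
  qed
  have ff: "?f (?f ab) = ab" for ab by (cases ab) simp
  show "?L = insert (i, Suc i) (?f ` inversions n w)"
  proof (intro equalityI subsetI)
    fix ab assume "ab \<in> ?L"
    then show "ab \<in> insert (i, Suc i) (?f ` inversions n w)"
      using L[of ab] ff[of ab] by (metis image_eqI insert_iff)
  next
    fix ab assume "ab \<in> insert (i, Suc i) (?f ` inversions n w)"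
    then show "ab \<in> ?L" using R assms by (auto simp: inversions_def)
  qed
  show "(i, Suc i) \<notin> ?f ` inversions n w"
  proof
    assume "(i, Suc i) \<in> ?f ` inversions n w"
    then obtain ab where "ab \<in> inversions n w" "(i, Suc i) = ?f ab" by (rule imageE)
    then have "?f (i, Suc i) \<in> inversions n w" using ff[of ab] by simp
    then show False by (simp add: inversions_def)
  qed
qed

lemma perm_length_ascent:
  assumes "1 \<le> i" "i < n" "w i < w (Suc i)"
  shows "perm_length n (w \<circ> simple_refl i) = Suc (perm_length n w)"
proof -
  have "inj_on (map_prod (simple_refl i) (simple_refl i)) (inversions n w)"
    by (rule inj_on_inverseI[of _ "map_prod (simple_refl i) (simple_refl i)"]) auto
  then have "card (map_prod (simple_refl i) (simple_refl i) ` inversions n w) = card (inversions n w)"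
    by (rule card_image)
  with inversions_ascent(2)[OF assms] show ?thesis
    unfolding perm_length_eq inversions_ascent(1)[OF assms]
    by (subst card_insert_disjoint) auto
qed

lemma perm_length_descent:
  assumes "1 \<le> i" "i < n" "w (Suc i) < w i"
  shows "perm_length n w = Suc (perm_length n (w \<circ> simple_refl i))"
proof -
  have "(w \<circ> simple_refl i) i < (w \<circ> simple_refl i) (Suc i)" using assms by simp
  from perm_length_ascent[OF assms(1,2) this] show ?thesis by (simp only: comp_simple_refl_twice)
qed

lemma perm_length_comp_less_iff:
  assumes "w permutes {1..n}" "1 \<le> i" "i < n"
  shows "perm_length n (w \<circ> simple_refl i) < perm_length n w \<longleftrightarrow> w (Suc i) < w i"
proof -
  have "w i \<noteq> w (Suc i)" using inj_eq[OF permutes_inj[OF assms(1)]] by simp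
  then consider "w i < w (Suc i)" | "w (Suc i) < w i" by linarith
  then show ?thesis
  proof cases
    case 1
    show ?thesis using perm_length_ascent[OF assms(2,3) 1] 1 by simp
  next
    case 2
    show ?thesis using perm_length_descent[OF assms(2,3) 2] 2 by simp
  qed
qed

lemma perm_descent_exists:
  assumes "w permutes {1..n}" "w \<noteq> id"
  shows "\<exists>i. 1 \<le> i \<and> i < n \<and> w (Suc i) < w i"
proof (rule ccontr)
  assume no: "\<not> ?thesis"
  then have asc: "w i < w (Suc i)" if "1 \<le> i" "i < n" for i
  proof -
    have "w i \<noteq> w (Suc i)" using inj_eq[OF permutes_inj[OF assms(1)]] by simp
    then show ?thesis using no that by (meson nat_neq_iff)
  qed
  have mono: "w a < w b" if "1 \<le> a" "a < b" "b \<le> n" for a b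
    using that(2,3)
  proof (induction b)
    case (Suc b)
    then show ?case using asc[of b] that(1) by (cases "a = b") auto
  qed simp
  \<comment> \<open>The least moved point \<open>k\<close> satisfies \<open>k < w k\<close>, while
    the value \<open>k\<close> is taken at a later position. This contradicts monotonicity.\<close>
  obtain k where k: "w k \<noteq> k" "\<And>j. j < k \<Longrightarrow> w j = j"
    using assms(2) exists_least_iff[of "\<lambda>k. w k \<noteq> k"] by (auto simp: fun_eq_iff)
  have kn: "k \<in> {1..n}" using k(1) assms(1) by (meson permutes_not_in)
  have "\<not> w k < k" using k permutes_inj[OF assms(1)] by (metis injD)
  then have "k < w k" using k(1) by simp
  obtain j where j: "w j = k" using permutes_surj[OF assms(1)] by (metis surjD)
  have "j \<in> {1..n}" using j kn assms(1) by (metis permutes_in_image)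
  moreover have "k < j" using j k by (metis nat_neq_iff)
  ultimately show False using mono[of k j] kn j \<open>k < w k\<close> by auto
qed

lemma permutes_induct_ascent [consumes 1, case_names id ascent]:
  assumes "w permutes {1..n}" and "P id"
    and "\<And>w i. w permutes {1..n} \<Longrightarrow> 1 \<le> i \<Longrightarrow> i < n \<Longrightarrow> w i < w (Suc i) \<Longrightarrow> P w \<Longrightarrow> P (w \<circ> simple_refl i)"
  shows "P w"
  using assms(1)
proof (induction "perm_length n w" arbitrary: w rule: less_induct)
  case less
  show ?case
  proof (cases "w = id")
    case False
    obtain i where i: "1 \<le> i" "i < n" "w (Suc i) < w i"
      using perm_descent_exists[OF less.prems False] by blast
    have "P (w \<circ> simple_refl i \<circ> simple_refl i)"
      using i less.prems perm_length_descent[OF i]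
      by (intro assms(3) less.hyps comp_simple_refl_permutes) auto
    then show ?thesis by simp
  qed (simp add: assms(2))
qed

section \<open>Divided differences along chains of ascents\<close>

inductive ddrel :: "nat \<Rightarrow> xypoly \<Rightarrow> (nat \<Rightarrow> nat) \<Rightarrow> xypoly \<Rightarrow> bool" for n f where
  base: "ddrel n f id f"
| step: "ddrel n f x g \<Longrightarrow> 1 \<le> i \<Longrightarrow> i < n \<Longrightarrow> x i < x (Suc i) \<Longrightarrow>
    ddrel n f (x \<circ> simple_refl i) (divided_diff i g)"

lemma ddrel_permutes: "ddrel n f x g \<Longrightarrow> x permutes {1..n}"
  by (induction rule: ddrel.induct) (blast intro: permutes_id comp_simple_refl_permutes)+

lemma ddrel_exists: "x permutes {1..n} \<Longrightarrow> \<exists>g. ddrel n f x g"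
  by (induction x rule: permutes_induct_ascent) (blast intro: ddrel.intros)+

text \<open>As in Matsumoto's theorem: two descents of the same permutation lead to a common
  permutation, two lengths further down if they are far apart and three if they are adjacent. A
  chain to it exists, and induction on the length reduces the claim to the commutation and braid
  relations.\<close>

lemma ddrel_unique:
  "ddrel n f x g \<Longrightarrow> ddrel n f x g' \<Longrightarrow> g = g'"
proof (induction "perm_length n x" arbitrary: x g g' rule: less_induct)
  case less
  note xp = ddrel_permutes[OF less.prems(1)]
  have IH: "h = h'" if "ddrel n f y h" "ddrel n f y h'" "perm_length n y < perm_length n x" for y h h'
    using less.hyps that by blast
  have last: "(x = id \<and> g = f) \<or> (\<exists>i h. 1 \<le> i \<and> i < n \<and> x (Suc i) < x i \<and> g = divided_diff i h
      \<and> ddrel n f (x \<circ> simple_refl i) h)" if "ddrel n f x g" for g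
    using that
  proof (cases rule: ddrel.cases)
    case (step y h i)
    then show ?thesis by (intro disjI2 exI[of _ i] exI[of _ h]) auto
  qed auto
  show ?case
  proof (cases "x = id")
    case True
    then show ?thesis using last[OF less.prems(1)] last[OF less.prems(2)] by auto
  next
    case False
    have wlog: "g = g'" if gi: "1 \<le> i" "i < n" "x (Suc i) < x i" "g = divided_diff i h"
        "ddrel n f (x \<circ> simple_refl i) h"
      and gj: "1 \<le> j" "j < n" "x (Suc j) < x j" "g' = divided_diff j h'"
        "ddrel n f (x \<circ> simple_refl j) h'" and ij: "i \<le> j" for i j h h' g g'
    proof -
      have li: "perm_length n (x \<circ> simple_refl i) < perm_length n x"
        using perm_length_descent[OF gi(1-3)] by simp
      have lj: "perm_length n (x \<circ> simple_refl j) < perm_length n x"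
        using perm_length_descent[OF gj(1-3)] by simp
      consider "i = j" | "Suc i < j" | "j = Suc i" using ij by linarith
      then show ?thesis
      proof cases
        case 1
        then show ?thesis using IH gi gj li by blast
      next
        case 2
        let ?c = "x \<circ> simple_refl i \<circ> simple_refl j"
        have c': "?c = x \<circ> simple_refl j \<circ> simple_refl i"
        proof
          fix k
          show "?c k = (x \<circ> simple_refl j \<circ> simple_refl i) k"
            using 2 by (cases "k = i"; cases "k = Suc i"; cases "k = j"; cases "k = Suc j") auto
        qed
        have "?c permutes {1..n}" using xp gi gj by (intro comp_simple_refl_permutes)
        then obtain k where k: "ddrel n f ?c k" using ddrel_exists by blast
        have "ddrel n f (?c \<circ> simple_refl j) (divided_diff j k)"
          using gj 2 by (intro ddrel.step[OF k]) auto
        then have h: "h = divided_diff j k" using gi(5) li IH by simp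
        have "ddrel n f (?c \<circ> simple_refl i) (divided_diff i k)"
          using gi 2 by (intro ddrel.step[OF k]) auto
        then have h': "h' = divided_diff i k" using gj(5) lj IH unfolding c' by simp
        show ?thesis using 2 by (simp add: gi gj h h' divided_diff_commute)
      next
        case 3
        let ?c = "x \<circ> simple_refl i \<circ> simple_refl j \<circ> simple_refl i"
        \<comment> \<open>Three consecutive values decrease, so the longest permutation of the three
          positions can be split off.\<close>
        have x3: "x (Suc (Suc i)) < x (Suc i)" "x (Suc i) < x i" using gi gj 3 by auto
        have c': "?c = x \<circ> simple_refl j \<circ> simple_refl i \<circ> simple_refl j"
        proof
          fix k
          show "?c k = (x \<circ> simple_refl j \<circ> simple_refl i \<circ> simple_refl j) k"
            using 3 by (cases "k = i"; cases "k = Suc i"; cases "k = Suc (Suc i)") auto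
        qed
        have "?c permutes {1..n}" using xp gi gj by (intro comp_simple_refl_permutes)
        then obtain k where k: "ddrel n f ?c k" using ddrel_exists by blast
        have "ddrel n f (?c \<circ> simple_refl i) (divided_diff i k)"
          using gi x3 3 by (intro ddrel.step[OF k]) auto
        from ddrel.step[OF this gj(1,2)] have "ddrel n f (?c \<circ> simple_refl i \<circ> simple_refl j) (divided_diff j (divided_diff i k))"
          using x3 3 by simp
        then have h: "h = divided_diff j (divided_diff i k)" using gi(5) li IH by simp
        have "ddrel n f (?c \<circ> simple_refl j) (divided_diff j k)"
          using gj x3 3 by (intro ddrel.step[OF k]) auto
        from ddrel.step[OF this gi(1,2)] have "ddrel n f (?c \<circ> simple_refl j \<circ> simple_refl i) (divided_diff i (divided_diff j k))"
          using x3 3 by simp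
        then have h': "h' = divided_diff i (divided_diff j k)" using gj(5) lj IH unfolding c' by simp
        show ?thesis unfolding gi(4) gj(4) h h' 3 by (rule divided_diff_braid)
      qed
    qed
    obtain i h where gi: "1 \<le> i" "i < n" "x (Suc i) < x i" "g = divided_diff i h"
        "ddrel n f (x \<circ> simple_refl i) h" using last[OF less.prems(1)] False by blast
    obtain j h' where gj: "1 \<le> j" "j < n" "x (Suc j) < x j" "g' = divided_diff j h'"
        "ddrel n f (x \<circ> simple_refl j) h'" using last[OF less.prems(2)] False by blast
    show ?thesis
      using wlog[OF gi gj] wlog[OF gj gi] by (cases "i \<le> j") auto
  qed
qed

text \<open>For a reduced word \<open>i\<^sub>1, \<dots>, i\<^sub>l\<close> of the inverse of x this is
  \<open>\<partial>\<^sub>i\<^sub>1 \<cdots> \<partial>\<^sub>i\<^sub>l f\<close>.\<close>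
definition dd_inv :: "nat \<Rightarrow> (nat \<Rightarrow> nat) \<Rightarrow> xypoly \<Rightarrow> xypoly" where
  "dd_inv n x f = (THE g. ddrel n f x g)"

lemma ddrel_dd_inv: "x permutes {1..n} \<Longrightarrow> ddrel n f x (dd_inv n x f)"
  unfolding dd_inv_def using ddrel_exists ddrel_unique by (metis theI)

lemma dd_inv_eqI: "ddrel n f x g \<Longrightarrow> dd_inv n x f = g"
  using ddrel_dd_inv ddrel_permutes ddrel_unique by blast

lemma dd_inv_id [simp]: "dd_inv n id f = f"
  by (rule dd_inv_eqI) (rule ddrel.base)

lemma dd_inv_ascent:
  "x permutes {1..n} \<Longrightarrow> 1 \<le> i \<Longrightarrow> i < n \<Longrightarrow> x i < x (Suc i) \<Longrightarrow>
    dd_inv n (x \<circ> simple_refl i) f = divided_diff i (dd_inv n x f)"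
  by (intro dd_inv_eqI ddrel.step ddrel_dd_inv)

lemma dd_inv_descent:
  assumes "x permutes {1..n}" "1 \<le> i" "i < n" "x (Suc i) < x i"
  shows "divided_diff i (dd_inv n x f) = 0"
  using dd_inv_ascent[OF comp_simple_refl_permutes[OF assms(1-3)] assms(2,3), of f] assms by simp

lemma dd_inv_hom:
  assumes "\<And>i f. 1 \<le> i \<Longrightarrow> i < n \<Longrightarrow> T (divided_diff i f) = divided_diff i (T f)"
    and "x permutes {1..n}"
  shows "dd_inv n x (T f) = T (dd_inv n x f)"
  using assms(2)
proof (induction rule: permutes_induct_ascent)
  case id
  show ?case by (simp only: dd_inv_id)
next
  case (ascent w i)
  then show ?case by (simp only: dd_inv_ascent assms(1))
qed

lemma dd_inv_0 [simp]: "x permutes {1..n} \<Longrightarrow> dd_inv n x 0 = 0"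
proof (induction rule: permutes_induct_ascent)
  case id
  show ?case by (simp only: dd_inv_id)
next
  case (ascent w i)
  then show ?case by (simp only: dd_inv_ascent divided_diff_0)
qed

lemma dd_inv_add: "x permutes {1..n} \<Longrightarrow> dd_inv n x (f + g) = dd_inv n x f + dd_inv n x g"
proof (induction rule: permutes_induct_ascent)
  case id
  show ?case by (simp only: dd_inv_id)
next
  case (ascent w i)
  then show ?case by (simp only: dd_inv_ascent divided_diff_add)
qed

lemma simple_refl_comp_permutes:
  "w permutes {1..n} \<Longrightarrow> 1 \<le> i \<Longrightarrow> i < n \<Longrightarrow> simple_refl i \<circ> w permutes {1..n}"
  by (intro permutes_compose simple_refl_permutes)

text \<open>Chains extend a permutation on the right and so add outer operators; here the innermost
  operator is split off instead. That \<open>k\<close> is a left ascent is a statement about the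
  positions \<open>a < b\<close> of the values \<open>k\<close> and \<open>Suc k\<close>, which move
  along with the chain.\<close>

lemma dd_inv_left_ascent:
  assumes "x permutes {1..n}" "1 \<le> k" "k < n" "a \<in> {1..n}" "b \<in> {1..n}" "a < b" "x a = k" "x b = Suc k"
  shows "dd_inv n (simple_refl k \<circ> x) f = dd_inv n x (divided_diff k f)"
  using assms(1,4-)
proof (induction arbitrary: a b rule: permutes_induct_ascent)
  case id
  have "dd_inv n (id \<circ> simple_refl k) f = divided_diff k (dd_inv n id f)"
    using assms(2,3) by (intro dd_inv_ascent permutes_id) auto
  then show ?case by (simp only: dd_inv_id id_comp comp_id)
next
  case (ascent x i)
  define a' b' where "a' = simple_refl i a" and "b' = simple_refl i b"
  have xa: "x a' = k" "x b' = Suc k" using ascent.prems by (auto simp: a'_def b'_def)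
  have ab': "a' < b'"
  proof (rule ccontr)
    assume "\<not> a' < b'"
    then have "a = i" "b = Suc i"
      using simple_refl_less[of a b i] ascent.prems by (auto simp: a'_def b'_def)
    then show False using xa ascent.hyps by (auto simp: a'_def b'_def)
  qed
  have in': "a' \<in> {1..n}" "b' \<in> {1..n}"
    unfolding a'_def b'_def simple_refl_in[OF ascent.hyps(2,3)] by fact+
  have IH: "dd_inv n (simple_refl k \<circ> x) f = dd_inv n x (divided_diff k f)"
    using ascent.IH[OF in' ab' xa] .
  \<comment> \<open>Left multiplication could destroy this ascent only if its two values were
    \<open>k\<close> and \<open>Suc k\<close>, and then \<open>a < b\<close> would fail.\<close>
  have asc: "(simple_refl k \<circ> x) i < (simple_refl k \<circ> x) (Suc i)"
  proof (cases "(x i, x (Suc i)) = (k, Suc k)")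
    case True
    note inj = inj_eq[OF permutes_inj[OF ascent.hyps(1)]]
    have "a' = i" "b' = Suc i" using True xa inj[of a' i] inj[of b' "Suc i"] by auto
    then have "a = Suc i" "b = i" by (metis a'_def b'_def simple_refl_simps(1,2,4))+
    then show ?thesis using ascent.prems by simp
  next
    case False
    then show ?thesis using simple_refl_less[OF ascent.hyps(4)] by simp
  qed
  have "dd_inv n (simple_refl k \<circ> x \<circ> simple_refl i) f = divided_diff i (dd_inv n (simple_refl k \<circ> x) f)"
    using ascent.hyps asc by (intro dd_inv_ascent simple_refl_comp_permutes assms(2,3))
  also have "\<dots> = divided_diff i (dd_inv n x (divided_diff k f))" by (simp only: IH)
  also have "\<dots> = dd_inv n (x \<circ> simple_refl i) (divided_diff k f)"
    using ascent.hyps by (simp add: dd_inv_ascent)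
  finally show ?case unfolding comp_assoc .
qed

text \<open>\<open>dd n w\<close> is the operator \<open>\<partial>\<^sub>w\<close>.\<close>
definition dd :: "nat \<Rightarrow> (nat \<Rightarrow> nat) \<Rightarrow> xypoly \<Rightarrow> xypoly" where
  "dd n w = dd_inv n (inv w)"

lemma inv_comp_simple_refl:
  assumes "w permutes {1..n}" "1 \<le> k" "k < n"
  shows "inv (w \<circ> simple_refl k) = simple_refl k \<circ> inv w"
    "inv (simple_refl k \<circ> w) = inv w \<circ> simple_refl k"
  by (rule inv_unique_comp; use permutes_inv_o[OF assms(1)] in \<open>simp add: fun_eq_iff\<close>)+

lemma dd_id [simp]: "dd n id f = f"
  by (simp add: dd_def)

lemma dd_0 [simp]: "w permutes {1..n} \<Longrightarrow> dd n w 0 = 0"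
  unfolding dd_def by (intro dd_inv_0 permutes_inv)

lemma dd_add: "w permutes {1..n} \<Longrightarrow> dd n w (f + g) = dd n w f + dd n w g"
  unfolding dd_def by (intro dd_inv_add permutes_inv)

lemma dd_ascent:
  assumes "w permutes {1..n}" "1 \<le> k" "k < n" "w k < w (Suc k)"
  shows "dd n (w \<circ> simple_refl k) f = dd n w (divided_diff k f)"
proof -
  have iv: "inv w (w j) = j" for j using permutes_inverses(2)[OF assms(1)] .
  have "w k \<in> {1..n}" "w (Suc k) \<in> {1..n}"
    unfolding permutes_in_image[OF assms(1)] using assms(2,3) by auto
  then show ?thesis unfolding dd_def inv_comp_simple_refl(1)[OF assms(1-3)]
    by (rule dd_inv_left_ascent[where a = "w k" and b = "w (Suc k)", OF permutes_inv[OF assms(1)] assms(2,3)])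
       (use assms(4) iv in auto)
qed

lemma dd_descent:
  assumes "w permutes {1..n}" "1 \<le> k" "k < n" "w (Suc k) < w k"
  shows "dd n w (divided_diff k f) = 0"
proof -
  have "dd n w (divided_diff k f) = dd n (w \<circ> simple_refl k) (divided_diff k (divided_diff k f))"
    using dd_ascent[OF comp_simple_refl_permutes[OF assms(1-3)] assms(2,3), of "divided_diff k f"] assms
    by simp
  then show ?thesis using dd_0[OF comp_simple_refl_permutes[OF assms(1-3)]] by simp
qed

lemma dd_left:
  assumes "w permutes {1..n}" "1 \<le> i" "i < n"
  shows "divided_diff i (dd n w f) = (if inv w i < inv w (Suc i) then dd n (simple_refl i \<circ> w) f else 0)"
proof -
  have "inv w i \<noteq> inv w (Suc i)" using inj_eq[OF permutes_inj[OF permutes_inv[OF assms(1)]]] by simp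
  then show ?thesis unfolding dd_def inv_comp_simple_refl(2)[OF assms]
    using dd_inv_ascent[OF permutes_inv[OF assms(1)] assms(2,3), of f]
      dd_inv_descent[OF permutes_inv[OF assms(1)] assms(2,3), of f]
    by auto
qed

lemma perm_length_inv:
  assumes "w permutes {1..n}"
  shows "perm_length n (inv w) = perm_length n w"
proof -
  have iv: "inv w (w j) = j" "w (inv w j) = j" for j using permutes_inverses[OF assms] by auto
  have m: "w j \<in> {1..n} \<longleftrightarrow> j \<in> {1..n}" "inv w j \<in> {1..n} \<longleftrightarrow> j \<in> {1..n}" for j
    using permutes_in_image[OF assms] permutes_in_image[OF permutes_inv[OF assms]] by auto
  have "bij_betw (\<lambda>(i, j). (w j, w i)) (inversions n w) (inversions n (inv w))"
  proof (rule bij_betw_byWitness[where f' = "\<lambda>(i, j). (inv w j, inv w i)"])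
    show "(\<lambda>(i, j). (w j, w i)) ` inversions n w \<subseteq> inversions n (inv w)"
      using m by (fastforce simp: inversions_def iv)
    show "(\<lambda>(i, j). (inv w j, inv w i)) ` inversions n (inv w) \<subseteq> inversions n w"
      using m by (fastforce simp: inversions_def iv)
  qed (auto simp: iv)
  then show ?thesis unfolding perm_length_eq by (metis bij_betw_same_card)
qed

lemma perm_length_left:
  assumes "w permutes {1..n}" "1 \<le> i" "i < n"
  shows "perm_length n (simple_refl i \<circ> w) =
    (if inv w i < inv w (Suc i) then Suc (perm_length n w) else perm_length n w - 1)"
    "\<not> inv w i < inv w (Suc i) \<Longrightarrow> 0 < perm_length n w"
proof -
  have ne: "inv w i \<noteq> inv w (Suc i)" using inj_eq[OF permutes_inj[OF permutes_inv[OF assms(1)]]] by simp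
  have iv: "inv w permutes {1..n}" by (rule permutes_inv[OF assms(1)])
  have "perm_length n (simple_refl i \<circ> w) = perm_length n (inv w \<circ> simple_refl i)"
    using perm_length_inv[OF simple_refl_comp_permutes[OF assms]] inv_comp_simple_refl(2)[OF assms] by simp
  then show "perm_length n (simple_refl i \<circ> w) =
    (if inv w i < inv w (Suc i) then Suc (perm_length n w) else perm_length n w - 1)"
    "\<not> inv w i < inv w (Suc i) \<Longrightarrow> 0 < perm_length n w"
    using perm_length_ascent[of i n "inv w"] perm_length_descent[of i n "inv w"] ne assms
      perm_length_inv[OF assms(1)] by auto
qed

lemma inversions_id: "inversions n id = {}"
  by (auto simp: inversions_def)

lemma perm_length_id [simp]: "perm_length n id = 0"
  by (simp only: perm_length_eq inversions_id card.empty)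

section \<open>Reduced words\<close>

definition word_perm :: "nat list \<Rightarrow> nat \<Rightarrow> nat" where
  "word_perm is = foldr (\<circ>) (map simple_refl is) id"

lemma word_perm_Nil: "word_perm [] = id"
  and word_perm_Cons: "word_perm (i # is) = simple_refl i \<circ> word_perm is"
  by (simp_all only: word_perm_def list.map foldr.simps id_apply o_apply)

lemma word_perm_permutes: "set is \<subseteq> {1..<n} \<Longrightarrow> word_perm is permutes {1..n}"
proof (induction "is")
  case Nil
  show ?case unfolding word_perm_Nil by (rule permutes_id)
next
  case (Cons i js)
  then have "1 \<le> i" "i < n" "word_perm js permutes {1..n}" by auto
  then show ?case unfolding word_perm_Cons by (intro simple_refl_comp_permutes)
qed

text \<open>Arbitrary words are considered because the tail of a reduced word has to be recognized
  as reduced: length lost in the tail cannot be made up for by one further letter.\<close>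

lemma word_perm_length:
  "set is \<subseteq> {1..<n} \<Longrightarrow> perm_length n (word_perm is) \<le> length is \<and>
    (perm_length n (word_perm is) = length is \<longrightarrow> dd n (word_perm is) f = foldr divided_diff is f)"
proof (induction "is")
  case (Cons i js)
  let ?w = "word_perm js"
  have w: "?w permutes {1..n}" "1 \<le> i" "i < n" using Cons.prems word_perm_permutes[of js n] by auto
  have le: "perm_length n (simple_refl i \<circ> ?w) \<le> Suc (perm_length n ?w)"
    using perm_length_left(1)[OF w] by (simp split: if_splits)
  have "dd n (simple_refl i \<circ> ?w) f = divided_diff i (foldr divided_diff js f)"
    if "perm_length n (simple_refl i \<circ> ?w) = Suc (length js)"
    using that le Cons dd_left[OF w, of f] perm_length_left[OF w] by (auto split: if_splits)
  then have "perm_length n (simple_refl i \<circ> ?w) \<le> length (i # js) \<and>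
    (perm_length n (simple_refl i \<circ> ?w) = length (i # js) \<longrightarrow>
      dd n (simple_refl i \<circ> ?w) f = foldr divided_diff (i # js) f)"
    using le Cons by auto
  then show ?case unfolding word_perm_Cons .
next
  case Nil
  have "perm_length n id \<le> length [] \<and>
      (perm_length n id = length [] \<longrightarrow> dd n id f = foldr divided_diff [] f)" by simp
  then show ?case unfolding word_perm_Nil .
qed

lemma reduced_word_dd:
  "reduced_word n w is \<Longrightarrow> dd n w f = foldr divided_diff is f"
  using word_perm_length[of "is" n f] by (auto simp: reduced_word_def word_perm_def[symmetric])

lemma reduced_word_exists:
  assumes "w permutes {1..n}"
  shows "\<exists>is. reduced_word n w is"
proof -
  have "\<exists>is. set is \<subseteq> {1..<n} \<and> word_perm is = inv x \<and> length is = perm_length n x"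
    if "x permutes {1..n}" for x
    using that
  proof (induction rule: permutes_induct_ascent)
    case id
    show ?case
      by (rule exI[of _ "[]"])
         (simp only: word_perm_Nil inv_id perm_length_id list.size list.set empty_subsetI simp_thms)
  next
    case (ascent x i)
    then obtain js where "set js \<subseteq> {1..<n} \<and> word_perm js = inv x \<and> length js = perm_length n x" by blast
    then have "set (i # js) \<subseteq> {1..<n} \<and> word_perm (i # js) = inv (x \<circ> simple_refl i) \<and>
        length (i # js) = perm_length n (x \<circ> simple_refl i)"
      unfolding word_perm_Cons inv_comp_simple_refl(1)[OF ascent.hyps(1-3)]
        perm_length_ascent[OF ascent.hyps(2-4)]
      using ascent.hyps by auto
    then show ?case by (rule exI)
  qed
  from this[OF permutes_inv[OF assms]] show ?thesis
    by (simp add: reduced_word_def word_perm_def[symmetric] perm_length_inv[OF assms] permutes_inv_inv[OF assms])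
qed

section \<open>Double Schubert polynomials\<close>

abbreviation stair :: "nat \<Rightarrow> (nat \<times> nat) set" where
  "stair n \<equiv> {(i, j). 1 \<le> i \<and> 1 \<le> j \<and> i + j \<le> n}"

lemma finite_stair: "finite (stair n)"
  by (rule finite_subset[of _ "{1..n} \<times> {1..n}"]) auto

lemma longest_perm_simps [simp]:
  "1 \<le> i \<Longrightarrow> i \<le> n \<Longrightarrow> longest_perm n i = Suc n - i"
  "longest_perm n (longest_perm n i) = i"
  by (auto simp: longest_perm_def)

lemma longest_perm_twice: "longest_perm n \<circ> longest_perm n = id"
  by (rule ext) simp

lemma longest_perm_permutes: "longest_perm n permutes {1..n}"
proof (rule bij_imp_permutes)
  show "bij_betw (longest_perm n) {1..n} {1..n}"
    by (rule bij_betw_byWitness[where f' = "longest_perm n"]) (auto simp: longest_perm_def)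
qed (auto simp: longest_perm_def)

lemma longest_perm_less:
  "a \<in> {1..n} \<Longrightarrow> b \<in> {1..n} \<Longrightarrow> longest_perm n a < longest_perm n b \<longleftrightarrow> b < a"
  by (auto simp: longest_perm_def)

lemma longest_comp_ascent:
  assumes "w permutes {1..n}" "1 \<le> i" "i < n"
  shows "(longest_perm n \<circ> w) i < (longest_perm n \<circ> w) (Suc i) \<longleftrightarrow> w (Suc i) < w i"
proof -
  have "w i \<in> {1..n}" "w (Suc i) \<in> {1..n}"
    unfolding permutes_in_image[OF assms(1)] using assms by auto
  then show ?thesis by (simp add: longest_perm_less del: atLeastAtMost_iff)
qed

lemma longest_comp_permutes: "w permutes {1..n} \<Longrightarrow> longest_perm n \<circ> w permutes {1..n}"
  by (rule permutes_compose[OF _ longest_perm_permutes])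

lemma longest_comp_twice: "longest_perm n \<circ> (longest_perm n \<circ> w) = w"
  by (simp add: fun_eq_iff)

text \<open>Left multiplication by the longest permutation reverses the order of values, so going
  down from it by descents is going up from the identity by ascents. Double Schubert polynomials
  thus become instances of \<open>dd_inv\<close>.\<close>

lemma is_dschubert_eq:
  assumes "is_dschubert n y w f"
  shows "w permutes {1..n} \<and> f = dd_inv n (longest_perm n \<circ> w) (\<Prod>(i, j)\<in>stair n. X i - y j)"
  using assms
proof (induction rule: is_dschubert.induct)
  case longest
  show ?case unfolding longest_perm_twice dd_inv_id by (rule conjI[OF longest_perm_permutes refl])
next
  case (descent w f i)
  then have w: "w permutes {1..n}" and "w (Suc i) < w i"
    using perm_length_comp_less_iff[of w n i] by auto
  then have "(longest_perm n \<circ> w) i < (longest_perm n \<circ> w) (Suc i)"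
    using longest_comp_ascent[OF w descent.hyps(2,3)] by blast
  note asc = dd_inv_ascent[OF longest_comp_permutes[OF w] descent.hyps(2,3) this]
  have "f = dd_inv n (longest_perm n \<circ> w) (\<Prod>(i, j)\<in>stair n. X i - y j)"
    using descent.IH by (rule conjunct2)
  then have "divided_diff i f = dd_inv n (longest_perm n \<circ> w \<circ> simple_refl i) (\<Prod>(i, j)\<in>stair n. X i - y j)"
    unfolding asc by simp
  then show ?case using comp_simple_refl_permutes[OF w descent.hyps(2,3)]
    unfolding comp_assoc by (rule conjI[rotated])
qed

lemma dschubert_eq:
  assumes "w permutes {1..n}"
  shows "dschubert n y w = dd_inv n (longest_perm n \<circ> w) (\<Prod>(i, j)\<in>stair n. X i - y j)"
proof -
  have "is_dschubert n y (longest_perm n \<circ> x) (dd_inv n x (\<Prod>(i, j)\<in>stair n. X i - y j))"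
    if "x permutes {1..n}" for x
    using that
  proof (induction rule: permutes_induct_ascent)
    case id
    show ?case unfolding dd_inv_id comp_id by (rule is_dschubert.longest)
  next
    case (ascent x i)
    let ?w = "longest_perm n \<circ> x"
    have w: "?w permutes {1..n}" by (rule longest_comp_permutes[OF ascent.hyps(1)])
    have "?w (Suc i) < ?w i"
      using longest_comp_ascent[OF w ascent.hyps(2,3)] ascent.hyps(4) unfolding longest_comp_twice by blast
    then have "perm_length n (?w \<circ> simple_refl i) < perm_length n ?w"
      using perm_length_comp_less_iff[OF w ascent.hyps(2,3)] by blast
    from is_dschubert.descent[OF ascent.IH ascent.hyps(2,3) this]
    show ?case unfolding dd_inv_ascent[OF ascent.hyps] comp_assoc .
  qed
  from this[OF longest_comp_permutes[OF assms]]
  have "is_dschubert n y w (dd_inv n (longest_perm n \<circ> w) (\<Prod>(i, j)\<in>stair n. X i - y j))"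
    unfolding longest_comp_twice .
  then show ?thesis unfolding dschubert_def
    by (rule the_equality) (rule conjunct2[OF is_dschubert_eq])
qed

lemma dschubert_longest: "dschubert n y (longest_perm n) = (\<Prod>(i, j)\<in>stair n. X i - y j)"
  unfolding dschubert_eq[OF longest_perm_permutes] longest_perm_twice dd_inv_id ..

lemma divided_diff_dschubert:
  assumes "w permutes {1..n}" "1 \<le> i" "i < n"
  shows "divided_diff i (dschubert n y w) = (if w (Suc i) < w i then dschubert n y (w \<circ> simple_refl i) else 0)"
proof -
  note x = longest_comp_permutes[OF assms(1)]
  have ne: "(longest_perm n \<circ> w) i \<noteq> (longest_perm n \<circ> w) (Suc i)"
    using inj_eq[OF permutes_inj[OF x]] by simp
  show ?thesis
  proof (cases "w (Suc i) < w i")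
    case True
    then have "(longest_perm n \<circ> w) i < (longest_perm n \<circ> w) (Suc i)"
      using longest_comp_ascent[OF assms] by blast
    from dd_inv_ascent[OF x assms(2,3) this]
    have "dschubert n y (w \<circ> simple_refl i) = divided_diff i (dschubert n y w)"
      unfolding dschubert_eq[OF assms(1)] dschubert_eq[OF comp_simple_refl_permutes[OF assms]] comp_assoc .
    then show ?thesis using True by simp
  next
    case False
    then have "(longest_perm n \<circ> w) (Suc i) < (longest_perm n \<circ> w) i"
      using longest_comp_ascent[OF assms] ne by linarith
    from dd_inv_descent[OF x assms(2,3) this] have "divided_diff i (dschubert n y w) = 0"
      unfolding dschubert_eq[OF assms(1)] .
    then show ?thesis using False by simp
  qed
qed

lemma permutes_induct_descent [consumes 1, case_names longest descent]:
  assumes "w permutes {1..n}" and "P (longest_perm n)"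
    and "\<And>w i. w permutes {1..n} \<Longrightarrow> 1 \<le> i \<Longrightarrow> i < n \<Longrightarrow> w (Suc i) < w i \<Longrightarrow> P w \<Longrightarrow> P (w \<circ> simple_refl i)"
  shows "P w"
proof -
  have "P (longest_perm n \<circ> x)" if "x permutes {1..n}" for x
    using that
  proof (induction rule: permutes_induct_ascent)
    case id
    show ?case unfolding comp_id by (rule assms(2))
  next
    case (ascent x i)
    let ?w = "longest_perm n \<circ> x"
    have w: "?w permutes {1..n}" by (rule longest_comp_permutes[OF ascent.hyps(1)])
    have "?w (Suc i) < ?w i"
      using longest_comp_ascent[OF w ascent.hyps(2,3)] ascent.hyps(4) unfolding longest_comp_twice by blast
    from assms(3)[OF w ascent.hyps(2,3) this ascent.IH] show ?case unfolding comp_assoc .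
  qed
  from this[OF longest_comp_permutes[OF assms(1)]] show ?thesis unfolding longest_comp_twice .
qed

subsection \<open>Localization\<close>

text \<open>Restriction of an equivariant class to the torus fixed point \<open>\<sigma>\<close>.
  The result contains none of \<open>X 1, ..., X n\<close> and is therefore a scalar for the divided
  differences.\<close>

definition ev :: "nat \<Rightarrow> (nat \<Rightarrow> nat) \<Rightarrow> xypoly \<Rightarrow> xypoly" where
  "ev n \<sigma> = subst (\<lambda>v. case v of XVar j \<Rightarrow> if 1 \<le> j \<and> j \<le> n then Y (\<sigma> j) else X j | YVar j \<Rightarrow> Y j)"

lemma ev_simps [simp]:
  "ev n \<sigma> 0 = 0" "ev n \<sigma> 1 = 1" "ev n \<sigma> (f + g) = ev n \<sigma> f + ev n \<sigma> g"
  "ev n \<sigma> (f - g) = ev n \<sigma> f - ev n \<sigma> g" "ev n \<sigma> (f * g) = ev n \<sigma> f * ev n \<sigma> g"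
  "ev n \<sigma> (Y j) = Y j" "1 \<le> i \<Longrightarrow> i \<le> n \<Longrightarrow> ev n \<sigma> (X i) = Y (\<sigma> i)"
  by (simp_all add: ev_def)

lemma ev_sum [simp]: "ev n \<sigma> (sum h A) = (\<Sum>a\<in>A. ev n \<sigma> (h a))"
  and ev_prod [simp]: "ev n \<sigma> (prod h A) = (\<Prod>a\<in>A. ev n \<sigma> (h a))"
  by (simp_all only: ev_def subst_sum subst_prod)

lemma ev_swap_x:
  assumes "1 \<le> i" "i < n"
  shows "ev n \<sigma> (swap_x i f) = ev n (\<sigma> \<circ> simple_refl i) f"
  unfolding ev_def swap_x_eq_subst subst_subst
proof (rule subst_cong_all)
  fix v
  show "subst (\<lambda>v. case v of XVar j \<Rightarrow> if 1 \<le> j \<and> j \<le> n then Y (\<sigma> j) else X j | YVar j \<Rightarrow> Y j) (Var (swap_var i v))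
    = (case v of XVar j \<Rightarrow> if 1 \<le> j \<and> j \<le> n then Y ((\<sigma> \<circ> simple_refl i) j) else X j | YVar j \<Rightarrow> Y j)"
  proof (cases v)
    case (XVar j)
    then show ?thesis using assms
      by (cases "j = i"; cases "j = Suc i") (auto simp: swap_var_XVar)
  qed simp
qed

lemma ev_divided_diff:
  assumes "1 \<le> i" "i < n"
  shows "(Y (\<sigma> i) - Y (\<sigma> (Suc i))) * ev n \<sigma> (divided_diff i f) = ev n \<sigma> f - ev n (\<sigma> \<circ> simple_refl i) f"
proof -
  have "ev n \<sigma> ((X i - X (Suc i)) * divided_diff i f) = ev n \<sigma> (f - swap_x i f)"
    by (simp only: divided_diff)
  then show ?thesis using assms by (simp add: ev_swap_x)
qed

lemma swap_x_ev:
  assumes "1 \<le> i" "i < n"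
  shows "swap_x i (ev n \<sigma> f) = ev n \<sigma> f"
  unfolding ev_def swap_x_eq_subst subst_subst
proof (rule subst_cong_all)
  fix v
  show "subst (\<lambda>v. Var (swap_var i v)) (case v of XVar j \<Rightarrow> if 1 \<le> j \<and> j \<le> n then Y (\<sigma> j) else X j | YVar j \<Rightarrow> Y j)
    = (case v of XVar j \<Rightarrow> if 1 \<le> j \<and> j \<le> n then Y (\<sigma> j) else X j | YVar j \<Rightarrow> Y j)"
    using assms by (cases v) auto
qed

text \<open>A recursion on the prefix instead of a cardinality, because the rank arguments compare
  counts at three successive prefixes.\<close>

primrec cnt :: "(nat \<Rightarrow> bool) \<Rightarrow> nat \<Rightarrow> nat" where
  "cnt A 0 = 0"
| "cnt A (Suc k) = cnt A k + (if A (Suc k) then 1 else 0)"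

lemma cnt_mono: "(\<And>j. 1 \<le> j \<Longrightarrow> j \<le> k \<Longrightarrow> A j \<Longrightarrow> B j) \<Longrightarrow> cnt A k \<le> cnt B k"
proof (induction k)
  case (Suc k)
  then have "cnt A k \<le> cnt B k" by simp
  then show ?case using Suc.prems[of "Suc k"] by auto
qed simp

lemma cnt_cong: "(\<And>j. 1 \<le> j \<Longrightarrow> j \<le> k \<Longrightarrow> A j \<longleftrightarrow> B j) \<Longrightarrow> cnt A k = cnt B k"
  by (intro antisym cnt_mono) auto

lemma cnt_eq_card: "cnt A k = card {j \<in> {1..k}. A j}"
proof (induction k)
  case (Suc k)
  have "{j \<in> {1..Suc k}. A j} = (if A (Suc k) then insert (Suc k) {j \<in> {1..k}. A j} else {j \<in> {1..k}. A j})"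
    by (auto simp: le_Suc_eq)
  then show ?case using Suc by auto
qed simp

text \<open>Only the prefix that ends at \<open>i\<close> separates \<open>i\<close> from
  \<open>Suc i\<close>.\<close>

lemma cnt_simple_refl:
  assumes "1 \<le> i" "k \<noteq> i"
  shows "cnt (\<lambda>j. A (simple_refl i j)) k = cnt A k"
proof (cases "k < i")
  case True
  then show ?thesis by (intro cnt_cong) simp
next
  case False
  then have "Suc i \<le> k" using assms by simp
  then show ?thesis
  proof (induction k rule: dec_induct)
    case base
    obtain i' where i': "i = Suc i'" using assms by (cases i) auto
    have "cnt (\<lambda>j. A (simple_refl i j)) i' = cnt A i'" using i' by (intro cnt_cong) auto
    then show ?case using i' simple_refl_simps(1,2)[of i] by simp
  qed simp
qed

text \<open>An excess at the prefix \<open>i\<close> but at neither neighbouring prefix would force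
  \<open>B\<close> to miss \<open>i\<close> and to contain \<open>Suc i\<close>. So a violated rank
  condition can be moved to a prefix that the exchange of \<open>i\<close> and \<open>Suc i\<close>
  does not affect.\<close>

lemma cnt_violation:
  assumes "cnt A k > cnt B k" and desc: "B (Suc i) \<Longrightarrow> B i" and i: "1 \<le> i"
  shows "\<exists>k. k \<noteq> i \<and> cnt A k > cnt B k"
proof (cases "k = i")
  case True
  obtain i' where i': "i = Suc i'" using i by (cases i) auto
  have c: "cnt A (Suc i') > cnt B (Suc i')" using assms(1) True i' by simp
  consider "cnt A i' > cnt B i'" | "cnt A (Suc (Suc i')) > cnt B (Suc (Suc i'))"
    using c desc i' by (cases "B (Suc i)"; cases "B i"; cases "A i"; cases "A (Suc i)") auto
  then show ?thesis using i' by (metis n_not_Suc_n)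
qed (use assms in blast)

text \<open>The hypothesis says that a rank condition for \<open>\<sigma> \<ge> w\<close> in Bruhat
  order is violated. In the descent from the longest permutation the violation can be taken at a
  prefix other than \<open>i\<close>; then it is present at both points of the divided difference,
  and both values vanish.\<close>

lemma ev_dschubert_eq_0:
  assumes "w permutes {1..n}" "\<sigma> permutes {1..n}"
    and "cnt (\<lambda>j. \<sigma> j \<le> m) k > cnt (\<lambda>j. w j \<le> m) k"
  shows "ev n \<sigma> (dschubert n Y w) = 0"
proof -
  have "\<forall>\<sigma> k. \<sigma> permutes {1..n} \<longrightarrow> cnt (\<lambda>j. \<sigma> j \<le> m) k > cnt (\<lambda>j. w j \<le> m) k \<longrightarrow>
      ev n \<sigma> (dschubert n Y w) = 0"
    using assms(1)
  proof (induction rule: permutes_induct_descent)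
    case longest
    show ?case
    proof (intro allI impI)
      fix \<sigma> k
      assume s: "\<sigma> permutes {1..n}" and "cnt (\<lambda>j. \<sigma> j \<le> m) k > cnt (\<lambda>j. longest_perm n j \<le> m) k"
      \<comment> \<open>Some \<open>j\<close> has \<open>\<sigma> j \<le> m < Suc n - j\<close>, so
        the factor of the staircase product at \<open>(j, \<sigma> j)\<close> vanishes.\<close>
      then have "\<not> (\<forall>j. 1 \<le> j \<longrightarrow> j \<le> k \<longrightarrow> \<sigma> j \<le> m \<longrightarrow> longest_perm n j \<le> m)"
        using cnt_mono[of k "\<lambda>j. \<sigma> j \<le> m" "\<lambda>j. longest_perm n j \<le> m"] by (meson not_le)
      then obtain j where j: "1 \<le> j" "\<sigma> j \<le> m" "longest_perm n j > m" by auto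
      have jn: "j \<le> n" using j permutes_not_in[OF s, of j] by (auto simp: longest_perm_def split: if_splits)
      then have "\<sigma> j \<in> {1..n}" unfolding permutes_in_image[OF s] using j by simp
      then have "(j, \<sigma> j) \<in> stair n" using j jn by (auto simp: longest_perm_def split: if_splits)
      moreover have "ev n \<sigma> (X j - Y (\<sigma> j)) = 0" using j jn by simp
      ultimately show "ev n \<sigma> (dschubert n Y (longest_perm n)) = 0"
        unfolding dschubert_longest ev_prod
        by (intro prod_zero finite_stair bexI[of _ "(j, \<sigma> j)"]) auto
    qed
  next
    case (descent w i)
    show ?case
    proof (intro allI impI)
      fix \<sigma> k
      assume s: "\<sigma> permutes {1..n}" and k: "cnt (\<lambda>j. \<sigma> j \<le> m) k > cnt (\<lambda>j. (w \<circ> simple_refl i) j \<le> m) k"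
      obtain k where k: "k \<noteq> i" "cnt (\<lambda>j. \<sigma> j \<le> m) k > cnt (\<lambda>j. (w \<circ> simple_refl i) j \<le> m) k"
        using cnt_violation[OF k, of i] descent.hyps by auto
      then have k2: "cnt (\<lambda>j. \<sigma> j \<le> m) k > cnt (\<lambda>j. w j \<le> m) k"
        using cnt_simple_refl[OF descent.hyps(2) k(1), of "\<lambda>j. w j \<le> m"] by simp
      have s': "\<sigma> \<circ> simple_refl i permutes {1..n}" by (rule comp_simple_refl_permutes[OF s descent.hyps(2,3)])
      have k3: "cnt (\<lambda>j. (\<sigma> \<circ> simple_refl i) j \<le> m) k > cnt (\<lambda>j. w j \<le> m) k"
        using k2 cnt_simple_refl[OF descent.hyps(2) k(1), of "\<lambda>j. \<sigma> j \<le> m"] by simp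
      have 0: "ev n \<sigma> (dschubert n Y w) = 0" "ev n (\<sigma> \<circ> simple_refl i) (dschubert n Y w) = 0"
        using descent.IH s s' k2 k3 by blast+
      have "\<sigma> i \<noteq> \<sigma> (Suc i)" using inj_eq[OF permutes_inj[OF s]] by simp
      then show "ev n \<sigma> (dschubert n Y (w \<circ> simple_refl i)) = 0"
        using ev_divided_diff[OF descent.hyps(2,3), of \<sigma> "dschubert n Y w"] 0
          divided_diff_dschubert[OF descent.hyps(1-3), of Y] descent.hyps(4)
        by simp
    qed
  qed
  then show ?thesis using assms by blast
qed

text \<open>The divided difference for \<open>w \<circ> simple_refl i\<close>, taken at this same
  permutation, evaluates the polynomial of \<open>w\<close> there and at \<open>w\<close>. Only the
  value at \<open>w\<close> survives, and it is known by induction.\<close>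

lemma ev_dschubert_self:
  assumes "w permutes {1..n}"
  shows "ev n w (dschubert n Y w) = (\<Prod>(i, j)\<in>inversions n w. Y (w i) - Y (w j))"
  using assms
proof (induction rule: permutes_induct_descent)
  case longest
  have "(\<Prod>(i, j)\<in>inversions n (longest_perm n). Y (longest_perm n i) - Y (longest_perm n j))
      = (\<Prod>(i, j)\<in>stair n. Y (longest_perm n i) - Y j)"
    by (rule prod.reindex_bij_witness[where i = "\<lambda>(i, j). (i, Suc n - j)" and j = "\<lambda>(i, j). (i, Suc n - j)"])
       (auto simp: inversions_def longest_perm_def)
  also have "\<dots> = ev n (longest_perm n) (dschubert n Y (longest_perm n))"
    unfolding dschubert_longest ev_prod by (rule prod.cong) auto
  finally show ?case by (rule sym)
next
  case (descent w i)
  let ?w = "w \<circ> simple_refl i"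
  note h = descent.hyps
  have w': "?w permutes {1..n}" by (rule comp_simple_refl_permutes[OF h(1-3)])
  have asc: "?w i < ?w (Suc i)" using h by simp
  define e where "e = ev n ?w (dschubert n Y ?w)"
  define p where "p = (\<Prod>(a, b)\<in>inversions n ?w. Y (?w a) - Y (?w b))"
  \<comment> \<open>With the smaller value \<open>w (Suc i)\<close> as threshold, the prefix of
    length \<open>i\<close> tells the two permutations apart.\<close>
  have "cnt (\<lambda>j. ?w j \<le> w (Suc i)) i > cnt (\<lambda>j. w j \<le> w (Suc i)) i"
  proof -
    obtain i' where i': "i = Suc i'" using h by (cases i) auto
    have "cnt (\<lambda>j. ?w j \<le> w (Suc i)) i' = cnt (\<lambda>j. w j \<le> w (Suc i)) i'"
      using i' by (intro cnt_cong) auto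
    then show ?thesis using i' h(4) simple_refl_simps(1)[of i] by simp
  qed
  then have "ev n ?w (dschubert n Y w) = 0" by (rule ev_dschubert_eq_0[OF h(1) w'])
  then have "(Y (?w i) - Y (?w (Suc i))) * ev n ?w (dschubert n Y ?w) = - ev n w (dschubert n Y w)"
    using ev_divided_diff[OF h(2,3), of ?w "dschubert n Y w"] divided_diff_dschubert[OF h(1-3), of Y] h(4)
    by simp
  also have "\<dots> = - (\<Prod>(a, b)\<in>inversions n w. Y (w a) - Y (w b))" by (simp only: descent.IH)
  also have "(\<Prod>(a, b)\<in>inversions n w. Y (w a) - Y (w b)) =
      (Y (w i) - Y (w (Suc i))) * (\<Prod>(a, b)\<in>inversions n ?w. Y (?w a) - Y (?w b))"
  proof -
    note inv = inversions_ascent[where w = ?w, OF h(2,3) asc, unfolded comp_simple_refl_twice]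
    let ?f = "map_prod (simple_refl i) (simple_refl i)"
    have "inj_on ?f (inversions n ?w)" by (rule inj_on_inverseI[of _ ?f]) auto
    then have "(\<Prod>(a, b)\<in>?f ` inversions n ?w. Y (w a) - Y (w b))
        = (\<Prod>(a, b)\<in>inversions n ?w. Y (?w a) - Y (?w b))"
      by (subst prod.reindex) (auto intro: prod.cong)
    then show ?thesis unfolding inv(1) using inv(2) by (subst prod.insert) auto
  qed
  finally have *: "(Y (?w i) - Y (?w (Suc i))) * e = - ((Y (w i) - Y (w (Suc i))) * p)"
    unfolding e_def p_def .
  have "(Y (w (Suc i)) - Y (w i)) * e = (Y (w (Suc i)) - Y (w i)) * p"
    using * by (simp add: algebra_simps)
  moreover have nz: "Y (w (Suc i)) - Y (w i) \<noteq> 0" using h(4) by simp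
  ultimately have "e = p" using mult_left_cancel[OF nz] by blast
  then show ?case unfolding e_def p_def .
qed

text \<open>The first point moved by \<open>w\<close> violates a rank condition for the identity.
  Localization at the identity therefore isolates one coefficient of an expansion in double Schubert
  polynomials.\<close>

lemma ev_id_dschubert:
  assumes "w permutes {1..n}"
  shows "ev n id (dschubert n Y w) = (if w = id then 1 else 0)"
proof (cases "w = id")
  case True
  have "ev n id (dschubert n Y id) = 1"
    unfolding ev_dschubert_self[OF permutes_id] inversions_id by simp
  then show ?thesis using True by simp
next
  case False
  obtain k where k: "w k \<noteq> k" "\<And>j. j < k \<Longrightarrow> w j = j"
    using False exists_least_iff[of "\<lambda>k. w k \<noteq> k"] by (auto simp: fun_eq_iff)
  have "\<not> w k < k" using k inj_eq[OF permutes_inj[OF assms]] by metis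
  then have gt: "k < w k" using k(1) by simp
  have kn: "k \<in> {1..n}" using k(1) permutes_not_in[OF assms] by blast
  then obtain k' where k': "k = Suc k'" by (cases k) auto
  have "cnt (\<lambda>j. id j \<le> k) k' = cnt (\<lambda>j. w j \<le> k) k'"
    using k' k(2) by (intro cnt_cong) auto
  then have "cnt (\<lambda>j. id j \<le> k) k > cnt (\<lambda>j. w j \<le> k) k" using k' gt by simp
  then show ?thesis using ev_dschubert_eq_0[OF assms permutes_id] False by simp
qed

subsection \<open>Symmetry in the y-variables\<close>

definition swap_y :: "nat \<Rightarrow> xypoly \<Rightarrow> xypoly" where
  "swap_y k = subst (\<lambda>v. case v of XVar j \<Rightarrow> X j | YVar j \<Rightarrow> Y (simple_refl k j))"

lemma swap_y_simps [simp]: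
  "swap_y k 0 = 0" "swap_y k 1 = 1" "swap_y k (f + g) = swap_y k f + swap_y k g"
  "swap_y k (f - g) = swap_y k f - swap_y k g" "swap_y k (f * g) = swap_y k f * swap_y k g"
  "swap_y k (sum h A) = (\<Sum>a\<in>A. swap_y k (h a))" "swap_y k (prod h A) = (\<Prod>a\<in>A. swap_y k (h a))"
  "swap_y k (X i) = X i" "swap_y k (Y j) = Y (simple_refl k j)"
  by (simp_all add: swap_y_def)

lemma swap_y_divided_diff: "swap_y k (divided_diff i f) = divided_diff i (swap_y k f)"
  unfolding swap_y_def
proof (rule subst_divided_diff)
  fix f
  show "subst (\<lambda>v. case v of XVar j \<Rightarrow> X j | YVar j \<Rightarrow> Y (simple_refl k j)) (swap_x i f)
     = swap_x i (subst (\<lambda>v. case v of XVar j \<Rightarrow> X j | YVar j \<Rightarrow> Y (simple_refl k j)) f)"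
  proof (rule subst_swap_xI)
    fix v
    show "(case swap_var i v of XVar j \<Rightarrow> X j | YVar j \<Rightarrow> Y (simple_refl k j))
      = swap_x i (case v of XVar j \<Rightarrow> X j | YVar j \<Rightarrow> Y (simple_refl k j))"
      by (cases v) (simp_all add: swap_var_XVar)
  qed
qed simp_all

text \<open>The hypothesis lets \<open>divided_diff (n - k)\<close> be the first operator applied to
  the staircase product. It removes the factor at the corner \<open>(n - k, k)\<close>; without this
  corner the staircase has equal columns \<open>k\<close> and \<open>Suc k\<close>, and the
  remaining operators touch only the x-variables.\<close>

lemma swap_y_dschubert:
  assumes "w permutes {1..n}" "1 \<le> k" "k < n" "inv w k < inv w (Suc k)"
  shows "swap_y k (dschubert n Y w) = dschubert n Y w"
proof -
  define m where "m = n - k"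
  have m: "1 \<le> m" "m < n" "Suc m = Suc n - k" using assms by (auto simp: m_def)
  have nk: "n = m + k" using assms by (simp add: m_def)
  define A where "A = stair n - {(m, k)}"
  define Q where "Q = (\<Prod>(i, j)\<in>A. X i - Y j)"
  define S0 where "S0 = (\<Prod>(i, j)\<in>stair n. X i - Y j)"
  have mk: "(m, k) \<in> stair n" using assms m by (auto simp: m_def)
  have S0: "S0 = (X m - Y k) * Q"
    unfolding S0_def Q_def A_def
    by (subst prod.remove[OF finite_stair mk]) (simp only: prod.case)
  \<comment> \<open>Rows \<open>m\<close> and \<open>Suc m\<close> of the staircase agree once the
    corner is removed, so \<open>Q\<close> is a scalar for \<open>divided_diff m\<close>.\<close>
  have "swap_x m Q = (\<Prod>(i, j)\<in>A. X (simple_refl m i) - Y j)"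
    unfolding Q_def by (simp add: swap_x_prod case_prod_unfold swap_var_XVar)
  also have "\<dots> = Q" unfolding Q_def
  proof (rule prod.reindex_bij_witness[where i = "\<lambda>(i, j). (simple_refl m i, j)" and j = "\<lambda>(i, j). (simple_refl m i, j)"])
    show "(case b of (i, j) \<Rightarrow> (simple_refl m i, j)) \<in> A" if "b \<in> A" for b
    proof (cases b)
      case (Pair i j)
      then show ?thesis using that m(1) assms(2)
        by (cases "i = m"; cases "i = Suc m") (auto simp: A_def nk)
    qed
    then show "(case b of (i, j) \<Rightarrow> (simple_refl m i, j)) \<in> A" if "b \<in> A" for b using that by blast
  qed auto
  finally have "swap_x m Q = Q" .
  then have dS0: "divided_diff m S0 = Q"
    unfolding S0 by (subst divided_diff_scale') (auto intro: divided_diff_eqI)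
  have "swap_y k Q = (\<Prod>(i, j)\<in>A. X i - Y (simple_refl k j))"
    unfolding Q_def by (simp add: case_prod_unfold)
  also have "\<dots> = Q" unfolding Q_def
  proof (rule prod.reindex_bij_witness[where i = "\<lambda>(i, j). (i, simple_refl k j)" and j = "\<lambda>(i, j). (i, simple_refl k j)"])
    show "(case b of (i, j) \<Rightarrow> (i, simple_refl k j)) \<in> A" if "b \<in> A" for b
    proof (cases b)
      case (Pair i j)
      then show ?thesis using that m(1) assms(2)
        by (cases "j = k"; cases "j = Suc k") (auto simp: A_def nk)
    qed
    then show "(case b of (i, j) \<Rightarrow> (i, simple_refl k j)) \<in> A" if "b \<in> A" for b using that by blast
  qed auto
  finally have sQ: "swap_y k Q = Q" .
  define x where "x = longest_perm n \<circ> w"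
  have x: "x permutes {1..n}" unfolding x_def by (rule longest_comp_permutes[OF assms(1)])
  define x' where "x' = simple_refl m \<circ> x"
  have x': "x' permutes {1..n}" unfolding x'_def by (rule simple_refl_comp_permutes[OF x m(1,2)])
  have xx': "x = simple_refl m \<circ> x'" unfolding x'_def by (simp add: fun_eq_iff)
  have wi: "w (inv w j) = j" for j using permutes_inverses(1)[OF assms(1)] .
  have xa: "x (inv w k) = Suc m" "x (inv w (Suc k)) = m"
    using assms m by (auto simp: x_def wi m_def longest_perm_def)
  then have xa': "x' (inv w k) = m" "x' (inv w (Suc k)) = Suc m" by (simp_all add: x'_def)
  have "inv w k \<in> {1..n}" "inv w (Suc k) \<in> {1..n}"
    unfolding permutes_in_image[OF permutes_inv[OF assms(1)]] using assms by auto
  from dd_inv_left_ascent[OF x' m(1,2) this assms(4) xa', of S0]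
  have "dschubert n Y w = dd_inv n x' Q"
    unfolding dschubert_eq[OF assms(1)] x_def[symmetric] S0_def[symmetric] xx'[symmetric] dS0 .
  moreover have "swap_y k (dd_inv n x' Q) = dd_inv n x' Q"
    using dd_inv_hom[OF _ x', of "swap_y k" Q] swap_y_divided_diff unfolding sQ by simp
  ultimately show ?thesis by simp
qed

subsection \<open>Degrees and interpolation\<close>

lemma xdeg_divided_diff_stair:
  assumes "\<And>i. 1 \<le> i \<Longrightarrow> i \<le> n \<Longrightarrow> xdeg i f \<le> n - i" "1 \<le> k" "k < n" "1 \<le> i" "i \<le> n"
  shows "xdeg i (divided_diff k f) \<le> n - i"
  by (rule xdeg_divided_diff[where n = n and B = "\<lambda>i. n - i" and B' = "\<lambda>i. n - i"]) (use assms in auto)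

lemma xdeg_dd_inv_stair:
  assumes "x permutes {1..n}" "\<And>i. 1 \<le> i \<Longrightarrow> i \<le> n \<Longrightarrow> xdeg i f \<le> n - i"
  shows "\<forall>i. 1 \<le> i \<longrightarrow> i \<le> n \<longrightarrow> xdeg i (dd_inv n x f) \<le> n - i"
  using assms(1)
proof (induction rule: permutes_induct_ascent)
  case id
  show ?case unfolding dd_inv_id using assms(2) by blast
next
  case (ascent x i)
  show ?case unfolding dd_inv_ascent[OF ascent.hyps]
    using xdeg_divided_diff_stair[OF _ ascent.hyps(2,3)] ascent.IH by blast
qed

lemma xdeg_dschubert:
  assumes "w permutes {1..n}" "1 \<le> i" "i \<le> n"
  shows "xdeg i (dschubert n (\<lambda>j. Y (\<pi> j)) w) \<le> n - i"
proof -
  have "xdeg m (\<Prod>(i, j)\<in>stair n. X i - Y (\<pi> j)) \<le> n - m" if "1 \<le> m" "m \<le> n" for m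
  proof -
    have "xdeg m (\<Prod>(i, j)\<in>stair n. X i - Y (\<pi> j)) \<le> (\<Sum>(i, j)\<in>stair n. xdeg m (X i - Y (\<pi> j)))"
      using xdeg_prod_le[of m "\<lambda>(i, j). X i - Y (\<pi> j)" "stair n"] by (simp add: case_prod_unfold)
    also have "\<dots> \<le> (\<Sum>(i, j)\<in>stair n. if i = m then 1 else 0)"
    proof (rule sum_mono)
      fix b
      show "(case b of (i, j) \<Rightarrow> xdeg m (X i - Y (\<pi> j))) \<le> (case b of (i, j) \<Rightarrow> if i = m then 1 else 0)"
      proof (cases b)
        case (Pair i j)
        have "xdeg m (X i - Y (\<pi> j)) \<le> (if i = m then 1 else 0)" by (rule xdeg_diff) auto
        then show ?thesis using Pair by simp
      qed
    qed
    also have "\<dots> = (\<Sum>b\<in>stair n. if fst b = m then 1 else 0)"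
      by (rule sum.cong) auto
    also have "\<dots> = sum (\<lambda>_. 1) {b \<in> stair n. fst b = m}"
      by (rule sum.inter_filter[OF finite_stair, symmetric])
    also have "\<dots> = card {b \<in> stair n. fst b = m}" by simp
    also have "{b \<in> stair n. fst b = m} = (\<lambda>j. (m, j)) ` {1..n - m}"
      using that by auto
    also have "card \<dots> \<le> n - m" using card_image_le[of "{1..n - m}" "\<lambda>j. (m, j)"] by simp
    finally show ?thesis .
  qed
  then show ?thesis
    using xdeg_dd_inv_stair[OF longest_comp_permutes[OF assms(1)]] assms
    unfolding dschubert_eq[OF assms(1)] by blast
qed

text \<open>Symmetry carries the degree bound 0 for \<open>X n\<close> to all the other
  variables.\<close>

lemma const_in_x:
  assumes sym: "\<And>i. 1 \<le> i \<Longrightarrow> i < n \<Longrightarrow> swap_x i f = f"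
    and deg: "\<And>i. 1 \<le> i \<Longrightarrow> i \<le> n \<Longrightarrow> xdeg i f \<le> n - i"
  shows "ev n \<sigma> f = f"
proof -
  have step: "xdeg i f \<le> xdeg (Suc i) f" if "1 \<le> i" "i < n" for i
    using xdeg_swap_x[of i "Suc i" f] sym[OF that] by simp
  have "xdeg i f \<le> xdeg n f" if "1 \<le> i" "i \<le> n" for i
    using that(2,1)
  proof (induction i rule: inc_induct)
    case (step i)
    then show ?case using \<open>\<And>i. 1 \<le> i \<Longrightarrow> i < n \<Longrightarrow> xdeg i f \<le> xdeg (Suc i) f\<close>[of i] by simp
  qed simp
  then have 0: "xdeg i f = 0" if "1 \<le> i" "i \<le> n" for i
    using that deg[of n] by (metis bot_nat_0.extremum_uniqueI diff_self_eq_0 le_trans order_refl)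
  define T where "T m = (\<lambda>v. case v of XVar j \<Rightarrow> if 1 \<le> j \<and> j \<le> m then Y (\<sigma> j) else X j | YVar j \<Rightarrow> Y j)" for m
  have "m \<le> n \<Longrightarrow> subst (T m) f = f" for m
  proof (induction m)
    case 0
    have "subst (T 0) f = subst Var f"
      unfolding T_def by (rule subst_cong_all) (auto split: var.split)
    then show ?case by simp
  next
    case (Suc m)
    define R where "R = (\<lambda>v. if v = XVar (Suc m) then Y (\<sigma> (Suc m)) else Var v)"
    have "subst R f = f" unfolding R_def by (rule subst_xdeg_0[OF 0]) (use Suc.prems in auto)
    then have "f = subst (T m) (subst R f)" using Suc by simp
    also have "\<dots> = subst (T (Suc m)) f"
      unfolding subst_subst T_def R_def by (rule subst_cong_all) (auto split: var.split)
    finally show ?case by (rule HOL.sym)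
  qed
  then show ?thesis unfolding ev_def T_def by blast
qed

lemma perm_length_le: "perm_length n w \<le> n * n"
proof -
  have "inversions n w \<subseteq> {1..n} \<times> {1..n}" by (auto simp: inversions_def)
  then have "card (inversions n w) \<le> card ({1..n} \<times> {1..n})" by (intro card_mono) auto
  then show ?thesis by (simp add: perm_length_eq)
qed

text \<open>The difference \<open>E\<close> of both sides commutes with divided differences and
  vanishes at the identity. By descending induction on the length of \<open>x\<close>, every divided
  difference kills \<open>E (dd_inv n x f)\<close>; so this is symmetric, by its degrees free of the
  x-variables, and equal to its localization 0.\<close>

lemma dschubert_interpolation:
  assumes deg: "\<And>i. 1 \<le> i \<Longrightarrow> i \<le> n \<Longrightarrow> xdeg i f \<le> n - i"
  shows "f = (\<Sum>w | w permutes {1..n}. ev n id (dd n w f) * dschubert n Y w)"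
proof -
  let ?P = "{w. w permutes {1..n}}"
  define E where "E g = g - (\<Sum>w\<in>?P. ev n id (dd n w g) * dschubert n Y w)" for g
  have E0: "E 0 = 0" by (simp add: E_def)
  have dE: "divided_diff i (E g) = E (divided_diff i g)" if i: "1 \<le> i" "i < n" for i g
  proof -
    have "divided_diff i (\<Sum>w\<in>?P. ev n id (dd n w g) * dschubert n Y w)
        = (\<Sum>w\<in>?P. ev n id (dd n w g) * divided_diff i (dschubert n Y w))"
      unfolding divided_diff_sum by (rule sum.cong[OF refl divided_diff_scale[OF swap_x_ev[OF i]]])
    also have "\<dots> = (\<Sum>w\<in>?P. if w (Suc i) < w i then ev n id (dd n w g) * dschubert n Y (w \<circ> simple_refl i) else 0)"
    proof (rule sum.cong[OF refl])
      fix w assume "w \<in> ?P"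
      then have w: "w permutes {1..n}" by simp
      show "ev n id (dd n w g) * divided_diff i (dschubert n Y w) =
          (if w (Suc i) < w i then ev n id (dd n w g) * dschubert n Y (w \<circ> simple_refl i) else 0)"
        unfolding divided_diff_dschubert[OF w i] by simp
    qed
    \<comment> \<open>Pairing \<open>w\<close> with \<open>w \<circ> simple_refl i\<close> moves the
      divided difference from the Schubert polynomials to the coefficients.\<close>
    also have "\<dots> = (\<Sum>w\<in>?P. if w i < w (Suc i) then ev n id (dd n (w \<circ> simple_refl i) g) * dschubert n Y w else 0)"
    proof (rule sum.reindex_bij_witness[where i = "\<lambda>w. w \<circ> simple_refl i" and j = "\<lambda>w. w \<circ> simple_refl i"])
      fix w assume "w \<in> ?P"
      then show "w \<circ> simple_refl i \<in> ?P" using comp_simple_refl_permutes i by blast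
    next
      fix w assume "w \<in> ?P"
      show "(if (w \<circ> simple_refl i) i < (w \<circ> simple_refl i) (Suc i)
          then ev n id (dd n (w \<circ> simple_refl i \<circ> simple_refl i) g) * dschubert n Y (w \<circ> simple_refl i) else 0) =
        (if w (Suc i) < w i then ev n id (dd n w g) * dschubert n Y (w \<circ> simple_refl i) else 0)"
        unfolding comp_simple_refl_twice by simp
    qed (use comp_simple_refl_permutes i in \<open>simp_all only: comp_simple_refl_twice mem_Collect_eq\<close>)
    also have "\<dots> = (\<Sum>w\<in>?P. ev n id (dd n w (divided_diff i g)) * dschubert n Y w)"
    proof (rule sum.cong[OF refl])
      fix w assume "w \<in> ?P"
      then have w: "w permutes {1..n}" by simp
      have "w i \<noteq> w (Suc i)" using inj_eq[OF permutes_inj[OF w]] by simp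
      then consider "w i < w (Suc i)" | "w (Suc i) < w i" by linarith
      then show "(if w i < w (Suc i) then ev n id (dd n (w \<circ> simple_refl i) g) * dschubert n Y w else 0)
          = ev n id (dd n w (divided_diff i g)) * dschubert n Y w"
        by cases (simp_all add: dd_ascent[OF w i] dd_descent[OF w i])
    qed
    finally show ?thesis unfolding E_def divided_diff_diff by simp
  qed
  have evE: "ev n id (E g) = 0" for g
  proof -
    have "ev n id (ev n id g') = ev n id g'" for g'
      unfolding ev_def subst_subst by (rule subst_cong_all) (auto split: var.split)
    then have "ev n id (\<Sum>w\<in>?P. ev n id (dd n w g) * dschubert n Y w)
        = (\<Sum>w\<in>?P. if w = id then ev n id (dd n w g) else 0)"
      unfolding ev_sum ev_simps by (intro sum.cong) (auto simp: ev_id_dschubert)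
    also have "\<dots> = ev n id g"
      using permutes_id[of "{1..n}"] by (subst sum.delta) (simp_all add: finite_permutations)
    finally show ?thesis by (simp add: E_def)
  qed
  have "E (dd_inv n x f) = 0" if "x permutes {1..n}" for x
    using that
  proof (induction "n * n - perm_length n x" arbitrary: x rule: less_induct)
    case less
    have sym: "swap_x i (E (dd_inv n x f)) = E (dd_inv n x f)" if i: "1 \<le> i" "i < n" for i
    proof -
      have "divided_diff i (E (dd_inv n x f)) = 0"
      proof (cases "x i < x (Suc i)")
        case True
        have "n * n - perm_length n (x \<circ> simple_refl i) < n * n - perm_length n x"
          using perm_length_ascent[OF i True] perm_length_le[of n "x \<circ> simple_refl i"] by linarith
        from less.hyps[OF this comp_simple_refl_permutes[OF less.prems i]]
        show ?thesis unfolding dE[OF i] dd_inv_ascent[OF less.prems i True] .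
      next
        case False
        moreover have "x i \<noteq> x (Suc i)" using inj_eq[OF permutes_inj[OF less.prems]] by simp
        ultimately show ?thesis
          unfolding dE[OF i] by (subst dd_inv_descent[OF less.prems i]) (auto simp: E0)
      qed
      then show ?thesis by (simp add: divided_diff_eq_0_iff)
    qed
    have "xdeg i (E (dd_inv n x f)) \<le> n - i" if "1 \<le> i" "i \<le> n" for i
      unfolding E_def
    proof (intro xdeg_diff xdeg_sum)
      show "xdeg i (dd_inv n x f) \<le> n - i" using xdeg_dd_inv_stair[OF less.prems deg] that by blast
    next
      fix w assume "w \<in> ?P"
      then have 1: "xdeg i (dschubert n Y w) \<le> n - i" using xdeg_dschubert[of w n i id] that by simp
      have 2: "xdeg i (ev n \<sigma> g) = 0" for g \<sigma>
      proof (induction g rule: xypoly_induct)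
        case (const c)
        show ?case by (simp add: ev_def xdeg_def xsplit_def)
      next
        case (Var v)
        then show ?case using that by (cases v) (auto simp: ev_def)
      next
        case (add f g)
        then show ?case using xdeg_add[of i "ev n \<sigma> f" 0 "ev n \<sigma> g"] by simp
      next
        case (mult f g)
        then show ?case using xdeg_mult_le[of i "ev n \<sigma> f" "ev n \<sigma> g"] by simp
      qed
      show "xdeg i (ev n id (dd n w (dd_inv n x f)) * dschubert n Y w) \<le> n - i"
        using 1 2 xdeg_mult_le[of i "ev n id (dd n w (dd_inv n x f))" "dschubert n Y w"] by simp
    qed
    from const_in_x[OF sym this] show ?case using evE by metis
  qed
  from this[OF permutes_id] show ?thesis unfolding dd_inv_id E_def by simp
qed

text \<open>By the Leibniz rule each divided difference falls on one of the factors. With no more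
  operators than the length of \<open>b\<close>, all of them must fall on the Schubert polynomial to
  bring it down to 1; the other factor is then only permuted, by \<open>b\<close> in total.\<close>

lemma ev_dd_mult_dschubert:
  assumes "a permutes {1..n}"
  shows "\<forall>g b. b permutes {1..n} \<longrightarrow>
    (perm_length n a < perm_length n b \<longrightarrow> ev n id (dd n a (g * dschubert n Y b)) = 0) \<and>
    (perm_length n a = perm_length n b \<longrightarrow>
      ev n id (dd n a (g * dschubert n Y b)) = (if a = b then ev n b g else 0))"
  using assms
proof (induction rule: permutes_induct_ascent)
  case id
  show ?case unfolding dd_id ev_simps by (auto simp: ev_id_dschubert)
next
  case (ascent a k)
  note h = ascent.hyps
  have len: "perm_length n (a \<circ> simple_refl k) = Suc (perm_length n a)" by (rule perm_length_ascent[OF h(2-4)])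
  show ?case
  proof (intro allI impI)
    fix g b assume b: "b permutes {1..n}"
    have split: "ev n id (dd n (a \<circ> simple_refl k) (g * dschubert n Y b)) =
        ev n id (dd n a (divided_diff k g * dschubert n Y b)) +
        ev n id (dd n a (swap_x k g * divided_diff k (dschubert n Y b)))"
      unfolding dd_ascent[OF h] divided_diff_mult dd_add[OF h(1)] ev_simps ..
    have IH1: "perm_length n a < perm_length n b \<longrightarrow> ev n id (dd n a (g' * dschubert n Y b)) = 0" if "b permutes {1..n}" for b g'
      using ascent.IH that by blast
    have IH2: "perm_length n a = perm_length n b \<longrightarrow> ev n id (dd n a (g' * dschubert n Y b)) = (if a = b then ev n b g' else 0)"
      if "b permutes {1..n}" for b g'
      using ascent.IH that by blast
    show "(perm_length n (a \<circ> simple_refl k) < perm_length n b \<longrightarrow>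
          ev n id (dd n (a \<circ> simple_refl k) (g * dschubert n Y b)) = 0) \<and>
        (perm_length n (a \<circ> simple_refl k) = perm_length n b \<longrightarrow>
          ev n id (dd n (a \<circ> simple_refl k) (g * dschubert n Y b)) = (if a \<circ> simple_refl k = b then ev n b g else 0))"
    proof (cases "b (Suc k) < b k")
      case True
      let ?b = "b \<circ> simple_refl k"
      have b': "?b permutes {1..n}" by (rule comp_simple_refl_permutes[OF b h(2,3)])
      have lb: "perm_length n b = Suc (perm_length n ?b)" by (rule perm_length_descent[OF h(2,3) True])
      have d: "divided_diff k (dschubert n Y b) = dschubert n Y ?b"
        using divided_diff_dschubert[OF b h(2,3), of Y] True by simp
      have ab: "a \<circ> simple_refl k = b \<longleftrightarrow> a = ?b" by (metis comp_simple_refl_twice)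
      have e: "ev n ?b (swap_x k g) = ev n b g"
        unfolding ev_swap_x[OF h(2,3)] comp_simple_refl_twice ..
      show ?thesis unfolding split d len lb ab
        using IH1[OF b, of "divided_diff k g"] IH1[OF b', of "swap_x k g"] IH2[OF b', of "swap_x k g"] lb e
        by auto
    next
      case False
      then have d: "divided_diff k (dschubert n Y b) = 0"
        using divided_diff_dschubert[OF b h(2,3), of Y] by simp
      have ab: "a \<circ> simple_refl k \<noteq> b" using False h(4) by auto
      show ?thesis unfolding split d len
        using IH1[OF b, of "divided_diff k g"] ab h(1) by (simp add: dd_0)
    qed
  qed
qed

declare One_nat_def [simp del]

section \<open>Matchless clans\<close>

text \<open>The inverse of the Grassmannian permutation that lists \<open>P\<close> and then its
  complement. \<open>v_perm\<close> has this form for every clan and \<open>u_perm\<close> for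
  matchless ones.\<close>

definition grass :: "nat \<Rightarrow> nat set \<Rightarrow> nat \<Rightarrow> nat" where
  "grass n P i =
     (if i \<in> P then card {k \<in> P. k \<le> i}
      else if i \<in> {1..n} then card P + card {k \<in> {1..n} - P. k \<le> i} else i)"

lemma rank_less:
  assumes "finite A" "b \<in> A" "a < (b::nat)"
  shows "card {k \<in> A. k \<le> a} < card {k \<in> A. k \<le> b}"
proof (rule psubset_card_mono)
  have "b \<in> {k \<in> A. k \<le> b}" "b \<notin> {k \<in> A. k \<le> a}" using assms by auto
  then have "{k \<in> A. k \<le> a} \<noteq> {k \<in> A. k \<le> b}" by blast
  then show "{k \<in> A. k \<le> a} \<subset> {k \<in> A. k \<le> b}" using assms by auto
qed (use assms in simp)

lemma rank_bounds:
  assumes "finite A" "a \<in> A"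
  shows "1 \<le> card {k \<in> A. k \<le> (a::nat)}" "card {k \<in> A. k \<le> a} \<le> card A"
proof -
  have "{k \<in> A. k \<le> a} \<noteq> {}" using assms by auto
  then show "1 \<le> card {k \<in> A. k \<le> a}" using assms by (simp add: Suc_le_eq card_gt_0_iff One_nat_def)
  show "card {k \<in> A. k \<le> a} \<le> card A" by (rule card_mono) (use assms in auto)
qed

lemma card_compl: "P \<subseteq> {1..n} \<Longrightarrow> card ({1..n} - P) = n - card P"
  by (subst card_Diff_subset) (auto intro: finite_subset)

lemma card_le: "P \<subseteq> {1..n} \<Longrightarrow> card P \<le> n"
  using card_mono[of "{1..n}" P] by simp

lemma grass_le_iff:
  assumes "P \<subseteq> {1..n}"
  shows "grass n P i \<le> card P \<longleftrightarrow> i \<in> P \<or> i \<notin> {1..n} \<and> i \<le> card P"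
proof -
  have fin: "finite P" "finite ({1..n} - P)" using assms finite_subset by auto
  show ?thesis using rank_bounds[OF fin(1), of i] rank_bounds[OF fin(2), of i] assms
    by (auto simp: grass_def)
qed

lemma grass_less_iff:
  assumes "P \<subseteq> {1..n}" "a \<in> {1..n}" "b \<in> {1..n}" "a < b"
  shows "grass n P b < grass n P a \<longleftrightarrow> a \<notin> P \<and> b \<in> P" "grass n P a < grass n P b \<longleftrightarrow> \<not> (a \<notin> P \<and> b \<in> P)"
proof -
  have fin: "finite P" "finite ({1..n} - P)" using assms finite_subset by auto
  have *: "grass n P b < grass n P a" if "a \<notin> P" "b \<in> P"
    using that assms rank_bounds[OF fin(1), of b] rank_bounds[OF fin(2), of a] by (auto simp: grass_def)
  have **: "grass n P a < grass n P b" if "\<not> (a \<notin> P \<and> b \<in> P)"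
    using that assms rank_less[OF fin(1), of b a] rank_less[OF fin(2), of b a]
      rank_bounds[OF fin(1), of a] rank_bounds[OF fin(2), of b] by (auto simp: grass_def)
  show "grass n P b < grass n P a \<longleftrightarrow> a \<notin> P \<and> b \<in> P" "grass n P a < grass n P b \<longleftrightarrow> \<not> (a \<notin> P \<and> b \<in> P)"
    using * ** by (meson less_asym)+
qed

lemma grass_permutes:
  assumes "P \<subseteq> {1..n}"
  shows "grass n P permutes {1..n}"
proof (rule bij_imp_permutes)
  have fin: "finite P" "finite ({1..n} - P)" using assms finite_subset by auto
  have "inj_on (grass n P) {1..n}"
  proof (rule linorder_inj_onI)
    fix a b :: nat assume "a < b" "a \<in> {1..n}" "b \<in> {1..n}"
    then show "grass n P a \<noteq> grass n P b" using grass_less_iff[OF assms, of a b] by auto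
  qed auto
  moreover have "grass n P ` {1..n} \<subseteq> {1..n}"
  proof
    fix j assume "j \<in> grass n P ` {1..n}"
    then obtain i where i: "i \<in> {1..n}" "j = grass n P i" by blast
    show "j \<in> {1..n}"
    proof (cases "i \<in> P")
      case True
      then show ?thesis using i rank_bounds[OF fin(1) True] card_le[OF assms] by (auto simp: grass_def)
    next
      case False
      then have "i \<in> {1..n} - P" using i by simp
      then show ?thesis using i False rank_bounds[OF fin(2), of i] card_compl[OF assms] card_le[OF assms]
        by (auto simp: grass_def)
    qed
  qed
  ultimately show "bij_betw (grass n P) {1..n} {1..n}"
    by (simp add: bij_betw_def endo_inj_surj)
qed (use assms in \<open>auto simp: grass_def\<close>)

lemma simple_refl_image_iff: "j \<in> simple_refl i ` P \<longleftrightarrow> simple_refl i j \<in> P"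
  by (metis image_iff simple_refl_simps(4))

lemma simple_refl_image_subset:
  "P \<subseteq> {1..n} \<Longrightarrow> 1 \<le> i \<Longrightarrow> i < n \<Longrightarrow> simple_refl i ` P \<subseteq> {1..n}"
  using simple_refl_in by blast

lemma card_simple_refl_image: "card (simple_refl i ` P) = card P"
  by (rule card_image) (simp add: inj_on_def)

lemma simple_refl_image_twice [simp]: "simple_refl i ` simple_refl i ` P = P"
  by (auto simp: image_image)

lemma rank_simple_refl:
  assumes "\<not> (i \<in> A \<and> Suc i \<in> A)" "a \<in> A"
  shows "card {k \<in> simple_refl i ` A. k \<le> simple_refl i a} = card {k \<in> A. k \<le> a}"
proof -
  have "simple_refl i k \<le> simple_refl i a \<longleftrightarrow> k \<le> a" if "k \<in> A" for k
  proof -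
    have "(k, a) \<noteq> (i, Suc i)" "(a, k) \<noteq> (i, Suc i)" using that assms by auto
    then show ?thesis using simple_refl_less[of k a i] simple_refl_less[of a k i]
      by (cases k a rule: linorder_cases) (auto simp: not_le)
  qed
  then have "{k \<in> simple_refl i ` A. k \<le> simple_refl i a} = simple_refl i ` {k \<in> A. k \<le> a}"
    by blast
  then show ?thesis by (simp add: card_simple_refl_image)
qed

lemma grass_simple_refl:
  assumes "P \<subseteq> {1..n}" "1 \<le> i" "i < n" "(i \<in> P) \<noteq> (Suc i \<in> P)"
  shows "grass n (simple_refl i ` P) = grass n P \<circ> simple_refl i"
proof
  fix j
  define a where "a = simple_refl i j"
  have j: "j = simple_refl i a" by (simp add: a_def)
  have compl: "{1..n} - simple_refl i ` P = simple_refl i ` ({1..n} - P)"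
    using simple_refl_in[OF assms(2,3)] by (auto simp: simple_refl_image_iff simp del: atLeastAtMost_iff)
  have "grass n (simple_refl i ` P) (simple_refl i a) = grass n P a"
  proof -
    consider "a \<in> P" | "a \<in> {1..n} - P" | "a \<notin> {1..n}" using assms(1) by blast
    then show ?thesis
    proof cases
      case 1
      then show ?thesis
        using rank_simple_refl[of i P a] assms by (auto simp: grass_def simple_refl_image_iff)
    next
      case 2
      then have "simple_refl i a \<in> {1..n}" using simple_refl_in[OF assms(2,3), of a] by blast
      then show ?thesis
        using 2 rank_simple_refl[of i "{1..n} - P" a] assms
        unfolding grass_def compl by (auto simp: simple_refl_image_iff card_simple_refl_image)
    next
      case 3
      then have "simple_refl i a \<notin> {1..n}" using simple_refl_in[OF assms(2,3), of a] by blast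
      moreover have "simple_refl i a = a" using 3 assms by (intro simple_refl_simps(3)) auto
      ultimately show ?thesis using 3 assms(1) by (auto simp: grass_def simple_refl_image_iff)
    qed
  qed
  then show "grass n (simple_refl i ` P) j = (grass n P \<circ> simple_refl i) j" unfolding j by simp
qed

lemma compl_simple_refl:
  "1 \<le> i \<Longrightarrow> i < n \<Longrightarrow> {1..n} - simple_refl i ` P = simple_refl i ` ({1..n} - P)"
  using simple_refl_in by (auto simp: simple_refl_image_iff simp del: atLeastAtMost_iff)

text \<open>Consecutive labels sit on nodes of the same kind unless \<open>k = card P\<close>, and
  labels increase within a kind. With \<open>swap_y_dschubert\<close> this gives symmetry in all
  neighbouring y-variables but one pair.\<close>

lemma inv_grass_less:
  assumes P: "P \<subseteq> {1..n}" and k: "1 \<le> k" "k < n" "k \<noteq> card P"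
  shows "inv (grass n P) k < inv (grass n P) (Suc k)"
proof -
  note g = grass_permutes[OF P]
  define a b where "a = inv (grass n P) k" and "b = inv (grass n P) (Suc k)"
  have ab: "grass n P a = k" "grass n P b = Suc k"
    using permutes_inverses(1)[OF g] by (auto simp: a_def b_def)
  have in': "a \<in> {1..n}" "b \<in> {1..n}"
    unfolding a_def b_def permutes_in_image[OF permutes_inv[OF g]] using k by auto
  have "a \<in> P \<longleftrightarrow> k \<le> card P" "b \<in> P \<longleftrightarrow> Suc k \<le> card P"
    using grass_le_iff[OF P, of a] grass_le_iff[OF P, of b] ab in' by auto
  then have "a \<in> P \<longleftrightarrow> b \<in> P" using k by auto
  moreover have "a \<noteq> b" using ab by auto
  ultimately have "\<not> b < a" using grass_less_iff[OF P in'(2,1)] ab by auto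
  then show ?thesis using \<open>a \<noteq> b\<close> by (simp add: a_def b_def)
qed

section \<open>Renaming the second alphabet\<close>

definition ren_y :: "(nat \<Rightarrow> nat) \<Rightarrow> xypoly \<Rightarrow> xypoly" where
  "ren_y \<pi> = subst (\<lambda>v. case v of XVar j \<Rightarrow> X j | YVar j \<Rightarrow> Y (\<pi> j))"

lemma ren_y_divided_diff: "ren_y \<pi> (divided_diff i f) = divided_diff i (ren_y \<pi> f)"
  unfolding ren_y_def
proof (rule subst_divided_diff)
  fix f
  show "subst (\<lambda>v. case v of XVar j \<Rightarrow> X j | YVar j \<Rightarrow> Y (\<pi> j)) (swap_x i f)
     = swap_x i (subst (\<lambda>v. case v of XVar j \<Rightarrow> X j | YVar j \<Rightarrow> Y (\<pi> j)) f)"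
  proof (rule subst_swap_xI)
    fix v
    show "(case swap_var i v of XVar j \<Rightarrow> X j | YVar j \<Rightarrow> Y (\<pi> j))
      = swap_x i (case v of XVar j \<Rightarrow> X j | YVar j \<Rightarrow> Y (\<pi> j))"
      by (cases v) (simp_all add: swap_var_XVar)
  qed
qed simp_all

lemma swap_y_eq_ren_y: "swap_y k = ren_y (simple_refl k)"
  by (simp add: swap_y_def ren_y_def)

lemma ren_y_comp: "ren_y \<pi> (ren_y \<rho> f) = ren_y (\<pi> \<circ> \<rho>) f"
  unfolding ren_y_def subst_subst by (rule subst_cong_all) (auto split: var.split)

lemma ren_y_id: "ren_y id f = f"
proof -
  have "ren_y id f = subst Var f" unfolding ren_y_def by (rule subst_cong_all) (auto split: var.split)
  then show ?thesis by simp
qed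

text \<open>Renaming commutes with divided differences, so facts about the alphabet \<open>Y\<close>
  carry over to the reversed one.\<close>

lemma ren_y_dschubert:
  assumes "w permutes {1..n}"
  shows "ren_y (longest_perm n) (dschubert n Y w) = dschubert n (\<lambda>j. Y (Suc n - j)) w"
proof -
  have "ren_y (longest_perm n) (\<Prod>(i, j)\<in>stair n. X i - Y j) = (\<Prod>(i, j)\<in>stair n. X i - Y (longest_perm n j))"
    by (simp add: ren_y_def case_prod_unfold)
  also have "\<dots> = (\<Prod>(i, j)\<in>stair n. X i - Y (Suc n - j))"
    by (rule prod.cong) auto
  finally show ?thesis
    unfolding dschubert_eq[OF assms]
    using dd_inv_hom[OF _ longest_comp_permutes[OF assms], of "ren_y (longest_perm n)"] ren_y_divided_diff
    by (metis (no_types, lifting))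
qed

text \<open>The product of double Schubert polynomials attached to the matchless clan whose set of
  plus signs is P.\<close>
definition matchless_poly :: "nat \<Rightarrow> nat set \<Rightarrow> xypoly" where
  "matchless_poly n P =
     dschubert n (\<lambda>j. Y (Suc n - j)) (grass n ({1..n} - P)) * dschubert n Y (grass n P)"

section \<open>Divided differences of the products for matchless clans\<close>

lemma divided_diff_grass:
  assumes "P \<subseteq> {1..n}" "1 \<le> i" "i < n"
  shows "divided_diff i (dschubert n y (grass n P)) =
    (if i \<notin> P \<and> Suc i \<in> P then dschubert n y (grass n (simple_refl i ` P)) else 0)"
  using divided_diff_dschubert[OF grass_permutes[OF assms(1)] assms(2,3)]
    grass_less_iff(1)[OF assms(1), of i "Suc i"] grass_simple_refl[OF assms] assms(2,3)
  by auto

lemma divided_diff_matchless_same: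
  assumes "P \<subseteq> {1..n}" "1 \<le> i" "i < n" "i \<in> P \<longleftrightarrow> Suc i \<in> P"
  shows "divided_diff i (matchless_poly n P) = 0"
proof -
  have "divided_diff i (dschubert n y (grass n P)) = 0" "divided_diff i (dschubert n y (grass n ({1..n} - P))) = 0" for y
    using assms by (auto simp: divided_diff_grass)
  then show ?thesis
    unfolding matchless_poly_def divided_diff_mult by simp
qed

text \<open>If exactly one of \<open>i\<close>, \<open>Suc i\<close> lies in \<open>P\<close>, one
  factor has a descent at \<open>i\<close> and the other is symmetric. The exchange makes them trade
  roles, and both derivatives are the same product, just as \<open>+-\<close> and \<open>-+\<close>
  are joined to the same arc.\<close>

lemma divided_diff_matchless_swap:
  assumes "P \<subseteq> {1..n}" "1 \<le> i" "i < n"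
  shows "divided_diff i (matchless_poly n (simple_refl i ` P)) = divided_diff i (matchless_poly n P)"
proof -
  have wlog: "divided_diff i (matchless_poly n (simple_refl i ` P)) = divided_diff i (matchless_poly n P)"
    if P: "P \<subseteq> {1..n}" "i \<in> P" "Suc i \<notin> P" for P
  proof -
    let ?Q = "{1..n} - P" and ?P' = "simple_refl i ` P" and ?y = "\<lambda>j. Y (Suc n - j)"
    have P': "?P' \<subseteq> {1..n}" by (rule simple_refl_image_subset[OF P(1) assms(2,3)])
    have Q': "simple_refl i ` ?Q \<subseteq> {1..n}" by (rule simple_refl_image_subset[OF _ assms(2,3)]) auto
    have 1: "divided_diff i (dschubert n Y (grass n P)) = 0"
      "divided_diff i (dschubert n ?y (grass n ?Q)) = dschubert n ?y (grass n (simple_refl i ` ?Q))"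
      using P assms(2,3) by (auto simp: divided_diff_grass)
    have 2: "divided_diff i (dschubert n Y (grass n ?P')) = dschubert n Y (grass n P)"
      using P assms(2,3) P' by (auto simp: divided_diff_grass simple_refl_image_iff)
    have 3: "divided_diff i (dschubert n ?y (grass n (simple_refl i ` ?Q))) = 0"
      using P assms(2,3) Q' by (auto simp: divided_diff_grass simple_refl_image_iff)
    have "divided_diff i (matchless_poly n P) =
        dschubert n ?y (grass n (simple_refl i ` ?Q)) * dschubert n Y (grass n P)"
      unfolding matchless_poly_def divided_diff_mult 1 by simp
    also have "\<dots> = divided_diff i (matchless_poly n ?P')"
      unfolding matchless_poly_def compl_simple_refl[OF assms(2,3)]
      using 3 by (subst divided_diff_scale) (auto simp: 2 divided_diff_eq_0_iff)
    finally show ?thesis by (rule sym)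
  qed
  consider "i \<in> P \<and> Suc i \<notin> P" | "i \<notin> P \<and> Suc i \<in> P" | "i \<in> P \<longleftrightarrow> Suc i \<in> P" by blast
  then show ?thesis
  proof cases
    case 1
    then show ?thesis using wlog assms by blast
  next
    case 2
    then have "divided_diff i (matchless_poly n (simple_refl i ` simple_refl i ` P)) = divided_diff i (matchless_poly n (simple_refl i ` P))"
      by (intro wlog simple_refl_image_subset assms) (auto simp: simple_refl_image_iff)
    then show ?thesis by simp
  next
    case 3
    have "simple_refl i ` P = P"
    proof (rule set_eqI)
      fix j
      show "j \<in> simple_refl i ` P \<longleftrightarrow> j \<in> P"
        unfolding simple_refl_image_iff using 3 by (cases "j = i"; cases "j = Suc i") auto
    qed
    then show ?thesis by simp
  qed
qed

lemma divided_diff_alternating_aux: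
  assumes "divided_diff j f = 0" "divided_diff i g = 0"
    "divided_diff j (divided_diff i f) = 0" "divided_diff i (divided_diff j g) = 0"
  shows "divided_diff i (divided_diff j (f * g)) = divided_diff i f * divided_diff j g"
    "divided_diff j (divided_diff i (f * g)) = divided_diff i f * divided_diff j g"
proof -
  have s: "swap_x j f = f" "swap_x i g = g" "swap_x j (divided_diff i f) = divided_diff i f"
    "swap_x i (divided_diff j g) = divided_diff j g"
    using assms by (simp_all add: divided_diff_eq_0_iff)
  show "divided_diff i (divided_diff j (f * g)) = divided_diff i f * divided_diff j g"
    by (simp add: divided_diff_scale[OF s(1)] divided_diff_scale'[OF s(4)])
  show "divided_diff j (divided_diff i (f * g)) = divided_diff i f * divided_diff j g"
    by (simp add: divided_diff_scale'[OF s(2)] divided_diff_scale[OF s(3)])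
qed

text \<open>Each operator acts on one factor only, and what it produces is still symmetric for the
  other operator, so the two commute. On clans: whichever neighbours are joined first, the second
  reflection leads to the same arc around one remaining sign.\<close>

lemma divided_diff_alternating:
  assumes "P \<subseteq> {1..n}" "1 \<le> i" "Suc i < n"
    and "(i \<in> P) \<noteq> (Suc i \<in> P)" "(Suc i \<in> P) \<noteq> (Suc (Suc i) \<in> P)"
  shows "divided_diff i (divided_diff (Suc i) (matchless_poly n P))
    = divided_diff (Suc i) (divided_diff i (matchless_poly n P))"
proof -
  have D: "divided_diff (Suc i) (dschubert n y (grass n Q)) = 0"
      "divided_diff (Suc i) (divided_diff i (dschubert n y (grass n Q))) = 0"
    if "Q \<subseteq> {1..n}" "i \<notin> Q" "Suc i \<in> Q" "Suc (Suc i) \<notin> Q" for Q y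
    using that assms(2,3) by (auto simp: divided_diff_grass simple_refl_image_subset simple_refl_image_iff)
  have D': "divided_diff i (dschubert n y (grass n Q)) = 0"
      "divided_diff i (divided_diff (Suc i) (dschubert n y (grass n Q))) = 0"
    if "Q \<subseteq> {1..n}" "i \<in> Q" "Suc i \<notin> Q" "Suc (Suc i) \<in> Q" for Q y
    using that assms(2,3) by (auto simp: divided_diff_grass simple_refl_image_subset simple_refl_image_iff)
  consider "i \<in> P \<and> Suc i \<notin> P \<and> Suc (Suc i) \<in> P" | "i \<notin> P \<and> Suc i \<in> P \<and> Suc (Suc i) \<notin> P"
    using assms by blast
  then show ?thesis
  proof cases
    case 1
    then have "divided_diff (Suc i) (dschubert n y (grass n ({1..n} - P))) = 0"
      "divided_diff (Suc i) (divided_diff i (dschubert n y (grass n ({1..n} - P)))) = 0" for y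
      using assms by (auto intro!: D)
    moreover have "divided_diff i (dschubert n y (grass n P)) = 0"
      "divided_diff i (divided_diff (Suc i) (dschubert n y (grass n P))) = 0" for y
      using assms 1 by (auto intro!: D')
    ultimately show ?thesis unfolding matchless_poly_def
      by (simp add: divided_diff_alternating_aux)
  next
    case 2
    then have "divided_diff i (dschubert n y (grass n ({1..n} - P))) = 0"
      "divided_diff i (divided_diff (Suc i) (dschubert n y (grass n ({1..n} - P)))) = 0" for y
      using assms by (auto intro!: D')
    moreover have "divided_diff (Suc i) (dschubert n y (grass n P)) = 0"
      "divided_diff (Suc i) (divided_diff i (dschubert n y (grass n P))) = 0" for y
      using assms 2 by (auto intro!: D)
    ultimately show ?thesis unfolding matchless_poly_def
      by (subst (1 2) mult.commute) (simp add: divided_diff_alternating_aux)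
  qed
qed

lemma swap_y_matchless:
  assumes "P \<subseteq> {1..n}" "1 \<le> k" "k < n" "k \<noteq> card P"
  shows "swap_y k (matchless_poly n P) = matchless_poly n P"
proof -
  let ?Q = "{1..n} - P"
  have Q: "?Q \<subseteq> {1..n}" by auto
  have 1: "swap_y k (dschubert n Y (grass n P)) = dschubert n Y (grass n P)"
    using swap_y_dschubert[OF grass_permutes[OF assms(1)] assms(2,3) inv_grass_less[OF assms]] .
  have k': "1 \<le> n - k" "n - k < n" "n - k \<noteq> card ?Q"
    using assms card_compl[OF assms(1)] card_le[OF assms(1)] by auto
  have "swap_y (n - k) (dschubert n Y (grass n ?Q)) = dschubert n Y (grass n ?Q)"
    using swap_y_dschubert[OF grass_permutes[OF Q] k'(1,2) inv_grass_less[OF Q k']] .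
  then have "ren_y (longest_perm n) (ren_y (simple_refl (n - k)) (dschubert n Y (grass n ?Q)))
      = ren_y (longest_perm n) (dschubert n Y (grass n ?Q))"
    by (simp add: swap_y_eq_ren_y)
  \<comment> \<open>Reversal of the alphabet turns the exchange at \<open>n - k\<close> into the one
    at \<open>k\<close>, and the exceptional index \<open>card ?Q\<close> into
    \<open>card P\<close>.\<close>
  moreover have "longest_perm n \<circ> simple_refl (n - k) = simple_refl k \<circ> longest_perm n"
  proof
    fix j
    show "(longest_perm n \<circ> simple_refl (n - k)) j = (simple_refl k \<circ> longest_perm n) j"
    proof (cases "j \<in> {1..n}")
      case True
      have "j = n - k \<longleftrightarrow> Suc n - j = Suc k" "j = Suc (n - k) \<longleftrightarrow> Suc n - j = k" using True assms by auto
      then show ?thesis using True assms by (cases "j = n - k"; cases "j = Suc (n - k)") auto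
    next
      case False
      then show ?thesis using assms by (auto simp: longest_perm_def)
    qed
  qed
  ultimately have "swap_y k (dschubert n (\<lambda>j. Y (Suc n - j)) (grass n ?Q)) = dschubert n (\<lambda>j. Y (Suc n - j)) (grass n ?Q)"
    unfolding ren_y_dschubert[OF grass_permutes[OF Q], symmetric] swap_y_eq_ren_y ren_y_comp by simp
  with 1 show ?thesis by (simp add: matchless_poly_def)
qed

text \<open>Staircase bounds are too weak for a product of two factors; the bounds here, for
  \<open>P\<close> and for its complement, add up to \<open>n - i\<close>. The induction moves
  elements of \<open>P\<close> to the right, where \<open>?P'\<close> lies one divided difference
  above \<open>P\<close>, until \<open>P\<close> is a final segment.\<close>

lemma xdeg_grass:
  assumes "P \<subseteq> {1..n}"
  shows "\<forall>i. 1 \<le> i \<longrightarrow> i \<le> n \<longrightarrow> xdeg i (dschubert n (\<lambda>j. Y (\<pi> j)) (grass n P)) \<le> card {k \<in> P. i < k}"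
  using assms
proof (induction "\<Sum>k\<in>P. n - k" arbitrary: P rule: less_induct)
  case less
  let ?S = "\<lambda>P. dschubert n (\<lambda>j. Y (\<pi> j)) (grass n P)"
  have fin: "finite P" using less.prems finite_subset by auto
  show ?case
  proof (cases "\<exists>i. 1 \<le> i \<and> i < n \<and> i \<in> P \<and> Suc i \<notin> P")
    case True
    then obtain i where i: "1 \<le> i" "i < n" "i \<in> P" "Suc i \<notin> P" by blast
    let ?P' = "simple_refl i ` P"
    have P': "?P' \<subseteq> {1..n}" by (rule simple_refl_image_subset[OF less.prems i(1,2)])
    have P'eq: "?P' = insert (Suc i) (P - {i})"
    proof (rule set_eqI)
      fix j
      show "j \<in> ?P' \<longleftrightarrow> j \<in> insert (Suc i) (P - {i})"
        unfolding simple_refl_image_iff using i by (cases "j = i"; cases "j = Suc i") auto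
    qed
    have "(\<Sum>k\<in>?P'. n - k) = (n - Suc i) + (\<Sum>k\<in>P - {i}. n - k)"
      unfolding P'eq using fin i by (subst sum.insert) auto
    also have "\<dots> < (n - i) + (\<Sum>k\<in>P - {i}. n - k)" using i by simp
    also have "\<dots> = (\<Sum>k\<in>P. n - k)" using fin i by (simp add: sum.remove)
    finally have IH: "xdeg j (?S ?P') \<le> card {k \<in> ?P'. j < k}" if "1 \<le> j" "j \<le> n" for j
      using less.hyps P' that by blast
    have S: "?S P = divided_diff i (?S ?P')"
      using i P' by (simp add: divided_diff_grass simple_refl_image_iff)
    have c1: "card {k \<in> ?P'. j < k} = card {k \<in> P. j < k}" if "j \<noteq> i" for j
    proof -
      have "j < simple_refl i k \<longleftrightarrow> j < k" for k
        using that by (cases "k = i"; cases "k = Suc i") auto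
      then have "{k \<in> ?P'. j < k} = simple_refl i ` {k \<in> P. j < k}" by blast
      then show ?thesis by (simp add: card_simple_refl_image)
    qed
    have c2: "{k \<in> ?P'. i < k} = insert (Suc i) {k \<in> P. i < k}" unfolding P'eq using i by auto
    have "i < k \<longleftrightarrow> Suc i < k" if "k \<in> P" for k using that i(4) by (cases "k = Suc i") auto
    then have c3: "{k \<in> P. i < k} = {k \<in> P. Suc i < k}" by blast
    have card2: "card {k \<in> ?P'. i < k} = Suc (card {k \<in> P. i < k})"
      unfolding c2 using i fin by (subst card_insert_disjoint) auto
    show ?thesis unfolding S
    proof (intro allI impI)
      fix j assume j: "1 \<le> j" "j \<le> n"
      show "xdeg j (divided_diff i (?S ?P')) \<le> card {k \<in> P. j < k}"
        by (rule xdeg_divided_diff[OF IH i(1,2), where B' = "\<lambda>j. card {k \<in> P. j < k}"])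
           (use j c1 card2 c3 in auto)
    qed
  next
    \<comment> \<open>\<open>P\<close> is now a final segment of \<open>1..n\<close>. Where the next
      index lies in \<open>P\<close> the claim is the staircase bound; before that, symmetry in
      neighbouring variables hands the bound down.\<close>
    case False
    then have up: "Suc i \<in> P" if "i \<in> P" "1 \<le> i" "i < n" for i using that by blast
    have st: "xdeg i (?S P) \<le> n - i" if "1 \<le> i" "i \<le> n" for i
      using xdeg_dschubert[OF grass_permutes[OF less.prems] that] .
    have up': "j \<in> P" if "i \<in> P" "i \<le> j" "j \<le> n" "1 \<le> i" for i j
      using that(2,3,1,4) by (induction j rule: dec_induct) (use up in auto)
    have all: "card {k \<in> P. i < k} = n - i" if "1 \<le> i" "i < n" "Suc i \<in> P" for i
    proof -
      have "{k \<in> P. i < k} = {Suc i..n}" using that up'[of "Suc i"] less.prems by auto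
      then show ?thesis by simp
    qed
    have "xdeg i (?S P) \<le> card {k \<in> P. i < k}" if "1 \<le> i" "i \<le> n" for i
      using that(2,1)
    proof (induction i rule: inc_induct)
      case base
      then show ?case using st[of n] by simp
    next
      case (step i)
      show ?case
      proof (cases "Suc i \<in> P")
        case True
        then show ?thesis using st[of i] all[of i] step by simp
      next
        case False
        then have "i \<notin> P" using up step by blast
        then have "divided_diff i (?S P) = 0"
          using False step less.prems by (simp add: divided_diff_grass)
        then have "xdeg i (?S P) \<le> xdeg (Suc i) (?S P)"
          using xdeg_swap_x[of i "Suc i" "?S P"] by (simp add: divided_diff_eq_0_iff)
        also have "\<dots> \<le> card {k \<in> P. Suc i < k}" using step by simp
        also have "\<dots> \<le> card {k \<in> P. i < k}" using fin by (intro card_mono) auto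
        finally show ?thesis .
      qed
    qed
    then show ?thesis by blast
  qed
qed

lemma xdeg_matchless:
  assumes "P \<subseteq> {1..n}" "1 \<le> i" "i \<le> n"
  shows "xdeg i (matchless_poly n P) \<le> n - i"
proof -
  let ?Q = "{1..n} - P"
  have fin: "finite P" using assms finite_subset by auto
  have "xdeg i (matchless_poly n P) \<le> card {k \<in> ?Q. i < k} + card {k \<in> P. i < k}"
    unfolding matchless_poly_def
    using xdeg_mult_le[of i "dschubert n (\<lambda>j. Y (Suc n - j)) (grass n ?Q)" "dschubert n Y (grass n P)"]
      xdeg_grass[of ?Q n "\<lambda>j. Suc n - j"] xdeg_grass[OF assms(1), of id] assms(2,3)
    by (fastforce intro: le_trans add_mono)
  also have "\<dots> = card ({k \<in> ?Q. i < k} \<union> {k \<in> P. i < k})"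
    using fin by (intro card_Un_disjoint[symmetric]) auto
  also have "\<dots> = card {Suc i..n}" using assms by (intro arg_cong[of _ _ card]) auto
  finally show ?thesis by simp
qed

lemma ev_matchless_eq_0:
  assumes "P \<subseteq> {1..n}" "\<sigma> permutes {1..n}"
    and "cnt (\<lambda>j. \<sigma> j \<le> card P) k > cnt (\<lambda>j. j \<in> P) k"
  shows "ev n \<sigma> (matchless_poly n P) = 0"
proof -
  have "cnt (\<lambda>j. grass n P j \<le> card P) k = cnt (\<lambda>j. j \<in> P) k"
    using grass_le_iff[OF assms(1)] card_le[OF assms(1)] by (intro cnt_cong) auto
  then have "ev n \<sigma> (dschubert n Y (grass n P)) = 0"
    using ev_dschubert_eq_0[OF grass_permutes[OF assms(1)] assms(2), of "card P" k] assms(3) by simp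
  then show ?thesis by (simp add: matchless_poly_def)
qed

text \<open>A chain of ascents to a permutation that preserves the two blocks never uses the
  exchange at \<open>q\<close>.\<close>

lemma ren_y_block_invariant:
  assumes "\<And>k. 1 \<le> k \<Longrightarrow> k < n \<Longrightarrow> k \<noteq> q \<Longrightarrow> swap_y k f = f"
    and "\<tau> permutes {1..n}" and "\<And>j. \<tau> j \<le> q \<longleftrightarrow> j \<le> q"
  shows "ren_y \<tau> f = f"
proof -
  have "(\<forall>j. \<tau> j \<le> q \<longleftrightarrow> j \<le> q) \<longrightarrow> ren_y \<tau> f = f"
    using assms(2)
  proof (induction rule: permutes_induct_ascent)
    case id
    show ?case unfolding ren_y_id by simp
  next
    case (ascent w i)
    show ?case
    proof
      assume b: "\<forall>j. (w \<circ> simple_refl i) j \<le> q \<longleftrightarrow> j \<le> q"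
      have iq: "i \<noteq> q"
      proof
        assume "i = q"
        then have "w (Suc q) \<le> q" "\<not> w q \<le> q" using b[rule_format, of q] b[rule_format, of "Suc q"] by auto
        then show False using ascent.hyps(4) \<open>i = q\<close> by simp
      qed
      have "w j \<le> q \<longleftrightarrow> j \<le> q" for j
      proof -
        have "w j \<le> q \<longleftrightarrow> simple_refl i j \<le> q" using b[rule_format, of "simple_refl i j"] by simp
        also have "\<dots> \<longleftrightarrow> j \<le> q" using iq by (cases "j = i"; cases "j = Suc i") auto
        finally show ?thesis .
      qed
      then have "ren_y w f = f" using ascent.IH by blast
      then have "ren_y w (ren_y (simple_refl i) f) = f"
        using assms(1)[OF ascent.hyps(2,3) iq] by (simp add: swap_y_eq_ren_y)
      then show "ren_y (w \<circ> simple_refl i) f = f" unfolding ren_y_comp .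
    qed
  qed
  then show ?thesis using assms(3) by blast
qed

text \<open>The operator matches the second factor, so by duality the value is the first factor at
  the point \<open>grass n P\<close>. Reversing its alphabet amounts to exchanging two blocks of
  labels, because it is symmetric within the blocks. This turns the point into
  \<open>grass n ({1..n} - P)\<close>, where the value is known from
  \<open>ev_dschubert_self\<close>.\<close>

lemma ev_dd_matchless:
  assumes P: "P \<subseteq> {1..n}"
  shows "ev n id (dd n (grass n P) (matchless_poly n P)) =
    (\<Prod>(i, j)\<in>{(i, j). i \<in> P \<and> j \<in> {1..n} - P \<and> i < j}. Y (grass n P i) - Y (grass n P j))"
proof -
  let ?Q = "{1..n} - P"
  define p q where "p = card P" and "q = card ?Q"
  have n: "n = p + q" using card_compl[OF P] card_le[OF P] by (simp add: p_def q_def)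
  have Q: "?Q \<subseteq> {1..n}" by auto
  define v u where "v = grass n P" and "u = grass n ?Q"
  have v: "v permutes {1..n}" and u: "u permutes {1..n}"
    unfolding v_def u_def by (rule grass_permutes, fact)+
  \<comment> \<open>Reversal factors as \<open>\<rho> \<circ> \<tau>\<close>: \<open>\<tau>\<close>
    reverses each block of labels, which \<open>S\<close> does not notice, and \<open>\<rho>\<close>
    exchanges the blocks and thereby turns \<open>u\<close> into \<open>v\<close>.\<close>
  define \<tau> where "\<tau> j = (if j \<in> {1..q} then Suc q - j else if j \<in> {Suc q..n} then Suc (n + q) - j else j)" for j
  define \<rho> where "\<rho> j = (if j \<in> {1..q} then j + p else if j \<in> {Suc q..n} then j - q else j)" for j
  have t: "\<tau> permutes {1..n}"
  proof (rule bij_imp_permutes)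
    show "bij_betw \<tau> {1..n} {1..n}"
      by (rule bij_betw_byWitness[where f' = \<tau>]) (auto simp: \<tau>_def n)
  qed (auto simp: \<tau>_def n)
  have rt: "\<rho> (\<tau> j) = longest_perm n j" for j
    by (auto simp: \<rho>_def \<tau>_def longest_perm_def n)
  have PQ: "{1..n} - ?Q = P" using P by auto
  have fin: "finite P" "finite ?Q" using P finite_subset by auto
  have ru: "\<rho> (u i) = v i" if "i \<in> {1..n}" for i
  proof (cases "i \<in> P")
    case True
    have "u i = q + card {k \<in> P. k \<le> i}" unfolding u_def grass_def PQ q_def using True that by simp
    moreover have "v i = card {k \<in> P. k \<le> i}" unfolding v_def grass_def using True by simp
    ultimately show ?thesis using rank_bounds[OF fin(1) True] True
      by (auto simp: \<rho>_def p_def[symmetric] n)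
  next
    case False
    then have "i \<in> ?Q" using that by simp
    then have "u i = card {k \<in> ?Q. k \<le> i}" unfolding u_def grass_def by simp
    moreover have "v i = p + card {k \<in> ?Q. k \<le> i}"
      unfolding v_def grass_def p_def using False that by simp
    ultimately show ?thesis using rank_bounds[OF fin(2) \<open>i \<in> ?Q\<close>]
      by (simp add: \<rho>_def q_def[symmetric])
  qed
  define S where "S = dschubert n Y u"
  have "swap_y k S = S" if "1 \<le> k" "k < n" "k \<noteq> q" for k
    unfolding S_def u_def
    using swap_y_dschubert[OF grass_permutes[OF Q] that(1,2) inv_grass_less[OF Q that(1,2)]] that(3) by (simp add: q_def)
  then have St: "ren_y \<tau> S = S"
    by (rule ren_y_block_invariant[OF _ t]) (auto simp: \<tau>_def n)
  have comp: "ev n v (ren_y (longest_perm n) f) = ren_y \<rho> (ev n u (ren_y \<tau> f))" for f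
    unfolding ev_def ren_y_def subst_subst
    by (rule subst_cong_all) (auto split: var.split simp: rt ru)
  have "ev n id (dd n v (matchless_poly n P)) = ev n v (ren_y (longest_perm n) S)"
    using ev_dd_mult_dschubert[OF v, rule_format, of v] v
    unfolding matchless_poly_def S_def v_def[symmetric] u_def[symmetric] ren_y_dschubert[OF u, symmetric] by auto
  also have "\<dots> = ren_y \<rho> (ev n u S)" unfolding comp St ..
  also have "\<dots> = (\<Prod>(i, j)\<in>inversions n u. Y (\<rho> (u i)) - Y (\<rho> (u j)))"
    unfolding S_def ev_dschubert_self[OF u] by (simp add: ren_y_def case_prod_unfold)
  also have "\<dots> = (\<Prod>(i, j)\<in>inversions n u. Y (v i) - Y (v j))"
    by (rule prod.cong) (auto simp: inversions_def ru)
  also have "inversions n u = {(i, j). i \<in> P \<and> j \<in> ?Q \<and> i < j}"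
  proof (intro set_eqI, clarify)
    fix i j
    show "(i, j) \<in> inversions n u \<longleftrightarrow> (i, j) \<in> {(i, j). i \<in> P \<and> j \<in> ?Q \<and> i < j}"
      using grass_less_iff(1)[OF Q, of i j] P by (auto simp: inversions_def u_def)
  qed
  finally show ?thesis unfolding v_def .
qed

section \<open>Clans as signed involutions\<close>

definition mate :: "clan \<Rightarrow> nat \<Rightarrow> nat" where
  "mate \<gamma> k =
     (if k \<in> lefts \<gamma> then THE j. (k, j) \<in> arcs \<gamma>
      else if k \<in> rights \<gamma> then THE j. (j, k) \<in> arcs \<gamma> else k)"

lemma in_lefts: "a \<in> lefts \<gamma> \<longleftrightarrow> (\<exists>b. (a, b) \<in> arcs \<gamma>)"
  and in_rights: "b \<in> rights \<gamma> \<longleftrightarrow> (\<exists>a. (a, b) \<in> arcs \<gamma>)"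
  by (force simp: lefts_def rights_def)+

text \<open>Clans are modified through their involution: disjointness of the arcs is then automatic,
  and only the signs remain to be checked.\<close>

lemma clan_of_involution:
  assumes inv: "\<And>k. m (m k) = k" and dom: "\<And>k. m k \<noteq> k \<Longrightarrow> k \<in> {1..p + q}"
    and arcs: "arcs \<gamma> = {(a, b). m a = b \<and> a < b}"
  shows "mate \<gamma> = m" "lefts \<gamma> = {k. k < m k}" "rights \<gamma> = {k. m k < k}"
    and "pluses \<gamma> \<inter> minuses \<gamma> = {} \<Longrightarrow> pluses \<gamma> \<union> minuses \<gamma> = {k \<in> {1..p + q}. m k = k} \<Longrightarrow>
      int (card (pluses \<gamma>)) - int (card (minuses \<gamma>)) = int p - int q \<Longrightarrow> is_clan p q \<gamma>"
proof -
  show l: "lefts \<gamma> = {k. k < m k}" by (auto simp: in_lefts arcs)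
  show r: "rights \<gamma> = {k. m k < k}" using inv by (auto simp: in_rights arcs) metis
  show "mate \<gamma> = m"
  proof
    fix k
    consider "k < m k" | "m k < k" | "m k = k" by linarith
    then show "mate \<gamma> k = m k"
    proof cases
      case 1
      then have "(THE j. (k, j) \<in> arcs \<gamma>) = m k" unfolding arcs by (intro the_equality) auto
      then show ?thesis using 1 unfolding mate_def l by simp
    next
      case 2
      then have "(THE j. (j, k) \<in> arcs \<gamma>) = m k" unfolding arcs using inv by (intro the_equality) auto
      then show ?thesis using 2 unfolding mate_def l r by simp
    next
      case 3
      then show ?thesis unfolding mate_def l r by simp
    qed
  qed
  assume *: "pluses \<gamma> \<inter> minuses \<gamma> = {}" "pluses \<gamma> \<union> minuses \<gamma> = {k \<in> {1..p + q}. m k = k}"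
      "int (card (pluses \<gamma>)) - int (card (minuses \<gamma>)) = int p - int q"
  have "m a \<in> {1..p + q}" if "m a \<noteq> a" for a using dom[of "m a"] inv[of a] that by metis
  then have 1: "\<forall>(i, j) \<in> arcs \<gamma>. 1 \<le> i \<and> i < j \<and> j \<le> p + q"
    unfolding arcs using dom by fastforce
  have 2: "\<forall>a \<in> arcs \<gamma>. \<forall>b \<in> arcs \<gamma>. a \<noteq> b \<longrightarrow> {fst a, snd a} \<inter> {fst b, snd b} = {}"
    unfolding arcs using inv by (auto simp: ) (metis less_asym)+
  have "{k \<in> {1..p + q}. m k = k} = {1..p + q} - (lefts \<gamma> \<union> rights \<gamma>)"
    unfolding l r by (auto simp: nat_neq_iff)
  then show "is_clan p q \<gamma>" unfolding is_clan_def using 1 2 * by simp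
qed

lemma
  assumes "is_clan p q \<gamma>"
  shows mate_mate: "mate \<gamma> (mate \<gamma> k) = k"
    and arcs_eq: "arcs \<gamma> = {(a, b). mate \<gamma> a = b \<and> a < b}"
    and mate_dom: "mate \<gamma> k \<noteq> k \<Longrightarrow> k \<in> {1..p + q}"
proof -
  have A: "\<forall>(i, j) \<in> arcs \<gamma>. 1 \<le> i \<and> i < j \<and> j \<le> p + q"
    "\<forall>a \<in> arcs \<gamma>. \<forall>b \<in> arcs \<gamma>. a \<noteq> b \<longrightarrow> {fst a, snd a} \<inter> {fst b, snd b} = {}"
    using assms unfolding is_clan_def by blast+
  have c: "1 \<le> i \<and> i < j \<and> j \<le> p + q" if "(i, j) \<in> arcs \<gamma>" for i j
    using bspec[OF A(1) that] by simp
  have u: "a = c \<and> b = d" if "(a, b) \<in> arcs \<gamma>" "(c, d) \<in> arcs \<gamma>" "{a, b} \<inter> {c, d} \<noteq> {}" for a b c d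
  proof -
    have "(a, b) = (c, d)" using bspec[OF bspec[OF A(2) that(1)] that(2)] that(3) by auto
    then show ?thesis by simp
  qed
  have L: "mate \<gamma> a = b \<and> mate \<gamma> b = a" if ab: "(a, b) \<in> arcs \<gamma>" for a b
  proof -
    have 1: "a \<in> lefts \<gamma>" "b \<in> rights \<gamma>" using ab by (auto simp: in_lefts in_rights)
    have 2: "b \<notin> lefts \<gamma>"
    proof
      assume "b \<in> lefts \<gamma>"
      then obtain d where "(b, d) \<in> arcs \<gamma>" by (auto simp: in_lefts)
      with u[OF ab this] c[OF ab] show False by auto
    qed
    have "(THE j. (a, j) \<in> arcs \<gamma>) = b" using u[OF ab] ab by (intro the_equality) auto
    moreover have "(THE j. (j, b) \<in> arcs \<gamma>) = a" using u[OF ab] ab by (intro the_equality) auto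
    ultimately show ?thesis using 1 2 by (simp add: mate_def)
  qed
  have N: "mate \<gamma> k = k" if "k \<notin> lefts \<gamma>" "k \<notin> rights \<gamma>" for k using that by (simp add: mate_def)
  have LR: "(\<exists>j. (k, j) \<in> arcs \<gamma>) \<or> (\<exists>j. (j, k) \<in> arcs \<gamma>) \<or> mate \<gamma> k = k" for k
    using N by (auto simp: in_lefts in_rights)
  show "mate \<gamma> (mate \<gamma> k) = k" using LR[of k] L[of k] L[of _ k] by auto
  show "arcs \<gamma> = {(a, b). mate \<gamma> a = b \<and> a < b}"
  proof (intro set_eqI, clarify, intro iffI)
    fix a b assume "(a, b) \<in> arcs \<gamma>"
    then show "(a, b) \<in> {(a, b). mate \<gamma> a = b \<and> a < b}" using L[of a b] c[of a b] by auto
  next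
    fix a b assume ab: "(a, b) \<in> {(a, b). mate \<gamma> a = b \<and> a < b}"
    have "(j, a) \<notin> arcs \<gamma>" for j using L[of j a] c[of j a] ab by auto
    then have "\<exists>j. (a, j) \<in> arcs \<gamma>" using LR[of a] ab by auto
    then show "(a, b) \<in> arcs \<gamma>" using L ab by auto
  qed
  show "mate \<gamma> k \<noteq> k \<Longrightarrow> k \<in> {1..p + q}" using LR[of k] by (auto dest!: c)
qed

lemma
  assumes "is_clan p q \<gamma>"
  shows lefts_eq: "lefts \<gamma> = {k. k < mate \<gamma> k}"
    and rights_eq: "rights \<gamma> = {k. mate \<gamma> k < k}"
    and signs_eq: "pluses \<gamma> \<union> minuses \<gamma> = {k \<in> {1..p + q}. mate \<gamma> k = k}"
    and signs_disjoint: "pluses \<gamma> \<inter> minuses \<gamma> = {}"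
proof -
  note c = mate_mate[OF assms] mate_dom[OF assms] arcs_eq[OF assms]
  show l: "lefts \<gamma> = {k. k < mate \<gamma> k}" and r: "rights \<gamma> = {k. mate \<gamma> k < k}"
    using clan_of_involution(2,3)[of "mate \<gamma>" p q \<gamma>] c by auto
  have "pluses \<gamma> \<union> minuses \<gamma> = {1..p + q} - (lefts \<gamma> \<union> rights \<gamma>)"
    using assms by (simp add: is_clan_def)
  also have "\<dots> = {k \<in> {1..p + q}. mate \<gamma> k = k}"
  proof (rule set_eqI)
    fix k
    show "k \<in> {1..p + q} - (lefts \<gamma> \<union> rights \<gamma>) \<longleftrightarrow> k \<in> {k \<in> {1..p + q}. mate \<gamma> k = k}"
      unfolding l r by (cases k "mate \<gamma> k" rule: linorder_cases) auto
  qed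
  finally show "pluses \<gamma> \<union> minuses \<gamma> = {k \<in> {1..p + q}. mate \<gamma> k = k}" .
  show "pluses \<gamma> \<inter> minuses \<gamma> = {}" using assms by (simp add: is_clan_def)
qed

lemma mate_in_iff:
  assumes "is_clan p q \<gamma>"
  shows "mate \<gamma> k \<in> {1..p + q} \<longleftrightarrow> k \<in> {1..p + q}"
  using mate_dom[OF assms] mate_mate[OF assms] by metis

lemma mate_inject: "is_clan p q \<gamma> \<Longrightarrow> mate \<gamma> a = mate \<gamma> b \<longleftrightarrow> a = b"
  using mate_mate by metis

text \<open>The down steps of the lattice path. \<open>v_perm\<close> depends on this set alone and
  is the identity iff the set is \<open>{1..p}\<close>.\<close>

definition upper :: "clan \<Rightarrow> nat set" where
  "upper \<gamma> = pluses \<gamma> \<union> lefts \<gamma>"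

lemma
  assumes "is_clan p q \<gamma>"
  shows upper_subset: "upper \<gamma> \<subseteq> {1..p + q}"
    and compl_upper: "{1..p + q} - upper \<gamma> = minuses \<gamma> \<union> rights \<gamma>"
    and in_upper_iff: "k \<in> upper \<gamma> \<longleftrightarrow> k \<in> pluses \<gamma> \<or> k < mate \<gamma> k"
proof -
  note s = signs_eq[OF assms] signs_disjoint[OF assms] lefts_eq[OF assms] rights_eq[OF assms]
  have d: "k \<in> {1..p + q}" if "k < mate \<gamma> k \<or> mate \<gamma> k < k" for k using mate_dom[OF assms, of k] that by linarith
  show "upper \<gamma> \<subseteq> {1..p + q}" using s d by (auto simp: upper_def)
  show "{1..p + q} - upper \<gamma> = minuses \<gamma> \<union> rights \<gamma>"
  proof (rule set_eqI)
    fix k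
    have "k \<in> pluses \<gamma> \<or> k \<in> minuses \<gamma> \<longleftrightarrow> k \<in> {1..p + q} \<and> mate \<gamma> k = k" using s(1) by auto
    moreover have "\<not> (k \<in> pluses \<gamma> \<and> k \<in> minuses \<gamma>)" using s(2) by auto
    ultimately show "k \<in> {1..p + q} - upper \<gamma> \<longleftrightarrow> k \<in> minuses \<gamma> \<union> rights \<gamma>"
      using d[of k] unfolding upper_def s(3,4) by (cases k "mate \<gamma> k" rule: linorder_cases) auto
  qed
  show "k \<in> upper \<gamma> \<longleftrightarrow> k \<in> pluses \<gamma> \<or> k < mate \<gamma> k" by (simp add: upper_def s(3))
qed

text \<open>\<open>mate\<close> pairs left with right ends, so the sizes of \<open>upper\<close> and
  its complement differ as the numbers of signs do, by \<open>p - q\<close>, while they add up to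
  \<open>p + q\<close>.\<close>

lemma card_upper:
  assumes "is_clan p q \<gamma>"
  shows "card (upper \<gamma>) = p"
proof -
  note s = signs_eq[OF assms] signs_disjoint[OF assms] lefts_eq[OF assms] rights_eq[OF assms]
  have fin: "finite (upper \<gamma>)" "finite (minuses \<gamma> \<union> rights \<gamma>)"
    using upper_subset[OF assms] compl_upper[OF assms] by (auto intro: finite_subset simp flip: compl_upper[OF assms])
  have fl: "finite (pluses \<gamma>)" "finite (lefts \<gamma>)" "finite (minuses \<gamma>)" "finite (rights \<gamma>)"
    using fin by (auto simp: upper_def)
  have "bij_betw (mate \<gamma>) (lefts \<gamma>) (rights \<gamma>)"
    by (rule bij_betw_byWitness[where f' = "mate \<gamma>"]) (auto simp: s mate_mate[OF assms])
  then have lr: "card (lefts \<gamma>) = card (rights \<gamma>)" by (rule bij_betw_same_card)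
  have sg: "mate \<gamma> k = k" if "k \<in> pluses \<gamma> \<or> k \<in> minuses \<gamma>" for k
    using that s(1) by blast
  have u: "card (upper \<gamma>) = card (pluses \<gamma>) + card (lefts \<gamma>)" unfolding upper_def
    by (rule card_Un_disjoint[OF fl(1,2)]) (use sg in \<open>auto simp: s(3)\<close>)
  have d: "card (minuses \<gamma> \<union> rights \<gamma>) = card (minuses \<gamma>) + card (rights \<gamma>)"
    by (rule card_Un_disjoint[OF fl(3,4)]) (use sg in \<open>auto simp: s(4)\<close>)
  have "card (upper \<gamma>) + card ({1..p + q} - upper \<gamma>) = p + q"
    using upper_subset[OF assms] fin(1) card_mono[OF _ upper_subset[OF assms]] by (subst card_Diff_subset) auto
  then have "card (pluses \<gamma>) + card (minuses \<gamma>) + 2 * card (lefts \<gamma>) = p + q"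
    unfolding compl_upper[OF assms] u d lr by simp
  moreover have "int (card (pluses \<gamma>)) - int (card (minuses \<gamma>)) = int p - int q"
    using assms by (simp add: is_clan_def)
  ultimately show ?thesis unfolding u by linarith
qed

subsection \<open>The action of simple reflections\<close>

text \<open>Unless \<open>i\<close> and \<open>Suc i\<close> form an arc, the exchange reverses no
  arc. Minimum and maximum in \<open>swap_nodes\<close> then keep the orientation, and the
  involution is simply conjugated.\<close>

lemma swap_nodes_swap:
  assumes "is_clan p q \<gamma>" "1 \<le> i" "i < p + q" "mate \<gamma> i \<noteq> Suc i"
  shows "is_clan p q (swap_nodes i \<gamma>)"
    "mate (swap_nodes i \<gamma>) = simple_refl i \<circ> mate \<gamma> \<circ> simple_refl i"
    "pluses (swap_nodes i \<gamma>) = simple_refl i ` pluses \<gamma>"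
    "minuses (swap_nodes i \<gamma>) = simple_refl i ` minuses \<gamma>"
    "upper (swap_nodes i \<gamma>) = simple_refl i ` upper \<gamma>"
    "swap_nodes i (swap_nodes i \<gamma>) = \<gamma>"
proof -
  let ?s = "simple_refl i" and ?g = "swap_nodes i \<gamma>"
  define m where "m = ?s \<circ> mate \<gamma> \<circ> ?s"
  note mm = mate_mate[OF assms(1)]
  have inv: "m (m k) = k" for k by (simp add: m_def mm)
  have dom: "k \<in> {1..p + q}" if "m k \<noteq> k" for k
  proof -
    have "mate \<gamma> (?s k) \<noteq> ?s k" using that by (auto simp: m_def)
    then show ?thesis using mate_dom[OF assms(1)] simple_refl_in[OF assms(2,3)] by blast
  qed
  have sl: "?s a < ?s b" if "a < b" "mate \<gamma> a = b" for a b
    using that assms(4) simple_refl_less[of a b i] by auto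
  have arcs: "arcs ?g = {(a, b). m a = b \<and> a < b}"
  proof (intro set_eqI, clarify, intro iffI)
    fix c d assume "(c, d) \<in> arcs ?g"
    then obtain a b where ab: "(a, b) \<in> arcs \<gamma>" "c = min (?s a) (?s b)" "d = max (?s a) (?s b)"
      by (auto simp: swap_nodes_def Let_def)
    then have "mate \<gamma> a = b" "a < b" by (simp_all add: arcs_eq[OF assms(1)])
    then show "(c, d) \<in> {(a, b). m a = b \<and> a < b}" using ab sl[of a b] by (auto simp: m_def)
  next
    fix c d assume cd: "(c, d) \<in> {(a, b). m a = b \<and> a < b}"
    then have 1: "mate \<gamma> (?s c) = ?s d" by (auto simp: m_def)
    have "(c, d) \<noteq> (i, Suc i)"
    proof
      assume "(c, d) = (i, Suc i)"
      then have "mate \<gamma> (Suc i) = i" using 1 by simp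
      then show False using assms(4) mm by metis
    qed
    then have "?s c < ?s d" using cd simple_refl_less by auto
    then have "(?s c, ?s d) \<in> arcs \<gamma>" using 1 by (simp add: arcs_eq[OF assms(1)])
    moreover have "(c, d) = (min (?s (?s c)) (?s (?s d)), max (?s (?s c)) (?s (?s d)))" using cd by auto
    ultimately show "(c, d) \<in> arcs ?g"
      unfolding swap_nodes_def Let_def by (auto intro!: image_eqI[of _ _ "(?s c, ?s d)"] simp del: simple_refl_simps)
  qed
  note ci = clan_of_involution[OF inv dom arcs]
  show m': "mate ?g = ?s \<circ> mate \<gamma> \<circ> ?s" using ci(1) unfolding m_def .
  show pl: "pluses ?g = ?s ` pluses \<gamma>" and mi: "minuses ?g = ?s ` minuses \<gamma>"
    by (simp_all add: swap_nodes_def Let_def)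
  have mem: "j \<in> ?s ` A \<longleftrightarrow> ?s j \<in> A" for j A by (metis image_iff simple_refl_simps(4))
  have cs: "card (?s ` A) = card A" for A by (rule card_image) (simp add: inj_on_def)
  have "pluses ?g \<inter> minuses ?g = {}" unfolding pl mi
    using signs_disjoint[OF assms(1)] by (auto simp: mem)
  moreover have "pluses ?g \<union> minuses ?g = {k \<in> {1..p + q}. m k = k}"
  proof (rule set_eqI)
    fix k
    have "k \<in> pluses ?g \<union> minuses ?g \<longleftrightarrow> ?s k \<in> pluses \<gamma> \<union> minuses \<gamma>" unfolding pl mi by (simp add: mem)
    also have "\<dots> \<longleftrightarrow> ?s k \<in> {1..p + q} \<and> mate \<gamma> (?s k) = ?s k" unfolding signs_eq[OF assms(1)] by simp
    also have "\<dots> \<longleftrightarrow> k \<in> {1..p + q} \<and> m k = k"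
      unfolding simple_refl_in[OF assms(2,3)] m_def o_apply by (metis simple_refl_simps(4))
    finally show "k \<in> pluses ?g \<union> minuses ?g \<longleftrightarrow> k \<in> {k \<in> {1..p + q}. m k = k}" by simp
  qed
  moreover have "int (card (pluses ?g)) - int (card (minuses ?g)) = int p - int q"
    using assms(1) unfolding pl mi cs by (simp add: is_clan_def)
  ultimately show cl: "is_clan p q ?g" using ci(4) by blast
  show "upper ?g = ?s ` upper \<gamma>"
  proof (rule set_eqI)
    fix k
    have "k < ?s (mate \<gamma> (?s k)) \<longleftrightarrow> ?s k < mate \<gamma> (?s k)"
    proof -
      define j where "j = ?s k"
      have k: "k = ?s j" by (simp add: j_def)
      have "(j, mate \<gamma> j) \<noteq> (i, Suc i)" using assms(4) by auto
      moreover have "(mate \<gamma> j, j) \<noteq> (i, Suc i)" using assms(4) mm[of j] by auto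
      ultimately show ?thesis
        using simple_refl_less[of j "mate \<gamma> j" i] simple_refl_less[of "mate \<gamma> j" j i]
        unfolding k by (cases j "mate \<gamma> j" rule: linorder_cases) auto
    qed
    then show "k \<in> upper ?g \<longleftrightarrow> k \<in> ?s ` upper \<gamma>"
      unfolding in_upper_iff[OF cl] m' pl mem in_upper_iff[OF assms(1)] by simp
  qed
  have m'i: "mate ?g i \<noteq> Suc i"
  proof
    assume "mate ?g i = Suc i"
    then have "?s (mate \<gamma> (Suc i)) = ?s i" unfolding m' by simp
    then have "mate \<gamma> (Suc i) = i" by (simp only: simple_refl_inj)
    then show False using assms(4) mm by metis
  qed
  have "arcs (swap_nodes i ?g) = arcs \<gamma>"
  proof -
    define f where "f = (\<lambda>(a, b). (min (?s a) (?s b), max (?s a) (?s b)))"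
    have "f (f ab) = ab" if "ab \<in> arcs \<gamma>" for ab
    proof (cases ab)
      case (Pair a b)
      then have "mate \<gamma> a = b" "a < b" using that by (simp_all add: arcs_eq[OF assms(1)])
      then show ?thesis using sl[of a b] Pair by (auto simp: f_def min_def max_def)
    qed
    then have "f ` f ` arcs \<gamma> = (\<lambda>ab. ab) ` arcs \<gamma>"
      unfolding image_image by (intro image_cong) auto
    then show ?thesis by (simp add: swap_nodes_def Let_def f_def)
  qed
  moreover have "?s ` ?s ` A = A" for A by (auto simp: image_image)
  ultimately show "swap_nodes i ?g = \<gamma>"
    by (intro clan.equality) (auto simp: swap_nodes_def Let_def)
qed

lemma swap_nodes_trivial:
  assumes "is_clan p q \<gamma>" "1 \<le> i" "i < p + q"
    and "mate \<gamma> i = Suc i \<or> {i, Suc i} \<subseteq> pluses \<gamma> \<or> {i, Suc i} \<subseteq> minuses \<gamma>"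
  shows "swap_nodes i \<gamma> = \<gamma>"
proof -
  let ?s = "simple_refl i"
  note s = signs_eq[OF assms(1)] signs_disjoint[OF assms(1)]
  have mm: "mate \<gamma> (mate \<gamma> k) = k" for k by (rule mate_mate[OF assms(1)])
  have set: "?s ` A = A" if "i \<in> A \<longleftrightarrow> Suc i \<in> A" for A
  proof (rule set_eqI)
    fix k
    show "k \<in> ?s ` A \<longleftrightarrow> k \<in> A"
      using that by (cases "k = i"; cases "k = Suc i") (auto simp: image_iff, (metis simple_refl_simps)+)
  qed
  have sg: "mate \<gamma> k = k" if "k \<in> pluses \<gamma> \<or> k \<in> minuses \<gamma>" for k using that s(1) by blast
  have pm: "i \<in> pluses \<gamma> \<longleftrightarrow> Suc i \<in> pluses \<gamma>" "i \<in> minuses \<gamma> \<longleftrightarrow> Suc i \<in> minuses \<gamma>"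
    using assms(4) s(2) sg[of i] sg[of "Suc i"] mm[of i] by auto
  have arc: "(min (?s a) (?s b), max (?s a) (?s b)) = (a, b)" if ab: "(a, b) \<in> arcs \<gamma>" for a b
  proof -
    have m: "mate \<gamma> a = b" "a < b" "mate \<gamma> b = a" using ab mm by (auto simp: arcs_eq[OF assms(1)])
    show ?thesis
    proof (cases "mate \<gamma> i = Suc i")
      case True
      have "mate \<gamma> (Suc i) = i" using True mm by metis
      then have "a = i \<longleftrightarrow> b = Suc i" "a \<noteq> Suc i" "b \<noteq> i" using m True by auto
      then show ?thesis using m by (cases "a = i") auto
    next
      case False
      then have "mate \<gamma> i = i" "mate \<gamma> (Suc i) = Suc i" using assms(4) sg by auto
      then have "a \<noteq> i" "a \<noteq> Suc i" "b \<noteq> i" "b \<noteq> Suc i" using m by auto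
      then show ?thesis using m by auto
    qed
  qed
  then have "(\<lambda>(a, b). (min (?s a) (?s b), max (?s a) (?s b))) ` arcs \<gamma> = (\<lambda>ab. ab) ` arcs \<gamma>"
    by (intro image_cong) auto
  then show ?thesis using set pm by (intro clan.equality) (auto simp: swap_nodes_def Let_def)
qed

section \<open>Length under exchanges of neighbouring nodes\<close>

lemma finite_lefts:
  assumes "is_clan p q \<gamma>"
  shows "finite (lefts \<gamma>)"
  by (rule finite_subset[OF _ finite_subset[OF upper_subset[OF assms]]]) (auto simp: upper_def)

definition crossing_pairs :: "nat set \<Rightarrow> (nat \<Rightarrow> nat) \<Rightarrow> (nat \<times> nat) set" where
  "crossing_pairs L m = {(a, c). a \<in> L \<and> c \<in> L \<and> a < c \<and> c < m a \<and> m a < m c}"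

lemma clan_length_eq:
  assumes "is_clan p q \<gamma>"
  shows "clan_length \<gamma> = (\<Sum>a\<in>lefts \<gamma>. int (mate \<gamma> a) - int a) - int (card (crossing_pairs (lefts \<gamma>) (mate \<gamma>)))"
proof -
  have a: "arcs \<gamma> = (\<lambda>a. (a, mate \<gamma> a)) ` lefts \<gamma>"
    unfolding lefts_eq[OF assms] by (subst arcs_eq[OF assms]) auto
  have "(\<Sum>(i, j)\<in>arcs \<gamma>. int j - int i) = (\<Sum>a\<in>lefts \<gamma>. int (mate \<gamma> a) - int a)"
    unfolding a by (subst sum.reindex) (auto simp: inj_on_def)
  moreover have "crossings \<gamma> = (\<lambda>(a, c). ((a, mate \<gamma> a), (c, mate \<gamma> c))) ` crossing_pairs (lefts \<gamma>) (mate \<gamma>)"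
    unfolding crossings_def a crossing_pairs_def by (force simp: image_iff)
  moreover have "card ((\<lambda>(a, c). ((a, mate \<gamma> a), (c, mate \<gamma> c))) ` crossing_pairs (lefts \<gamma>) (mate \<gamma>))
      = card (crossing_pairs (lefts \<gamma>) (mate \<gamma>))"
    by (rule card_image) (auto simp: inj_on_def)
  ultimately show ?thesis by (simp add: clan_length_def)
qed

lemma finite_crossing_pairs: "finite L \<Longrightarrow> finite (crossing_pairs L m)"
  by (rule finite_subset[of _ "L \<times> L"]) (auto simp: crossing_pairs_def)

text \<open>Besides the joining of opposite signs, these are the \<open>i\<close> at which the
  action raises the length. Two neighbouring signs satisfy the inequality as well and have to be
  excluded.\<close>

definition ascent :: "clan \<Rightarrow> nat \<Rightarrow> bool" where
  "ascent \<gamma> i \<longleftrightarrow> mate \<gamma> i < mate \<gamma> (Suc i) \<and> \<not> (mate \<gamma> i = i \<and> mate \<gamma> (Suc i) = Suc i)"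

lemma ascent_cases:
  assumes "is_clan p q \<gamma>" "ascent \<gamma> i"
  obtains (right) "mate \<gamma> i < i"
    | (sign_left) "mate \<gamma> i = i" "Suc i < mate \<gamma> (Suc i)"
    | (left_left) "Suc i < mate \<gamma> i" "mate \<gamma> i < mate \<gamma> (Suc i)"
proof -
  note mm = mate_mate[OF assms(1)]
  have a: "mate \<gamma> i < mate \<gamma> (Suc i)" "\<not> (mate \<gamma> i = i \<and> mate \<gamma> (Suc i) = Suc i)"
    using assms(2) by (auto simp: ascent_def)
  consider "mate \<gamma> i < i" | "mate \<gamma> i = i" | "mate \<gamma> i = Suc i" | "Suc i < mate \<gamma> i" by linarith
  then show thesis
  proof cases
    case 2
    then have "Suc i < mate \<gamma> (Suc i)" using a by linarith
    then show ?thesis using 2 sign_left by blast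
  next
    case 3
    then have "mate \<gamma> (Suc i) = i" using mm by metis
    then show ?thesis using 3 a by simp
  qed (use right left_left a in auto)
qed

lemma ascent_not_arc: "is_clan p q \<gamma> \<Longrightarrow> ascent \<gamma> i \<Longrightarrow> mate \<gamma> i \<noteq> Suc i"
  by (erule (1) ascent_cases) auto

text \<open>A right end before a sign, or a sign before a left end, widens one arc. A right end
  before a left end widens two arcs and creates one crossing. Two ends of the same kind keep the
  total width and lose one crossing.\<close>

lemma clan_length_ascent:
  assumes "is_clan p q \<gamma>" "1 \<le> i" "i < p + q" "ascent \<gamma> i"
  shows "clan_length (swap_nodes i \<gamma>) = clan_length \<gamma> + 1"
proof -
  let ?s = "simple_refl i" and ?g = "swap_nodes i \<gamma>"
  define m where "m = mate \<gamma>"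
  define L where "L = lefts \<gamma>"
  note mm = mate_mate[OF assms(1), folded m_def]
  note sw = swap_nodes_swap[OF assms(1-3) ascent_not_arc[OF assms(1,4)]]
  have minj: "m a = m b \<longleftrightarrow> a = b" for a b using mm by metis
  have L_iff: "a \<in> L \<longleftrightarrow> a < m a" for a unfolding L_def m_def lefts_eq[OF assms(1)] by simp
  have finL: "finite L" unfolding L_def by (rule finite_lefts[OF assms(1)])
  have na: "m i \<noteq> Suc i" "m (Suc i) \<noteq> i" using ascent_not_arc[OF assms(1,4), folded m_def] mm by metis+
  have sl: "?s a < ?s (m a) \<longleftrightarrow> a < m a" for a
  proof -
    have "(a, m a) \<noteq> (i, Suc i)" "(m a, a) \<noteq> (i, Suc i)" using na by auto
    then show ?thesis using simple_refl_less[of a "m a" i] simple_refl_less[of "m a" a i]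
      by (cases a "m a" rule: linorder_cases) auto
  qed
  have lefts': "lefts ?g = ?s ` L"
  proof (rule set_eqI)
    fix k
    have "k \<in> ?s ` L \<longleftrightarrow> ?s k \<in> L" by (metis image_iff simple_refl_simps(4))
    also have "\<dots> \<longleftrightarrow> ?s (?s k) < ?s (m (?s k))" unfolding L_iff sl ..
    finally show "k \<in> lefts ?g \<longleftrightarrow> k \<in> ?s ` L"
      unfolding lefts_eq[OF sw(1)] sw(2) m_def by simp
  qed
  have mate': "mate ?g (?s a) = ?s (m a)" for a unfolding sw(2) m_def by simp
  have inj: "inj_on ?s A" for A by (simp add: inj_on_def)
  \<comment> \<open>The crossings after the exchange, named by the left ends that they had
    before.\<close>
  define C' where "C' = {(a, c). a \<in> L \<and> c \<in> L \<and> ?s a < ?s c \<and> ?s c < ?s (m a) \<and> ?s (m a) < ?s (m c)}"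
  have cp': "crossing_pairs (lefts ?g) (mate ?g) = map_prod ?s ?s ` C'"
    unfolding lefts' crossing_pairs_def C'_def by (auto simp: mate' image_iff map_prod_def) 
  have cc': "card (crossing_pairs (lefts ?g) (mate ?g)) = card C'"
    unfolding cp' by (rule card_image) (auto simp: inj_on_def)
  define C where "C = crossing_pairs L m"
  have finC: "finite C" unfolding C_def by (rule finite_crossing_pairs[OF finL])
  have S': "(\<Sum>a\<in>lefts ?g. int (mate ?g a) - int a) = (\<Sum>a\<in>L. int (?s (m a)) - int (?s a))"
    unfolding lefts' by (subst sum.reindex[OF inj]) (simp add: mate')
  \<comment> \<open>The displacement of a node. Summed over the right ends and over the left ends it
    gives the change of the total width.\<close>
  define d where "d j = (if j = i then 1 else if j = Suc i then -1 else (0::int))" for j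
  have ds: "int (?s j) = int j + d j" for j by (auto simp: d_def)
  have S: "(\<Sum>a\<in>L. int (?s (m a)) - int (?s a)) = (\<Sum>a\<in>L. int (m a) - int a) + (\<Sum>a\<in>L. d (m a)) - (\<Sum>a\<in>L. d a)"
    unfolding ds by (simp add: sum.distrib sum_subtractf algebra_simps)
  have sd: "(\<Sum>a\<in>L. d (h a)) = (if \<exists>a\<in>L. h a = i then 1 else 0) - (if \<exists>a\<in>L. h a = Suc i then 1 else 0)"
    if "inj_on h L" for h
  proof -
    have one: "(\<Sum>a\<in>L. if h a = j then (1::int) else 0) = (if \<exists>a\<in>L. h a = j then 1 else 0)" for j
    proof (cases "\<exists>a\<in>L. h a = j")
      case True
      then obtain a where a: "a \<in> L" "h a = j" by blast
      have "(\<Sum>b\<in>L. if h b = j then (1::int) else 0) = (\<Sum>b\<in>L. if b = a then 1 else 0)"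
        by (rule sum.cong) (use that a in \<open>auto simp: inj_on_def\<close>)
      then show ?thesis using True a finL by simp
    qed auto
    have "(\<Sum>a\<in>L. d (h a)) = (\<Sum>a\<in>L. (if h a = i then 1 else 0) - (if h a = Suc i then 1 else 0))"
      by (rule sum.cong) (auto simp: d_def)
    then show ?thesis by (simp add: sum_subtractf one)
  qed
  have ex: "(\<exists>a\<in>L. m a = j) \<longleftrightarrow> m j < j" for j
  proof
    assume "\<exists>a\<in>L. m a = j"
    then obtain a where "a \<in> L" "m a = j" by blast
    then show "m j < j" using mm[of a] by (auto simp: L_iff)
  next
    assume "m j < j"
    then have "m j \<in> L" using mm[of j] by (simp add: L_iff)
    then show "\<exists>a\<in>L. m a = j" using mm[of j] by blast
  qed
  have sd1: "(\<Sum>a\<in>L. d (m a)) = (if m i < i then 1 else 0) - (if m (Suc i) < Suc i then 1 else 0)"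
    using sd[of m] by (simp add: ex inj_on_def minj)
  have sd2: "(\<Sum>a\<in>L. d a) = (if i < m i then 1 else 0) - (if Suc i < m (Suc i) then 1 else 0)"
    using sd[of "\<lambda>a. a"] by (simp add: L_iff)
  have main: "clan_length ?g = clan_length \<gamma> + ((\<Sum>a\<in>L. d (m a)) - (\<Sum>a\<in>L. d a)) + (int (card C) - int (card C'))"
    unfolding clan_length_eq[OF sw(1)] clan_length_eq[OF assms(1)] cc' S' S
    by (simp add: L_def[symmetric] m_def[symmetric] C_def)
  have lt: "?s a < ?s b \<longleftrightarrow> a < b" if "\<not> (a = i \<and> b = Suc i)" "\<not> (b = i \<and> a = Suc i)" for a b
    using that simple_refl_less[of a b i] simple_refl_less[of b a i] by (cases a b rule: linorder_cases) auto
  from assms(1,4) show ?thesis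
  proof (cases rule: ascent_cases)
    case right
    then have mi: "m i < i" by (simp add: m_def)
    have iL: "i \<notin> L" unfolding L_iff using mi by simp
    consider (l) "Suc i < m (Suc i)" | (s) "m (Suc i) = Suc i" | (r) "m (Suc i) < Suc i" by linarith
    then show ?thesis
    proof cases
      case l
      have "C' = insert (m i, Suc i) C"
      proof (intro set_eqI, clarify)
        fix a c
        show "(a, c) \<in> C' \<longleftrightarrow> (a, c) \<in> insert (m i, Suc i) C"
        proof (cases "(a, c) = (m i, Suc i)")
          case True
          then show ?thesis using mi l mm[of i] by (auto simp: C'_def L_iff)
        next
          case False
          show ?thesis
          proof (cases "a \<in> L \<and> c \<in> L")
            case True
            then have "a \<noteq> i" "c \<noteq> i" "m a \<noteq> Suc i" "m c \<noteq> Suc i"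
              using iL l mm[of a] mm[of c] by (auto simp: L_iff)
            moreover have "\<not> (m a = i \<and> c = Suc i)" using False mm[of a] by auto
            ultimately have "?s a < ?s c \<longleftrightarrow> a < c" "?s c < ?s (m a) \<longleftrightarrow> c < m a" "?s (m a) < ?s (m c) \<longleftrightarrow> m a < m c"
              by (auto intro!: lt)
            then show ?thesis using False by (auto simp: C'_def C_def crossing_pairs_def)
          next
            case F: False
            then show ?thesis using False by (auto simp: C'_def C_def crossing_pairs_def)
          qed
        qed
      qed
      moreover have "(m i, Suc i) \<notin> C" using mm[of i] by (simp add: C_def crossing_pairs_def)
      ultimately have "int (card C') = int (card C) + 1" using finC by simp
      then show ?thesis unfolding main sd1 sd2 using mi l by simp
    next
      case s
      have "C' = C"
      proof (intro set_eqI, clarify)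
        fix a c
        show "(a, c) \<in> C' \<longleftrightarrow> (a, c) \<in> C"
        proof (cases "a \<in> L \<and> c \<in> L")
          case True
          then have "a \<noteq> Suc i" "c \<noteq> Suc i" "m a \<noteq> Suc i" "m c \<noteq> Suc i"
            using s mm[of a] mm[of c] by (auto simp: L_iff)
          then have "?s a < ?s c \<longleftrightarrow> a < c" "?s c < ?s (m a) \<longleftrightarrow> c < m a" "?s (m a) < ?s (m c) \<longleftrightarrow> m a < m c"
            by (auto intro!: lt)
          then show ?thesis by (auto simp: C'_def C_def crossing_pairs_def)
        qed (auto simp: C'_def C_def crossing_pairs_def)
      qed
      then show ?thesis unfolding main sd1 sd2 using mi s by simp
    next
      case r
      have asc: "m i < m (Suc i)" using assms(4) by (simp add: ascent_def m_def)
      have r': "m (Suc i) < i" using r na by linarith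
      have "C = insert (m i, m (Suc i)) C'"
      proof (intro set_eqI, clarify)
        fix a c
        show "(a, c) \<in> C \<longleftrightarrow> (a, c) \<in> insert (m i, m (Suc i)) C'"
        proof (cases "(a, c) = (m i, m (Suc i))")
          case True
          then show ?thesis using mi r r' asc mm by (auto simp: C_def crossing_pairs_def L_iff)
        next
          case False
          show ?thesis
          proof (cases "a \<in> L \<and> c \<in> L")
            case True
            then have n: "a \<noteq> i" "c \<noteq> i" "a \<noteq> Suc i" "c \<noteq> Suc i" using mi r by (auto simp: L_iff)
            have n2: "\<not> (m a = i \<and> m c = Suc i)" using False mm[of a] mm[of c] by auto
            have e1: "?s a < ?s c \<longleftrightarrow> a < c" "?s c < ?s (m a) \<longleftrightarrow> c < m a"
              by (rule lt; use n in simp)+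
            have e2: "?s (m a) < ?s (m c) \<longleftrightarrow> m a < m c" if "a < c"
            proof (rule lt[OF n2])
              show "\<not> (m c = i \<and> m a = Suc i)"
              proof
                assume "m c = i \<and> m a = Suc i"
                then have "c = m i" "a = m (Suc i)" using mm by metis+
                then show False using asc that by simp
              qed
            qed
            show ?thesis using True e1 e2 False by (auto simp: C'_def C_def crossing_pairs_def)
          next
            case F: False
            then show ?thesis using False by (auto simp: C'_def C_def crossing_pairs_def)
          qed
        qed
      qed
      moreover have "(m i, m (Suc i)) \<notin> C'" using mm by (simp add: C'_def)
      moreover have "finite C'" using calculation finC by simp
      ultimately have "int (card C) = int (card C') + 1" by simp
      then show ?thesis unfolding main sd1 sd2 using mi r by simp
    qed
  next
    case sign_left
    then have s: "m i = i" and l: "Suc i < m (Suc i)" by (simp_all add: m_def)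
    have "C' = C"
    proof (intro set_eqI, clarify)
      fix a c
      show "(a, c) \<in> C' \<longleftrightarrow> (a, c) \<in> C"
      proof (cases "a \<in> L \<and> c \<in> L")
        case True
        then have "a \<noteq> i" "c \<noteq> i" "m a \<noteq> i" "m c \<noteq> i"
          using s mm[of a] mm[of c] by (auto simp: L_iff)
        then have "?s a < ?s c \<longleftrightarrow> a < c" "?s c < ?s (m a) \<longleftrightarrow> c < m a" "?s (m a) < ?s (m c) \<longleftrightarrow> m a < m c"
          by (auto intro!: lt)
        then show ?thesis by (auto simp: C'_def C_def crossing_pairs_def)
      qed (auto simp: C'_def C_def crossing_pairs_def)
    qed
    then show ?thesis unfolding main sd1 sd2 using s l by simp
  next
    case left_left
    then have l: "Suc i < m i" "m i < m (Suc i)" by (simp_all add: m_def)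
    have "C = insert (i, Suc i) C'"
    proof (intro set_eqI, clarify)
      fix a c
      show "(a, c) \<in> C \<longleftrightarrow> (a, c) \<in> insert (i, Suc i) C'"
      proof (cases "(a, c) = (i, Suc i)")
        case True
        then show ?thesis using l by (auto simp: C_def crossing_pairs_def L_iff)
      next
        case False
        show ?thesis
        proof (cases "a \<in> L \<and> c \<in> L")
          case True
          then have n: "m a \<noteq> i" "m c \<noteq> i" "m a \<noteq> Suc i" "m c \<noteq> Suc i"
            using l mm[of a] mm[of c] by (auto simp: L_iff)
          have e1: "?s c < ?s (m a) \<longleftrightarrow> c < m a" "?s (m a) < ?s (m c) \<longleftrightarrow> m a < m c"
            by (rule lt; use n in simp)+
          have e2: "?s a < ?s c \<longleftrightarrow> a < c" if "m a < m c"
            by (rule lt) (use False that l in auto)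
          show ?thesis using True e1 e2 False by (auto simp: C'_def C_def crossing_pairs_def)
        next
          case F: False
          then show ?thesis using False l by (auto simp: C'_def C_def crossing_pairs_def L_iff)
        qed
      qed
    qed
    moreover have "(i, Suc i) \<notin> C'" by (simp add: C'_def)
    moreover have "finite C'" using calculation finC by simp
    ultimately have "int (card C) = int (card C') + 1" by simp
    then show ?thesis unfolding main sd1 sd2 using l by simp
  qed
qed

lemma ascent_swap:
  assumes "is_clan p q \<gamma>" "1 \<le> i" "i < p + q" "mate \<gamma> (Suc i) < mate \<gamma> i" "mate \<gamma> i \<noteq> Suc i"
  shows "ascent (swap_nodes i \<gamma>) i"
proof -
  note sw = swap_nodes_swap(2)[OF assms(1-3,5)]
  have "(mate \<gamma> (Suc i), mate \<gamma> i) \<noteq> (i, Suc i)" using assms(5) by simp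
  then have "simple_refl i (mate \<gamma> (Suc i)) < simple_refl i (mate \<gamma> i)"
    by (rule simple_refl_less[OF assms(4)])
  moreover have "\<not> (simple_refl i (mate \<gamma> (Suc i)) = i \<and> simple_refl i (mate \<gamma> i) = Suc i)"
    using assms(4) by (metis lessI less_asym simple_refl_simps(1,2,4))
  ultimately show ?thesis by (simp add: ascent_def sw)
qed

lemma join_signs:
  assumes "is_clan p q \<gamma>" "1 \<le> i" "i < p + q"
    and "i \<in> pluses \<gamma> \<and> Suc i \<in> minuses \<gamma> \<or> i \<in> minuses \<gamma> \<and> Suc i \<in> pluses \<gamma>"
  shows "is_clan p q (s_act i \<gamma>)" "mate (s_act i \<gamma>) = (mate \<gamma>)(i := Suc i, Suc i := i)"
    "clan_length (s_act i \<gamma>) = clan_length \<gamma> + 1" "upper (s_act i \<gamma>) = insert i (upper \<gamma> - {Suc i})"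
proof -
  let ?g = "s_act i \<gamma>"
  define m where "m = mate \<gamma>"
  define m' where "m' = m(i := Suc i, Suc i := i)"
  note mm = mate_mate[OF assms(1), folded m_def]
  note s = signs_eq[OF assms(1)] signs_disjoint[OF assms(1)]
  have g: "?g = \<lparr>arcs = insert (i, Suc i) (arcs \<gamma>), pluses = pluses \<gamma> - {i, Suc i}, minuses = minuses \<gamma> - {i, Suc i}\<rparr>"
    using assms(4) by (simp add: s_act_def)
  have sg: "m i = i" "m (Suc i) = Suc i" using assms(4) s(1) unfolding m_def by blast+
  have mi: "m a \<noteq> i" "m a \<noteq> Suc i" if "a \<noteq> i" "a \<noteq> Suc i" for a using that sg mm by metis+
  have inv: "m' (m' k) = k" for k using sg mm mi[of k] by (auto simp: m'_def)
  have dom: "k \<in> {1..p + q}" if "m' k \<noteq> k" for k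
    using that assms(2,3) mate_dom[OF assms(1), of k, folded m_def] by (auto simp: m'_def split: if_splits)
  have arcs: "arcs ?g = {(a, b). m' a = b \<and> a < b}"
    using sg by (auto simp: g arcs_eq[OF assms(1)] m_def[symmetric] m'_def)
  note ci = clan_of_involution[OF inv dom arcs]
  show mt: "mate ?g = (mate \<gamma>)(i := Suc i, Suc i := i)" using ci(1) unfolding m'_def m_def .
  have fin: "finite (pluses \<gamma>)" "finite (minuses \<gamma>)"
  proof -
    have "finite (pluses \<gamma> \<union> minuses \<gamma>)" unfolding s(1) by simp
    then show "finite (pluses \<gamma>)" "finite (minuses \<gamma>)" by auto
  qed
  have "int (card (pluses ?g)) - int (card (minuses ?g)) = int p - int q"
  proof -
    have "card (pluses \<gamma>) = Suc (card (pluses \<gamma> - {i, Suc i}))" "card (minuses \<gamma>) = Suc (card (minuses \<gamma> - {i, Suc i}))"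
    proof -
      from assms(4) s(2) consider "pluses \<gamma> - {i, Suc i} = pluses \<gamma> - {i}" "minuses \<gamma> - {i, Suc i} = minuses \<gamma> - {Suc i}" "i \<in> pluses \<gamma>" "Suc i \<in> minuses \<gamma>"
        | "pluses \<gamma> - {i, Suc i} = pluses \<gamma> - {Suc i}" "minuses \<gamma> - {i, Suc i} = minuses \<gamma> - {i}" "Suc i \<in> pluses \<gamma>" "i \<in> minuses \<gamma>"
        by blast
      then show "card (pluses \<gamma>) = Suc (card (pluses \<gamma> - {i, Suc i}))" "card (minuses \<gamma>) = Suc (card (minuses \<gamma> - {i, Suc i}))"
        by (cases; simp only: card_Suc_Diff1 fin)+
    qed
    moreover have "int (card (pluses \<gamma>)) - int (card (minuses \<gamma>)) = int p - int q" using assms(1) by (simp add: is_clan_def)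
    ultimately show ?thesis by (simp add: g)
  qed
  moreover have "pluses ?g \<inter> minuses ?g = {}" using s(2) by (auto simp: g)
  moreover have "pluses ?g \<union> minuses ?g = {k \<in> {1..p + q}. m' k = k}"
  proof -
    have "pluses ?g \<union> minuses ?g = (pluses \<gamma> \<union> minuses \<gamma>) - {i, Suc i}" by (auto simp: g)
    also have "\<dots> = {k \<in> {1..p + q}. m' k = k}" unfolding s(1) m'_def m_def by auto
    finally show ?thesis .
  qed
  ultimately show cl: "is_clan p q ?g" using ci(4) by blast
  have lf: "lefts ?g = insert i (lefts \<gamma>)"
    unfolding lefts_eq[OF cl] lefts_eq[OF assms(1)] mt using sg by (auto simp: m_def)
  have nl: "i \<notin> lefts \<gamma>" "Suc i \<notin> lefts \<gamma>" unfolding lefts_eq[OF assms(1)] using sg by (auto simp: m_def)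
  have "(\<Sum>a\<in>lefts ?g. int (mate ?g a) - int a) = 1 + (\<Sum>a\<in>lefts \<gamma>. int (mate \<gamma> a) - int a)"
  proof -
    have "(\<Sum>a\<in>lefts \<gamma>. int (mate ?g a) - int a) = (\<Sum>a\<in>lefts \<gamma>. int (mate \<gamma> a) - int a)"
      by (rule sum.cong) (use nl in \<open>auto simp: mt\<close>)
    then show ?thesis unfolding lf using nl finite_lefts[OF assms(1)] by (simp add: mt)
  qed
  \<comment> \<open>Nothing lies between the ends of the new arc, so it crosses no other
    arc.\<close>
  moreover have "crossing_pairs (lefts ?g) (mate ?g) = crossing_pairs (lefts \<gamma>) (mate \<gamma>)"
  proof (intro set_eqI, clarify)
    fix a c
    have "a \<noteq> Suc i" "c \<noteq> Suc i" if "a \<in> lefts \<gamma>" "c \<in> lefts \<gamma>" using that nl by auto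
    moreover have "a \<noteq> i" "c \<noteq> i" if "a \<in> lefts \<gamma>" "c \<in> lefts \<gamma>" using that nl by auto
    moreover have "\<not> (a < i \<and> i < mate \<gamma> a \<and> mate \<gamma> a < Suc i)" by simp
    ultimately show "(a, c) \<in> crossing_pairs (lefts ?g) (mate ?g) \<longleftrightarrow> (a, c) \<in> crossing_pairs (lefts \<gamma>) (mate \<gamma>)"
      using nl sg unfolding lf mt crossing_pairs_def by (auto simp: m_def)
  qed
  ultimately show "clan_length ?g = clan_length \<gamma> + 1"
    unfolding clan_length_eq[OF cl] clan_length_eq[OF assms(1)] by simp
  show "upper ?g = insert i (upper \<gamma> - {Suc i})"
    unfolding upper_def lf using nl by (auto simp: g)
qed

text \<open>Whenever the action fixes a clan there is a visible reason: two equal signs, an arc of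
  neighbours, or the clan already arises by the same reflection from a shorter one. Each reason
  later yields a vanishing divided difference.\<close>

lemma s_act_cases:
  assumes "is_clan p q \<gamma>" "1 \<le> i" "i < p + q"
  obtains (join) "i \<in> pluses \<gamma> \<and> Suc i \<in> minuses \<gamma> \<or> i \<in> minuses \<gamma> \<and> Suc i \<in> pluses \<gamma>"
    | (ascent) "ascent \<gamma> i" "s_act i \<gamma> = swap_nodes i \<gamma>" "clan_length (s_act i \<gamma>) = clan_length \<gamma> + 1"
    | (same) "{i, Suc i} \<subseteq> pluses \<gamma> \<or> {i, Suc i} \<subseteq> minuses \<gamma>" "s_act i \<gamma> = \<gamma>"
    | (arc) "mate \<gamma> i = Suc i" "s_act i \<gamma> = \<gamma>"
    | (descent) "mate \<gamma> i \<noteq> Suc i" "ascent (swap_nodes i \<gamma>) i" "s_act i (swap_nodes i \<gamma>) = \<gamma>"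
        "clan_length \<gamma> = clan_length (swap_nodes i \<gamma>) + 1" "s_act i \<gamma> = \<gamma>"
proof -
  note s = signs_eq[OF assms(1)] signs_disjoint[OF assms(1)]
  define jn where "jn \<beta> \<longleftrightarrow> i \<in> pluses \<beta> \<and> Suc i \<in> minuses \<beta> \<or> i \<in> minuses \<beta> \<and> Suc i \<in> pluses \<beta>" for \<beta> :: clan
  have act: "s_act i \<beta> = (if clan_length (swap_nodes i \<beta>) > clan_length \<beta> then swap_nodes i \<beta> else \<beta>)"
    if "\<not> jn \<beta>" for \<beta>
    unfolding s_act_def by (rule if_not_P[OF that[unfolded jn_def]])
  have njn: "\<not> jn \<beta>" if "is_clan p q \<beta>" "ascent \<beta> i" for \<beta>
    using that(2) signs_eq[OF that(1)] by (fastforce simp: jn_def ascent_def)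
  have asc: "s_act i \<beta> = swap_nodes i \<beta>" if "is_clan p q \<beta>" "ascent \<beta> i" for \<beta>
    using act[OF njn[OF that]] clan_length_ascent[OF that(1) assms(2,3) that(2)] by simp
  consider "jn \<gamma>" | "ascent \<gamma> i" | "\<not> jn \<gamma>" "mate \<gamma> i = i" "mate \<gamma> (Suc i) = Suc i" | "\<not> jn \<gamma>" "mate \<gamma> i = Suc i"
    | "\<not> jn \<gamma>" "mate \<gamma> i \<noteq> Suc i" "mate \<gamma> (Suc i) < mate \<gamma> i"
    unfolding ascent_def using mate_inject[OF assms(1), of i "Suc i"] by (metis nat_neq_iff n_not_Suc_n)
  then show thesis
  proof cases
    case 1
    then show ?thesis using join by (simp add: jn_def)
  next
    case 2
    then show ?thesis using ascent asc[OF assms(1) 2] clan_length_ascent[OF assms 2] by simp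
  next
    case 3
    have "i \<in> pluses \<gamma> \<union> minuses \<gamma>" "Suc i \<in> pluses \<gamma> \<union> minuses \<gamma>" unfolding s(1) using 3 assms by auto
    then have sm: "{i, Suc i} \<subseteq> pluses \<gamma> \<or> {i, Suc i} \<subseteq> minuses \<gamma>" using 3(1) by (auto simp: jn_def)
    then have "swap_nodes i \<gamma> = \<gamma>" by (intro swap_nodes_trivial[OF assms]) blast
    then show ?thesis using same[OF sm] act[OF 3(1)] by simp
  next
    case 4
    then have "swap_nodes i \<gamma> = \<gamma>" by (intro swap_nodes_trivial[OF assms]) blast
    then show ?thesis using arc[OF 4(2)] act[OF 4(1)] by simp
  next
    case 5
    note sw = swap_nodes_swap[OF assms 5(2)]
    have a: "ascent (swap_nodes i \<gamma>) i" by (rule ascent_swap[OF assms 5(3,2)])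
    have l: "clan_length \<gamma> = clan_length (swap_nodes i \<gamma>) + 1"
      using clan_length_ascent[OF sw(1) assms(2,3) a] unfolding sw(6) .
    show ?thesis
      using descent[OF 5(2) a] asc[OF sw(1) a] l act[OF 5(1)] unfolding sw(6) by simp
  qed
qed

lemma is_clan_s_act:
  assumes "is_clan p q \<gamma>" "1 \<le> i" "i < p + q"
  shows "is_clan p q (s_act i \<gamma>)"
  using assms
proof (cases rule: s_act_cases)
  case join
  then show ?thesis by (rule join_signs(1)[OF assms])
next
  case ascent
  then show ?thesis using swap_nodes_swap(1)[OF assms ascent_not_arc[OF assms(1)]] by simp
qed (use assms in auto)

lemma clan_length_s_act_le:
  assumes "is_clan p q \<gamma>" "1 \<le> i" "i < p + q"
  shows "clan_length (s_act i \<gamma>) \<le> clan_length \<gamma> + 1"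
  using assms by (cases rule: s_act_cases) (use join_signs(3)[OF assms] in auto)

section \<open>The Wyser--Yong polynomials\<close>

text \<open>Standardization of the sequence \<open>f 1, ..., f n\<close>. Only comparisons of keys
  matter, so the effect of a change of clan is traced on keys instead of positions.\<close>

definition rankp :: "nat \<Rightarrow> (nat \<Rightarrow> nat) \<Rightarrow> nat \<Rightarrow> nat" where
  "rankp n f k = (if k \<in> {1..n} then card {j \<in> {1..n}. f j \<le> f k} else k)"

lemma rankp_less:
  assumes "a \<in> {1..n}" "b \<in> {1..n}"
  shows "rankp n f a < rankp n f b \<longleftrightarrow> f a < f b"
proof -
  have *: "rankp n f a < rankp n f b" if "f a < f b" "a \<in> {1..n}" "b \<in> {1..n}" for a b
  proof -
    have "b \<in> {j \<in> {1..n}. f j \<le> f b}" "b \<notin> {j \<in> {1..n}. f j \<le> f a}" using that by auto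
    then have "{j \<in> {1..n}. f j \<le> f a} \<noteq> {j \<in> {1..n}. f j \<le> f b}" by blast
    then have "{j \<in> {1..n}. f j \<le> f a} \<subset> {j \<in> {1..n}. f j \<le> f b}" using that by auto
    then have "card {j \<in> {1..n}. f j \<le> f a} < card {j \<in> {1..n}. f j \<le> f b}"
      by (intro psubset_card_mono) auto
    then show ?thesis using that by (simp add: rankp_def)
  qed
  have "rankp n f a = rankp n f b" if "f a = f b" using that assms by (simp add: rankp_def)
  then show ?thesis using *[of a b] *[of b a] assms by (cases "f a" "f b" rule: linorder_cases) auto
qed

lemma rankp_permutes:
  assumes "inj_on f {1..n}"
  shows "rankp n f permutes {1..n}"
proof (rule bij_imp_permutes)
  have "inj_on (rankp n f) {1..n}"
  proof (rule inj_onI)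
    fix a b assume ab: "a \<in> {1..n}" "b \<in> {1..n}" "rankp n f a = rankp n f b"
    then have "f a = f b" using rankp_less[OF ab(1,2), of f] rankp_less[OF ab(2,1), of f] by simp
    then show "a = b" by (rule inj_onD[OF assms _ ab(1,2)])
  qed
  moreover have "rankp n f ` {1..n} \<subseteq> {1..n}"
  proof
    fix j assume "j \<in> rankp n f ` {1..n}"
    then obtain k where k: "k \<in> {1..n}" "j = card {i \<in> {1..n}. f i \<le> f k}" by (auto simp: rankp_def)
    have "card {k} \<le> card {i \<in> {1..n}. f i \<le> f k}" using k by (intro card_mono) auto
    moreover have "card {i \<in> {1..n}. f i \<le> f k} \<le> card {1..n}" by (intro card_mono) auto
    ultimately show "j \<in> {1..n}" using k by simp
  qed
  ultimately show "bij_betw (rankp n f) {1..n} {1..n}" by (simp add: bij_betw_def endo_inj_surj)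
qed (auto simp: rankp_def)

lemma rankp_Suc:
  assumes "inj_on f {1..n}" "a \<in> {1..n}" "b \<in> {1..n}" "f a < f b"
    and "\<And>c. c \<in> {1..n} \<Longrightarrow> f a < f c \<Longrightarrow> f b \<le> f c"
  shows "rankp n f b = Suc (rankp n f a)"
proof -
  have "{j \<in> {1..n}. f j \<le> f b} = insert b {j \<in> {1..n}. f j \<le> f a}"
  proof (intro set_eqI iffI)
    fix j assume j: "j \<in> {j \<in> {1..n}. f j \<le> f b}"
    show "j \<in> insert b {j \<in> {1..n}. f j \<le> f a}"
    proof (cases "f j \<le> f a")
      case False
      then have "f j = f b" using assms(5)[of j] j by auto
      then have "j = b" by (rule inj_onD[OF assms(1)]) (use j assms(3) in auto)
      then show ?thesis by simp
    qed (use j in simp)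
  next
    fix j assume "j \<in> insert b {j \<in> {1..n}. f j \<le> f a}"
    then show "j \<in> {j \<in> {1..n}. f j \<le> f b}" using assms by auto
  qed
  then show ?thesis using assms by (simp add: rankp_def)
qed

lemma rankp_order:
  assumes \<pi>: "\<pi> permutes {1..n}"
    and le: "\<And>a b. a \<in> {1..n} \<Longrightarrow> b \<in> {1..n} \<Longrightarrow> g a \<le> g b \<longleftrightarrow> f (\<pi> a) \<le> f (\<pi> b)"
  shows "rankp n g = rankp n f \<circ> \<pi>"
proof
  fix k
  show "rankp n g k = (rankp n f \<circ> \<pi>) k"
  proof (cases "k \<in> {1..n}")
    case True
    then have pk: "\<pi> k \<in> {1..n}" using permutes_in_image[OF \<pi>] by blast
    have "bij_betw \<pi> {j \<in> {1..n}. g j \<le> g k} {j \<in> {1..n}. f j \<le> f (\<pi> k)}"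
      unfolding bij_betw_def
    proof
      show "inj_on \<pi> {j \<in> {1..n}. g j \<le> g k}" using permutes_inj[OF \<pi>] by (rule inj_on_subset) simp
      show "\<pi> ` {j \<in> {1..n}. g j \<le> g k} = {j \<in> {1..n}. f j \<le> f (\<pi> k)}"
      proof (intro set_eqI iffI)
        fix j assume "j \<in> \<pi> ` {j \<in> {1..n}. g j \<le> g k}"
        then obtain a where a: "a \<in> {1..n}" "g a \<le> g k" "j = \<pi> a" by blast
        then show "j \<in> {j \<in> {1..n}. f j \<le> f (\<pi> k)}"
          using le[OF a(1) True] permutes_in_image[OF \<pi>, of a] by simp
      next
        fix j assume j: "j \<in> {j \<in> {1..n}. f j \<le> f (\<pi> k)}"
        define a where "a = inv \<pi> j"
        have pa: "\<pi> a = j" unfolding a_def by (rule permutes_inverses(1)[OF \<pi>])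
        have a: "a \<in> {1..n}" using permutes_in_image[OF \<pi>, of a] j unfolding pa by simp
        then have "g a \<le> g k" using le[OF a True] j pa by simp
        then show "j \<in> \<pi> ` {j \<in> {1..n}. g j \<le> g k}" using a pa by blast
      qed
    qed
    then have "card {j \<in> {1..n}. g j \<le> g k} = card {j \<in> {1..n}. f j \<le> f (\<pi> k)}"
      by (rule bij_betw_same_card)
    then show ?thesis using True pk by (simp add: rankp_def del: atLeastAtMost_iff)
  next
    case False
    then have "\<pi> k = k" using permutes_not_in[OF \<pi>] by blast
    then show ?thesis using False by (simp add: rankp_def del: atLeastAtMost_iff)
  qed
qed

text \<open>Listing the nodes cycle by cycle, the cycles sorted by their smaller nodes and the right end of
  an arc before its left end, is a one-line notation of a w with \<open>w * \<delta> = \<gamma>\<close>, \<open>\<delta>\<close> matchless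
  and lengths adding up; \<open>pos\<close> is the inverse of this w.\<close>
definition key :: "clan \<Rightarrow> nat \<Rightarrow> nat" where
  "key \<gamma> k = (if k < mate \<gamma> k then 2 * k + 1 else 2 * mate \<gamma> k)"

definition pos :: "nat \<Rightarrow> clan \<Rightarrow> nat \<Rightarrow> nat" where
  "pos n \<gamma> = rankp n (key \<gamma>)"

text \<open>The image of \<open>upper\<close> is the set of plus signs at the start of the canonical
  chain: an arc is replaced by a minus at the position of its right end and a plus at the next
  position, that of its left end.\<close>

definition Phi :: "nat \<Rightarrow> clan \<Rightarrow> xypoly" where
  "Phi n \<gamma> = dd_inv n (pos n \<gamma>) (matchless_poly n (pos n \<gamma> ` upper \<gamma>))"

lemma key_inject:
  assumes "is_clan p q \<gamma>"
  shows "key \<gamma> a = key \<gamma> b \<longleftrightarrow> a = b"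
proof
  assume k: "key \<gamma> a = key \<gamma> b"
  have "a < mate \<gamma> a \<longleftrightarrow> odd (key \<gamma> a)" "b < mate \<gamma> b \<longleftrightarrow> odd (key \<gamma> b)" by (auto simp: key_def)
  then have "a < mate \<gamma> a \<longleftrightarrow> b < mate \<gamma> b" using k by simp
  then show "a = b" using k mate_inject[OF assms, of a b] by (auto simp: key_def split: if_splits)
qed simp

lemma inj_key: "is_clan p q \<gamma> \<Longrightarrow> inj_on (key \<gamma>) A"
  by (simp add: inj_on_def key_inject)

lemma pos_permutes: "is_clan p q \<gamma> \<Longrightarrow> pos n \<gamma> permutes {1..n}"
  unfolding pos_def by (rule rankp_permutes) (rule inj_key)

lemma pos_less: "a \<in> {1..n} \<Longrightarrow> b \<in> {1..n} \<Longrightarrow> pos n \<gamma> a < pos n \<gamma> b \<longleftrightarrow> key \<gamma> a < key \<gamma> b"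
  unfolding pos_def by (rule rankp_less)

lemma pos_Suc:
  assumes "is_clan p q \<gamma>" "a \<in> {1..n}" "b \<in> {1..n}" "key \<gamma> a < key \<gamma> b"
    and "\<And>c. key \<gamma> a < key \<gamma> c \<Longrightarrow> key \<gamma> b \<le> key \<gamma> c"
  shows "pos n \<gamma> b = Suc (pos n \<gamma> a)"
  unfolding pos_def using assms by (intro rankp_Suc inj_key) auto

lemma pos_in: "is_clan p q \<gamma> \<Longrightarrow> pos n \<gamma> a \<in> {1..n} \<longleftrightarrow> a \<in> {1..n}"
  by (rule permutes_in_image) (rule pos_permutes)

lemma pos_inject: "is_clan p q \<gamma> \<Longrightarrow> pos n \<gamma> a = pos n \<gamma> b \<longleftrightarrow> a = b"
  using inj_eq[OF permutes_inj[OF pos_permutes]] by metis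

lemma pos_image_iff: "is_clan p q \<gamma> \<Longrightarrow> pos n \<gamma> a \<in> pos n \<gamma> ` A \<longleftrightarrow> a \<in> A"
  using inj_image_mem_iff[OF permutes_inj[OF pos_permutes]] by metis

lemma pos_upper_subset: "is_clan p q \<gamma> \<Longrightarrow> pos (p + q) \<gamma> ` upper \<gamma> \<subseteq> {1..p + q}"
  using upper_subset pos_in by blast

section \<open>Moves that relate chains to the canonical one\<close>

lemma perm_transpose_comp:
  assumes "inj x" "x a = k" "x b = Suc k"
  shows "x \<circ> transpose a b = simple_refl k \<circ> x"
proof
  fix j
  have "x j = k \<longleftrightarrow> j = a" "x j = Suc k \<longleftrightarrow> j = b" using assms by (auto simp: inj_eq[OF assms(1), symmetric])
  then show "(x \<circ> transpose a b) j = (simple_refl k \<circ> x) j"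
    using assms by (cases "j = a"; cases "j = b") (auto simp: transpose_def)
qed

text \<open>Both sides first apply the operators \<open>k\<close> and \<open>Suc k\<close>, in
  opposite orders, and then the chain for \<open>z\<close>. On alternating signs these two operators
  commute.\<close>

lemma dd_inv_alternating:
  assumes z: "z permutes {1..n}" and k: "1 \<le> k" "Suc k < n" and P: "P \<subseteq> {1..n}"
    and alt: "(k \<in> P) \<noteq> (Suc k \<in> P)" "(Suc k \<in> P) \<noteq> (Suc (Suc k) \<in> P)"
    and nodes: "a \<in> {1..n}" "b \<in> {1..n}" "c \<in> {1..n}" "a < b" "b < c"
    and za: "z a = k" "z b = Suc k" "z c = Suc (Suc k)"
  shows "dd_inv n (simple_refl (Suc k) \<circ> (simple_refl k \<circ> z)) (matchless_poly n P)
    = dd_inv n (simple_refl k \<circ> (simple_refl (Suc k) \<circ> z)) (matchless_poly n P)"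
proof -
  have k': "1 \<le> Suc k" "k < n" using k by auto
  have p1: "simple_refl k \<circ> z permutes {1..n}" by (rule simple_refl_comp_permutes[OF z k(1) k'(2)])
  have p2: "simple_refl (Suc k) \<circ> z permutes {1..n}" by (rule simple_refl_comp_permutes[OF z k'(1) k(2)])
  have ac: "a < c" using nodes by simp
  have "dd_inv n (simple_refl (Suc k) \<circ> (simple_refl k \<circ> z)) (matchless_poly n P)
      = dd_inv n z (divided_diff k (divided_diff (Suc k) (matchless_poly n P)))"
    using dd_inv_left_ascent[OF p1 k'(1) k(2) nodes(1,3) ac] dd_inv_left_ascent[OF z k(1) k'(2) nodes(1,2,4) za(1,2)]
    by (simp add: za)
  also have "\<dots> = dd_inv n z (divided_diff (Suc k) (divided_diff k (matchless_poly n P)))"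
    unfolding divided_diff_alternating[OF P k alt] ..
  also have "\<dots> = dd_inv n (simple_refl k \<circ> (simple_refl (Suc k) \<circ> z)) (matchless_poly n P)"
    using dd_inv_left_ascent[OF p2 k(1) k'(2) nodes(1,3) ac] dd_inv_left_ascent[OF z k'(1) k(2) nodes(2,3,5) za(2,3)]
    by (simp add: za)
  finally show ?thesis .
qed

text \<open>The value \<open>Suc k\<close> stands before \<open>k\<close>, so
  \<open>divided_diff k\<close> can be taken as the first operator applied, and it does not
  distinguish \<open>+-\<close> from \<open>-+\<close>.\<close>

lemma dd_inv_flip:
  assumes x: "x permutes {1..n}" and k: "1 \<le> k" "k < n" and P: "P \<subseteq> {1..n}"
    and nodes: "a \<in> {1..n}" "b \<in> {1..n}" "b < a" and xa: "x a = k" "x b = Suc k"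
  shows "dd_inv n x (matchless_poly n (simple_refl k ` P)) = dd_inv n x (matchless_poly n P)"
proof -
  define y where "y = simple_refl k \<circ> x"
  have y: "y permutes {1..n}" unfolding y_def by (rule simple_refl_comp_permutes[OF x k])
  have "y b = k" "y a = Suc k" using xa by (simp_all add: y_def)
  from dd_inv_left_ascent[OF y k nodes(2,1,3) this]
  have "dd_inv n (simple_refl k \<circ> y) f = dd_inv n y (divided_diff k f)" for f .
  moreover have "simple_refl k \<circ> y = x" by (simp add: y_def fun_eq_iff)
  ultimately show ?thesis using divided_diff_matchless_swap[OF P k] by simp
qed

text \<open>A right end at \<open>i\<close> is not the smaller node of its cycle, so the exchange
  keeps the order of the cycles and only renames entries of the canonical list.\<close>

lemma Phi_ascent_right:
  assumes \<gamma>: "is_clan p q \<gamma>" and i: "1 \<le> i" "i < p + q" and asc: "ascent \<gamma> i" and r: "mate \<gamma> i < i"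
  shows "Phi (p + q) (swap_nodes i \<gamma>) = divided_diff i (Phi (p + q) \<gamma>)"
proof -
  let ?n = "p + q" and ?s = "simple_refl i" and ?g = "swap_nodes i \<gamma>"
  note mm = mate_mate[OF \<gamma>]
  note na = ascent_not_arc[OF \<gamma> asc]
  note sw = swap_nodes_swap[OF \<gamma> i na]
  define mn where "mn c = (if c < mate \<gamma> c then c else mate \<gamma> c)" for c
  have mn: "mn c \<noteq> i" for c using r mm[of c] by (auto simp: mn_def)
  have k1: "key \<gamma> c = 2 * mn c + (if c < mate \<gamma> c then 1 else 0)" for c by (simp add: key_def mn_def)
  have sl: "?s c < ?s (mate \<gamma> c) \<longleftrightarrow> c < mate \<gamma> c" for c
  proof -
    have "(c, mate \<gamma> c) \<noteq> (i, Suc i)" "(mate \<gamma> c, c) \<noteq> (i, Suc i)" using na mm[of c] by auto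
    then show ?thesis using simple_refl_less[of c "mate \<gamma> c" i] simple_refl_less[of "mate \<gamma> c" c i]
      by (cases c "mate \<gamma> c" rule: linorder_cases) auto
  qed
  have k2: "key ?g (?s c) = 2 * ?s (mn c) + (if c < mate \<gamma> c then 1 else 0)" for c
    by (simp add: key_def mn_def sw(2) sl)
  have lt: "?s (mn c) < ?s (mn d) \<longleftrightarrow> mn c < mn d" for c d
    using mn[of c] mn[of d] simple_refl_less[of "mn c" "mn d" i] simple_refl_less[of "mn d" "mn c" i]
    by (cases "mn c" "mn d" rule: linorder_cases) auto
  have "key ?g (?s c) \<le> key ?g (?s d) \<longleftrightarrow> key \<gamma> c \<le> key \<gamma> d" for c d
    unfolding k1 k2 using lt[of c d] lt[of d c] by auto
  from this[of "?s a" "?s b" for a b] have "pos ?n ?g = pos ?n \<gamma> \<circ> ?s"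
    unfolding pos_def by (intro rankp_order simple_refl_permutes[OF i]) simp
  moreover have "pos ?n \<gamma> i < pos ?n \<gamma> (Suc i)"
  proof -
    have "mate \<gamma> i < mate \<gamma> (Suc i)" using asc by (simp add: ascent_def)
    then have "key \<gamma> i < key \<gamma> (Suc i)" using r by (auto simp: key_def)
    then show ?thesis using i by (subst pos_less) auto
  qed
  moreover have "(pos ?n \<gamma> \<circ> ?s) ` upper ?g = pos ?n \<gamma> ` upper \<gamma>"
    unfolding sw(5) image_comp[symmetric] by simp
  ultimately show ?thesis
    unfolding Phi_def using dd_inv_ascent[OF pos_permutes[OF \<gamma>] i] by simp
qed

text \<open>After the exchange the list reads sign, right end, left end, whereas the canonical order
  is right end, left end, sign. The two differ by an alternating move and a flip of neighbouring
  signs; which of them comes first depends on the sign.\<close>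

lemma Phi_ascent_sign_left:
  assumes \<gamma>: "is_clan p q \<gamma>" and i: "1 \<le> i" "i < p + q" and asc: "ascent \<gamma> i"
    and sg: "mate \<gamma> i = i" and l: "Suc i < mate \<gamma> (Suc i)"
  shows "Phi (p + q) (swap_nodes i \<gamma>) = divided_diff i (Phi (p + q) \<gamma>)"
proof -
  define n where "n = p + q"
  define s where "s = simple_refl i"
  define g where "g = swap_nodes i \<gamma>"
  define c where "c = mate \<gamma> (Suc i)"
  define x where "x = pos n \<gamma>"
  define k where "k = x i"
  note mm = mate_mate[OF \<gamma>]
  note sw = swap_nodes_swap[OF \<gamma> i ascent_not_arc[OF \<gamma> asc], folded g_def s_def]
  have c: "Suc i < c" "mate \<gamma> c = Suc i" using l mm[of "Suc i"] by (auto simp: c_def)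
  have cn: "c \<in> {1..n}" "i \<in> {1..n}" "Suc i \<in> {1..n}"
    using mate_in_iff[OF \<gamma>, of "Suc i"] i by (auto simp: c_def n_def)
  have xp: "x permutes {1..n}" and g: "is_clan p q g" unfolding x_def g_def
    using pos_permutes[OF \<gamma>] sw(1) g_def by auto
  have keys: "key \<gamma> i = 2 * i" "key \<gamma> c = 2 * i + 2" "key \<gamma> (Suc i) = 2 * i + 3"
    using sg l c by (auto simp: key_def c_def)
  have other: "key \<gamma> a < 2 * i \<or> key \<gamma> a > 2 * i + 3" if "a \<noteq> i" "a \<noteq> c" "a \<noteq> Suc i" for a
  proof -
    have "key \<gamma> a \<noteq> 2 * i" "key \<gamma> a \<noteq> 2 * i + 2" "key \<gamma> a \<noteq> 2 * i + 3"
      using key_inject[OF \<gamma>, of a] keys that by metis+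
    moreover have "key \<gamma> a \<noteq> 2 * i + 1" using that by (auto simp: key_def, presburger)
    ultimately show ?thesis by linarith
  qed
  have xc: "x c = Suc k" unfolding x_def k_def
  proof (rule pos_Suc[OF \<gamma> cn(2,1)])
    fix e assume e: "key \<gamma> i < key \<gamma> e"
    then show "key \<gamma> c \<le> key \<gamma> e" using other[of e] keys by (cases "e = i"; cases "e = c"; cases "e = Suc i") auto
  qed (simp add: keys)
  have xi: "x (Suc i) = Suc (Suc k)" unfolding xc[symmetric] unfolding x_def
  proof (rule pos_Suc[OF \<gamma> cn(1,3)])
    fix e assume e: "key \<gamma> c < key \<gamma> e"
    then show "key \<gamma> (Suc i) \<le> key \<gamma> e" using other[of e] keys by (cases "e = i"; cases "e = c"; cases "e = Suc i") auto
  qed (simp add: keys)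
  note xinj = permutes_inj[OF xp]
  have k: "1 \<le> k" "Suc k < n" "k < n" "1 \<le> Suc k"
    using pos_in[OF \<gamma>, of n i] pos_in[OF \<gamma>, of n "Suc i"] cn xi by (auto simp: k_def x_def)
  have mate': "mate g a = s (mate \<gamma> (s a))" for a by (simp add: sw(2))
  have keys': "key g i = 2 * i + 1" "key g c = 2 * i" "key g (Suc i) = 2 * i + 2"
    using sg c by (auto simp: key_def mate' s_def c_def)
  have other': "key g a = key \<gamma> a" if "a \<noteq> i" "a \<noteq> c" "a \<noteq> Suc i" for a
  proof -
    have "mate \<gamma> a \<noteq> i" "mate \<gamma> a \<noteq> Suc i" using that sg mm[of a] by (auto simp: c_def)
    then show ?thesis using that by (simp add: key_def mate' s_def)
  qed
  define t where "t = transpose i c"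
  have t: "t i = c" "t c = i" "t a = a" if "a \<noteq> i" "a \<noteq> c" for a using that by (auto simp: t_def)
  have ti: "t (Suc i) = Suc i" using c by (simp add: t_def)
  have pos': "pos n g = x \<circ> t" unfolding x_def pos_def
  proof (rule rankp_order)
    show "t permutes {1..n}" unfolding t_def by (rule permutes_swap_id) (use cn in auto)
    fix a b
    show "key g a \<le> key g b \<longleftrightarrow> key \<gamma> (t a) \<le> key \<gamma> (t b)"
    proof -
      have A: "a = i \<or> a = c \<or> a = Suc i \<or> (key g a = key \<gamma> a \<and> t a = a \<and> (key \<gamma> a < 2 * i \<or> key \<gamma> a > 2 * i + 3))" for a
        using other[of a] other'[of a] t(3)[of a] by blast
      from A[of a] A[of b] show ?thesis using keys keys' ti t(1,2) c by (elim disjE) (auto simp: t_def)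
    qed
  qed
  have pos'2: "pos n g = simple_refl k \<circ> x" unfolding pos' t_def
    by (rule perm_transpose_comp[OF xinj]) (simp_all add: k_def xc[unfolded k_def])
  have pos'p: "pos n g permutes {1..n}" by (rule pos_permutes[OF g])
  define P where "P = x ` upper \<gamma>"
  have P: "P \<subseteq> {1..n}" unfolding P_def x_def n_def by (rule pos_upper_subset[OF \<gamma>])
  have sgp: "mate \<gamma> a = a" if "a \<in> pluses \<gamma>" for a using that signs_eq[OF \<gamma>] by blast
  have up: "Suc i \<in> upper \<gamma>" "c \<notin> upper \<gamma>" "i \<in> upper \<gamma> \<longleftrightarrow> i \<in> pluses \<gamma>"
    using in_upper_iff[OF \<gamma>] l c sg sgp[of c] by (auto simp: c_def)
  have memP: "x a \<in> P \<longleftrightarrow> a \<in> upper \<gamma>" for a unfolding P_def x_def by (rule pos_image_iff[OF \<gamma>])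
  have kP: "k \<in> P \<longleftrightarrow> i \<in> pluses \<gamma>" "Suc k \<notin> P" "Suc (Suc k) \<in> P"
    using memP[of i] memP[of c] memP[of "Suc i"] up unfolding xc xi k_def[symmetric] by auto
  define xs where "xs = x \<circ> s"
  \<comment> \<open>The common lower permutation, in which the nodes \<open>i < Suc i < c\<close>
    take increasing values. Both lists arise from it by the two words of length 2.\<close>
  define z where "z = simple_refl (Suc k) \<circ> x"
  have zp: "z permutes {1..n}" unfolding z_def by (rule simple_refl_comp_permutes[OF xp k(4,2)])
  have zv: "z i = k" "z (Suc i) = Suc k" "z c = Suc (Suc k)"
    using xc xi by (simp_all add: z_def k_def[symmetric])
  have xs: "xs = simple_refl (Suc k) \<circ> (simple_refl k \<circ> z)"
  proof
    fix a
    have ne: "x a \<noteq> k" "x a \<noteq> Suc k" "x a \<noteq> Suc (Suc k)" if "a \<noteq> i" "a \<noteq> c" "a \<noteq> Suc i"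
      using that inj_eq[OF xinj, of a i] inj_eq[OF xinj, of a c] inj_eq[OF xinj, of a "Suc i"]
      unfolding xc xi k_def[symmetric] by blast+
    show "xs a = (simple_refl (Suc k) \<circ> (simple_refl k \<circ> z)) a"
    proof -
      consider "a = i" | "a = Suc i" | "a = c" | "a \<noteq> i \<and> a \<noteq> Suc i \<and> a \<noteq> c" by blast
      then show ?thesis
      proof cases
        case 4
        then show ?thesis using ne by (simp add: xs_def s_def z_def)
      qed (use zv xi xc c in \<open>simp_all add: xs_def s_def k_def[symmetric]\<close>)
    qed
  qed
  have posz: "simple_refl k \<circ> (simple_refl (Suc k) \<circ> z) = pos n g"
    unfolding pos'2 z_def by (simp add: fun_eq_iff)
  have "x i < x (Suc i)" unfolding xi k_def by simp
  from dd_inv_ascent[OF xp _ _ this, of "matchless_poly n P"]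
  have D: "divided_diff i (Phi n \<gamma>) = dd_inv n xs (matchless_poly n P)"
    using i unfolding n_def[symmetric] by (simp add: Phi_def x_def[symmetric] P_def xs_def s_def)
  have alt: "dd_inv n xs (matchless_poly n Q) = dd_inv n (pos n g) (matchless_poly n Q)"
    if "Q \<subseteq> {1..n}" "(k \<in> Q) \<noteq> (Suc k \<in> Q)" "(Suc k \<in> Q) \<noteq> (Suc (Suc k) \<in> Q)" for Q
    unfolding xs posz[symmetric]
    using c(1) by (intro dd_inv_alternating[OF zp k(1,2) that cn(2,3,1) _ _ zv]) auto
  have mem: "a \<in> transpose u v ` A \<longleftrightarrow> transpose u v a \<in> A" for a u v :: nat and A
    by (metis image_iff transpose_involutory)
  have "dd_inv n xs (matchless_poly n P) = dd_inv n (pos n g) (matchless_poly n (pos n g ` upper g))"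
  proof (cases "i \<in> pluses \<gamma>")
    \<comment> \<open>The start reads \<open>+-+\<close>, so the alternating move applies at once; a
      flip then leads to \<open>-++\<close>.\<close>
    case True
    have "t ` s ` upper \<gamma> = t ` upper \<gamma>"
    proof -
      have "s ` upper \<gamma> = upper \<gamma>"
      proof (rule set_eqI)
        fix a
        show "a \<in> s ` upper \<gamma> \<longleftrightarrow> a \<in> upper \<gamma>"
          unfolding s_def simple_refl_image_iff using up True by (cases "a = i"; cases "a = Suc i") auto
      qed
      then show ?thesis by simp
    qed
    then have "pos n g ` upper g = x ` t ` upper \<gamma>"
      unfolding pos' sw(5) by (simp only: image_comp[symmetric])
    also have "\<dots> = simple_refl k ` P"
      unfolding P_def image_comp pos'[symmetric] pos'2 ..
    finally have P': "pos n g ` upper g = simple_refl k ` P" .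
    have "dd_inv n xs (matchless_poly n P) = dd_inv n (pos n g) (matchless_poly n P)"
      using kP True by (intro alt[OF P]) auto
    also have "\<dots> = dd_inv n (pos n g) (matchless_poly n (simple_refl k ` P))"
      by (rule dd_inv_flip[symmetric, OF pos'p k(1,3) P cn(1,2)])
         (use c in \<open>simp_all add: pos'2 xc k_def[symmetric]\<close>)
    finally show ?thesis unfolding P' .
  next
    \<comment> \<open>The start reads \<open>--+\<close>; flipping its last two signs makes it
      alternate.\<close>
    case False
    have "t ` s ` upper \<gamma> = transpose c (Suc i) ` upper \<gamma>"
    proof (rule set_eqI)
      fix a
      show "a \<in> t ` s ` upper \<gamma> \<longleftrightarrow> a \<in> transpose c (Suc i) ` upper \<gamma>"
        unfolding t_def s_def simple_refl_def mem
        using up False c by (cases "a = i"; cases "a = Suc i"; cases "a = c") (auto simp: transpose_def)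
    qed
    then have "pos n g ` upper g = x ` transpose c (Suc i) ` upper \<gamma>"
      unfolding pos' sw(5) by (simp only: image_comp[symmetric])
    also have "\<dots> = simple_refl (Suc k) ` P"
      unfolding P_def image_comp by (subst perm_transpose_comp[OF xinj xc xi]) simp
    finally have P': "pos n g ` upper g = simple_refl (Suc k) ` P" .
    have xsp: "xs permutes {1..n}" unfolding xs_def s_def using comp_simple_refl_permutes[OF xp] i by (simp add: n_def)
    have PS: "simple_refl (Suc k) ` P \<subseteq> {1..n}" by (rule simple_refl_image_subset[OF P k(4,2)])
    have "dd_inv n xs (matchless_poly n P) = dd_inv n xs (matchless_poly n (simple_refl (Suc k) ` P))"
      by (rule dd_inv_flip[symmetric, OF xsp k(4,2) P cn(1,2)])
         (use c xc xi in \<open>simp_all add: xs_def s_def\<close>)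
    also have "\<dots> = dd_inv n (pos n g) (matchless_poly n (simple_refl (Suc k) ` P))"
      using kP False by (intro alt[OF PS]) (auto simp: simple_refl_image_iff)
    finally show ?thesis unfolding P' .
  qed
  then show ?thesis unfolding n_def[symmetric] g_def[symmetric] D unfolding Phi_def by (rule HOL.sym)
qed

text \<open>With \<open>b\<close> and \<open>c\<close> the mates of \<open>i\<close> and
  \<open>Suc i\<close>, the exchange makes the list read \<open>b\<close>, \<open>Suc i\<close>,
  \<open>c\<close>, \<open>i\<close>, while the canonical order is \<open>c\<close>,
  \<open>i\<close>, \<open>b\<close>, \<open>Suc i\<close>. The signs at these positions are
  \<open>-+-+\<close>, so an alternating move on the last three positions and another on the first
  three lead from one to the other.\<close>

lemma Phi_ascent_left_left:
  assumes \<gamma>: "is_clan p q \<gamma>" and i: "1 \<le> i" "i < p + q" and asc: "ascent \<gamma> i"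
    and l: "Suc i < mate \<gamma> i" "mate \<gamma> i < mate \<gamma> (Suc i)"
  shows "Phi (p + q) (swap_nodes i \<gamma>) = divided_diff i (Phi (p + q) \<gamma>)"
proof -
  define n where "n = p + q"
  define s where "s = simple_refl i"
  define g where "g = swap_nodes i \<gamma>"
  define b where "b = mate \<gamma> i"
  define c where "c = mate \<gamma> (Suc i)"
  define x where "x = pos n \<gamma>"
  define k where "k = x b"
  note mm = mate_mate[OF \<gamma>]
  note sw = swap_nodes_swap[OF \<gamma> i ascent_not_arc[OF \<gamma> asc], folded g_def s_def]
  have bc: "Suc i < b" "b < c" "mate \<gamma> b = i" "mate \<gamma> c = Suc i" using l mm by (auto simp: b_def c_def)
  have cn: "b \<in> {1..n}" "i \<in> {1..n}" "c \<in> {1..n}" "Suc i \<in> {1..n}"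
    using mate_in_iff[OF \<gamma>, of "Suc i"] mate_in_iff[OF \<gamma>, of i] i by (auto simp: b_def c_def n_def)
  have xp: "x permutes {1..n}" and g: "is_clan p q g" unfolding x_def
    using pos_permutes[OF \<gamma>] sw(1) by auto
  have keys: "key \<gamma> b = 2 * i" "key \<gamma> i = 2 * i + 1" "key \<gamma> c = 2 * i + 2" "key \<gamma> (Suc i) = 2 * i + 3"
    using l bc by (auto simp: key_def b_def[symmetric] c_def[symmetric])
  have other: "key \<gamma> a < 2 * i \<or> key \<gamma> a > 2 * i + 3" if "a \<noteq> i" "a \<noteq> c" "a \<noteq> Suc i" "a \<noteq> b" for a
  proof -
    have "key \<gamma> a \<noteq> 2 * i" "key \<gamma> a \<noteq> 2 * i + 1" "key \<gamma> a \<noteq> 2 * i + 2" "key \<gamma> a \<noteq> 2 * i + 3"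
      using key_inject[OF \<gamma>, of a] keys that by metis+
    then show ?thesis by linarith
  qed
  have nxt: "x v = Suc (x u)" if "u \<in> {1..n}" "v \<in> {1..n}" "key \<gamma> v = Suc (key \<gamma> u)" for u v
    unfolding x_def by (rule pos_Suc[OF \<gamma> that(1,2)]) (use that(3) in auto)
  have xv: "x b = k" "x i = Suc k" "x c = Suc (Suc k)" "x (Suc i) = Suc (Suc (Suc k))"
    using nxt[OF cn(1,2)] nxt[OF cn(2,3)] nxt[OF cn(3,4)] keys by (simp_all add: k_def)
  note xinj = permutes_inj[OF xp]
  have k: "1 \<le> k" "Suc (Suc k) < n"
    using pos_in[OF \<gamma>, of n b] pos_in[OF \<gamma>, of n "Suc i"] cn xv by (auto simp: x_def)
  have kk: "k < n" "Suc k < n" "1 \<le> Suc k" "1 \<le> Suc (Suc k)" using k by auto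
  have mate': "mate g a = s (mate \<gamma> (s a))" for a by (simp add: sw(2))
  define t where "t = transpose b c"
  have pos': "pos n g = x \<circ> t" unfolding x_def pos_def
  proof (rule rankp_order)
    show "t permutes {1..n}" unfolding t_def by (rule permutes_swap_id) (use cn in auto)
    have "key g a = key \<gamma> (t a)" for a
    proof -
      have m: "mate \<gamma> a \<noteq> i" "mate \<gamma> a \<noteq> Suc i" if "a \<noteq> b" "a \<noteq> c"
        using that mm[of a] by (auto simp: b_def c_def)
      consider "a = i" | "a = Suc i" | "a = b" | "a = c" | "a \<noteq> i \<and> a \<noteq> Suc i \<and> a \<noteq> b \<and> a \<noteq> c" by blast
      then show ?thesis
      proof cases
        case 5
        then show ?thesis using m by (simp add: key_def mate' s_def t_def)
      qed (use bc in \<open>auto simp: key_def mate' s_def t_def b_def[symmetric] c_def[symmetric]\<close>)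
    qed
    then show "key g a \<le> key g b \<longleftrightarrow> key \<gamma> (t a) \<le> key \<gamma> (t b)" for a b by simp
  qed
  define P where "P = x ` upper \<gamma>"
  have P: "P \<subseteq> {1..n}" unfolding P_def x_def n_def by (rule pos_upper_subset[OF \<gamma>])
  have sg: "mate \<gamma> a = a" if "a \<in> pluses \<gamma>" for a using that signs_eq[OF \<gamma>] by blast
  have up: "i \<in> upper \<gamma>" "Suc i \<in> upper \<gamma>" "b \<notin> upper \<gamma>" "c \<notin> upper \<gamma>"
    using in_upper_iff[OF \<gamma>] bc l sg[of b] sg[of c] by (auto simp: b_def[symmetric] c_def[symmetric])
  have memP: "x a \<in> P \<longleftrightarrow> a \<in> upper \<gamma>" for a unfolding P_def x_def by (rule pos_image_iff[OF \<gamma>])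
  have kP: "k \<notin> P" "Suc k \<in> P" "Suc (Suc k) \<notin> P" "Suc (Suc (Suc k)) \<in> P"
    using memP[of b] memP[of i] memP[of c] memP[of "Suc i"] up unfolding xv by auto
  have P': "pos n g ` upper g = P"
  proof -
    have "s ` upper \<gamma> = upper \<gamma>"
    proof (rule set_eqI)
      fix a
      show "a \<in> s ` upper \<gamma> \<longleftrightarrow> a \<in> upper \<gamma>"
        unfolding s_def simple_refl_image_iff using up by (cases "a = i"; cases "a = Suc i") auto
    qed
    moreover have "t ` upper \<gamma> = upper \<gamma>"
    proof -
      have "t a = a" if "a \<in> upper \<gamma>" for a using that up by (auto simp: t_def transpose_def)
      then show ?thesis by force
    qed
    ultimately show ?thesis unfolding pos' sw(5) P_def by (simp only: image_comp[symmetric])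
  qed
  define xs where "xs = x \<circ> s"
  have xsp: "xs permutes {1..n}" unfolding xs_def s_def using comp_simple_refl_permutes[OF xp] i by (simp add: n_def)
  define k1 k2 where "k1 = Suc k" and "k2 = Suc k1"
  have kd: "Suc k = k1" "Suc k1 = k2" by (simp_all add: k1_def k2_def)
  \<comment> \<open>The first move leads from \<open>xs\<close> to \<open>v\<close> through the
    lower permutation \<open>z1\<close>, the second from \<open>v\<close> to \<open>w\<close>
    through \<open>z2\<close>.\<close>
  define z1 where "z1 = simple_refl k1 \<circ> (simple_refl k2 \<circ> xs)"
  define v where "v = simple_refl k1 \<circ> (simple_refl k2 \<circ> z1)"
  define z2 where "z2 = simple_refl k \<circ> (simple_refl k1 \<circ> v)"
  define w where "w = simple_refl k \<circ> (simple_refl k1 \<circ> z2)"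
  have kb: "1 \<le> k1" "k1 < n" "1 \<le> k2" "k2 < n" using k kk by (simp_all add: k1_def k2_def)
  have z1p: "z1 permutes {1..n}" unfolding z1_def by (intro simple_refl_comp_permutes xsp kb)
  have vp: "v permutes {1..n}" unfolding v_def by (intro simple_refl_comp_permutes z1p kb)
  have z2p: "z2 permutes {1..n}" unfolding z2_def by (intro simple_refl_comp_permutes vp kb k kk)
  have xsv: "xs b = k" "xs i = Suc k2" "xs c = k2" "xs (Suc i) = k1"
    using xv bc by (simp_all add: xs_def s_def k1_def k2_def)
  have z1v: "z1 b = k" "z1 i = k1" "z1 c = Suc k2" "z1 (Suc i) = k2"
    using xsv by (simp_all add: z1_def k1_def k2_def)
  have vv: "v b = k" "v i = k2" "v c = k1" "v (Suc i) = Suc k2"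
    using z1v by (simp_all add: v_def k1_def k2_def)
  have z2v: "z2 b = k1" "z2 i = k" "z2 c = k2" "z2 (Suc i) = Suc k2"
    using vv by (simp_all add: z2_def k1_def k2_def)
  have wv: "w b = k2" "w i = k1" "w c = k" "w (Suc i) = Suc k2"
    using z2v by (simp_all add: w_def k1_def k2_def)
  have xsz: "xs = simple_refl k2 \<circ> (simple_refl k1 \<circ> z1)" by (simp add: z1_def fun_eq_iff)
  have vz: "v = simple_refl k1 \<circ> (simple_refl k \<circ> z2)" by (simp add: z2_def fun_eq_iff)
  have w: "w = pos n g"
  proof
    fix a
    have ne: "x a \<noteq> k" "x a \<noteq> k1" "x a \<noteq> k2" "x a \<noteq> Suc k2" if "a \<noteq> i" "a \<noteq> c" "a \<noteq> Suc i" "a \<noteq> b"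
      using that inj_eq[OF xinj, of a] xv unfolding k1_def k2_def by metis+
    consider "a = i" | "a = Suc i" | "a = b" | "a = c" | "a \<noteq> i \<and> a \<noteq> Suc i \<and> a \<noteq> b \<and> a \<noteq> c" by blast
    then show "w a = pos n g a"
    proof cases
      case 5
      then have "xs a = x a" by (simp add: xs_def s_def)
      moreover have "simple_refl k (x a) = x a" "simple_refl k1 (x a) = x a" "simple_refl k2 (x a) = x a"
        using ne 5 kd by auto
      ultimately have "w a = x a" by (simp add: w_def z2_def v_def z1_def)
      then show ?thesis using 5 by (simp add: pos' t_def)
    qed (use wv xv bc in \<open>simp_all add: pos' t_def k1_def k2_def\<close>)
  qed
  have 1: "dd_inv n xs (matchless_poly n P) = dd_inv n v (matchless_poly n P)"
    unfolding xsz v_def unfolding kd(2)[symmetric]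
    by (rule dd_inv_alternating[OF z1p kb(1) _ P _ _ cn(2,4,3)])
       (use kP kb z1v bc in \<open>auto simp: k1_def k2_def\<close>)
  have 2: "dd_inv n v (matchless_poly n P) = dd_inv n w (matchless_poly n P)"
    unfolding vz w_def unfolding kd(1)[symmetric]
    by (rule dd_inv_alternating[OF z2p k(1) kk(2) P _ _ cn(2,1,3)])
       (use kP z2v bc in \<open>auto simp: k1_def k2_def\<close>)
  have "x i < x (Suc i)" unfolding xv by simp
  from dd_inv_ascent[OF xp _ _ this, of "matchless_poly n P"]
  have D: "divided_diff i (Phi n \<gamma>) = dd_inv n xs (matchless_poly n P)"
    using i unfolding n_def[symmetric] by (simp add: Phi_def x_def[symmetric] P_def xs_def s_def)
  show ?thesis unfolding n_def[symmetric] g_def[symmetric] D 1 2 w unfolding Phi_def P' ..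
qed

lemma Phi_ascent:
  assumes "is_clan p q \<gamma>" "1 \<le> i" "i < p + q" "ascent \<gamma> i"
  shows "Phi (p + q) (swap_nodes i \<gamma>) = divided_diff i (Phi (p + q) \<gamma>)"
  using assms(1,4)
proof (cases rule: ascent_cases)
  case right
  then show ?thesis by (rule Phi_ascent_right[OF assms])
next
  case sign_left
  then show ?thesis by (rule Phi_ascent_sign_left[OF assms])
next
  case left_left
  then show ?thesis by (rule Phi_ascent_left_left[OF assms])
qed

lemma pos_adjacent_signs:
  assumes \<gamma>: "is_clan p q \<gamma>" and i: "1 \<le> i" "i < p + q" and sg: "mate \<gamma> i = i" "mate \<gamma> (Suc i) = Suc i"
  shows "pos (p + q) \<gamma> (Suc i) = Suc (pos (p + q) \<gamma> i)"
proof (rule pos_Suc[OF \<gamma>])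
  fix c assume c: "key \<gamma> i < key \<gamma> c"
  have "key \<gamma> c \<noteq> 2 * i + 1"
  proof
    assume k: "key \<gamma> c = 2 * i + 1"
    then have "odd (key \<gamma> c)" by simp
    then have "c < mate \<gamma> c" by (auto simp: key_def split: if_splits)
    then have "c = i" using k by (simp add: key_def)
    then show False using c by simp
  qed
  then show "key \<gamma> (Suc i) \<le> key \<gamma> c" using c sg by (simp add: key_def[of \<gamma> i] key_def[of \<gamma> "Suc i"])
qed (use assms in \<open>auto simp: key_def\<close>)

text \<open>The new arc occupies the positions of the two signs, right end first. Its canonical
  start is \<open>-+\<close>, so a clan with \<open>+-\<close> needs one flip.\<close>

lemma Phi_join:
  assumes \<gamma>: "is_clan p q \<gamma>" and i: "1 \<le> i" "i < p + q"
    and jn: "i \<in> pluses \<gamma> \<and> Suc i \<in> minuses \<gamma> \<or> i \<in> minuses \<gamma> \<and> Suc i \<in> pluses \<gamma>"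
  shows "Phi (p + q) (s_act i \<gamma>) = divided_diff i (Phi (p + q) \<gamma>)"
proof -
  define n where "n = p + q"
  define s where "s = simple_refl i"
  define g where "g = s_act i \<gamma>"
  define x where "x = pos n \<gamma>"
  define k where "k = x i"
  note mm = mate_mate[OF \<gamma>]
  note js = join_signs[OF \<gamma> i jn, folded g_def]
  have sg: "mate \<gamma> i = i" "mate \<gamma> (Suc i) = Suc i" using jn signs_eq[OF \<gamma>] by blast+
  have xi: "x i = k" "x (Suc i) = Suc k"
    using pos_adjacent_signs[OF \<gamma> i sg] by (simp_all add: k_def x_def n_def)
  have cn: "i \<in> {1..n}" "Suc i \<in> {1..n}" using i by (auto simp: n_def)
  have xp: "x permutes {1..n}" unfolding x_def by (rule pos_permutes[OF \<gamma>])
  have k: "1 \<le> k" "k < n"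
    using pos_in[OF \<gamma>, of n i] pos_in[OF \<gamma>, of n "Suc i"] cn xi by (auto simp: x_def)
  have keys: "key \<gamma> i = 2 * i" "key \<gamma> (Suc i) = 2 * i + 2" using sg by (auto simp: key_def)
  have keys': "key g i = 2 * i + 1" "key g (Suc i) = 2 * i" by (auto simp: key_def js(2))
  have other: "key g a = key \<gamma> a \<and> (key \<gamma> a < 2 * i \<or> key \<gamma> a > 2 * i + 2)" if "a \<noteq> i" "a \<noteq> Suc i" for a
  proof -
    have "key \<gamma> a \<noteq> 2 * i" "key \<gamma> a \<noteq> 2 * i + 2" using key_inject[OF \<gamma>, of a] keys that by metis+
    moreover have "key \<gamma> a \<noteq> 2 * i + 1" using that by (auto simp: key_def, presburger)
    moreover have "key g a = key \<gamma> a" using that by (simp add: key_def js(2))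
    ultimately show ?thesis by linarith
  qed
  have pos': "pos n g = x \<circ> s" unfolding x_def pos_def
  proof (rule rankp_order)
    show "s permutes {1..n}" unfolding s_def n_def by (rule simple_refl_permutes[OF i])
    fix a b
    have A: "a = i \<or> a = Suc i \<or> (key g a = key \<gamma> a \<and> s a = a \<and> (key \<gamma> a < 2 * i \<or> key \<gamma> a > 2 * i + 2))" for a
      using other[of a] by (auto simp: s_def)
    from A[of a] A[of b] show "key g a \<le> key g b \<longleftrightarrow> key \<gamma> (s a) \<le> key \<gamma> (s b)"
      using keys keys' by (elim disjE) (auto simp: s_def)
  qed
  define P where "P = x ` upper \<gamma>"
  have P: "P \<subseteq> {1..n}" unfolding P_def x_def n_def by (rule pos_upper_subset[OF \<gamma>])
  have "x i < x (Suc i)" unfolding xi by simp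
  from dd_inv_ascent[OF xp _ _ this, of "matchless_poly n P"]
  have D: "divided_diff i (Phi n \<gamma>) = dd_inv n (pos n g) (matchless_poly n P)"
    using i unfolding n_def[symmetric] by (simp add: Phi_def x_def[symmetric] P_def pos' s_def)
  have up: "i \<in> upper \<gamma> \<longleftrightarrow> i \<in> pluses \<gamma>" "Suc i \<in> upper \<gamma> \<longleftrightarrow> Suc i \<in> pluses \<gamma>"
    using in_upper_iff[OF \<gamma>] sg by auto
  have dj: "\<not> (i \<in> pluses \<gamma> \<and> i \<in> minuses \<gamma>)" "\<not> (Suc i \<in> pluses \<gamma> \<and> Suc i \<in> minuses \<gamma>)"
    using signs_disjoint[OF \<gamma>] by auto
  have posp: "pos n g permutes {1..n}" by (rule pos_permutes[OF js(1)])
  have sx: "x \<circ> s = simple_refl k \<circ> x"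
    unfolding s_def simple_refl_def[of i] by (rule perm_transpose_comp[OF permutes_inj[OF xp] xi])
  have "dd_inv n (pos n g) (matchless_poly n (pos n g ` upper g)) = dd_inv n (pos n g) (matchless_poly n P)"
  proof (cases "i \<in> pluses \<gamma>")
    case True
    then have "upper g = upper \<gamma>" unfolding js(4) using up jn dj by auto
    then have "pos n g ` upper g = simple_refl k ` P" unfolding P_def pos' sx by (simp add: image_comp)
    then show ?thesis
      using dd_inv_flip[OF posp k P cn(2,1)] xi by (simp add: pos' s_def)
  next
    case False
    have "upper g = s ` upper \<gamma>"
    proof (rule set_eqI)
      fix a
      show "a \<in> upper g \<longleftrightarrow> a \<in> s ` upper \<gamma>"
        unfolding s_def simple_refl_image_iff js(4) using up False jn by (cases "a = i"; cases "a = Suc i") auto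
    qed
    then have "pos n g ` upper g = x ` s ` s ` upper \<gamma>" unfolding pos' by (simp add: image_comp)
    then show ?thesis unfolding P_def s_def by simp
  qed
  then show ?thesis unfolding n_def[symmetric] g_def[symmetric] D unfolding Phi_def by simp
qed

text \<open>Each case in which the length stays gives 0: equal signs make the first operator vanish
  on the product, an arc of neighbours is a descent of \<open>pos\<close>, and otherwise the formula
  already is a divided difference at \<open>i\<close>.\<close>

lemma divided_diff_Phi:
  assumes \<gamma>: "is_clan p q \<gamma>" and i: "1 \<le> i" "i < p + q"
  shows "divided_diff i (Phi (p + q) \<gamma>) =
    (if clan_length (s_act i \<gamma>) > clan_length \<gamma> then Phi (p + q) (s_act i \<gamma>) else 0)"
  using assms
proof (cases rule: s_act_cases)
  case join
  then show ?thesis using Phi_join[OF assms join] join_signs(3)[OF assms join] by simp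
next
  case ascent
  then show ?thesis using Phi_ascent[OF assms ascent(1)] by simp
next
  case same
  let ?n = "p + q" and ?x = "pos (p + q) \<gamma>"
  let ?P = "?x ` upper \<gamma>"
  have sg: "mate \<gamma> i = i" "mate \<gamma> (Suc i) = Suc i" using same(1) signs_eq[OF \<gamma>] by blast+
  note xi = pos_adjacent_signs[OF \<gamma> i sg]
  note xp = pos_permutes[OF \<gamma>, of ?n]
  have cn: "i \<in> {1..?n}" "Suc i \<in> {1..?n}" using i by auto
  have k: "1 \<le> ?x i" "?x i < ?n"
    using pos_in[OF \<gamma>, of ?n i] pos_in[OF \<gamma>, of ?n "Suc i"] cn xi by auto
  have "i \<in> upper \<gamma> \<longleftrightarrow> Suc i \<in> upper \<gamma>"
    using in_upper_iff[OF \<gamma>] sg same(1) signs_disjoint[OF \<gamma>] by auto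
  then have kP: "?x i \<in> ?P \<longleftrightarrow> Suc (?x i) \<in> ?P"
    unfolding xi[symmetric] pos_image_iff[OF \<gamma>] .
  have sx: "?x \<circ> simple_refl i = simple_refl (?x i) \<circ> ?x"
    unfolding simple_refl_def[of i] by (rule perm_transpose_comp[OF permutes_inj[OF xp] refl xi])
  have "divided_diff i (Phi ?n \<gamma>) = dd_inv ?n (simple_refl (?x i) \<circ> ?x) (matchless_poly ?n ?P)"
    unfolding Phi_def sx[symmetric] using dd_inv_ascent[OF xp i] xi by simp
  also have "\<dots> = dd_inv ?n ?x (divided_diff (?x i) (matchless_poly ?n ?P))"
    by (rule dd_inv_left_ascent[OF xp k cn _ refl xi]) simp
  also have "\<dots> = 0"
    unfolding divided_diff_matchless_same[OF pos_upper_subset[OF \<gamma>] k kP] by (rule dd_inv_0[OF xp])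
  finally show ?thesis using same(2) by simp
next
  case arc
  have "mate \<gamma> (Suc i) = i" using arc mate_mate[OF \<gamma>] by metis
  then have "key \<gamma> (Suc i) < key \<gamma> i" using arc by (simp add: key_def)
  then have "pos (p + q) \<gamma> (Suc i) < pos (p + q) \<gamma> i" using i by (subst pos_less) auto
  then show ?thesis unfolding Phi_def using dd_inv_descent[OF pos_permutes[OF \<gamma>] i] arc by simp
next
  case descent
  note sw = swap_nodes_swap[OF assms descent(1)]
  have "Phi (p + q) \<gamma> = divided_diff i (Phi (p + q) (swap_nodes i \<gamma>))"
    using Phi_ascent[OF sw(1) i descent(2)] unfolding sw(6) .
  then show ?thesis using descent by simp
qed

section \<open>Agreement with the inductive definition\<close>

lemma v_perm_eq:
  assumes "is_clan p q \<gamma>"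
  shows "v_perm p q \<gamma> = grass (p + q) (upper \<gamma>)"
proof
  fix i
  show "v_perm p q \<gamma> i = grass (p + q) (upper \<gamma>) i"
    unfolding v_perm_def grass_def compl_upper[OF assms, symmetric] card_upper[OF assms] upper_def[symmetric]
    by (simp del: atLeastAtMost_iff)
qed

lemma matchless_facts:
  assumes "is_clan p q \<gamma>" "matchless \<gamma>"
  shows "mate \<gamma> = id" "pluses \<gamma> = upper \<gamma>" "minuses \<gamma> = {1..p + q} - upper \<gamma>"
    "lefts \<gamma> = {}" "rights \<gamma> = {}"
proof -
  show l: "lefts \<gamma> = {}" and r: "rights \<gamma> = {}" using assms(2) by (auto simp: matchless_def lefts_def rights_def)
  show "mate \<gamma> = id" by (rule ext) (simp add: mate_def l r)
  show "pluses \<gamma> = upper \<gamma>" by (simp add: upper_def l)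
  show "minuses \<gamma> = {1..p + q} - upper \<gamma>" using compl_upper[OF assms(1)] r by simp
qed

lemma u_perm_matchless:
  assumes "is_clan p q \<gamma>" "matchless \<gamma>"
  shows "u_perm p q \<gamma> = grass (p + q) ({1..p + q} - upper \<gamma>)"
proof
  fix i
  note m = matchless_facts[OF assms]
  have u: "upper \<gamma> \<subseteq> {1..p + q}" by (rule upper_subset[OF assms(1)])
  have d: "{1..p + q} - ({1..p + q} - upper \<gamma>) = upper \<gamma>" using u by blast
  have c: "card ({1..p + q} - upper \<gamma>) = q" using card_compl[OF u] card_upper[OF assms(1)] by simp
  have "i \<in> upper \<gamma> \<longleftrightarrow> i \<in> {1..p + q}" if "i \<notin> {1..p + q} - upper \<gamma>" using that u by blast
  then show "u_perm p q \<gamma> i = grass (p + q) ({1..p + q} - upper \<gamma>) i"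
    unfolding u_perm_def grass_def m d c Un_empty_right by (simp del: atLeastAtMost_iff Diff_iff)
qed

lemma pos_matchless:
  assumes "is_clan p q \<gamma>" "matchless \<gamma>"
  shows "pos n \<gamma> = id"
proof
  fix k
  have key: "key \<gamma> j = 2 * j" for j by (simp add: key_def matchless_facts(1)[OF assms])
  have "{j \<in> {1..n}. key \<gamma> j \<le> key \<gamma> k} = {1..k}" if "k \<in> {1..n}" using that by (auto simp: key)
  then show "pos n \<gamma> k = id k" by (simp add: pos_def rankp_def del: atLeastAtMost_iff)
qed

lemma Phi_matchless:
  assumes "is_clan p q \<gamma>" "matchless \<gamma>"
  shows "Phi (p + q) \<gamma> = matchless_poly (p + q) (upper \<gamma>)"
  unfolding Phi_def pos_matchless[OF assms] image_id id_apply dd_inv_id ..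

text \<open>The formula does not mention a derivation, so all derivations of a clan give the same
  polynomial.\<close>

lemma is_Upsilon_eq_Phi:
  "is_Upsilon p q \<gamma> f \<Longrightarrow> is_clan p q \<gamma> \<and> f = Phi (p + q) \<gamma>"
proof (induction rule: is_Upsilon.induct)
  case (matchless \<gamma>)
  show ?case
    unfolding Phi_matchless[OF matchless] matchless_poly_def v_perm_eq[OF matchless(1)] u_perm_matchless[OF matchless]
    using matchless(1) by simp
next
  case (step \<gamma> f i)
  then show ?case using is_clan_s_act[of p q \<gamma> i] divided_diff_Phi[of p q \<gamma> i] by simp
qed

text \<open>A crude bound; it serves to turn the length into a natural number for
  inductions.\<close>

lemma clan_length_lower:
  assumes "is_clan p q \<gamma>"
  shows "0 \<le> clan_length \<gamma> + int ((p + q) * (p + q))"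
proof -
  have l: "lefts \<gamma> \<subseteq> {1..p + q}" using upper_subset[OF assms] by (auto simp: upper_def)
  have "crossing_pairs (lefts \<gamma>) (mate \<gamma>) \<subseteq> {1..p + q} \<times> {1..p + q}"
    using l unfolding crossing_pairs_def by blast
  then have "card (crossing_pairs (lefts \<gamma>) (mate \<gamma>)) \<le> card ({1..p + q} \<times> {1..p + q})"
    by (intro card_mono) auto
  then have "card (crossing_pairs (lefts \<gamma>) (mate \<gamma>)) \<le> (p + q) * (p + q)"
    by (simp add: card_cartesian_product)
  moreover have "0 \<le> (\<Sum>a\<in>lefts \<gamma>. int (mate \<gamma> a) - int a)"
    unfolding lefts_eq[OF assms] by (rule sum_nonneg) auto
  ultimately show ?thesis unfolding clan_length_eq[OF assms] by linarith
qed

text \<open>Undoes a joining of signs. Plus before minus is one of two possible choices, and both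
  are joined to the same clan.\<close>

lemma split_arc:
  assumes \<gamma>: "is_clan p q \<gamma>" and i: "1 \<le> i" "i < p + q" and a: "mate \<gamma> i = Suc i"
  shows "\<exists>\<delta>. is_clan p q \<delta> \<and> s_act i \<delta> = \<gamma> \<and> clan_length \<gamma> = clan_length \<delta> + 1"
proof -
  define \<delta> :: clan where "\<delta> = \<lparr>arcs = arcs \<gamma> - {(i, Suc i)}, pluses = insert i (pluses \<gamma>),
    minuses = insert (Suc i) (minuses \<gamma>)\<rparr>"
  define m where "m = (mate \<gamma>)(i := i, Suc i := Suc i)"
  note mm = mate_mate[OF \<gamma>]
  have a': "mate \<gamma> (Suc i) = i" using a mm[of i] by simp
  have ne: "mate \<gamma> k \<noteq> i" "mate \<gamma> k \<noteq> Suc i" if "k \<noteq> i" "k \<noteq> Suc i" for k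
    using that a a' mm[of k] by auto
  have inv: "m (m k) = k" for k using ne[of k] mm[of k] by (auto simp: m_def)
  have dom: "k \<in> {1..p + q}" if "m k \<noteq> k" for k
    using mate_dom[OF \<gamma>, of k] that unfolding m_def by (auto split: if_splits)
  have arcs: "arcs \<delta> = {(a, b). m a = b \<and> a < b}"
    unfolding \<delta>_def clan.simps arcs_eq[OF \<gamma>] m_def using a a' ne by auto
  have sgn: "mate \<gamma> k = k" if "k \<in> pluses \<gamma> \<or> k \<in> minuses \<gamma>" for k using that signs_eq[OF \<gamma>] by blast
  then have ns: "i \<notin> pluses \<gamma>" "i \<notin> minuses \<gamma>" "Suc i \<notin> pluses \<gamma>" "Suc i \<notin> minuses \<gamma>" using a a' by force+
  have 1: "pluses \<delta> \<inter> minuses \<delta> = {}" using signs_disjoint[OF \<gamma>] ns by (auto simp: \<delta>_def)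
  have "pluses \<delta> \<union> minuses \<delta> = insert i (insert (Suc i) (pluses \<gamma> \<union> minuses \<gamma>))" by (auto simp: \<delta>_def)
  also have "\<dots> = {k \<in> {1..p + q}. m k = k}"
    unfolding signs_eq[OF \<gamma>] m_def using i a a' by auto
  finally have 2: "pluses \<delta> \<union> minuses \<delta> = {k \<in> {1..p + q}. m k = k}" .
  have "finite (pluses \<gamma> \<union> minuses \<gamma>)" unfolding signs_eq[OF \<gamma>] by simp
  then have fin: "finite (pluses \<gamma>)" "finite (minuses \<gamma>)" by simp_all
  have 3: "int (card (pluses \<delta>)) - int (card (minuses \<delta>)) = int p - int q"
    using \<gamma> ns fin by (simp add: \<delta>_def is_clan_def)
  have cl: "is_clan p q \<delta>" by (rule clan_of_involution(4)[OF inv dom arcs 1 2 3])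
  have jn: "i \<in> pluses \<delta> \<and> Suc i \<in> minuses \<delta> \<or> i \<in> minuses \<delta> \<and> Suc i \<in> pluses \<delta>" by (simp add: \<delta>_def)
  have "(i, Suc i) \<in> arcs \<gamma>" unfolding arcs_eq[OF \<gamma>] using a by simp
  then have "s_act i \<delta> = \<gamma>"
    unfolding s_act_def using jn ns by (auto simp: \<delta>_def intro!: clan.equality)
  then show ?thesis using cl join_signs(3)[OF cl i jn] by auto
qed

lemma clan_predecessor:
  assumes \<gamma>: "is_clan p q \<gamma>" and i: "1 \<le> i" "i < p + q" and d: "mate \<gamma> (Suc i) < mate \<gamma> i" and na: "mate \<gamma> i \<noteq> Suc i"
  shows "is_clan p q (swap_nodes i \<gamma>)" "s_act i (swap_nodes i \<gamma>) = \<gamma>" "ascent (swap_nodes i \<gamma>) i"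
    "clan_length \<gamma> = clan_length (swap_nodes i \<gamma>) + 1" "swap_nodes i (swap_nodes i \<gamma>) = \<gamma>"
    "upper (swap_nodes i \<gamma>) = simple_refl i ` upper \<gamma>"
proof -
  note sw = swap_nodes_swap[OF \<gamma> i na]
  show "is_clan p q (swap_nodes i \<gamma>)" "swap_nodes i (swap_nodes i \<gamma>) = \<gamma>"
    "upper (swap_nodes i \<gamma>) = simple_refl i ` upper \<gamma>" by (rule sw)+
  have "mate \<gamma> k = k" if "k \<in> pluses \<gamma> \<or> k \<in> minuses \<gamma>" for k using that signs_eq[OF \<gamma>] by blast
  then have ns: "\<not> ((i \<in> pluses \<gamma> \<or> i \<in> minuses \<gamma>) \<and> (Suc i \<in> pluses \<gamma> \<or> Suc i \<in> minuses \<gamma>))"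
    using d by force
  have na': "\<not> ascent \<gamma> i" using d by (simp add: ascent_def)
  from \<gamma> i have "s_act i (swap_nodes i \<gamma>) = \<gamma> \<and> ascent (swap_nodes i \<gamma>) i \<and>
    clan_length \<gamma> = clan_length (swap_nodes i \<gamma>) + 1"
    by (cases rule: s_act_cases) (use ns na na' in auto)
  then show "s_act i (swap_nodes i \<gamma>) = \<gamma>" "ascent (swap_nodes i \<gamma>) i"
    "clan_length \<gamma> = clan_length (swap_nodes i \<gamma>) + 1" by auto
qed

lemma not_sorted_descent:
  fixes f :: "nat \<Rightarrow> nat"
  assumes "a < b" "f b < f a"
  shows "\<exists>i. a \<le> i \<and> i < b \<and> f (Suc i) < f i"
proof (rule ccontr)
  assume "\<not> ?thesis"
  then have s: "f i \<le> f (Suc i)" if "a \<le> i" "i < b" for i using that by (meson not_le)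
  have "f a \<le> f c" if "a \<le> c" "c \<le> b" for c
    using that
  proof (induction c rule: dec_induct)
    case (step c)
    then show ?case using s[of c] by simp
  qed simp
  from this[of b] show False using assms by simp
qed

lemma is_Upsilon_exists:
  assumes "is_clan p q \<gamma>"
  shows "\<exists>f. is_Upsilon p q \<gamma> f"
  using assms
proof (induction "nat (clan_length \<gamma> + int ((p + q) * (p + q)))" arbitrary: \<gamma> rule: less_induct)
  case less
  show ?case
  proof (cases "matchless \<gamma>")
    case True
    then show ?thesis using is_Upsilon.matchless less.prems by blast
  next
    case False
    then obtain a b where "(a, b) \<in> arcs \<gamma>" by (auto simp: matchless_def)
    then have ab: "mate \<gamma> a = b" "a < b" by (auto simp: arcs_eq[OF less.prems])
    then have ba: "mate \<gamma> b = a" using mate_mate[OF less.prems] by metis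
    have "a \<in> {1..p + q}" "b \<in> {1..p + q}"
      using mate_dom[OF less.prems, of a] mate_dom[OF less.prems, of b] ab ba by auto
    \<comment> \<open>\<open>mate\<close> exchanges \<open>a < b\<close>, so it decreases somewhere
      between them, and there the clan has a shorter predecessor.\<close>
    moreover obtain i where "a \<le> i" "i < b" "mate \<gamma> (Suc i) < mate \<gamma> i"
      using not_sorted_descent[of a b "mate \<gamma>"] ab ba by auto
    ultimately have i: "1 \<le> i" "i < p + q" "mate \<gamma> (Suc i) < mate \<gamma> i" by auto
    obtain \<delta> where \<delta>: "is_clan p q \<delta>" "s_act i \<delta> = \<gamma>" "clan_length \<gamma> = clan_length \<delta> + 1"
      using split_arc[OF less.prems i(1,2)] clan_predecessor(1,2,4)[OF less.prems i] by blast
    have "nat (clan_length \<delta> + int ((p + q) * (p + q))) < nat (clan_length \<gamma> + int ((p + q) * (p + q)))"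
      using clan_length_lower[OF \<delta>(1)] \<delta>(3) by linarith
    from less.hyps[OF this \<delta>(1)] obtain f where f: "is_Upsilon p q \<delta> f" ..
    have "clan_length (s_act i \<delta>) > clan_length \<delta>" using \<delta>(2,3) by simp
    from is_Upsilon.step[OF f i(1,2) this] show ?thesis unfolding \<delta>(2) by blast
  qed
qed

lemma Upsilon_eq_Phi:
  assumes "is_clan p q \<gamma>"
  shows "Upsilon p q \<gamma> = Phi (p + q) \<gamma>"
proof -
  obtain f where "is_Upsilon p q \<gamma> f" using is_Upsilon_exists[OF assms] by blast
  then have "is_Upsilon p q \<gamma> (Phi (p + q) \<gamma>)" using is_Upsilon_eq_Phi by blast
  then show ?thesis unfolding Upsilon_def
    by (rule the_equality) (rule conjunct2[OF is_Upsilon_eq_Phi])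
qed

subsection \<open>Localization at the identity\<close>

text \<open>These two facts let the rank argument for double Schubert polynomials be repeated, with
  \<open>upper\<close> in place of the set of positions with small values.\<close>

lemma upper_s_act:
  assumes \<gamma>: "is_clan p q \<gamma>" and i: "1 \<le> i" "i < p + q" and l: "clan_length (s_act i \<gamma>) > clan_length \<gamma>"
  shows "upper (s_act i \<gamma>) = upper \<gamma> \<or> upper (s_act i \<gamma>) = simple_refl i ` upper \<gamma>"
    "Suc i \<in> upper (s_act i \<gamma>) \<Longrightarrow> i \<in> upper (s_act i \<gamma>)"
proof -
  have "(upper (s_act i \<gamma>) = upper \<gamma> \<or> upper (s_act i \<gamma>) = simple_refl i ` upper \<gamma>) \<and>
    (Suc i \<in> upper (s_act i \<gamma>) \<longrightarrow> i \<in> upper (s_act i \<gamma>))"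
    using \<gamma> i
  proof (cases rule: s_act_cases)
    case join
    note u = join_signs(4)[OF \<gamma> i join]
    have "mate \<gamma> k = k" if "k \<in> pluses \<gamma> \<or> k \<in> minuses \<gamma>" for k using that signs_eq[OF \<gamma>] by blast
    then have "i \<in> upper \<gamma> \<longleftrightarrow> i \<in> pluses \<gamma>" "Suc i \<in> upper \<gamma> \<longleftrightarrow> Suc i \<in> pluses \<gamma>"
      using in_upper_iff[OF \<gamma>] join by auto
    then have up: "(i \<in> upper \<gamma>) \<noteq> (Suc i \<in> upper \<gamma>)" using join signs_disjoint[OF \<gamma>] by auto
    show ?thesis
    proof (cases "i \<in> upper \<gamma>")
      case True
      then show ?thesis using up unfolding u by auto
    next
      case False
      have "a \<in> upper (s_act i \<gamma>) \<longleftrightarrow> a \<in> simple_refl i ` upper \<gamma>" for a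
        unfolding u simple_refl_image_iff using up False by (cases "a = i"; cases "a = Suc i") auto
      then show ?thesis unfolding u by auto
    qed
  next
    case ascent
    have u: "upper (s_act i \<gamma>) = simple_refl i ` upper \<gamma>"
      unfolding ascent(2) using swap_nodes_swap(5)[OF \<gamma> i ascent_not_arc[OF \<gamma> ascent(1)]] .
    have sg: "mate \<gamma> k = k" if "k \<in> pluses \<gamma>" for k using that signs_eq[OF \<gamma>] by blast
    have "i \<in> upper \<gamma> \<longrightarrow> Suc i \<in> upper \<gamma>"
      using \<gamma> ascent(1)
    proof (cases rule: ascent_cases)
      case right
      then show ?thesis using in_upper_iff[OF \<gamma>, of i] sg[of i] by auto
    qed (auto simp: in_upper_iff[OF \<gamma>])
    then show ?thesis unfolding u simple_refl_image_iff by simp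
  qed (use l in auto)
  then show "upper (s_act i \<gamma>) = upper \<gamma> \<or> upper (s_act i \<gamma>) = simple_refl i ` upper \<gamma>"
    "Suc i \<in> upper (s_act i \<gamma>) \<Longrightarrow> i \<in> upper (s_act i \<gamma>)" by blast+
qed

text \<open>For matchless clans the second factor of the product vanishes. A step works as for
  double Schubert polynomials, with \<open>upper_s_act\<close> in the role of a descent.\<close>

lemma ev_is_Upsilon_eq_0:
  "is_Upsilon p q \<gamma> f \<Longrightarrow> \<forall>\<sigma> k. \<sigma> permutes {1..p + q} \<longrightarrow>
    cnt (\<lambda>j. \<sigma> j \<le> p) k > cnt (\<lambda>j. j \<in> upper \<gamma>) k \<longrightarrow> ev (p + q) \<sigma> f = 0"
proof (induction rule: is_Upsilon.induct)
  case (matchless \<gamma>)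
  have f: "dschubert (p + q) (\<lambda>j. Y (Suc (p + q) - j)) (u_perm p q \<gamma>) * dschubert (p + q) Y (v_perm p q \<gamma>)
    = matchless_poly (p + q) (upper \<gamma>)"
    unfolding matchless_poly_def v_perm_eq[OF matchless(1)] u_perm_matchless[OF matchless] ..
  show ?case unfolding f
    using ev_matchless_eq_0[OF upper_subset[OF matchless(1)]] unfolding card_upper[OF matchless(1)] by blast
next
  case (step \<gamma> f i)
  let ?n = "p + q"
  have \<gamma>: "is_clan p q \<gamma>" using is_Upsilon_eq_Phi[OF step.hyps(1)] by blast
  note up = upper_s_act[OF \<gamma> step.hyps(2,3,4)]
  show ?case
  proof (intro allI impI)
    fix \<sigma> k
    assume s: "\<sigma> permutes {1..?n}" and k: "cnt (\<lambda>j. \<sigma> j \<le> p) k > cnt (\<lambda>j. j \<in> upper (s_act i \<gamma>)) k"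
    obtain k where k: "k \<noteq> i" "cnt (\<lambda>j. \<sigma> j \<le> p) k > cnt (\<lambda>j. j \<in> upper (s_act i \<gamma>)) k"
      using cnt_violation[OF k, of i] up(2) step.hyps(2) by auto
    have "cnt (\<lambda>j. j \<in> upper (s_act i \<gamma>)) k = cnt (\<lambda>j. j \<in> upper \<gamma>) k"
      using up(1) cnt_simple_refl[OF step.hyps(2) k(1), of "\<lambda>j. j \<in> upper \<gamma>"]
      by (auto simp: simple_refl_image_iff)
    then have k2: "cnt (\<lambda>j. \<sigma> j \<le> p) k > cnt (\<lambda>j. j \<in> upper \<gamma>) k" using k(2) by simp
    have s': "\<sigma> \<circ> simple_refl i permutes {1..?n}" by (rule comp_simple_refl_permutes[OF s step.hyps(2,3)])
    have k3: "cnt (\<lambda>j. (\<sigma> \<circ> simple_refl i) j \<le> p) k > cnt (\<lambda>j. j \<in> upper \<gamma>) k"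
      using k2 cnt_simple_refl[OF step.hyps(2) k(1), of "\<lambda>j. \<sigma> j \<le> p"] by simp
    have 0: "ev ?n \<sigma> f = 0" "ev ?n (\<sigma> \<circ> simple_refl i) f = 0"
      using step.IH s s' k2 k3 by blast+
    have "\<sigma> i \<noteq> \<sigma> (Suc i)" using inj_eq[OF permutes_inj[OF s]] by simp
    then show "ev ?n \<sigma> (divided_diff i f) = 0"
      using ev_divided_diff[OF step.hyps(2,3), of \<sigma> f] 0 by simp
  qed
qed

text \<open>A set of \<open>p\<close> nodes other than \<open>{1..p}\<close> has fewer than
  \<open>p\<close> elements in the prefix of length \<open>p\<close>, whereas the identity has all
  \<open>p\<close> small values there.\<close>

lemma ev_id_Phi_eq_0:
  assumes \<gamma>: "is_clan p q \<gamma>" and u: "upper \<gamma> \<noteq> {1..p}"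
  shows "ev (p + q) id (Phi (p + q) \<gamma>) = 0"
proof -
  obtain f where f: "is_Upsilon p q \<gamma> f" using is_Upsilon_exists[OF \<gamma>] by blast
  have fin: "finite (upper \<gamma>)" using upper_subset[OF \<gamma>] by (rule finite_subset) simp
  have "{j \<in> {1..p}. j \<in> upper \<gamma>} \<noteq> {1..p}"
  proof
    assume "{j \<in> {1..p}. j \<in> upper \<gamma>} = {1..p}"
    then have "{1..p} \<subseteq> upper \<gamma>" by blast
    then have "{1..p} = upper \<gamma>" by (rule card_subset_eq[OF fin]) (simp add: card_upper[OF \<gamma>])
    then show False using u by simp
  qed
  then have "{j \<in> {1..p}. j \<in> upper \<gamma>} \<subset> {1..p}" by blast
  then have "card {j \<in> {1..p}. j \<in> upper \<gamma>} < card {1..p}" by (intro psubset_card_mono) auto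
  moreover have "{j \<in> {1..p}. id j \<le> p} = {1..p}" by auto
  ultimately have "cnt (\<lambda>j. id j \<le> p) p > cnt (\<lambda>j. j \<in> upper \<gamma>) p"
    unfolding cnt_eq_card by simp
  then show ?thesis using ev_is_Upsilon_eq_0[OF f] permutes_id is_Upsilon_eq_Phi[OF f] by blast
qed

lemma v_perm_id_iff:
  assumes \<gamma>: "is_clan p q \<gamma>"
  shows "v_perm p q \<gamma> = id \<longleftrightarrow> upper \<gamma> = {1..p}"
proof
  assume v: "v_perm p q \<gamma> = id"
  have "upper \<gamma> \<subseteq> {1..p}"
  proof
    fix j assume j: "j \<in> upper \<gamma>"
    then have "grass (p + q) (upper \<gamma>) j \<le> card (upper \<gamma>)" by (subst grass_le_iff[OF upper_subset[OF \<gamma>]]) simp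
    then have "j \<le> p" using v unfolding v_perm_eq[OF \<gamma>] card_upper[OF \<gamma>] by simp
    then show "j \<in> {1..p}" using j upper_subset[OF \<gamma>] by auto
  qed
  then show "upper \<gamma> = {1..p}" by (rule card_subset_eq[rotated]) (simp_all add: card_upper[OF \<gamma>])
next
  assume u: "upper \<gamma> = {1..p}"
  show "v_perm p q \<gamma> = id"
  proof
    fix j
    have 1: "{k \<in> {1..p}. k \<le> j} = {1..j}" if "j \<in> {1..p}" using that by auto
    have 2: "{k \<in> {1..p + q} - {1..p}. k \<le> j} = {p + 1..j}" if "j \<in> {1..p + q}" using that by auto
    show "v_perm p q \<gamma> j = id j" unfolding v_perm_eq[OF \<gamma>] u grass_def using 1 2 by auto
  qed
qed

lemma swap_y_Phi:
  assumes \<gamma>: "is_clan p q \<gamma>" and k: "1 \<le> k" "k < p + q" "k \<noteq> p"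
  shows "swap_y k (Phi (p + q) \<gamma>) = Phi (p + q) \<gamma>"
proof -
  have "card (pos (p + q) \<gamma> ` upper \<gamma>) = p"
    using card_image[of "pos (p + q) \<gamma>" "upper \<gamma>"] pos_inject[OF \<gamma>] card_upper[OF \<gamma>]
    by (simp add: inj_on_def)
  then have "swap_y k (matchless_poly (p + q) (pos (p + q) \<gamma> ` upper \<gamma>)) = matchless_poly (p + q) (pos (p + q) \<gamma> ` upper \<gamma>)"
    using k by (intro swap_y_matchless pos_upper_subset[OF \<gamma>]) auto
  then show ?thesis
    unfolding Phi_def
    using dd_inv_hom[where T = "swap_y k", OF swap_y_divided_diff pos_permutes[OF \<gamma>],
        of "p + q" "matchless_poly (p + q) (pos (p + q) \<gamma> ` upper \<gamma>)"] by simp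
qed

lemma swap_y_ev: "swap_y i (ev n \<sigma> f) = ev n (simple_refl i \<circ> \<sigma>) (swap_y i f)"
  unfolding swap_y_def ev_def subst_subst
  by (rule subst_cong_all) (auto split: var.split)

text \<open>For a polynomial symmetric in \<open>Y i\<close> and \<open>Y (Suc i)\<close>, the value
  at the transposition is obtained from the value at the identity by exchanging these
  variables.\<close>

lemma ev_divided_diff_Phi:
  assumes \<gamma>: "is_clan p q \<gamma>" and i: "p < i" "i < p + q"
  shows "(Y i - Y (Suc i)) * ev (p + q) id (divided_diff i (Phi (p + q) \<gamma>)) =
    ev (p + q) id (Phi (p + q) \<gamma>) - swap_y i (ev (p + q) id (Phi (p + q) \<gamma>))"
proof -
  have i': "1 \<le> i" "i \<noteq> p" using i by auto
  show ?thesis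
    using ev_divided_diff[OF i'(1) i(2), of id "Phi (p + q) \<gamma>"]
    unfolding swap_y_ev swap_y_Phi[OF \<gamma> i'(1) i(2) i'(2)] id_o comp_id id_apply .
qed

text \<open>Sortedness makes both the nodes up to \<open>p\<close> and those beyond \<open>p\<close>
  appear in increasing order in the canonical list. Its operator is then the one matched with the
  second factor of the product, and \<open>ev_dd_matchless\<close> computes the
  localization.\<close>

lemma ev_Phi_sorted:
  assumes \<gamma>: "is_clan p q \<gamma>" and u: "upper \<gamma> = {1..p}"
    and srt: "\<And>a b. p < a \<Longrightarrow> a < b \<Longrightarrow> b \<le> p + q \<Longrightarrow> mate \<gamma> a < mate \<gamma> b"
  shows "ev (p + q) id (Phi (p + q) \<gamma>) =
    (\<Prod>(a, m)\<in>{(a, m). a \<in> {1..p} \<and> m \<in> {p + 1..p + q} \<and> a < mate \<gamma> m}. Y a - Y m)"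
proof -
  define n where "n = p + q"
  define x where "x = pos n \<gamma>"
  define P where "P = x ` {1..p}"
  have xp: "x permutes {1..n}" unfolding x_def by (rule pos_permutes[OF \<gamma>])
  note xinj = permutes_inj[OF xp]
  have P: "P \<subseteq> {1..n}" unfolding P_def using pos_upper_subset[OF \<gamma>] u by (simp add: x_def n_def)
  have pn: "{1..p} \<subseteq> {1..n}" "{p + 1..n} \<subseteq> {1..n}" by (auto simp: n_def)
  have sg: "mate \<gamma> k = k" if "k \<in> pluses \<gamma>" for k using that signs_eq[OF \<gamma>] by blast
  have lo: "a \<le> mate \<gamma> a" if "a \<in> {1..p}" for a
    using that in_upper_iff[OF \<gamma>, of a] sg[of a] unfolding u by auto
  have hi: "mate \<gamma> m \<le> m" if "m \<in> {p + 1..n}" for m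
    using that in_upper_iff[OF \<gamma>, of m] unfolding u by auto
  have klo: "key \<gamma> a = 2 * a \<or> key \<gamma> a = 2 * a + 1" if "a \<in> {1..p}" for a
    using lo[OF that] by (auto simp: key_def)
  have khi: "key \<gamma> m = 2 * mate \<gamma> m" if "m \<in> {p + 1..n}" for m
    using hi[OF that] by (auto simp: key_def)
  have xle: "x a \<le> x b \<longleftrightarrow> key \<gamma> a \<le> key \<gamma> b" if "a \<in> {1..n}" "b \<in> {1..n}" for a b
    using pos_less[OF that(2,1), of \<gamma>] unfolding x_def by (meson not_le)
  have c1: "card P = p" unfolding P_def using card_image[OF inj_on_subset[OF xinj subset_UNIV]] by simp
  have cmpl: "{1..n} - P = x ` {p + 1..n}"
  proof -
    have "{1..n} - {1..p} = {p + 1..n}" by auto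
    then show ?thesis unfolding P_def using image_set_diff[OF xinj, of "{1..n}" "{1..p}"] permutes_image[OF xp] by simp
  qed
  \<comment> \<open>The labelling of the starting clan inverts \<open>pos\<close>: this is where
    sortedness enters.\<close>
  have g: "grass n P (x a) = a" for a
  proof -
    consider "a \<in> {1..p}" | "a \<in> {p + 1..n}" | "a \<notin> {1..n}" by fastforce
    then show ?thesis
    proof cases
      case 1
      have "{k \<in> P. k \<le> x a} = x ` {1..a}"
      proof (intro set_eqI iffI)
        fix k assume "k \<in> {k \<in> P. k \<le> x a}"
        then obtain b where b: "k = x b" "b \<in> {1..p}" "x b \<le> x a" by (auto simp: P_def)
        then have "b \<le> a" using xle[of b a] klo[of a] klo[of b] 1 pn by fastforce
        then show "k \<in> x ` {1..a}" using b by auto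
      next
        fix k assume "k \<in> x ` {1..a}"
        then obtain b where b: "k = x b" "b \<in> {1..a}" by blast
        have bp: "b \<in> {1..p}" using b 1 by auto
        have "key \<gamma> b \<le> key \<gamma> a"
        proof (cases "b = a")
          case False
          then have "b < a" using b by simp
          then show ?thesis using klo[OF bp] klo[OF 1] by linarith
        qed simp
        then have "x b \<le> x a" using xle[of b a] bp 1 pn by blast
        then show "k \<in> {k \<in> P. k \<le> x a}" using b bp by (auto simp: P_def)
      qed
      then have "card {k \<in> P. k \<le> x a} = a" using card_image[OF inj_on_subset[OF xinj subset_UNIV]] by simp
      moreover have "x a \<in> P" using 1 by (simp add: P_def)
      ultimately show ?thesis by (simp add: grass_def)
    next
      case 2
      have "{k \<in> {1..n} - P. k \<le> x a} = x ` {p + 1..a}" unfolding cmpl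
      proof (intro set_eqI iffI)
        fix k assume "k \<in> {k \<in> x ` {p + 1..n}. k \<le> x a}"
        then obtain b where b: "k = x b" "b \<in> {p + 1..n}" "x b \<le> x a" by auto
        have "key \<gamma> b \<le> key \<gamma> a" using xle[of b a] b 2 pn by blast
        then have "mate \<gamma> b \<le> mate \<gamma> a" using khi[OF b(2)] khi[OF 2] by simp
        then have "\<not> a < b" using srt[of a b] b 2 by (auto simp: n_def)
        then show "k \<in> x ` {p + 1..a}" using b by auto
      next
        fix k assume "k \<in> x ` {p + 1..a}"
        then obtain b where b: "k = x b" "b \<in> {p + 1..a}" by blast
        have bp: "b \<in> {p + 1..n}" using b 2 by auto
        have "mate \<gamma> b \<le> mate \<gamma> a" using srt[of b a] b 2 by (cases "b = a") (auto simp: n_def)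
        then have "key \<gamma> b \<le> key \<gamma> a" using khi[OF bp] khi[OF 2] by simp
        then have "x b \<le> x a" using xle[of b a] bp 2 pn by blast
        then show "k \<in> {k \<in> x ` {p + 1..n}. k \<le> x a}" using b bp by auto
      qed
      then have "card {k \<in> {1..n} - P. k \<le> x a} = a - p" using card_image[OF inj_on_subset[OF xinj subset_UNIV]] by simp
      moreover have "x a \<in> {1..n} - P" using 2 by (simp add: cmpl)
      ultimately show ?thesis using 2 c1 by (simp add: grass_def)
    next
      case 3
      then have "x a = a" using permutes_not_in[OF xp] by blast
      then show ?thesis using 3 P by (auto simp: grass_def)
    qed
  qed
  have "inv (grass n P) = x"
    by (rule inv_unique_comp) (use g permutes_bij[OF grass_permutes[OF P]] in
        \<open>auto simp: fun_eq_iff bij_def\<close>, metis g permutes_inverses(1) xp)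
  then have Phi: "Phi n \<gamma> = dd n (grass n P) (matchless_poly n P)"
    unfolding Phi_def dd_def u x_def[symmetric] P_def[symmetric] by simp
  have "ev n id (Phi n \<gamma>) =
    (\<Prod>(i, j)\<in>{(i, j). i \<in> P \<and> j \<in> {1..n} - P \<and> i < j}. Y (grass n P i) - Y (grass n P j))"
    unfolding Phi by (rule ev_dd_matchless[OF P])
  \<comment> \<open>A plus before a minus means \<open>key \<gamma> a < key \<gamma> m\<close>. The
    key of \<open>a\<close> is \<open>2 * a\<close> or \<open>2 * a + 1\<close> and that of
    \<open>m\<close> is \<open>2 * mate \<gamma> m\<close>, so this is
    \<open>a < mate \<gamma> m\<close>; the ends of one arc do not contribute.\<close>
  also have "\<dots> = (\<Prod>(a, m)\<in>{(a, m). a \<in> {1..p} \<and> m \<in> {p + 1..n} \<and> a < mate \<gamma> m}. Y a - Y m)"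
  proof (rule HOL.sym, rule prod.reindex_bij_witness[where j = "map_prod x x" and i = "map_prod (grass n P) (grass n P)"])
    fix am assume am: "am \<in> {(a, m). a \<in> {1..p} \<and> m \<in> {p + 1..n} \<and> a < mate \<gamma> m}"
    obtain a m where e: "am = (a, m)" by fastforce
    have am': "a \<in> {1..p}" "m \<in> {p + 1..n}" "a < mate \<gamma> m" using am e by auto
    have "key \<gamma> a < key \<gamma> m" using klo[OF am'(1)] khi[OF am'(2)] am'(3) by linarith
    then have "x a < x m" unfolding x_def using am' pn by (subst pos_less) auto
    moreover have "x a \<in> P" "x m \<in> {1..n} - P" unfolding cmpl using am' by (simp_all add: P_def)
    ultimately show "map_prod x x am \<in> {(i, j). i \<in> P \<and> j \<in> {1..n} - P \<and> i < j}"
      unfolding e by (simp del: Diff_iff)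
    show "map_prod (grass n P) (grass n P) (map_prod x x am) = am" unfolding e by (simp add: g)
    show "(case map_prod x x am of (i, j) \<Rightarrow> Y (grass n P i) - Y (grass n P j)) = (case am of (a, m) \<Rightarrow> Y a - Y m)"
      unfolding e by (simp add: g)
  next
    fix ij assume ij: "ij \<in> {(i, j). i \<in> P \<and> j \<in> {1..n} - P \<and> i < j}"
    then obtain a m where am: "ij = (x a, x m)" "a \<in> {1..p}" "m \<in> {p + 1..n}" "x a < x m"
      unfolding cmpl unfolding P_def by auto
    have "key \<gamma> a < key \<gamma> m" using am(4) unfolding x_def using am pn by (subst (asm) pos_less) auto
    then have "a < mate \<gamma> m" using klo[OF am(2)] khi[OF am(3)] by linarith
    then show "map_prod (grass n P) (grass n P) ij \<in> {(a, m). a \<in> {1..p} \<and> m \<in> {p + 1..n} \<and> a < mate \<gamma> m}"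
      using am by (simp add: g)
    show "map_prod x x (map_prod (grass n P) (grass n P) ij) = ij" using am by (simp add: g)
  qed
  finally show ?thesis unfolding n_def .
qed

text \<open>At a descent of \<open>mate\<close> beyond \<open>p\<close> the exchange gives a shorter
  clan with the same \<open>upper\<close>, and the factor \<open>Y i - Y (Suc i)\<close> can be
  cancelled, so the recursion determines \<open>F\<close>. It is stated for any \<open>F\<close> in
  order to be applied to transfer matrices.\<close>

lemma ev_Phi_unique:
  fixes F :: "clan \<Rightarrow> xypoly"
  assumes sorted: "\<And>\<gamma>. is_clan p q \<gamma> \<Longrightarrow> upper \<gamma> = {1..p} \<Longrightarrow>
      (\<And>a b. p < a \<Longrightarrow> a < b \<Longrightarrow> b \<le> p + q \<Longrightarrow> mate \<gamma> a < mate \<gamma> b) \<Longrightarrow>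
      F \<gamma> = (\<Prod>(a, m)\<in>{(a, m). a \<in> {1..p} \<and> m \<in> {p + 1..p + q} \<and> a < mate \<gamma> m}. Y a - Y m)"
    and ascent: "\<And>\<gamma> i. is_clan p q \<gamma> \<Longrightarrow> upper \<gamma> = {1..p} \<Longrightarrow> p < i \<Longrightarrow> i < p + q \<Longrightarrow> ascent \<gamma> i \<Longrightarrow>
      (Y i - Y (Suc i)) * F (swap_nodes i \<gamma>) = F \<gamma> - swap_y i (F \<gamma>)"
    and "is_clan p q \<gamma>" "upper \<gamma> = {1..p}"
  shows "F \<gamma> = ev (p + q) id (Phi (p + q) \<gamma>)"
  using assms(3,4)
proof (induction "nat (clan_length \<gamma> + int ((p + q) * (p + q)))" arbitrary: \<gamma> rule: less_induct)
  case less
  note \<gamma> = less.prems(1) and u = less.prems(2)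
  show ?case
  proof (cases "\<forall>a b. p < a \<longrightarrow> a < b \<longrightarrow> b \<le> p + q \<longrightarrow> mate \<gamma> a < mate \<gamma> b")
    case True
    then show ?thesis using sorted[OF \<gamma> u] ev_Phi_sorted[OF \<gamma> u] by simp
  next
    case False
    then obtain a b where ab: "p < a" "a < b" "b \<le> p + q" "\<not> mate \<gamma> a < mate \<gamma> b" by blast
    then have "mate \<gamma> b < mate \<gamma> a" using mate_inject[OF \<gamma>, of a b] by linarith
    from not_sorted_descent[OF ab(2) this] obtain i where "a \<le> i" "i < b" "mate \<gamma> (Suc i) < mate \<gamma> i" by blast
    then have i: "p < i" "i < p + q" "mate \<gamma> (Suc i) < mate \<gamma> i" using ab by simp_all
    have i1: "1 \<le> i" using i by simp
    have na: "mate \<gamma> i \<noteq> Suc i" using in_upper_iff[OF \<gamma>, of i] i unfolding u by auto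
    define \<delta> where "\<delta> = swap_nodes i \<gamma>"
    note pr = clan_predecessor[OF \<gamma> i1 i(2,3) na, folded \<delta>_def]
    have u': "upper \<delta> = {1..p}"
    proof (rule set_eqI)
      fix k
      show "k \<in> upper \<delta> \<longleftrightarrow> k \<in> {1..p}"
        unfolding pr(6) simple_refl_image_iff u using i by (cases "k = i"; cases "k = Suc i") auto
    qed
    have "nat (clan_length \<delta> + int ((p + q) * (p + q))) < nat (clan_length \<gamma> + int ((p + q) * (p + q)))"
      using clan_length_lower[OF pr(1)] pr(4) by linarith
    from less.hyps[OF this pr(1) u'] have IH: "F \<delta> = ev (p + q) id (Phi (p + q) \<delta>)" .
    have "divided_diff i (Phi (p + q) \<delta>) = Phi (p + q) \<gamma>"
      using divided_diff_Phi[OF pr(1) i1 i(2)] pr(2,4) by simp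
    then have "(Y i - Y (Suc i)) * ev (p + q) id (Phi (p + q) \<gamma>) = (Y i - Y (Suc i)) * F \<gamma>"
      using ev_divided_diff_Phi[OF pr(1) i(1,2)] ascent[OF pr(1) u' i(1,2) pr(3)] IH pr(5) by simp
    then show ?thesis by simp
  qed
qed

section \<open>Fragments as colourings\<close>

definition tW :: "tile \<Rightarrow> bool" where "tW t \<longleftrightarrow> t \<in> {Horizontal, Cross, ElbowWN}"
definition tE :: "tile \<Rightarrow> bool" where "tE t \<longleftrightarrow> t \<in> {Horizontal, Cross, ElbowSE}"
definition tN :: "tile \<Rightarrow> bool" where "tN t \<longleftrightarrow> t \<in> {Vertical, Cross, ElbowWN}"
definition tS :: "tile \<Rightarrow> bool" where "tS t \<longleftrightarrow> t \<in> {Vertical, Cross, ElbowSE}"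

lemmas t_defs = tW_def tE_def tN_def tS_def

text \<open>Segments are oriented from the south or west edge to the north or east edge, so this
  relation follows a pipe from its entry to its exit. The full rectangle is the diagram of every
  clan with \<open>upper \<gamma> = {1..p}\<close>.\<close>

definition box_rel :: "nat \<Rightarrow> nat \<Rightarrow> (nat \<times> nat \<Rightarrow> tile) \<Rightarrow> (edge \<times> edge) set" where
  "box_rel p q \<pi> = (\<Union>b\<in>{1..p} \<times> {1..q}. segments b (\<pi> b))"

lemma segments_iff:
  "(x, y) \<in> segments (Suc a, Suc b) t \<longleftrightarrow>
    t \<in> {Horizontal, Cross} \<and> x = VEdge (Suc a) b \<and> y = VEdge (Suc a) (Suc b) \<or>
    t \<in> {Vertical, Cross} \<and> x = HEdge (Suc a) (Suc b) \<and> y = HEdge a (Suc b) \<or>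
    t = ElbowWN \<and> x = VEdge (Suc a) b \<and> y = HEdge a (Suc b) \<or>
    t = ElbowSE \<and> x = HEdge (Suc a) (Suc b) \<and> y = VEdge (Suc a) (Suc b)"
  by (cases t) auto

lemma touches_iff:
  "touches (Suc a, Suc b) t (VEdge (Suc a) b) \<longleftrightarrow> tW t"
  "touches (Suc a, Suc b) t (VEdge (Suc a) (Suc b)) \<longleftrightarrow> tE t"
  "touches (Suc a, Suc b) t (HEdge a (Suc b)) \<longleftrightarrow> tN t"
  "touches (Suc a, Suc b) t (HEdge (Suc a) (Suc b)) \<longleftrightarrow> tS t"
  by (cases t; simp add: touches_def t_defs Field_def)+

lemma box_rel_iff:
  "(x, y) \<in> box_rel p q \<pi> \<longleftrightarrow> (\<exists>a<p. \<exists>b<q. (x, y) \<in> segments (Suc a, Suc b) (\<pi> (Suc a, Suc b)))"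
proof
  assume "(x, y) \<in> box_rel p q \<pi>"
  then obtain i j where ij: "i \<in> {1..p}" "j \<in> {1..q}" "(x, y) \<in> segments (i, j) (\<pi> (i, j))"
    unfolding box_rel_def by blast
  obtain a b where "i = Suc a" "j = Suc b" using ij(1,2) by (cases i; cases j) auto
  then have "a < p" "b < q" using ij by simp_all
  then show "\<exists>a<p. \<exists>b<q. (x, y) \<in> segments (Suc a, Suc b) (\<pi> (Suc a, Suc b))"
    using ij(3) \<open>i = Suc a\<close> \<open>j = Suc b\<close> by blast
next
  assume "\<exists>a<p. \<exists>b<q. (x, y) \<in> segments (Suc a, Suc b) (\<pi> (Suc a, Suc b))"
  then obtain a b where ab: "a < p" "b < q" "(x, y) \<in> segments (Suc a, Suc b) (\<pi> (Suc a, Suc b))" by blast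
  moreover have "(Suc a, Suc b) \<in> {1..p} \<times> {1..q}" using ab by simp
  ultimately show "(x, y) \<in> box_rel p q \<pi>" unfolding box_rel_def by blast
qed

lemma box_rel_cases [consumes 1, case_names WE SN WN SE]:
  assumes "(x, y) \<in> box_rel p q \<pi>"
  obtains a b where "a < p" "b < q" "\<pi> (Suc a, Suc b) \<in> {Horizontal, Cross}"
      "x = VEdge (Suc a) b" "y = VEdge (Suc a) (Suc b)"
    | a b where "a < p" "b < q" "\<pi> (Suc a, Suc b) \<in> {Vertical, Cross}"
      "x = HEdge (Suc a) (Suc b)" "y = HEdge a (Suc b)"
    | a b where "a < p" "b < q" "\<pi> (Suc a, Suc b) = ElbowWN"
      "x = VEdge (Suc a) b" "y = HEdge a (Suc b)"
    | a b where "a < p" "b < q" "\<pi> (Suc a, Suc b) = ElbowSE"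
      "x = HEdge (Suc a) (Suc b)" "y = VEdge (Suc a) (Suc b)"
  using assms unfolding box_rel_iff segments_iff by blast

lemma box_rel_intros:
  assumes "a < p" "b < q"
  shows "\<pi> (Suc a, Suc b) \<in> {Horizontal, Cross} \<Longrightarrow> (VEdge (Suc a) b, VEdge (Suc a) (Suc b)) \<in> box_rel p q \<pi>"
    "\<pi> (Suc a, Suc b) \<in> {Vertical, Cross} \<Longrightarrow> (HEdge (Suc a) (Suc b), HEdge a (Suc b)) \<in> box_rel p q \<pi>"
    "\<pi> (Suc a, Suc b) = ElbowWN \<Longrightarrow> (VEdge (Suc a) b, HEdge a (Suc b)) \<in> box_rel p q \<pi>"
    "\<pi> (Suc a, Suc b) = ElbowSE \<Longrightarrow> (HEdge (Suc a) (Suc b), VEdge (Suc a) (Suc b)) \<in> box_rel p q \<pi>"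
  unfolding box_rel_iff segments_iff using assms by blast+

lemma box_rel_single_valued:
  assumes "(x, y) \<in> box_rel p q \<pi>" "(x, z) \<in> box_rel p q \<pi>"
  shows "y = z"
  using assms(1) by (cases rule: box_rel_cases; use assms(2) in \<open>cases rule: box_rel_cases\<close>) auto

lemma box_rel_terminal: "(VEdge i q, y) \<notin> box_rel p q \<pi>"
proof
  assume "(VEdge i q, y) \<in> box_rel p q \<pi>"
  then show False by (cases rule: box_rel_cases) auto
qed

text \<open>Elements connected along a partial function have a common iterated image; if one of them
  has no image, it must be that common image itself.\<close>

lemma rtrancl_terminal:
  assumes sv: "\<And>x y z. (x, y) \<in> R \<Longrightarrow> (x, z) \<in> R \<Longrightarrow> y = z" and tm: "\<And>y. (e, y) \<notin> R"
    and "(e, f) \<in> (R \<union> R\<inverse>)\<^sup>*"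
  shows "(f, e) \<in> R\<^sup>*"
  using assms(3)
proof (induction rule: rtrancl_induct)
  case (step y z)
  then consider "(y, z) \<in> R" | "(z, y) \<in> R" by blast
  then show ?case
  proof cases
    case 1
    from step.IH show ?thesis
    proof (cases rule: converse_rtranclE)
      case base
      then show ?thesis using 1 tm by blast
    next
      case (step w)
      then show ?thesis using sv[OF 1 step(1)] by simp
    qed
  next
    case 2
    then show ?thesis using step.IH by (rule converse_rtrancl_into_rtrancl)
  qed
qed simp

lemma sym_rtrancl: "sym ((R \<union> R\<inverse>)\<^sup>*)"
  by (intro sym_rtrancl) (auto simp: sym_def)

abbreviation conn :: "nat \<Rightarrow> nat \<Rightarrow> (nat \<times> nat \<Rightarrow> tile) \<Rightarrow> (edge \<times> edge) set" where
  "conn p q \<pi> \<equiv> (box_rel p q \<pi> \<union> (box_rel p q \<pi>)\<inverse>)\<^sup>*"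

lemma pipe_iff: "f \<in> pipe ({1..p} \<times> {1..q}) \<pi> e \<longleftrightarrow> (e, f) \<in> conn p q \<pi>"
  by (simp add: pipe_def box_rel_def Let_def)

lemma pipe_cong:
  assumes "(e, g) \<in> (box_rel p q \<pi>)\<^sup>*" "(f, g) \<in> (box_rel p q \<pi>)\<^sup>*"
  shows "pipe ({1..p} \<times> {1..q}) \<pi> e = pipe ({1..p} \<times> {1..q}) \<pi> f"
proof -
  have sub: "(box_rel p q \<pi>)\<^sup>* \<subseteq> conn p q \<pi>" by (rule rtrancl_mono) blast
  have "(e, g) \<in> conn p q \<pi>" "(f, g) \<in> conn p q \<pi>" using assms sub by blast+
  then have "(e, f) \<in> conn p q \<pi>" "(f, e) \<in> conn p q \<pi>"
    using sym_rtrancl[of "box_rel p q \<pi>"] by (meson rtrancl_trans symD)+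
  then show ?thesis unfolding set_eq_iff pipe_iff by (meson rtrancl_trans)
qed

text \<open>Every step goes north or east, so the walk stops, and as long as \<open>T\<close> holds
  it can stop only on the east border. The extra 1 in the measure accounts for an elbow from the
  south to the east edge of a box, since these two edges have the same indices.\<close>

lemma reach_east:
  assumes V: "\<And>a b. a < p \<Longrightarrow> b < q \<Longrightarrow> T (VEdge (Suc a) b) \<Longrightarrow> \<exists>y. (VEdge (Suc a) b, y) \<in> box_rel p q \<pi> \<and> T y"
    and H: "\<And>a b. a < p \<Longrightarrow> b < q \<Longrightarrow> T (HEdge (Suc a) (Suc b)) \<Longrightarrow>
      \<exists>y. (HEdge (Suc a) (Suc b), y) \<in> box_rel p q \<pi> \<and> T y"
    and grid: "\<And>i j. T (VEdge i j) \<Longrightarrow> 1 \<le> i \<and> i \<le> p \<and> j \<le> q" "\<And>i j. T (HEdge i j) \<Longrightarrow> 1 \<le> i \<and> i \<le> p \<and> 1 \<le> j \<and> j \<le> q"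
    and "T e"
  shows "\<exists>i<p. (e, VEdge (Suc i) q) \<in> (box_rel p q \<pi>)\<^sup>*"
  using assms(5)
proof (induction "case e of VEdge i j \<Rightarrow> 2 * (q - j) + 2 * i | HEdge i j \<Rightarrow> 2 * (q - j) + 2 * i + 1" arbitrary: e rule: less_induct)
  case less
  show ?case
  proof (cases "\<exists>y. (e, y) \<in> box_rel p q \<pi> \<and> T y")
    case True
    then obtain y where y: "(e, y) \<in> box_rel p q \<pi>" "T y" by blast
    have "(case y of VEdge i j \<Rightarrow> 2 * (q - j) + 2 * i | HEdge i j \<Rightarrow> 2 * (q - j) + 2 * i + 1)
      < (case e of VEdge i j \<Rightarrow> 2 * (q - j) + 2 * i | HEdge i j \<Rightarrow> 2 * (q - j) + 2 * i + 1)"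
      using y(1) by (cases rule: box_rel_cases) auto
    from less.hyps[OF this y(2)] obtain i where "i < p" "(y, VEdge (Suc i) q) \<in> (box_rel p q \<pi>)\<^sup>*" by blast
    then show ?thesis using y(1) by (meson converse_rtrancl_into_rtrancl)
  next
    case False
    show ?thesis
    proof (cases e)
      case (VEdge i j)
      then have ij: "1 \<le> i" "i \<le> p" "j \<le> q" using grid less.prems by blast+
      obtain a where a: "i = Suc a" using ij by (cases i) auto
      have "\<not> j < q"
      proof
        assume "j < q"
        then show False using V[of a j] False less.prems VEdge a ij by auto
      qed
      then show ?thesis using VEdge a ij by (intro exI[of _ a]) simp
    next
      case (HEdge i j)
      then have ij: "1 \<le> i" "i \<le> p" "1 \<le> j" "j \<le> q" using grid less.prems by blast+
      obtain a b where ab: "i = Suc a" "j = Suc b" using ij by (cases i; cases j) auto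
      show ?thesis using H[of a b] False less.prems HEdge ab ij by auto
    qed
  qed
qed

lemma reach_south:
  assumes V: "\<And>a b. a < p \<Longrightarrow> b < q \<Longrightarrow> T (VEdge (Suc a) (Suc b)) \<Longrightarrow> \<exists>y. (y, VEdge (Suc a) (Suc b)) \<in> box_rel p q \<pi> \<and> T y"
    and H: "\<And>a b. a < p \<Longrightarrow> b < q \<Longrightarrow> T (HEdge a (Suc b)) \<Longrightarrow> \<exists>y. (y, HEdge a (Suc b)) \<in> box_rel p q \<pi> \<and> T y"
    and grid: "\<And>i j. T (VEdge i j) \<Longrightarrow> 1 \<le> i \<and> i \<le> p \<and> 1 \<le> j \<and> j \<le> q" "\<And>i j. T (HEdge i j) \<Longrightarrow> i \<le> p \<and> 1 \<le> j \<and> j \<le> q"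
    and "T e"
  shows "\<exists>j<q. (HEdge p (Suc j), e) \<in> (box_rel p q \<pi>)\<^sup>*"
  using assms(5)
proof (induction "case e of VEdge i j \<Rightarrow> 2 * j + 2 * (p - i) + 1 | HEdge i j \<Rightarrow> 2 * j + 2 * (p - i)" arbitrary: e rule: less_induct)
  case less
  show ?case
  proof (cases "\<exists>y. (y, e) \<in> box_rel p q \<pi> \<and> T y")
    case True
    then obtain y where y: "(y, e) \<in> box_rel p q \<pi>" "T y" by blast
    have "(case y of VEdge i j \<Rightarrow> 2 * j + 2 * (p - i) + 1 | HEdge i j \<Rightarrow> 2 * j + 2 * (p - i))
      < (case e of VEdge i j \<Rightarrow> 2 * j + 2 * (p - i) + 1 | HEdge i j \<Rightarrow> 2 * j + 2 * (p - i))"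
      using y(1) by (cases rule: box_rel_cases) auto
    from less.hyps[OF this y(2)] obtain j where "j < q" "(HEdge p (Suc j), y) \<in> (box_rel p q \<pi>)\<^sup>*" by blast
    then show ?thesis using y(1) by (meson rtrancl_into_rtrancl)
  next
    case False
    show ?thesis
    proof (cases e)
      case (VEdge i j)
      then have ij: "1 \<le> i" "i \<le> p" "1 \<le> j" "j \<le> q" using grid less.prems by blast+
      obtain a b where ab: "i = Suc a" "j = Suc b" using ij by (cases i; cases j) auto
      show ?thesis using V[of a b] False less.prems VEdge ab ij by auto
    next
      case (HEdge i j)
      then have ij: "i \<le> p" "1 \<le> j" "j \<le> q" using grid less.prems by blast+
      obtain b where b: "j = Suc b" using ij by (cases j) auto
      have "\<not> i < p"
      proof
        assume "i < p"
        then show False using H[of i b] False less.prems HEdge b ij by auto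
      qed
      then show ?thesis using HEdge b ij by (intro exI[of _ b]) simp
    qed
  qed
qed

subsection \<open>Crossings\<close>

text \<open>The colours along a cut through the rectangle form a word on which each box acts at two
  adjacent positions.\<close>
locale cut_words =
  fixes N :: nat and W :: "nat \<Rightarrow> nat \<Rightarrow> nat" and t :: "nat \<Rightarrow> nat" and sw :: "nat \<Rightarrow> bool"
  assumes step: "k < N \<Longrightarrow> W (Suc k) = (if sw k then W k \<circ> simple_refl (t k) else W k)"
    and start: "a < b \<Longrightarrow> W 0 a \<noteq> 0 \<Longrightarrow> W 0 b \<noteq> 0 \<Longrightarrow> W 0 b < W 0 a"
begin

definition crossing :: "nat \<Rightarrow> bool" where
  "crossing k \<longleftrightarrow> sw k \<and> W k (t k) \<noteq> 0 \<and> W k (Suc (t k)) \<noteq> 0"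

lemma distinct: "k \<le> N \<Longrightarrow> W k a = W k b \<Longrightarrow> W k a \<noteq> 0 \<Longrightarrow> a = b"
proof (induction k arbitrary: a b)
  case 0
  then show ?case using start[of a b] start[of b a] by (cases a b rule: linorder_cases) auto
next
  case (Suc k)
  then have k: "k < N" by simp
  show ?case
  proof (cases "sw k")
    case True
    then have "simple_refl (t k) a = simple_refl (t k) b"
      using Suc.IH[of "simple_refl (t k) a" "simple_refl (t k) b"] Suc.prems step[OF k] by simp
    then show ?thesis by simp
  next
    case False
    then show ?thesis using Suc step[OF k] by simp
  qed
qed

text \<open>The nonzero letters start in decreasing order and only neighbours are exchanged, so two
  letters in increasing order must have been exchanged with each other.\<close>

lemma inverted_crossing:
  "k \<le> N \<Longrightarrow> a < b \<Longrightarrow> W k a \<noteq> 0 \<Longrightarrow> W k a < W k b \<Longrightarrow>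
    \<exists>k'<k. crossing k' \<and> {W k' (t k'), W k' (Suc (t k'))} = {W k a, W k b}"
proof (induction k arbitrary: a b)
  case 0
  then show ?case using start[of a b] by simp
next
  case (Suc k)
  have kN: "k < N" using Suc.prems by simp
  show ?case
  proof (cases "sw k")
    case False
    then have W: "W (Suc k) = W k" using step[OF kN] by simp
    show ?thesis using Suc.IH[of a b] Suc.prems kN unfolding W by (meson less_SucI less_imp_le)
  next
    case True
    then have W: "W (Suc k) = W k \<circ> simple_refl (t k)" using step[OF kN] by simp
    let ?s = "simple_refl (t k)"
    show ?thesis
    proof (cases "(a, b) = (t k, Suc (t k))")
      case True
      then have "crossing k" using Suc.prems \<open>sw k\<close> W by (auto simp: crossing_def)
      moreover have "{W k (t k), W k (Suc (t k))} = {W (Suc k) a, W (Suc k) b}" using True W by auto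
      ultimately show ?thesis by blast
    next
      case False
      then have "?s a < ?s b" using simple_refl_less[OF Suc.prems(2)] by blast
      from Suc.IH[OF _ this] Suc.prems W kN show ?thesis by (auto intro: less_SucI)
    qed
  qed
qed

text \<open>A crossing that meets the larger letter first never exchanges a pair that is already in
  increasing order.\<close>

lemma inverted_persists:
  assumes desc: "\<And>k. k < N \<Longrightarrow> crossing k \<Longrightarrow> W k (Suc (t k)) < W k (t k)"
    and xy: "y \<noteq> 0" "y < x" and "k \<le> k'" "k' \<le> N" "\<exists>a b. a < b \<and> W k a = y \<and> W k b = x"
  shows "\<exists>a b. a < b \<and> W k' a = y \<and> W k' b = x"
  using assms(4,5)
proof (induction k' rule: dec_induct)
  case base
  show ?case by (rule assms(6))
next
  case (step m)
  then obtain a b where ab: "a < b" "W m a = y" "W m b = x" by auto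
  have mN: "m < N" using step.prems by simp
  show ?case
  proof (cases "sw m")
    case False
    then show ?thesis using cut_words_axioms ab mN unfolding cut_words_def by auto
  next
    case True
    have W: "W (Suc m) = W m \<circ> simple_refl (t m)" using True cut_words_axioms mN unfolding cut_words_def by auto
    have "(a, b) \<noteq> (t m, Suc (t m))" using desc[OF mN] ab xy True by (auto simp: crossing_def)
    then have "simple_refl (t m) a < simple_refl (t m) b" using simple_refl_less[OF ab(1)] by blast
    moreover have "W (Suc m) (simple_refl (t m) a) = y" "W (Suc m) (simple_refl (t m) b) = x" using W ab by simp_all
    ultimately show ?thesis by blast
  qed
qed

text \<open>A crossing that meets the smaller letter first undoes an earlier crossing of the same
  pair. Conversely, if none does so, an inverted pair stays inverted and is not crossed
  again.\<close>

lemma crossings_once_iff: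
  "(\<forall>k k'. k < k' \<and> k' < N \<and> crossing k \<and> crossing k' \<longrightarrow>
      {W k (t k), W k (Suc (t k))} \<noteq> {W k' (t k'), W k' (Suc (t k'))}) \<longleftrightarrow>
    (\<forall>k<N. crossing k \<longrightarrow> W k (Suc (t k)) < W k (t k))" (is "?L \<longleftrightarrow> ?R")
proof
  assume L: ?L
  show ?R
  proof (intro allI impI, rule ccontr)
    fix k assume k: "k < N" "crossing k" "\<not> W k (Suc (t k)) < W k (t k)"
    then have "W k (t k) \<noteq> W k (Suc (t k))" using distinct[of k "t k" "Suc (t k)"] by (auto simp: crossing_def)
    then have "W k (t k) < W k (Suc (t k))" using k by simp
    from inverted_crossing[of k "t k" "Suc (t k)"] this k obtain k' where
      "k' < k" "crossing k'" "{W k' (t k'), W k' (Suc (t k'))} = {W k (t k), W k (Suc (t k))}"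
      by (auto simp: crossing_def)
    then show False using L k(1,2) by blast
  qed
next
  assume R: ?R
  show ?L
  proof (intro allI impI notI)
    fix k k' assume A: "k < k' \<and> k' < N \<and> crossing k \<and> crossing k'"
      and E: "{W k (t k), W k (Suc (t k))} = {W k' (t k'), W k' (Suc (t k'))}"
    define x y where "x = W k (t k)" and "y = W k (Suc (t k))"
    have k: "k < N" "crossing k" "k' < N" "crossing k'" "Suc k \<le> k'" "k' \<le> N" using A by auto
    have xy: "y < x" "y \<noteq> 0" using R k by (auto simp: x_def y_def crossing_def)
    have W: "W (Suc k) = W k \<circ> simple_refl (t k)" using step[OF k(1)] k(2) by (simp add: crossing_def)
    have "\<exists>a b. a < b \<and> W (Suc k) a = y \<and> W (Suc k) b = x"
      by (rule exI[of _ "t k"], rule exI[of _ "Suc (t k)"]) (simp add: W x_def y_def)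
    from inverted_persists[OF _ xy(2,1) k(5,6) this] R obtain a b where ab: "a < b" "W k' a = y" "W k' b = x" by blast
    have "W k' (Suc (t k')) < W k' (t k')" using R k by blast
    then have "W k' (t k') = x" "W k' (Suc (t k')) = y" using E xy unfolding x_def[symmetric] y_def[symmetric]
      by (auto simp: doubleton_eq_iff)
    then have "a = Suc (t k')" "b = t k'" using distinct[OF k(6), of a "Suc (t k')"] distinct[OF k(6), of b "t k'"] ab xy by auto
    then show False using ab(1) by simp
  qed
qed

end

text \<open>The edges come in the order north, east, west, south: a sweep from the north-east
  replaces the first two colours by the last two.\<close>

definition flow :: "tile \<Rightarrow> nat \<Rightarrow> nat \<Rightarrow> nat \<Rightarrow> nat \<Rightarrow> bool" where
  "flow t n e w s \<longleftrightarrow> (case t of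
     Blank \<Rightarrow> n = 0 \<and> e = 0 \<and> w = 0 \<and> s = 0
   | Horizontal \<Rightarrow> n = 0 \<and> e \<noteq> 0 \<and> w = e \<and> s = 0
   | Vertical \<Rightarrow> n \<noteq> 0 \<and> e = 0 \<and> w = 0 \<and> s = n
   | Cross \<Rightarrow> n \<noteq> 0 \<and> e \<noteq> 0 \<and> w = e \<and> s = n
   | ElbowWN \<Rightarrow> n \<noteq> 0 \<and> e = 0 \<and> w = n \<and> s = 0
   | ElbowSE \<Rightarrow> n = 0 \<and> e \<noteq> 0 \<and> w = 0 \<and> s = e)"

definition flow_col :: "nat \<Rightarrow> nat \<Rightarrow> (nat \<times> nat \<Rightarrow> tile) \<Rightarrow> (edge \<Rightarrow> nat) \<Rightarrow> bool" where
  "flow_col p q \<pi> col \<longleftrightarrow>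
     (\<forall>a<p. \<forall>b<q. flow (\<pi> (Suc a, Suc b)) (col (HEdge a (Suc b))) (col (VEdge (Suc a) (Suc b)))
        (col (VEdge (Suc a) b)) (col (HEdge (Suc a) (Suc b)))) \<and>
     (\<forall>b<q. col (HEdge 0 (Suc b)) = 0) \<and> (\<forall>a<p. col (VEdge (Suc a) 0) = 0)"

text \<open>The rectangle is swept box by box, columns from right to left and rows from top to
  bottom. The colours along the moving cut are words as in \<open>cut_words\<close>: they start with
  the east border, where nonzero colours decrease downwards, and a box replaces its north and east
  letters by its west and south letters.\<close>

lemma crossings_order_iff:
  assumes fc: "flow_col p q \<pi> col"
    and east: "\<And>a. a < p \<Longrightarrow> col (VEdge (Suc a) q) = 0 \<or> col (VEdge (Suc a) q) = p - a"
  shows "(\<forall>a<p. \<forall>b<q. \<forall>a'<p. \<forall>b'<q. \<pi> (Suc a, Suc b) = Cross \<and> \<pi> (Suc a', Suc b') = Cross \<and>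
      {col (HEdge a (Suc b)), col (VEdge (Suc a) (Suc b))} = {col (HEdge a' (Suc b')), col (VEdge (Suc a') (Suc b'))}
      \<longrightarrow> a = a' \<and> b = b') \<longleftrightarrow>
    (\<forall>a<p. \<forall>b<q. \<pi> (Suc a, Suc b) = Cross \<longrightarrow> col (VEdge (Suc a) (Suc b)) < col (HEdge a (Suc b)))"
    (is "?L \<longleftrightarrow> ?R")
proof (cases "p = 0 \<or> q = 0")
  case True
  then show ?thesis by auto
next
  case False
  then have p: "0 < p" and q: "0 < q" by auto
  define aa where "aa k = k mod p" for k
  define bb where "bb k = q - 1 - k div p" for k
  define t where "t k = aa k + bb k" for k
  \<comment> \<open>The cut before box \<open>k\<close>, read from the north-west: top edges of
    untouched columns, west edges of the boxes done in the current column, the north edge of the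
    current box, east edges of this box and those below it, bottom edges of finished
    columns.\<close>
  define cut where "cut k s = (if s < bb k then col (HEdge 0 (Suc s))
      else if s < t k then col (VEdge (Suc (s - bb k)) (bb k))
      else if s = t k then col (HEdge (aa k) (Suc (bb k)))
      else if s \<le> p + bb k then col (VEdge (s - bb k) (Suc (bb k)))
      else if s < p + q then col (HEdge p (Suc (s - p))) else 0)" for k s
  \<comment> \<open>After the last box the cut consists of the west border, which is colourless, and
    the bottom.\<close>
  define W where "W k s = (if k < p * q then cut k s else if s < p then 0 else if s < p + q then col (HEdge p (Suc (s - p))) else 0)" for k s
  \<comment> \<open>At an elbow the letters west, south repeat the letters north, east, and a blank
    box has only zeros; in the other cases the two letters trade places.\<close>
  define sw where "sw k \<longleftrightarrow> \<pi> (Suc (aa k), Suc (bb k)) \<in> {Horizontal, Vertical, Cross}" for k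
  have aa: "aa k < p" for k using p by (simp add: aa_def)
  have bb: "bb k < q" for k using q by (simp add: bb_def)
  have fl: "flow (\<pi> (Suc (aa k), Suc (bb k))) (col (HEdge (aa k) (Suc (bb k)))) (col (VEdge (Suc (aa k)) (Suc (bb k))))
        (col (VEdge (Suc (aa k)) (bb k))) (col (HEdge (Suc (aa k)) (Suc (bb k))))" for k
    using fc aa bb unfolding flow_col_def by blast
  have Wt: "W k (t k) = col (HEdge (aa k) (Suc (bb k)))" "W k (Suc (t k)) = col (VEdge (Suc (aa k)) (Suc (bb k)))"
    if "k < p * q" for k
    using that aa[of k] by (auto simp: W_def cut_def t_def)
  have nxt: "W (Suc k) s = (if s = t k then col (VEdge (Suc (aa k)) (bb k))
      else if s = Suc (t k) then col (HEdge (Suc (aa k)) (Suc (bb k))) else W k s)" if k: "k < p * q" for k s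
  proof -
    have kd: "k div p < q" using k by (simp add: less_mult_imp_div_less mult.commute)
    show ?thesis
    proof (cases "Suc (aa k) < p")
      case True
      then have a1: "aa (Suc k) = Suc (aa k)" and b1: "bb (Suc k) = bb k"
        by (simp_all add: aa_def bb_def mod_Suc div_Suc)
      have "Suc k < p * q"
      proof -
        have "Suc k = p * (k div p) + Suc (aa k)" by (simp add: aa_def)
        also have "\<dots> < p * Suc (k div p)" using True by simp
        also have "\<dots> \<le> p * q" using kd by (intro mult_le_mono2) simp
        finally show ?thesis .
      qed
      then show ?thesis using k True by (auto simp: W_def cut_def t_def a1 b1 Suc_diff_le)
    next
      case False
      \<comment> \<open>At the foot of a column the sweep continues at the top of the column to the
        left, or ends.\<close>
      then have ap: "Suc (aa k) = p" using aa[of k] by simp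
      then have a1: "aa (Suc k) = 0" and d1: "Suc k div p = Suc (k div p)"
        by (simp_all add: aa_def mod_Suc div_Suc)
      show ?thesis
      proof (cases "Suc k < p * q")
        case True
        then have "Suc k div p < q" by (simp add: less_mult_imp_div_less mult.commute)
        then have b1: "bb k = Suc (bb (Suc k))" using d1 by (simp add: bb_def)
        consider "s < bb (Suc k)" | "s = bb (Suc k)" | "bb (Suc k) < s" by linarith
        then show ?thesis using k True ap bb[of k]
          by cases (auto simp: W_def cut_def t_def a1 b1 Suc_diff_le Suc_diff_Suc)
      next
        case False
        then have "Suc k = p * q" using k by simp
        then have "Suc (k div p) = q" using d1 p by simp
        then have b0: "bb k = 0" by (simp add: bb_def)
        have z: "col (VEdge (Suc a) 0) = 0" if "a < p" for a using fc that unfolding flow_col_def by blast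
        show ?thesis using k False ap z by (auto simp: W_def cut_def t_def b0)
      qed
    qed
  qed
  interpret cut_words "p * q" W t sw
  proof
    fix k assume k: "k < p * q"
    show "W (Suc k) = (if sw k then W k \<circ> simple_refl (t k) else W k)"
    proof
      fix s
      show "W (Suc k) s = (if sw k then W k \<circ> simple_refl (t k) else W k) s"
        using fl[of k] Wt[OF k] unfolding nxt[OF k] flow_def sw_def
        by (cases "s = t k"; cases "s = Suc (t k)") (auto split: tile.splits)
    qed
  next
    fix a b :: nat assume ab: "a < b" "W 0 a \<noteq> 0" "W 0 b \<noteq> 0"
    have pq: "0 < p * q" using p q by simp
    have z: "col (HEdge 0 (Suc b)) = 0" if "b < q" for b using fc that unfolding flow_col_def by blast
    have a0: "aa 0 = 0" "bb 0 = q - 1" "t 0 = q - 1" using p by (simp_all add: aa_def bb_def t_def)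
    have W0: "W 0 s = (if s \<le> q - 1 then 0 else if s \<le> p + (q - 1) then col (VEdge (s - (q - 1)) q) else 0)" for s
      using pq q z z[of "q - 1"] by (auto simp: W_def cut_def a0)
    have r: "q - 1 < a" "b \<le> p + (q - 1)" using ab unfolding W0 by (auto split: if_splits)
    define a' b' where "a' = a - q" and "b' = b - q"
    have e: "a - (q - 1) = Suc a'" "b - (q - 1) = Suc b'" "a' < b'" "b' < p" using r ab(1) q by (auto simp: a'_def b'_def)
    have "W 0 a = col (VEdge (Suc a') q)" "W 0 b = col (VEdge (Suc b') q)"
      unfolding W0 using r ab(1) by (simp_all add: e)
    moreover have "p - b' < p - a'" using e by linarith
    ultimately show "W 0 b < W 0 a" using east[of a'] east[of b'] ab e by auto
  qed
  have cr: "crossing k \<longleftrightarrow> \<pi> (Suc (aa k), Suc (bb k)) = Cross" if "k < p * q" for k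
    using fl[of k] unfolding crossing_def Wt[OF that] sw_def flow_def by (auto split: tile.splits)
  have surj: "\<exists>k<p * q. aa k = a \<and> bb k = b" if "a < p" "b < q" for a b
  proof (intro exI conjI)
    let ?k = "(q - 1 - b) * p + a"
    have "?k < (q - 1 - b) * p + p" using that by simp
    also have "\<dots> = Suc (q - 1 - b) * p" by simp
    also have "\<dots> \<le> q * p" using that by (intro mult_le_mono1) simp
    finally show "?k < p * q" by (simp add: mult.commute)
    show "aa ?k = a" "bb ?k = b" using that p by (simp_all add: aa_def bb_def)
  qed
  have inj: "k = k'" if "k < p * q" "k' < p * q" "aa k = aa k'" "bb k = bb k'" for k k'
  proof -
    have "k div p < q" "k' div p < q" using that by (simp_all add: less_mult_imp_div_less mult.commute)
    then have "k div p = k' div p" using that(4) by (simp add: bb_def)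
    then show ?thesis using that(3) unfolding aa_def by (metis div_mult_mod_eq)
  qed
  have L: "?L \<longleftrightarrow> (\<forall>k k'. k < k' \<and> k' < p * q \<and> crossing k \<and> crossing k' \<longrightarrow>
      {W k (t k), W k (Suc (t k))} \<noteq> {W k' (t k'), W k' (Suc (t k'))})" (is "_ \<longleftrightarrow> ?L'")
  proof
    assume L: ?L
    show ?L'
    proof (intro allI impI notI)
      fix k k' assume A: "k < k' \<and> k' < p * q \<and> crossing k \<and> crossing k'"
        and E: "{W k (t k), W k (Suc (t k))} = {W k' (t k'), W k' (Suc (t k'))}"
      then have k: "k < p * q" "k' < p * q" by auto
      have "aa k = aa k' \<and> bb k = bb k'"
        using L[rule_format, OF aa[of k] bb[of k] aa[of k'] bb[of k']] A E unfolding Wt[OF k(1)] Wt[OF k(2)] cr[OF k(1)] cr[OF k(2)] by blast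
      then show False using inj[OF k] A by simp
    qed
  next
    assume L: ?L'
    show ?L
    proof (intro allI impI)
      fix a b a' b' assume r: "a < p" "b < q" "a' < p" "b' < q"
        and A: "\<pi> (Suc a, Suc b) = Cross \<and> \<pi> (Suc a', Suc b') = Cross \<and>
          {col (HEdge a (Suc b)), col (VEdge (Suc a) (Suc b))} = {col (HEdge a' (Suc b')), col (VEdge (Suc a') (Suc b'))}"
      obtain k where k: "k < p * q" "aa k = a" "bb k = b" using surj[OF r(1,2)] by blast
      obtain k' where k': "k' < p * q" "aa k' = a'" "bb k' = b'" using surj[OF r(3,4)] by blast
      have c: "crossing k" "crossing k'" using A cr[OF k(1)] cr[OF k'(1)] k k' by auto
      have e: "{W k (t k), W k (Suc (t k))} = {W k' (t k'), W k' (Suc (t k'))}"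
        unfolding Wt[OF k(1)] Wt[OF k'(1)] k(2,3) k'(2,3) using A by blast
      have "\<not> k < k'" "\<not> k' < k" using L c e k(1) k'(1) by metis+
      then show "a = a' \<and> b = b'" using k k' by auto
    qed
  qed
  have R: "?R \<longleftrightarrow> (\<forall>k<p * q. crossing k \<longrightarrow> W k (Suc (t k)) < W k (t k))"
  proof
    assume R: ?R
    show "\<forall>k<p * q. crossing k \<longrightarrow> W k (Suc (t k)) < W k (t k)"
      using R[rule_format, OF aa bb] cr Wt by simp
  next
    assume R: "\<forall>k<p * q. crossing k \<longrightarrow> W k (Suc (t k)) < W k (t k)"
    show ?R
    proof (intro allI impI)
      fix a b assume r: "a < p" "b < q" and c: "\<pi> (Suc a, Suc b) = Cross"
      obtain k where k: "k < p * q" "aa k = a" "bb k = b" using surj[OF r] by blast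
      show "col (VEdge (Suc a) (Suc b)) < col (HEdge a (Suc b))" using R[rule_format, OF k(1)] cr[OF k(1)] c Wt[OF k(1)] k by simp
    qed
  qed
  show ?thesis unfolding L R by (rule crossings_once_iff)
qed

text \<open>A pipe is coloured by the row of its exit, counted from below, and 0 means that there is no pipe.
  So at a cross the pipes have not crossed before iff the vertical one has the larger colour.\<close>
definition bcol :: "nat \<Rightarrow> clan \<Rightarrow> nat \<Rightarrow> nat" where
  "bcol p \<gamma> k = (if k \<in> lefts \<gamma> then Suc p - k else if k \<in> rights \<gamma> then Suc p - mate \<gamma> k else 0)"

section \<open>The rectangle of a clan whose upper nodes come first\<close>

definition bedge :: "nat \<Rightarrow> nat \<Rightarrow> nat \<Rightarrow> edge" where
  "bedge p q k = (if k \<le> p then VEdge k q else HEdge p (Suc (p + q) - k))"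

lemma boundary_edge_eq:
  assumes \<gamma>: "is_clan p q \<gamma>" and u: "upper \<gamma> = {1..p}" and k: "1 \<le> k" "k \<le> p + q"
  shows "boundary_edge q \<gamma> k = bedge p q k"
proof -
  have "{1..p + q} - {1..p} = {p + 1..p + q}" by auto
  then have l: "minuses \<gamma> \<union> rights \<gamma> = {p + 1..p + q}" using compl_upper[OF \<gamma>] unfolding u by metis
  have A: "pluses \<gamma> \<union> lefts \<gamma> = {1..p}" using u by (simp add: upper_def)
  show ?thesis
  proof (cases "k \<le> p")
    case True
    have "{m \<in> {1..p}. m \<le> k} = {1..k}" "{m \<in> {p + 1..p + q}. m < k} = {}" using True by auto
    then have c: "card {m \<in> {1..p}. m \<le> k} = k" "card {m \<in> {p + 1..p + q}. m < k} = 0" by simp_all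
    have "k \<in> {1..p}" using k True by simp
    then show ?thesis using True unfolding boundary_edge_def A l bedge_def Let_def c by simp
  next
    case False
    have "{m \<in> {1..p}. m \<le> k} = {1..p}" "{m \<in> {p + 1..p + q}. m < k} = {p + 1..<k}" using False k by auto
    then have c: "card {m \<in> {1..p}. m \<le> k} = p" "card {m \<in> {p + 1..p + q}. m < k} = k - (p + 1)"
      by simp_all
    have "k \<notin> {1..p}" using False by simp
    moreover have "q - (k - (p + 1)) = Suc (p + q) - k" using False k by simp
    ultimately show ?thesis using False unfolding boundary_edge_def A l bedge_def Let_def c by simp
  qed
qed

lemma diagram_eq:
  assumes \<gamma>: "is_clan p q \<gamma>" and u: "upper \<gamma> = {1..p}"
  shows "diagram p q \<gamma> = {1..p} \<times> {1..q}"
proof (intro set_eqI, clarify, intro iffI)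
  fix i j assume "(i, j) \<in> diagram p q \<gamma>"
  then obtain k c where k: "1 \<le> i" "1 \<le> j" "k \<in> {1..p + q}" "boundary_edge q \<gamma> k = VEdge i c" "j \<le> c"
    unfolding diagram_def by blast
  then have "bedge p q k = VEdge i c" using boundary_edge_eq[OF \<gamma> u, of k] by simp
  then show "(i, j) \<in> {1..p} \<times> {1..q}" using k by (auto simp: bedge_def split: if_splits)
next
  fix i j assume "(i, j) \<in> {1..p} \<times> {1..q}"
  then have ij: "1 \<le> i" "i \<le> p" "1 \<le> j" "j \<le> q" by auto
  then have "boundary_edge q \<gamma> i = VEdge i q" "i \<in> {1..p + q}" using boundary_edge_eq[OF \<gamma> u, of i] by (auto simp: bedge_def)
  then show "(i, j) \<in> diagram p q \<gamma>" unfolding diagram_def using ij by blast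
qed

lemma ball_Suc: "(\<forall>i. i \<in> {1..p} \<longrightarrow> P i) \<longleftrightarrow> (\<forall>a<p. P (Suc a))"
proof
  assume P: "\<forall>a<p. P (Suc a)"
  show "\<forall>i. i \<in> {1..p} \<longrightarrow> P i"
  proof (intro allI impI)
    fix i assume "i \<in> {1..p}"
    then show "P i" using P by (cases i) auto
  qed
qed auto

lemma ball_prod: "(\<forall>b\<in>A \<times> B. P b) \<longleftrightarrow> (\<forall>i. i \<in> A \<longrightarrow> (\<forall>j. j \<in> B \<longrightarrow> P (i, j)))"
  by auto

definition matched :: "nat \<Rightarrow> nat \<Rightarrow> (nat \<times> nat \<Rightarrow> tile) \<Rightarrow> bool" where
  "matched p q \<pi> \<longleftrightarrow>
     (\<forall>a<p. \<forall>b. Suc b < q \<longrightarrow> tE (\<pi> (Suc a, Suc b)) = tW (\<pi> (Suc a, Suc (Suc b)))) \<and>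
     (\<forall>b<q. \<forall>a. Suc a < p \<longrightarrow> tS (\<pi> (Suc a, Suc b)) = tN (\<pi> (Suc (Suc a), Suc b))) \<and>
     (\<forall>b<q. 0 < p \<longrightarrow> \<not> tN (\<pi> (Suc 0, Suc b))) \<and> (\<forall>a<p. 0 < q \<longrightarrow> \<not> tW (\<pi> (Suc a, Suc 0)))"

definition crossing_pipes_once :: "nat \<Rightarrow> nat \<Rightarrow> (nat \<times> nat \<Rightarrow> tile) \<Rightarrow> bool" where
  "crossing_pipes_once p q \<pi> \<longleftrightarrow> (let P = pipe ({1..p} \<times> {1..q}) \<pi> in
     \<forall>a<p. \<forall>b<q. \<forall>a'<p. \<forall>b'<q. \<pi> (Suc a, Suc b) = Cross \<and> \<pi> (Suc a', Suc b') = Cross \<and>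
       {P (VEdge (Suc a) b), P (HEdge (Suc a) (Suc b))} = {P (VEdge (Suc a') b'), P (HEdge (Suc a') (Suc b'))}
       \<longrightarrow> a = a' \<and> b = b')"

lemma bpd_fragments_iff:
  assumes \<gamma>: "is_clan p q \<gamma>" and u: "upper \<gamma> = {1..p}"
  shows "\<pi> \<in> bpd_fragments p q \<gamma> \<longleftrightarrow> \<pi> \<in> ({1..p} \<times> {1..q} \<rightarrow>\<^sub>E UNIV) \<and> matched p q \<pi> \<and>
    crossing_pipes_once p q \<pi> \<and>
    (\<forall>k l. 1 \<le> k \<and> k < l \<and> l \<le> p + q \<longrightarrow> ((bedge p q k, bedge p q l) \<in> conn p q \<pi> \<longleftrightarrow> (k, l) \<in> arcs \<gamma>))"
proof -
  let ?L = "{1..p} \<times> {1..q}"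
  have 1: "(\<forall>i j. (i, j) \<in> ?L \<and> (i, Suc j) \<in> ?L \<longrightarrow>
      (touches (i, j) (\<pi> (i, j)) (VEdge i j) \<longleftrightarrow> touches (i, Suc j) (\<pi> (i, Suc j)) (VEdge i j))) \<longleftrightarrow>
    (\<forall>a<p. \<forall>b. Suc b < q \<longrightarrow> tE (\<pi> (Suc a, Suc b)) = tW (\<pi> (Suc a, Suc (Suc b))))"
  proof -
    have "(\<forall>i j. (i, j) \<in> ?L \<and> (i, Suc j) \<in> ?L \<longrightarrow>
      (touches (i, j) (\<pi> (i, j)) (VEdge i j) \<longleftrightarrow> touches (i, Suc j) (\<pi> (i, Suc j)) (VEdge i j))) \<longleftrightarrow>
      (\<forall>i. i \<in> {1..p} \<longrightarrow> (\<forall>j. j \<in> {1..q} \<longrightarrow> Suc j \<le> q \<longrightarrow>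
      (touches (i, j) (\<pi> (i, j)) (VEdge i j) \<longleftrightarrow> touches (i, Suc j) (\<pi> (i, Suc j)) (VEdge i j))))" by auto
    also have "\<dots> \<longleftrightarrow> (\<forall>a<p. \<forall>b<q. Suc (Suc b) \<le> q \<longrightarrow> tE (\<pi> (Suc a, Suc b)) = tW (\<pi> (Suc a, Suc (Suc b))))"
      unfolding ball_Suc touches_iff ..
    also have "\<dots> \<longleftrightarrow> (\<forall>a<p. \<forall>b. Suc b < q \<longrightarrow> tE (\<pi> (Suc a, Suc b)) = tW (\<pi> (Suc a, Suc (Suc b))))"
      by (auto simp: Suc_le_eq)
    finally show ?thesis .
  qed
  have 2: "(\<forall>i j. (i, j) \<in> ?L \<and> (Suc i, j) \<in> ?L \<longrightarrow>
      (touches (i, j) (\<pi> (i, j)) (HEdge i j) \<longleftrightarrow> touches (Suc i, j) (\<pi> (Suc i, j)) (HEdge i j))) \<longleftrightarrow>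
    (\<forall>b<q. \<forall>a. Suc a < p \<longrightarrow> tS (\<pi> (Suc a, Suc b)) = tN (\<pi> (Suc (Suc a), Suc b)))"
  proof -
    have "(\<forall>i j. (i, j) \<in> ?L \<and> (Suc i, j) \<in> ?L \<longrightarrow>
      (touches (i, j) (\<pi> (i, j)) (HEdge i j) \<longleftrightarrow> touches (Suc i, j) (\<pi> (Suc i, j)) (HEdge i j))) \<longleftrightarrow>
      (\<forall>j. j \<in> {1..q} \<longrightarrow> (\<forall>i. i \<in> {1..p} \<longrightarrow> Suc i \<le> p \<longrightarrow>
      (touches (i, j) (\<pi> (i, j)) (HEdge i j) \<longleftrightarrow> touches (Suc i, j) (\<pi> (Suc i, j)) (HEdge i j))))" by auto
    also have "\<dots> \<longleftrightarrow> (\<forall>b<q. \<forall>a<p. Suc (Suc a) \<le> p \<longrightarrow> tS (\<pi> (Suc a, Suc b)) = tN (\<pi> (Suc (Suc a), Suc b)))"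
      unfolding ball_Suc touches_iff ..
    also have "\<dots> \<longleftrightarrow> (\<forall>b<q. \<forall>a. Suc a < p \<longrightarrow> tS (\<pi> (Suc a, Suc b)) = tN (\<pi> (Suc (Suc a), Suc b)))"
      by (auto simp: Suc_le_eq)
    finally show ?thesis .
  qed
  have 3: "(\<forall>j. (1, j) \<in> ?L \<longrightarrow> \<not> touches (1, j) (\<pi> (1, j)) (north (1, j))) \<longleftrightarrow> (\<forall>b<q. 0 < p \<longrightarrow> \<not> tN (\<pi> (Suc 0, Suc b)))"
  proof -
    have "(\<forall>j. (1, j) \<in> ?L \<longrightarrow> \<not> touches (1, j) (\<pi> (1, j)) (north (1, j))) \<longleftrightarrow>
      (\<forall>j. j \<in> {1..q} \<longrightarrow> 0 < p \<longrightarrow> \<not> touches (Suc 0, j) (\<pi> (Suc 0, j)) (HEdge 0 j))" by (auto simp: One_nat_def)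
    then show ?thesis unfolding ball_Suc touches_iff .
  qed
  have 4: "(\<forall>i. (i, 1) \<in> ?L \<longrightarrow> \<not> touches (i, 1) (\<pi> (i, 1)) (west (i, 1))) \<longleftrightarrow> (\<forall>a<p. 0 < q \<longrightarrow> \<not> tW (\<pi> (Suc a, Suc 0)))"
  proof -
    have "(\<forall>i. (i, 1) \<in> ?L \<longrightarrow> \<not> touches (i, 1) (\<pi> (i, 1)) (west (i, 1))) \<longleftrightarrow>
      (\<forall>i. i \<in> {1..p} \<longrightarrow> 0 < q \<longrightarrow> \<not> touches (i, Suc 0) (\<pi> (i, Suc 0)) (VEdge i 0))" by (auto simp: One_nat_def)
    then show ?thesis unfolding ball_Suc touches_iff .
  qed
  have 5: "(\<forall>b \<in> ?L. \<forall>b' \<in> ?L. \<pi> b = Cross \<and> \<pi> b' = Cross \<and>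
           {pipe ?L \<pi> (west b), pipe ?L \<pi> (south b)} = {pipe ?L \<pi> (west b'), pipe ?L \<pi> (south b')} \<longrightarrow> b = b')
    \<longleftrightarrow> crossing_pipes_once p q \<pi>"
  proof -
    have "(\<forall>b \<in> ?L. \<forall>b' \<in> ?L. \<pi> b = Cross \<and> \<pi> b' = Cross \<and>
           {pipe ?L \<pi> (west b), pipe ?L \<pi> (south b)} = {pipe ?L \<pi> (west b'), pipe ?L \<pi> (south b')} \<longrightarrow> b = b')
      \<longleftrightarrow> (\<forall>i. i \<in> {1..p} \<longrightarrow> (\<forall>j. j \<in> {1..q} \<longrightarrow> (\<forall>i'. i' \<in> {1..p} \<longrightarrow> (\<forall>j'. j' \<in> {1..q} \<longrightarrow>
        \<pi> (i, j) = Cross \<and> \<pi> (i', j') = Cross \<and>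
           {pipe ?L \<pi> (VEdge i (j - 1)), pipe ?L \<pi> (HEdge i j)} = {pipe ?L \<pi> (VEdge i' (j' - 1)), pipe ?L \<pi> (HEdge i' j')}
           \<longrightarrow> i = i' \<and> j = j'))))" by (simp only: ball_prod west.simps south.simps prod.inject)
    also have "\<dots> \<longleftrightarrow> crossing_pipes_once p q \<pi>"
      unfolding ball_Suc crossing_pipes_once_def Let_def by simp
    finally show ?thesis .
  qed
  have 6: "(\<forall>k l. 1 \<le> k \<and> k < l \<and> l \<le> p + q \<longrightarrow>
      (boundary_edge q \<gamma> l \<in> pipe ?L \<pi> (boundary_edge q \<gamma> k) \<longleftrightarrow> (k, l) \<in> arcs \<gamma>)) \<longleftrightarrow>
    (\<forall>k l. 1 \<le> k \<and> k < l \<and> l \<le> p + q \<longrightarrow> ((bedge p q k, bedge p q l) \<in> conn p q \<pi> \<longleftrightarrow> (k, l) \<in> arcs \<gamma>))"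
  proof -
    have "boundary_edge q \<gamma> l \<in> pipe ?L \<pi> (boundary_edge q \<gamma> k) \<longleftrightarrow> (bedge p q k, bedge p q l) \<in> conn p q \<pi>"
      if "1 \<le> k" "k < l" "l \<le> p + q" for k l
      using boundary_edge_eq[OF \<gamma> u, of k] boundary_edge_eq[OF \<gamma> u, of l] that by (simp add: pipe_iff)
    then show ?thesis by blast
  qed
  show ?thesis
    unfolding bpd_fragments_def Let_def diagram_eq[OF \<gamma> u] mem_Collect_eq 1 2 3 4 5 6 matched_def by blast
qed

subsection \<open>Colourings from fragments\<close>

locale matched_tiling =
  fixes p q :: nat and \<pi> :: "nat \<times> nat \<Rightarrow> tile"
  assumes matched: "matched p q \<pi>"
begin

text \<open>A border edge belongs to one box only, hence the two alternatives; on inner edges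
  \<open>matched\<close> makes them agree.\<close>

definition T :: "edge \<Rightarrow> bool" where
  "T e = (case e of
     VEdge i j \<Rightarrow> 1 \<le> i \<and> i \<le> p \<and> (j < q \<and> tW (\<pi> (i, Suc j)) \<or> 1 \<le> j \<and> j \<le> q \<and> tE (\<pi> (i, j)))
   | HEdge i j \<Rightarrow> 1 \<le> j \<and> j \<le> q \<and> (i < p \<and> tN (\<pi> (Suc i, j)) \<or> 1 \<le> i \<and> i \<le> p \<and> tS (\<pi> (i, j))))"

lemma T_box:
  assumes "a < p" "b < q"
  shows "T (VEdge (Suc a) b) \<longleftrightarrow> tW (\<pi> (Suc a, Suc b))" "T (VEdge (Suc a) (Suc b)) \<longleftrightarrow> tE (\<pi> (Suc a, Suc b))"
    "T (HEdge a (Suc b)) \<longleftrightarrow> tN (\<pi> (Suc a, Suc b))" "T (HEdge (Suc a) (Suc b)) \<longleftrightarrow> tS (\<pi> (Suc a, Suc b))"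
proof -
  note m = matched[unfolded matched_def]
  show "T (VEdge (Suc a) b) \<longleftrightarrow> tW (\<pi> (Suc a, Suc b))"
    using assms m by (cases b) (auto simp: T_def)
  show "T (VEdge (Suc a) (Suc b)) \<longleftrightarrow> tE (\<pi> (Suc a, Suc b))"
    using assms m by (auto simp: T_def)
  show "T (HEdge a (Suc b)) \<longleftrightarrow> tN (\<pi> (Suc a, Suc b))"
    using assms m by (cases a) (auto simp: T_def)
  show "T (HEdge (Suc a) (Suc b)) \<longleftrightarrow> tS (\<pi> (Suc a, Suc b))"
    using assms m by (auto simp: T_def)
qed

lemma T_grid:
  "T (VEdge i j) \<Longrightarrow> 1 \<le> i \<and> i \<le> p \<and> 1 \<le> j \<and> j \<le> q"
  "T (HEdge i j) \<Longrightarrow> 1 \<le> i \<and> i \<le> p \<and> 1 \<le> j \<and> j \<le> q"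
proof -
  note m = matched[unfolded matched_def]
  assume T: "T (VEdge i j)"
  then obtain a where a: "i = Suc a" "a < p" by (cases i) (auto simp: T_def)
  have "j \<noteq> 0"
  proof
    assume "j = 0"
    then show False using T m a by (auto simp: T_def)
  qed
  then show "1 \<le> i \<and> i \<le> p \<and> 1 \<le> j \<and> j \<le> q" using T by (auto simp: T_def)
next
  note m = matched[unfolded matched_def]
  assume T: "T (HEdge i j)"
  then obtain b where b: "j = Suc b" "b < q" by (cases j) (auto simp: T_def)
  have "i \<noteq> 0"
  proof
    assume "i = 0"
    then show False using T m b by (auto simp: T_def)
  qed
  then show "1 \<le> i \<and> i \<le> p \<and> 1 \<le> j \<and> j \<le> q" using T by (auto simp: T_def)
qed

lemma T_rel: "(x, y) \<in> box_rel p q \<pi> \<Longrightarrow> T x \<and> T y"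
  by (cases rule: box_rel_cases) (auto simp: T_box t_defs)

lemma T_conn:
  assumes "(x, y) \<in> conn p q \<pi>" "x \<noteq> y"
  shows "T x" "T y"
proof -
  show "T x" using assms(1)
    by (cases rule: converse_rtranclE) (use assms(2) T_rel in blast)+
  show "T y" using assms(1)
    by (cases rule: rtranclE) (use assms(2) T_rel in blast)+
qed

lemma T_exit:
  assumes "T e"
  shows "\<exists>i<p. (e, VEdge (Suc i) q) \<in> (box_rel p q \<pi>)\<^sup>*"
proof (rule reach_east[where T = T])
  fix a b assume ab: "a < p" "b < q" "T (VEdge (Suc a) b)"
  then have "\<pi> (Suc a, Suc b) \<in> {Horizontal, Cross} \<or> \<pi> (Suc a, Suc b) = ElbowWN" by (auto simp: T_box t_defs)
  then show "\<exists>y. (VEdge (Suc a) b, y) \<in> box_rel p q \<pi> \<and> T y"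
    using box_rel_intros(1,3)[OF ab(1,2), of \<pi>] T_rel by blast
next
  fix a b assume ab: "a < p" "b < q" "T (HEdge (Suc a) (Suc b))"
  then have "\<pi> (Suc a, Suc b) \<in> {Vertical, Cross} \<or> \<pi> (Suc a, Suc b) = ElbowSE" by (auto simp: T_box t_defs)
  then show "\<exists>y. (HEdge (Suc a) (Suc b), y) \<in> box_rel p q \<pi> \<and> T y"
    using box_rel_intros(2,4)[OF ab(1,2), of \<pi>] T_rel by blast
qed (use T_grid assms in blast)+

lemma T_enter:
  assumes "T e"
  shows "\<exists>j<q. (HEdge p (Suc j), e) \<in> (box_rel p q \<pi>)\<^sup>*"
proof (rule reach_south[where T = T])
  fix a b assume ab: "a < p" "b < q" "T (VEdge (Suc a) (Suc b))"
  then have "\<pi> (Suc a, Suc b) \<in> {Horizontal, Cross} \<or> \<pi> (Suc a, Suc b) = ElbowSE" by (auto simp: T_box t_defs)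
  then show "\<exists>y. (y, VEdge (Suc a) (Suc b)) \<in> box_rel p q \<pi> \<and> T y"
    using box_rel_intros(1,4)[OF ab(1,2), of \<pi>] T_rel by blast
next
  fix a b assume ab: "a < p" "b < q" "T (HEdge a (Suc b))"
  then have "\<pi> (Suc a, Suc b) \<in> {Vertical, Cross} \<or> \<pi> (Suc a, Suc b) = ElbowWN" by (auto simp: T_box t_defs)
  then show "\<exists>y. (y, HEdge a (Suc b)) \<in> box_rel p q \<pi> \<and> T y"
    using box_rel_intros(2,3)[OF ab(1,2), of \<pi>] T_rel by blast
qed (use T_grid assms in blast)+

lemma rtrancl_conn: "(box_rel p q \<pi>)\<^sup>* \<subseteq> conn p q \<pi>"
  by (rule rtrancl_mono) blast

lemma conn_sym: "(x, y) \<in> conn p q \<pi> \<Longrightarrow> (y, x) \<in> conn p q \<pi>"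
  using sym_rtrancl[of "box_rel p q \<pi>"] by (rule symD)

lemma conn_exit:
  assumes "(VEdge (Suc i) q, x) \<in> conn p q \<pi>"
  shows "(x, VEdge (Suc i) q) \<in> (box_rel p q \<pi>)\<^sup>*"
  using box_rel_single_valued box_rel_terminal assms by (rule rtrancl_terminal)

lemma exit_unique:
  assumes "(x, VEdge (Suc i) q) \<in> (box_rel p q \<pi>)\<^sup>*" "(x, VEdge (Suc j) q) \<in> (box_rel p q \<pi>)\<^sup>*"
  shows "i = j"
proof -
  have "(VEdge (Suc i) q, VEdge (Suc j) q) \<in> conn p q \<pi>"
    using assms rtrancl_conn conn_sym by (meson rtrancl_trans subsetD)
  then have "(VEdge (Suc j) q, VEdge (Suc i) q) \<in> (box_rel p q \<pi>)\<^sup>*" by (rule conn_exit)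
  then show ?thesis
    by (cases rule: converse_rtranclE) (use box_rel_terminal in auto)
qed

text \<open>The value 0 is free to mean that there is no pipe: an exit in row \<open>Suc i\<close>
  has \<open>i < p\<close> and hence a positive colour.\<close>

definition col :: "edge \<Rightarrow> nat" where
  "col e = (if T e then p - (THE i. i < p \<and> (e, VEdge (Suc i) q) \<in> (box_rel p q \<pi>)\<^sup>*) else 0)"

lemma col_eq:
  assumes "T e" "i < p" "(e, VEdge (Suc i) q) \<in> (box_rel p q \<pi>)\<^sup>*"
  shows "col e = p - i"
proof -
  have "(THE i. i < p \<and> (e, VEdge (Suc i) q) \<in> (box_rel p q \<pi>)\<^sup>*) = i"
    using assms exit_unique by (intro the_equality) blast+
  then show ?thesis using assms by (simp add: col_def)
qed

lemma col_0_iff: "col e = 0 \<longleftrightarrow> \<not> T e"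
proof
  assume 0: "col e = 0"
  show "\<not> T e"
  proof
    assume "T e"
    then obtain i where "i < p" "(e, VEdge (Suc i) q) \<in> (box_rel p q \<pi>)\<^sup>*" using T_exit by blast
    from col_eq[OF \<open>T e\<close> this] show False using 0 \<open>i < p\<close> by simp
  qed
qed (simp add: col_def)

lemma col_rel:
  assumes "(x, y) \<in> box_rel p q \<pi>"
  shows "col x = col y"
proof -
  have T: "T x" "T y" using T_rel[OF assms] by blast+
  obtain i where i: "i < p" "(y, VEdge (Suc i) q) \<in> (box_rel p q \<pi>)\<^sup>*" using T_exit[OF T(2)] by blast
  have "(x, VEdge (Suc i) q) \<in> (box_rel p q \<pi>)\<^sup>*" using assms i(2) by (rule converse_rtrancl_into_rtrancl)
  from col_eq[OF T(1) i(1) this] col_eq[OF T(2) i] show ?thesis by simp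
qed

lemma flow_col: "flow_col p q \<pi> col"
  unfolding flow_col_def
proof (intro conjI allI impI)
  fix a b assume ab: "a < p" "b < q"
  note z = T_box[OF ab] col_0_iff t_defs
  show "flow (\<pi> (Suc a, Suc b)) (col (HEdge a (Suc b))) (col (VEdge (Suc a) (Suc b)))
        (col (VEdge (Suc a) b)) (col (HEdge (Suc a) (Suc b)))"
    using box_rel_intros[OF ab, of \<pi>, THEN col_rel]
    by (cases "\<pi> (Suc a, Suc b)") (simp_all add: flow_def z)
next
  fix b assume "b < q"
  then show "col (HEdge 0 (Suc b)) = 0" unfolding col_0_iff using T_grid by fastforce
next
  fix a assume "a < p"
  then show "col (VEdge (Suc a) 0) = 0" unfolding col_0_iff using T_grid by fastforce
qed

lemma pipe_col:
  assumes "T x"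
  shows "pipe ({1..p} \<times> {1..q}) \<pi> x = pipe ({1..p} \<times> {1..q}) \<pi> (VEdge (Suc (p - col x)) q)"
proof -
  obtain i where i: "i < p" "(x, VEdge (Suc i) q) \<in> (box_rel p q \<pi>)\<^sup>*" using T_exit[OF assms] by blast
  have "p - col x = i" using col_eq[OF assms i] i by simp
  then show ?thesis using pipe_cong[OF i(2) rtrancl_refl] by simp
qed

end

section \<open>Colourings versus fragments\<close>

lemma flow_col_rel:
  assumes "flow_col p q \<pi> col" "(x, y) \<in> box_rel p q \<pi>"
  shows "col x = col y \<and> col x \<noteq> 0"
proof -
  have f: "flow (\<pi> (Suc a, Suc b)) (col (HEdge a (Suc b))) (col (VEdge (Suc a) (Suc b)))
        (col (VEdge (Suc a) b)) (col (HEdge (Suc a) (Suc b)))" if "a < p" "b < q" for a b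
    using assms(1) that unfolding flow_col_def by blast
  from assms(2) show ?thesis
    by (cases rule: box_rel_cases) (use f in \<open>force simp: flow_def\<close>)+
qed

lemma flow_col_conn:
  assumes "flow_col p q \<pi> col" "(x, y) \<in> conn p q \<pi>"
  shows "col x = col y"
  using assms(2)
proof (induction rule: rtrancl_induct)
  case (step y z)
  then show ?case using flow_col_rel[OF assms(1)] by (metis UnE converseD)
qed simp

lemma flow_col_touch:
  assumes "flow_col p q \<pi> col" "a < p" "b < q"
  shows "tW (\<pi> (Suc a, Suc b)) \<longleftrightarrow> col (VEdge (Suc a) b) \<noteq> 0"
    "tE (\<pi> (Suc a, Suc b)) \<longleftrightarrow> col (VEdge (Suc a) (Suc b)) \<noteq> 0"
    "tN (\<pi> (Suc a, Suc b)) \<longleftrightarrow> col (HEdge a (Suc b)) \<noteq> 0"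
    "tS (\<pi> (Suc a, Suc b)) \<longleftrightarrow> col (HEdge (Suc a) (Suc b)) \<noteq> 0"
proof -
  have f: "flow (\<pi> (Suc a, Suc b)) (col (HEdge a (Suc b))) (col (VEdge (Suc a) (Suc b)))
        (col (VEdge (Suc a) b)) (col (HEdge (Suc a) (Suc b)))"
    using assms unfolding flow_col_def by blast
  show "tW (\<pi> (Suc a, Suc b)) \<longleftrightarrow> col (VEdge (Suc a) b) \<noteq> 0"
    "tE (\<pi> (Suc a, Suc b)) \<longleftrightarrow> col (VEdge (Suc a) (Suc b)) \<noteq> 0"
    "tN (\<pi> (Suc a, Suc b)) \<longleftrightarrow> col (HEdge a (Suc b)) \<noteq> 0"
    "tS (\<pi> (Suc a, Suc b)) \<longleftrightarrow> col (HEdge (Suc a) (Suc b)) \<noteq> 0"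
    using f by (cases "\<pi> (Suc a, Suc b)"; simp add: flow_def t_defs)+
qed

lemma flow_col_matched: "flow_col p q \<pi> col \<Longrightarrow> matched p q \<pi>"
  unfolding matched_def using flow_col_touch[of p q \<pi> col]
  by (auto simp: flow_col_def)

lemma flow_col_exit:
  assumes fc: "flow_col p q \<pi> col" and "b < q" "col (HEdge p (Suc b)) \<noteq> 0"
  shows "\<exists>i<p. (HEdge p (Suc b), VEdge (Suc i) q) \<in> (box_rel p q \<pi>)\<^sup>* \<and> col (VEdge (Suc i) q) = col (HEdge p (Suc b))"
proof -
  interpret M: matched_tiling p q \<pi> by unfold_locales (rule flow_col_matched[OF fc])
  have p: "p \<noteq> 0" using assms by (cases p) (auto simp: flow_col_def)
  then obtain a where a: "p = Suc a" by (cases p) auto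
  have "M.T (HEdge p (Suc b))" using flow_col_touch(4)[OF fc, of a b] M.T_box(4)[of a b] assms a by simp
  then obtain i where i: "i < p" "(HEdge p (Suc b), VEdge (Suc i) q) \<in> (box_rel p q \<pi>)\<^sup>*" using M.T_exit by blast
  then have "col (HEdge p (Suc b)) = col (VEdge (Suc i) q)" using flow_col_conn[OF fc] M.rtrancl_conn by blast
  then show ?thesis using i by auto
qed

definition ordered :: "nat \<Rightarrow> nat \<Rightarrow> (nat \<times> nat \<Rightarrow> tile) \<Rightarrow> (edge \<Rightarrow> nat) \<Rightarrow> bool" where
  "ordered p q \<pi> col \<longleftrightarrow>
     (\<forall>a<p. \<forall>b<q. \<pi> (Suc a, Suc b) = Cross \<longrightarrow> col (VEdge (Suc a) (Suc b)) < col (HEdge a (Suc b)))"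

definition boundary_col :: "nat \<Rightarrow> nat \<Rightarrow> clan \<Rightarrow> (edge \<Rightarrow> nat) \<Rightarrow> bool" where
  "boundary_col p q \<gamma> col \<longleftrightarrow> (\<forall>k\<in>{1..p + q}. col (bedge p q k) = bcol p \<gamma> k)"

lemma bedge_simps:
  "a < p \<Longrightarrow> bedge p q (Suc a) = VEdge (Suc a) q" "b < q \<Longrightarrow> bedge p q (p + q - b) = HEdge p (Suc b)"
  by (auto simp: bedge_def Suc_diff_le)

lemma bedge_inject:
  "1 \<le> k \<Longrightarrow> k \<le> p + q \<Longrightarrow> 1 \<le> l \<Longrightarrow> l \<le> p + q \<Longrightarrow> bedge p q k = bedge p q l \<Longrightarrow> k = l"
  by (auto simp: bedge_def split: if_splits)

lemma upper_facts:
  assumes \<gamma>: "is_clan p q \<gamma>" and u: "upper \<gamma> = {1..p}"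
  shows "k \<in> lefts \<gamma> \<Longrightarrow> 1 \<le> k \<and> k \<le> p" "k \<in> rights \<gamma> \<Longrightarrow> p < k \<and> k \<le> p + q \<and> 1 \<le> mate \<gamma> k \<and> mate \<gamma> k \<le> p"
proof -
  show l: "k \<in> lefts \<gamma> \<Longrightarrow> 1 \<le> k \<and> k \<le> p" for k using u by (auto simp: upper_def)
  assume r: "k \<in> rights \<gamma>"
  have "k \<in> {1..p + q} - {1..p}" using compl_upper[OF \<gamma>] r unfolding u by auto
  moreover have "mate \<gamma> k \<in> lefts \<gamma>" using r unfolding lefts_eq[OF \<gamma>] rights_eq[OF \<gamma>] by (simp add: mate_mate[OF \<gamma>])
  ultimately show "p < k \<and> k \<le> p + q \<and> 1 \<le> mate \<gamma> k \<and> mate \<gamma> k \<le> p" using l[of "mate \<gamma> k"] by auto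
qed

text \<open>Distinct left ends have distinct positive colours, and a right end takes the colour of
  its mate, so a shared positive colour comes from an arc.\<close>

lemma bcol_eq_imp_arc:
  assumes \<gamma>: "is_clan p q \<gamma>" and u: "upper \<gamma> = {1..p}"
    and kl: "k < l" "bcol p \<gamma> k = bcol p \<gamma> l" "bcol p \<gamma> k \<noteq> 0"
  shows "(k, l) \<in> arcs \<gamma>"
proof -
  note f = upper_facts[OF \<gamma> u]
  have k: "k \<in> lefts \<gamma> \<or> k \<in> rights \<gamma>" and l: "l \<in> lefts \<gamma> \<or> l \<in> rights \<gamma>"
    using kl by (auto simp: bcol_def split: if_splits)
  have nl: "x \<notin> lefts \<gamma>" if "x \<in> rights \<gamma>" for x using f(1)[of x] f(2)[OF that] by auto
  show ?thesis
  proof (cases "k \<in> lefts \<gamma>")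
    case True
    show ?thesis
    proof (cases "l \<in> lefts \<gamma>")
      case l2: True
      have "Suc p - k = Suc p - l" using kl(2) True l2 by (simp add: bcol_def)
      then show ?thesis using f(1)[OF True] f(1)[OF l2] kl(1) by linarith
    next
      case False
      then have r: "l \<in> rights \<gamma>" using l by blast
      have "Suc p - k = Suc p - mate \<gamma> l" using kl(2) True False r by (simp add: bcol_def)
      then have "mate \<gamma> l = k" using f(1)[OF True] f(2)[OF r] by linarith
      then have "mate \<gamma> k = l" using mate_mate[OF \<gamma>] by blast
      then show ?thesis using kl(1) unfolding arcs_eq[OF \<gamma>] by simp
    qed
  next
    case False
    then have r: "k \<in> rights \<gamma>" using k by blast
    then have r': "l \<in> rights \<gamma>" using l f(1)[of l] f(2)[OF r] kl(1) by auto
    have "Suc p - mate \<gamma> k = Suc p - mate \<gamma> l" using kl(2) nl[OF r] nl[OF r'] r r' by (simp add: bcol_def)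
    then have "mate \<gamma> k = mate \<gamma> l" using f(2)[OF r] f(2)[OF r'] by linarith
    then show ?thesis using mate_inject[OF \<gamma>] kl(1) by simp
  qed
qed

lemma arc_bcol:
  assumes \<gamma>: "is_clan p q \<gamma>" and u: "upper \<gamma> = {1..p}" and kl: "(k, l) \<in> arcs \<gamma>"
  shows "1 \<le> k" "k \<le> p" "p < l" "l \<le> p + q" "bcol p \<gamma> k = Suc p - k" "bcol p \<gamma> l = Suc p - k"
proof -
  have k: "k \<in> lefts \<gamma>" and l: "l \<in> rights \<gamma>" using kl by (auto simp: in_lefts in_rights)
  have "mate \<gamma> k = l" using kl unfolding arcs_eq[OF \<gamma>] by simp
  then have m: "mate \<gamma> l = k" using mate_mate[OF \<gamma>] by blast
  note f = upper_facts[OF \<gamma> u]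
  show r: "1 \<le> k" "k \<le> p" "p < l" "l \<le> p + q" using f(1)[OF k] f(2)[OF l] by auto
  show "bcol p \<gamma> k = Suc p - k" using k by (simp add: bcol_def)
  show "bcol p \<gamma> l = Suc p - k" using l f(1)[of l] r m by (auto simp: bcol_def)
qed

text \<open>Colours are constant along pipes. Hence equal pairs of pipes have equal pairs of
  colours, which bounds the crossings, and connected border edges share a positive colour, which
  makes them an arc. Conversely, the pipe that enters at a right end leaves in the row given by its
  colour.\<close>

lemma fragment_of_colouring:
  assumes \<gamma>: "is_clan p q \<gamma>" and u: "upper \<gamma> = {1..p}"
    and \<pi>: "\<pi> \<in> ({1..p} \<times> {1..q} \<rightarrow>\<^sub>E UNIV)"
    and fc: "flow_col p q \<pi> col" and bd: "boundary_col p q \<gamma> col" and ord: "ordered p q \<pi> col"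
  shows "\<pi> \<in> bpd_fragments p q \<gamma>"
  unfolding bpd_fragments_iff[OF \<gamma> u]
proof (intro conjI allI impI)
  interpret M: matched_tiling p q \<pi>
    by unfold_locales (rule flow_col_matched[OF fc])
  have bdk: "col (bedge p q k) = bcol p \<gamma> k" if "1 \<le> k" "k \<le> p + q" for k
    using bd that unfolding boundary_col_def by simp
  show "\<pi> \<in> ({1..p} \<times> {1..q} \<rightarrow>\<^sub>E UNIV)" by (rule \<pi>)
  show "matched p q \<pi>" by (rule flow_col_matched[OF fc])
  have east: "col (VEdge (Suc a) q) = 0 \<or> col (VEdge (Suc a) q) = p - a" if "a < p" for a
  proof -
    have "col (VEdge (Suc a) q) = bcol p \<gamma> (Suc a)" using bdk[of "Suc a"] that by (simp add: bedge_simps)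
    moreover have "Suc a \<notin> rights \<gamma>" using upper_facts(2)[OF \<gamma> u, of "Suc a"] that by auto
    ultimately show ?thesis by (simp add: bcol_def)
  qed
  have pc: "col x = col y" if "pipe ({1..p} \<times> {1..q}) \<pi> x = pipe ({1..p} \<times> {1..q}) \<pi> y" for x y
  proof -
    have "y \<in> pipe ({1..p} \<times> {1..q}) \<pi> y" unfolding pipe_iff by simp
    then have "(x, y) \<in> conn p q \<pi>" unfolding that[symmetric] pipe_iff .
    then show ?thesis by (rule flow_col_conn[OF fc])
  qed
  have fl: "flow (\<pi> (Suc a, Suc b)) (col (HEdge a (Suc b))) (col (VEdge (Suc a) (Suc b)))
        (col (VEdge (Suc a) b)) (col (HEdge (Suc a) (Suc b)))" if "a < p" "b < q" for a b
    using fc that unfolding flow_col_def by blast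
  have once: "\<forall>a<p. \<forall>b<q. \<forall>a'<p. \<forall>b'<q. \<pi> (Suc a, Suc b) = Cross \<and> \<pi> (Suc a', Suc b') = Cross \<and>
      {col (HEdge a (Suc b)), col (VEdge (Suc a) (Suc b))} = {col (HEdge a' (Suc b')), col (VEdge (Suc a') (Suc b'))}
      \<longrightarrow> a = a' \<and> b = b'"
    using crossings_order_iff[OF fc east] ord unfolding ordered_def by blast
  show "crossing_pipes_once p q \<pi>"
    unfolding crossing_pipes_once_def Let_def
  proof (intro allI impI)
    fix a b a' b' assume r: "a < p" "b < q" "a' < p" "b' < q"
    assume A: "\<pi> (Suc a, Suc b) = Cross \<and> \<pi> (Suc a', Suc b') = Cross \<and>
       {pipe ({1..p} \<times> {1..q}) \<pi> (VEdge (Suc a) b), pipe ({1..p} \<times> {1..q}) \<pi> (HEdge (Suc a) (Suc b))} =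
       {pipe ({1..p} \<times> {1..q}) \<pi> (VEdge (Suc a') b'), pipe ({1..p} \<times> {1..q}) \<pi> (HEdge (Suc a') (Suc b'))}"
    have c: "col (VEdge (Suc a) b) = col (VEdge (Suc a) (Suc b))" "col (HEdge (Suc a) (Suc b)) = col (HEdge a (Suc b))"
      "col (VEdge (Suc a') b') = col (VEdge (Suc a') (Suc b'))" "col (HEdge (Suc a') (Suc b')) = col (HEdge a' (Suc b'))"
      using fl[OF r(1,2)] fl[OF r(3,4)] A by (simp_all add: flow_def)
    have "{col (VEdge (Suc a) b), col (HEdge (Suc a) (Suc b))} = {col (VEdge (Suc a') b'), col (HEdge (Suc a') (Suc b'))}"
      using A pc unfolding doubleton_eq_iff by metis
    then have "{col (HEdge a (Suc b)), col (VEdge (Suc a) (Suc b))} = {col (HEdge a' (Suc b')), col (VEdge (Suc a') (Suc b'))}"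
      unfolding c by (simp add: insert_commute)
    then show "a = a' \<and> b = b'" using once[rule_format, OF r] A by blast
  qed
  fix k l assume kl: "1 \<le> k \<and> k < l \<and> l \<le> p + q"
  show "(bedge p q k, bedge p q l) \<in> conn p q \<pi> \<longleftrightarrow> (k, l) \<in> arcs \<gamma>"
  proof
    assume c: "(bedge p q k, bedge p q l) \<in> conn p q \<pi>"
    have "bedge p q k \<noteq> bedge p q l" using bedge_inject[of k p q l] kl by auto
    from c this obtain y where "(bedge p q k, y) \<in> box_rel p q \<pi> \<union> (box_rel p q \<pi>)\<inverse>"
      by (cases rule: converse_rtranclE) auto
    then have "col (bedge p q k) \<noteq> 0" using flow_col_rel[OF fc] by (metis UnE converseD)
    moreover have "col (bedge p q k) = col (bedge p q l)" by (rule flow_col_conn[OF fc c])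
    ultimately show "(k, l) \<in> arcs \<gamma>" using bcol_eq_imp_arc[OF \<gamma> u, of k l] bdk kl by simp
  next
    assume "(k, l) \<in> arcs \<gamma>"
    note ab = arc_bcol[OF \<gamma> u this]
    define b where "b = p + q - l"
    have b: "b < q" "l = p + q - b" using ab by (auto simp: b_def)
    have bl: "bedge p q l = HEdge p (Suc b)" unfolding b(2) by (rule bedge_simps(2)[OF b(1)])
    have cl: "col (HEdge p (Suc b)) = Suc p - k" using bdk[of l] ab unfolding bl by simp
    obtain i where i: "i < p" "(HEdge p (Suc b), VEdge (Suc i) q) \<in> (box_rel p q \<pi>)\<^sup>*" "col (VEdge (Suc i) q) = Suc p - k"
      using flow_col_exit[OF fc b(1)] cl ab(2) by auto
    have "k = Suc i" using east[OF i(1)] i ab(1,2) by auto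
    then have "bedge p q k = VEdge (Suc i) q" using i(1) by (simp add: bedge_simps)
    then show "(bedge p q k, bedge p q l) \<in> conn p q \<pi>" unfolding bl using i(2) M.rtrancl_conn M.conn_sym by auto
  qed
qed

text \<open>Pipes are coloured by their exits. Every touched edge lies on a pipe from the bottom to
  the east border, so the condition on arcs decides which border edges are touched and with which
  colour.\<close>

lemma colouring_of_fragment:
  assumes \<gamma>: "is_clan p q \<gamma>" and u: "upper \<gamma> = {1..p}" and \<pi>: "\<pi> \<in> bpd_fragments p q \<gamma>"
  shows "\<exists>col. flow_col p q \<pi> col \<and> boundary_col p q \<gamma> col \<and> ordered p q \<pi> col"
proof -
  note F = \<pi>[unfolded bpd_fragments_iff[OF \<gamma> u]]
  interpret matched_tiling p q \<pi> by unfold_locales (use F in blast)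
  have arc: "(bedge p q k, bedge p q l) \<in> conn p q \<pi> \<longleftrightarrow> (k, l) \<in> arcs \<gamma>" if "1 \<le> k" "k < l" "l \<le> p + q" for k l
    using F that by blast
  \<comment> \<open>A pipe that leaves here has entered at some bottom edge, so the condition on
    arcs applies to these two border edges.\<close>
  have TR: "T (VEdge (Suc a) q) \<longleftrightarrow> Suc a \<in> lefts \<gamma>" if a: "a < p" for a
  proof
    assume "T (VEdge (Suc a) q)"
    then obtain j where j: "j < q" "(HEdge p (Suc j), VEdge (Suc a) q) \<in> (box_rel p q \<pi>)\<^sup>*" using T_enter by blast
    then have "(bedge p q (Suc a), bedge p q (p + q - j)) \<in> conn p q \<pi>"
      unfolding bedge_simps(1)[OF a] bedge_simps(2)[OF j(1)] using rtrancl_conn conn_sym by blast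
    then have "(Suc a, p + q - j) \<in> arcs \<gamma>" using arc[of "Suc a" "p + q - j"] a j(1) by simp
    then show "Suc a \<in> lefts \<gamma>" by (auto simp: in_lefts)
  next
    assume "Suc a \<in> lefts \<gamma>"
    then obtain l where l: "(Suc a, l) \<in> arcs \<gamma>" by (auto simp: in_lefts)
    note ab = arc_bcol[OF \<gamma> u l]
    have "(bedge p q (Suc a), bedge p q l) \<in> conn p q \<pi>" using arc[of "Suc a" l] l ab by simp
    moreover have "bedge p q (Suc a) \<noteq> bedge p q l" using bedge_inject[of "Suc a" p q l] ab by auto
    ultimately have "T (bedge p q (Suc a))" by (rule T_conn)
    then show "T (VEdge (Suc a) q)" unfolding bedge_simps(1)[OF a] .
  qed
  have "boundary_col p q \<gamma> col"
    unfolding boundary_col_def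
  proof
    fix k assume k: "k \<in> {1..p + q}"
    show "col (bedge p q k) = bcol p \<gamma> k"
    proof (cases "k \<le> p")
      case True
      then obtain a where a: "k = Suc a" "a < p" using k by (cases k) auto
      have nr: "Suc a \<notin> rights \<gamma>" using upper_facts(2)[OF \<gamma> u, of "Suc a"] a by auto
      show ?thesis
      proof (cases "T (VEdge (Suc a) q)")
        case t: True
        then have "col (VEdge (Suc a) q) = p - a" using a by (intro col_eq) auto
        then show ?thesis using t TR[OF a(2)] a by (simp add: bedge_simps bcol_def)
      next
        case False
        then have "col (VEdge (Suc a) q) = 0" by (simp add: col_0_iff)
        then show ?thesis using False TR[OF a(2)] nr a by (simp add: bedge_simps bcol_def)
      qed
    next
      case False
      define b where "b = p + q - k"
      have b: "b < q" "k = p + q - b" using False k by (auto simp: b_def)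
      have bk: "bedge p q k = HEdge p (Suc b)" unfolding b(2) by (rule bedge_simps(2)[OF b(1)])
      have nl: "k \<notin> lefts \<gamma>" using upper_facts(1)[OF \<gamma> u, of k] False by auto
      show ?thesis
      proof (cases "T (HEdge p (Suc b))")
        case t: True
        then obtain i where i: "i < p" "(HEdge p (Suc b), VEdge (Suc i) q) \<in> (box_rel p q \<pi>)\<^sup>*" using T_exit by blast
        then have "(bedge p q (Suc i), bedge p q k) \<in> conn p q \<pi>"
          unfolding bedge_simps(1)[OF i(1)] bk using rtrancl_conn conn_sym by blast
        then have "(Suc i, k) \<in> arcs \<gamma>" using arc[of "Suc i" k] i(1) False k by simp
        then have "bcol p \<gamma> k = Suc p - Suc i" by (rule arc_bcol(6)[OF \<gamma> u])
        then show ?thesis unfolding bk using col_eq[OF t i] by simp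
      next
        case nt: False
        have "k \<notin> rights \<gamma>"
        proof
          assume "k \<in> rights \<gamma>"
          then obtain m where m: "(m, k) \<in> arcs \<gamma>" by (auto simp: in_rights)
          note ab = arc_bcol[OF \<gamma> u m]
          have "(bedge p q m, bedge p q k) \<in> conn p q \<pi>" using arc[of m k] m ab by simp
          moreover have "bedge p q m \<noteq> bedge p q k" using bedge_inject[of m p q k] ab by auto
          ultimately have "T (bedge p q k)" by (rule T_conn)
          then show False using nt unfolding bk by simp
        qed
        then show ?thesis unfolding bk using nt nl by (simp add: bcol_def col_0_iff)
      qed
    qed
  qed
  moreover have "ordered p q \<pi> col"
  proof -
    have east: "col (VEdge (Suc a) q) = 0 \<or> col (VEdge (Suc a) q) = p - a" if "a < p" for a
      using col_eq[of "VEdge (Suc a) q" a] that by (auto simp: col_0_iff)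
    \<comment> \<open>A pipe can be recovered from its colour, so equal pairs of colours come from
      equal pairs of pipes.\<close>
    define P where "P c = pipe ({1..p} \<times> {1..q}) \<pi> (VEdge (Suc (p - c)) q)" for c
    have fl: "flow (\<pi> (Suc a, Suc b)) (col (HEdge a (Suc b))) (col (VEdge (Suc a) (Suc b)))
        (col (VEdge (Suc a) b)) (col (HEdge (Suc a) (Suc b)))" if "a < p" "b < q" for a b
      using flow_col that unfolding flow_col_def by blast
    have PP: "{pipe ({1..p} \<times> {1..q}) \<pi> (VEdge (Suc a) b), pipe ({1..p} \<times> {1..q}) \<pi> (HEdge (Suc a) (Suc b))}
      = P ` {col (HEdge a (Suc b)), col (VEdge (Suc a) (Suc b))}" if r: "a < p" "b < q" "\<pi> (Suc a, Suc b) = Cross" for a b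
    proof -
      have t: "T (VEdge (Suc a) b)" "T (HEdge (Suc a) (Suc b))" using r by (simp_all add: T_box t_defs)
      have "pipe ({1..p} \<times> {1..q}) \<pi> (VEdge (Suc a) b) = P (col (VEdge (Suc a) b))"
        "pipe ({1..p} \<times> {1..q}) \<pi> (HEdge (Suc a) (Suc b)) = P (col (HEdge (Suc a) (Suc b)))"
        unfolding P_def by (rule pipe_col[OF t(1)], rule pipe_col[OF t(2)])
      then show ?thesis using fl[OF r(1,2)] r(3) by (simp add: flow_def insert_commute)
    qed
    have cp: "crossing_pipes_once p q \<pi>" using F by blast
    have "\<forall>a<p. \<forall>b<q. \<forall>a'<p. \<forall>b'<q. \<pi> (Suc a, Suc b) = Cross \<and> \<pi> (Suc a', Suc b') = Cross \<and>
      {col (HEdge a (Suc b)), col (VEdge (Suc a) (Suc b))} = {col (HEdge a' (Suc b')), col (VEdge (Suc a') (Suc b'))}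
      \<longrightarrow> a = a' \<and> b = b'"
    proof (intro allI impI)
      fix a b a' b' assume r: "a < p" "b < q" "a' < p" "b' < q"
        and A: "\<pi> (Suc a, Suc b) = Cross \<and> \<pi> (Suc a', Suc b') = Cross \<and>
          {col (HEdge a (Suc b)), col (VEdge (Suc a) (Suc b))} = {col (HEdge a' (Suc b')), col (VEdge (Suc a') (Suc b'))}"
      have "{pipe ({1..p} \<times> {1..q}) \<pi> (VEdge (Suc a) b), pipe ({1..p} \<times> {1..q}) \<pi> (HEdge (Suc a) (Suc b))} =
        {pipe ({1..p} \<times> {1..q}) \<pi> (VEdge (Suc a') b'), pipe ({1..p} \<times> {1..q}) \<pi> (HEdge (Suc a') (Suc b'))}"
        using PP[OF r(1,2)] PP[OF r(3,4)] A by simp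
      then show "a = a' \<and> b = b'" using cp[unfolded crossing_pipes_once_def Let_def, rule_format, OF r] A by blast
    qed
    then show ?thesis using crossings_order_iff[OF flow_col east] unfolding ordered_def by blast
  qed
  ultimately show ?thesis using flow_col by blast
qed

section \<open>Transfer matrices\<close>

definition swap_weight :: "xypoly \<Rightarrow> nat \<Rightarrow> nat \<Rightarrow> nat \<Rightarrow> xypoly" where
  "swap_weight u i e s = (if e = 0 \<and> s = 0 then Y i - u else if e = 0 \<or> s = 0 \<or> s < e then 1 else 0)"

text \<open>A column of i boxes with blank weights \<open>Y r - u\<close>: the vertical edges to its right and to its
  left are coloured s and n, its bottom edge is coloured e, its top edge is empty.\<close>
fun column_weight :: "xypoly \<Rightarrow> nat \<Rightarrow> (nat \<Rightarrow> nat) \<Rightarrow> (nat \<Rightarrow> nat) \<Rightarrow> nat \<Rightarrow> xypoly" where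
  "column_weight u 0 s n e = (if e = 0 then 1 else 0)"
| "column_weight u (Suc i) s n e =
     (if s (Suc i) = n (Suc i) then swap_weight u (Suc i) e (s (Suc i)) * column_weight u i s n e else 0) +
     (if s (Suc i) = e \<and> (s (Suc i) = 0) \<noteq> (n (Suc i) = 0) then column_weight u i s n (n (Suc i)) else 0)"

definition colours :: "nat \<Rightarrow> nat \<Rightarrow> (nat \<Rightarrow> nat) set" where
  "colours p i = {1..i} \<rightarrow>\<^sub>E {..p}"

text \<open>Columns are counted from the left, starting at the colourless west border.
  \<open>u\<close> and \<open>e\<close> give the weight parameter and the bottom colour of each
  column.\<close>

primrec transfer :: "nat \<Rightarrow> (nat \<Rightarrow> xypoly) \<Rightarrow> (nat \<Rightarrow> nat) \<Rightarrow> nat \<Rightarrow> (nat \<Rightarrow> nat) \<Rightarrow> xypoly" where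
  "transfer p u e 0 s = (if \<forall>i\<in>{1..p}. s i = 0 then 1 else 0)"
| "transfer p u e (Suc j) s =
     (\<Sum>m\<in>colours p p. column_weight (u (Suc j)) p s m (e (Suc j)) * transfer p u e j m)"

lemma finite_colours [simp]: "finite (colours p i)"
  unfolding colours_def by (rule finite_PiE) auto

lemma column_weight_cong:
  "(\<And>r. 1 \<le> r \<Longrightarrow> r \<le> i \<Longrightarrow> s r = s' r) \<Longrightarrow> (\<And>r. 1 \<le> r \<Longrightarrow> r \<le> i \<Longrightarrow> n r = n' r) \<Longrightarrow>
    column_weight u i s n e = column_weight u i s' n' e"
proof (induction i arbitrary: e)
  case (Suc i)
  have A: "column_weight u i s n e = column_weight u i s' n' e" for e
    by (rule Suc.IH) (use Suc.prems in simp_all)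
  have B: "s (Suc i) = s' (Suc i)" "n (Suc i) = n' (Suc i)" using Suc.prems by simp_all
  show ?case unfolding column_weight.simps A B ..
qed simp

lemma transfer_cong:
  assumes "\<And>j'. 1 \<le> j' \<Longrightarrow> j' \<le> j \<Longrightarrow> u j' = u' j' \<and> e j' = e' j'" "\<And>r. 1 \<le> r \<Longrightarrow> r \<le> p \<Longrightarrow> s r = s' r"
  shows "transfer p u e j s = transfer p u' e' j s'"
  using assms
proof (induction j arbitrary: s s')
  case 0
  have "(\<forall>i\<in>{1..p}. s i = 0) \<longleftrightarrow> (\<forall>i\<in>{1..p}. s' i = 0)"
    by (rule ball_cong) (use 0 in simp_all)
  then show ?case by simp
next
  case (Suc j)
  have IH: "transfer p u e j m = transfer p u' e' j m" for m
    by (rule Suc.IH) (use Suc.prems(1) in simp_all)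
  have C: "column_weight x p s m y = column_weight x p s' m y" for x m y
    by (rule column_weight_cong) (use Suc.prems(2) in simp_all)
  have D: "u (Suc j) = u' (Suc j)" "e (Suc j) = e' (Suc j)" using Suc.prems(1)[of "Suc j"] by simp_all
  show ?case unfolding transfer.simps IH C D ..
qed

lemma swap_y_column_weight:
  assumes "p < i" "r \<le> p"
  shows "swap_y i (column_weight u r s n e) = column_weight (swap_y i u) r s n e"
  using assms(2)
proof (induction r arbitrary: e)
  case (Suc r)
  have "swap_y i (swap_weight u (Suc r) a b) = swap_weight (swap_y i u) (Suc r) a b" for a b
    using assms(1) Suc.prems by (simp add: swap_weight_def)
  moreover have "swap_y i (column_weight u r s n e) = column_weight (swap_y i u) r s n e" for e
    by (rule Suc.IH) (use Suc.prems in simp)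
  ultimately show ?case unfolding column_weight.simps swap_y_simps if_distrib[of "swap_y i"] by (simp only:)
qed simp

lemma swap_y_transfer:
  assumes "p < i"
  shows "swap_y i (transfer p u e j s) = transfer p (\<lambda>j. swap_y i (u j)) e j s"
  by (induction j arbitrary: s) (simp_all add: swap_y_column_weight[OF assms])

subsection \<open>Exchanging two columns\<close>

text \<open>\<open>u\<close> and \<open>\<beta>\<close> belong to the right column,
  \<open>u'\<close> and \<open>\<alpha>\<close> to the left one.\<close>

definition two_columns :: "nat \<Rightarrow> xypoly \<Rightarrow> xypoly \<Rightarrow> nat \<Rightarrow> (nat \<Rightarrow> nat) \<Rightarrow> (nat \<Rightarrow> nat) \<Rightarrow> nat \<Rightarrow> nat \<Rightarrow> xypoly" where
  "two_columns p u u' i s n \<alpha> \<beta> =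
     (\<Sum>m\<in>colours p i. column_weight u i s m \<beta> * column_weight u' i m n \<alpha>)"

lemma sum_colours_Suc:
  "(\<Sum>m\<in>colours p (Suc i). f m) = (\<Sum>c\<le>p. \<Sum>m\<in>colours p i. f (m(Suc i := c)))"
proof -
  have eq: "{1..Suc i} = insert (Suc i) {1..i}" by auto
  have inj: "inj_on (\<lambda>(c, m). m(Suc i := c)) ({..p} \<times> ({1..i} \<rightarrow>\<^sub>E {..p}))"
    by (rule inj_combinator[where T = "\<lambda>_. {..p}"]) simp
  have "(\<Sum>m\<in>colours p (Suc i). f m) = (\<Sum>(c, m)\<in>{..p} \<times> colours p i. f (m(Suc i := c)))"
    unfolding colours_def eq PiE_insert_eq
    by (subst sum.reindex[OF inj]) (simp add: case_prod_unfold)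
  then show ?thesis by (simp add: sum.cartesian_product)
qed

lemma sum_delta_le: "x \<le> (p::nat) \<Longrightarrow> (\<Sum>c\<le>p. if c = x then f c else 0) = (f x :: xypoly)"
  by (simp add: sum.delta)

text \<open>In the last row each of the two boxes is straight or turns, which gives the four terms.
  In each term the colour between the boxes is forced, so the sum over it collapses.\<close>

lemma two_columns_Suc:
  fixes u u' :: xypoly
  assumes "s (Suc i) \<le> p" "n (Suc i) \<le> p" "\<alpha> \<le> p" "\<beta> \<le> p"
  defines "x \<equiv> s (Suc i)" and "y \<equiv> n (Suc i)" and "W \<equiv> two_columns p u u' i s n"
  shows "two_columns p u u' (Suc i) s n \<alpha> \<beta> =
    (if x = y then swap_weight u (Suc i) \<beta> x * swap_weight u' (Suc i) \<alpha> x * W \<alpha> \<beta> else 0) +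
    (if x = \<alpha> \<and> (x = 0) \<noteq> (y = 0) then swap_weight u (Suc i) \<beta> x * W y \<beta> else 0) +
    (if x = \<beta> \<and> (x = 0) \<noteq> (y = 0) then swap_weight u' (Suc i) \<alpha> y * W \<alpha> y else 0) +
    (if x = \<beta> \<and> (\<beta> = 0) \<noteq> (\<alpha> = 0) \<and> (\<alpha> = 0) \<noteq> (y = 0) then W y \<alpha> else 0)"
proof -
  have cw: "column_weight v i (m(Suc i := c)) n e = column_weight v i m n e"
    "column_weight v i s (m(Suc i := c)) e = column_weight v i s m e" for v m c e
    by (rule column_weight_cong; simp)+
  define A where "A c m = column_weight u i s m c" for c m
  define B where "B c m = column_weight u' i m n c" for c m
  have W: "(\<Sum>m\<in>colours p i. A b m * B a m) = W a b" for a b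
    unfolding W_def two_columns_def A_def B_def ..
  have "two_columns p u u' (Suc i) s n \<alpha> \<beta> = (\<Sum>c\<le>p. \<Sum>m\<in>colours p i.
    ((if x = c then swap_weight u (Suc i) \<beta> x * A \<beta> m else 0) +
     (if x = \<beta> \<and> (x = 0) \<noteq> (c = 0) then A c m else 0)) *
    ((if c = y then swap_weight u' (Suc i) \<alpha> c * B \<alpha> m else 0) +
     (if c = \<alpha> \<and> (c = 0) \<noteq> (y = 0) then B y m else 0)))"
    unfolding two_columns_def sum_colours_Suc column_weight.simps cw fun_upd_same x_def y_def A_def B_def ..
  also have "\<dots> = (\<Sum>c\<le>p.
    (if c = x then (if x = y then swap_weight u (Suc i) \<beta> x * swap_weight u' (Suc i) \<alpha> x * W \<alpha> \<beta> else 0) else 0) +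
    (if c = x then (if x = \<alpha> \<and> (x = 0) \<noteq> (y = 0) then swap_weight u (Suc i) \<beta> x * W y \<beta> else 0) else 0) +
    (if c = y then (if x = \<beta> \<and> (x = 0) \<noteq> (y = 0) then swap_weight u' (Suc i) \<alpha> y * W \<alpha> y else 0) else 0) +
    (if c = \<alpha> then (if x = \<beta> \<and> (\<beta> = 0) \<noteq> (\<alpha> = 0) \<and> (\<alpha> = 0) \<noteq> (y = 0) then W y \<alpha> else 0) else 0))"
  proof (rule sum.cong[OF refl])
    fix c
    have 1: "(\<Sum>m\<in>colours p i. (a * A \<beta> m) * (b * B \<alpha> m)) = a * b * W \<alpha> \<beta>" for a b
      unfolding W[symmetric] sum_distrib_left by (rule sum.cong) (simp_all add: algebra_simps)
    have 2: "(\<Sum>m\<in>colours p i. (a * A \<beta> m) * B y m) = a * W y \<beta>" for a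
      unfolding W[symmetric] sum_distrib_left by (rule sum.cong) (simp_all add: algebra_simps)
    have 3: "(\<Sum>m\<in>colours p i. A c m * (b * B \<alpha> m)) = b * W \<alpha> c" for b
      unfolding W[symmetric] sum_distrib_left by (rule sum.cong) (simp_all add: algebra_simps)
    have 4: "(\<Sum>m\<in>colours p i. A c m * B y m) = W y c"
      unfolding W[symmetric] ..
    have split: "(\<Sum>m\<in>colours p i. ((if P then a * A \<beta> m else 0) + (if Q then A c m else 0)) *
        ((if R then b * B \<alpha> m else 0) + (if S then B y m else 0))) =
      (if P \<and> R then a * b * W \<alpha> \<beta> else 0) + (if P \<and> S then a * W y \<beta> else 0) +
      (if Q \<and> R then b * W \<alpha> c else 0) + (if Q \<and> S then W y c else 0)" for P Q R S a b
      unfolding 1[symmetric] 2[symmetric] 3[symmetric] 4[symmetric]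
      by (cases P; cases Q; cases R; cases S) (simp_all add: distrib_left distrib_right sum.distrib)
    show "(\<Sum>m\<in>colours p i.
        ((if x = c then swap_weight u (Suc i) \<beta> x * A \<beta> m else 0) +
         (if x = \<beta> \<and> (x = 0) \<noteq> (c = 0) then A c m else 0)) *
        ((if c = y then swap_weight u' (Suc i) \<alpha> c * B \<alpha> m else 0) +
         (if c = \<alpha> \<and> (c = 0) \<noteq> (y = 0) then B y m else 0))) =
      (if c = x then (if x = y then swap_weight u (Suc i) \<beta> x * swap_weight u' (Suc i) \<alpha> x * W \<alpha> \<beta> else 0) else 0) +
      (if c = x then (if x = \<alpha> \<and> (x = 0) \<noteq> (y = 0) then swap_weight u (Suc i) \<beta> x * W y \<beta> else 0) else 0) +
      (if c = y then (if x = \<beta> \<and> (x = 0) \<noteq> (y = 0) then swap_weight u' (Suc i) \<alpha> y * W \<alpha> y else 0) else 0) +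
      (if c = \<alpha> then (if x = \<beta> \<and> (\<beta> = 0) \<noteq> (\<alpha> = 0) \<and> (\<alpha> = 0) \<noteq> (y = 0) then W y \<alpha> else 0) else 0)"
      unfolding split
      by (intro arg_cong2[where f = "(+)"]) auto
  qed
  also have "\<dots> =
    (if x = y then swap_weight u (Suc i) \<beta> x * swap_weight u' (Suc i) \<alpha> x * W \<alpha> \<beta> else 0) +
    (if x = \<alpha> \<and> (x = 0) \<noteq> (y = 0) then swap_weight u (Suc i) \<beta> x * W y \<beta> else 0) +
    (if x = \<beta> \<and> (x = 0) \<noteq> (y = 0) then swap_weight u' (Suc i) \<alpha> y * W \<alpha> y else 0) +
    (if x = \<beta> \<and> (\<beta> = 0) \<noteq> (\<alpha> = 0) \<and> (\<alpha> = 0) \<noteq> (y = 0) then W y \<alpha> else 0)"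
    unfolding sum.distrib using assms(1-4)[folded x_def y_def] by (simp only: sum_delta_le)
  finally show ?thesis .
qed

text \<open>The Yang--Baxter equation for two adjacent columns. Both sides are expanded along the last
  row; the resulting identity holds with the values of \<open>two_columns\<close> for the rows above as
  indeterminates.\<close>
lemma two_columns_exchange:
  assumes "\<And>r. 1 \<le> r \<Longrightarrow> r \<le> i \<Longrightarrow> s r \<le> p \<and> n r \<le> p" "\<alpha> \<le> p" "\<beta> \<le> p"
  shows "two_columns p u' u i s n \<alpha> \<beta> = two_columns p u u' i s n \<alpha> \<beta> -
    (if \<alpha> < \<beta> then (u - u') * two_columns p u u' i s n \<beta> \<alpha> else 0)"
  using assms
proof (induction i arbitrary: \<alpha> \<beta>)
  case 0
  then show ?case by (simp add: two_columns_def)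
next
  case (Suc i)
  define W where "W = two_columns p u u' i s n"
  define z where "z = Y (Suc i)"
  have b: "s (Suc i) \<le> p" "n (Suc i) \<le> p" using Suc.prems(1)[of "Suc i"] by simp_all
  \<comment> \<open>Expanding a row also produces the bottom colours \<open>(y, \<beta>)\<close>,
    \<open>(\<alpha>, y)\<close> and \<open>(y, \<alpha>)\<close>, so the hypothesis is needed for
    all pairs.\<close>
  have IH: "two_columns p u' u i s n a b = W a b - (if a < b then (u - u') * W b a else 0)"
    if "a \<le> p" "b \<le> p" for a b
    unfolding W_def using Suc.IH[OF _ that] Suc.prems(1) by simp
  note r1 = two_columns_Suc[of s i p n, OF b Suc.prems(2,3), of u u', folded W_def]
  note r2 = two_columns_Suc[of s i p n, OF b Suc.prems(3,2), of u u', folded W_def]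
  note r3 = two_columns_Suc[of s i p n, OF b Suc.prems(2,3), of u' u, unfolded IH[OF Suc.prems(2,3)]
      IH[OF b(2) Suc.prems(3)] IH[OF Suc.prems(2) b(2)] IH[OF b(2) Suc.prems(2)]]
  define x y where "x = s (Suc i)" and "y = n (Suc i)"
  \<comment> \<open>What matters is which colours are 0 and how \<open>\<alpha>\<close> and
    \<open>\<beta>\<close> compare; every case is a linear identity in the values of
    \<open>W\<close>.\<close>
  show ?case
    unfolding r1 r2 r3 unfolding x_def[symmetric] y_def[symmetric] swap_weight_def z_def[symmetric]
    by (cases "\<alpha> = 0"; cases "\<beta> = 0"; cases "x = 0"; cases "y = 0"; cases \<alpha> \<beta> rule: linorder_cases)
      (auto simp: algebra_simps)
qed

lemma transfer_Suc_Suc: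
  "transfer p u e (Suc (Suc j)) s =
    (\<Sum>n\<in>colours p p. two_columns p (u (Suc (Suc j))) (u (Suc j)) p s n (e (Suc j)) (e (Suc (Suc j))) * transfer p u e j n)"
proof -
  have "transfer p u e (Suc (Suc j)) s = (\<Sum>m\<in>colours p p. \<Sum>n\<in>colours p p.
    column_weight (u (Suc (Suc j))) p s m (e (Suc (Suc j))) * column_weight (u (Suc j)) p m n (e (Suc j)) * transfer p u e j n)"
    by (simp add: sum_distrib_left mult.assoc)
  also have "\<dots> = (\<Sum>n\<in>colours p p. \<Sum>m\<in>colours p p.
    column_weight (u (Suc (Suc j))) p s m (e (Suc (Suc j))) * column_weight (u (Suc j)) p m n (e (Suc j)) * transfer p u e j n)"
    by (rule sum.swap)
  finally show ?thesis unfolding two_columns_def sum_distrib_right .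
qed

text \<open>Columns \<open>Suc j\<close> and \<open>Suc (Suc j)\<close> satisfy the exchange
  relation, and columns further right enter linearly and carry it along. Exchanging two bottom
  colours thus acts as a divided difference in the weight parameters.\<close>

lemma transfer_exchange:
  assumes c: "e (Suc j) < e (Suc (Suc j))" "e (Suc (Suc j)) \<le> p" and s: "s \<in> colours p p" and J: "Suc (Suc j) \<le> J"
  defines "\<tau> \<equiv> simple_refl (Suc j)"
  shows "(u (Suc (Suc j)) - u (Suc j)) * transfer p u (e \<circ> \<tau>) J s =
    transfer p u e J s - transfer p (u \<circ> \<tau>) e J s"
  using J s
proof (induction J arbitrary: s rule: dec_induct)
  case base
  have low: "transfer p u (e \<circ> \<tau>) j n = transfer p u e j n" "transfer p (u \<circ> \<tau>) e j n = transfer p u e j n" for n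
    by (rule transfer_cong; simp add: \<tau>_def)+
  have b: "s r \<le> p \<and> n r \<le> p" if "n \<in> colours p p" "1 \<le> r" "r \<le> p" for n r
    using base that unfolding colours_def by (auto dest!: PiE_mem)
  have t: "(f \<circ> \<tau>) (Suc j) = f (Suc (Suc j))" "(f \<circ> \<tau>) (Suc (Suc j)) = f (Suc j)" for f :: "nat \<Rightarrow> 'b"
    by (simp_all add: \<tau>_def)
  have "(u (Suc (Suc j)) - u (Suc j)) * two_columns p (u (Suc (Suc j))) (u (Suc j)) p s n (e (Suc (Suc j))) (e (Suc j)) =
      two_columns p (u (Suc (Suc j))) (u (Suc j)) p s n (e (Suc j)) (e (Suc (Suc j))) -
      two_columns p (u (Suc j)) (u (Suc (Suc j))) p s n (e (Suc j)) (e (Suc (Suc j)))" if "n \<in> colours p p" for n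
    using two_columns_exchange[of p s p n "e (Suc j)" "e (Suc (Suc j))" "u (Suc j)" "u (Suc (Suc j))"] b[OF that] c by simp
  then have *: "(u (Suc (Suc j)) - u (Suc j)) *
      (two_columns p (u (Suc (Suc j))) (u (Suc j)) p s n (e (Suc (Suc j))) (e (Suc j)) * transfer p u e j n) =
      two_columns p (u (Suc (Suc j))) (u (Suc j)) p s n (e (Suc j)) (e (Suc (Suc j))) * transfer p u e j n -
      two_columns p (u (Suc j)) (u (Suc (Suc j))) p s n (e (Suc j)) (e (Suc (Suc j))) * transfer p u e j n"
    if "n \<in> colours p p" for n
    unfolding mult.assoc[symmetric] left_diff_distrib[symmetric] using that by simp
  show ?case
    unfolding transfer_Suc_Suc t low sum_distrib_left sum_subtractf[symmetric]
    by (rule sum.cong[OF refl *])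
next
  case (step J)
  have t: "(f \<circ> \<tau>) (Suc J) = f (Suc J)" for f :: "nat \<Rightarrow> 'b" using step.hyps by (simp add: \<tau>_def)
  have *: "(u (Suc (Suc j)) - u (Suc j)) * (column_weight (u (Suc J)) p s m (e (Suc J)) * transfer p u (e \<circ> \<tau>) J m) =
      column_weight (u (Suc J)) p s m (e (Suc J)) * transfer p u e J m -
      column_weight (u (Suc J)) p s m (e (Suc J)) * transfer p (u \<circ> \<tau>) e J m" if "m \<in> colours p p" for m
    unfolding right_diff_distrib[symmetric] step.IH[OF that, symmetric] by (simp only: mult.left_commute)
  show ?case
    unfolding transfer.simps t sum_distrib_left sum_subtractf[symmetric]
    by (rule sum.cong[OF refl *])
qed

subsection \<open>Sorted clans\<close>

lemma column_weight_carry: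
  assumes "\<And>r. 1 \<le> r \<Longrightarrow> r \<le> i \<Longrightarrow> s r = 0" "e \<noteq> 0"
  shows "column_weight u i s n e = 0"
  using assms
proof (induction i)
  case (Suc i)
  have "column_weight u i s n e = 0" by (rule Suc.IH) (use Suc.prems in simp_all)
  then show ?case using Suc.prems(1)[of "Suc i"] Suc.prems(2) by simp
qed simp

lemma all_le_Suc: "(\<forall>r\<in>{1..Suc i}. P r) \<longleftrightarrow> P (Suc i) \<and> (\<forall>r\<in>{1..i}. P r)"
proof -
  have "{1..Suc i} = insert (Suc i) {1..i}" by auto
  then show ?thesis by simp
qed

lemma column_weight_empty:
  assumes "\<And>r. 1 \<le> r \<Longrightarrow> r \<le> i \<Longrightarrow> s r = 0"
  shows "column_weight u i s n 0 = (if \<forall>r\<in>{1..i}. n r = 0 then \<Prod>r\<in>{1..i}. Y r - u else 0)"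
  using assms
proof (induction i)
  case (Suc i)
  have IH: "column_weight u i s n 0 = (if \<forall>r\<in>{1..i}. n r = 0 then \<Prod>r\<in>{1..i}. Y r - u else 0)"
    by (rule Suc.IH) (use Suc.prems in simp)
  have c: "column_weight u i s n (n (Suc i)) = 0" if "n (Suc i) \<noteq> 0"
    by (rule column_weight_carry[OF _ that]) (use Suc.prems in simp)
  have s: "s (Suc i) = 0" using Suc.prems by simp
  have P: "(\<Prod>r\<in>{1..Suc i}. Y r - u) = (Y (Suc i) - u) * (\<Prod>r\<in>{1..i}. Y r - u)"
    by (simp add: mult.commute)
  show ?case
    unfolding all_le_Suc P using c s IH by (cases "n (Suc i) = 0") (simp_all add: swap_weight_def)
qed simp

text \<open>The entering pipe has the largest colour and belongs to the topmost occupied row. So it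
  passes the rows below \<open>a\<close> vertically, turns east in row \<open>a\<close>, and leaves
  the boxes above blank.\<close>

lemma column_weight_top:
  assumes "1 \<le> a" "a \<le> i" "\<And>r. 1 \<le> r \<Longrightarrow> r < a \<Longrightarrow> s r = 0" "s a = e" "e \<noteq> 0"
    and "\<And>r. a < r \<Longrightarrow> r \<le> i \<Longrightarrow> s r < e"
  shows "column_weight u i s n e =
    (if \<forall>r\<in>{1..i}. n r = (if r = a then 0 else s r) then \<Prod>r\<in>{1..<a}. Y r - u else 0)"
  using assms(2,6)
proof (induction i rule: dec_induct)
  case base
  obtain a' where a: "a = Suc a'" using assms(1) by (cases a) auto
  have "column_weight u a' s n 0 = (if \<forall>r\<in>{1..a'}. n r = 0 then \<Prod>r\<in>{1..a'}. Y r - u else 0)"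
    by (rule column_weight_empty) (use assms(3) a in simp)
  moreover have "(\<forall>r\<in>{1..a'}. n r = (if r = a then 0 else s r)) \<longleftrightarrow> (\<forall>r\<in>{1..a'}. n r = 0)"
    using assms(3) a by auto
  moreover have "{1..<a} = {1..a'}" using a by auto
  ultimately show ?case
    unfolding a all_le_Suc unfolding a[symmetric]
    using assms(4,5) a by (cases "n a = 0") (simp_all add: swap_weight_def)
next
  case (step i)
  have IH: "column_weight u i s n e =
    (if \<forall>r\<in>{1..i}. n r = (if r = a then 0 else s r) then \<Prod>r\<in>{1..<a}. Y r - u else 0)"
    by (rule step.IH) (use step.prems in simp)
  have lt: "s (Suc i) < e" using step by simp
  then have ne: "s (Suc i) \<noteq> e" by simp
  have w: "swap_weight u (Suc i) e (s (Suc i)) = 1" using lt by (simp add: swap_weight_def)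
  show ?case
    unfolding all_le_Suc column_weight.simps w IH using ne step.hyps by auto
qed

text \<open>Column \<open>j\<close> stands over the boundary edge \<open>Suc (p + q) - j\<close>;
  this node supplies both its variable and its bottom colour.\<close>

definition transfer_poly :: "nat \<Rightarrow> nat \<Rightarrow> clan \<Rightarrow> xypoly" where
  "transfer_poly p q \<gamma> = transfer p (\<lambda>j. Y (Suc (p + q) - j)) (\<lambda>j. bcol p \<gamma> (Suc (p + q) - j)) q
     (restrict (bcol p \<gamma>) {1..p})"

text \<open>A sign beyond \<open>p\<close> is its own mate, so the truncated difference gives it the
  colour 0.\<close>

lemma bcol_eq:
  assumes \<gamma>: "is_clan p q \<gamma>" and u: "upper \<gamma> = {1..p}" and k: "1 \<le> k" "k \<le> p + q"
  shows "bcol p \<gamma> k = (if k \<le> p then if k < mate \<gamma> k then Suc p - k else 0 else Suc p - mate \<gamma> k)"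
proof (cases "k \<le> p")
  case True
  then have "k \<notin> rights \<gamma>" using upper_facts(2)[OF \<gamma> u, of k] by auto
  then show ?thesis using True by (simp add: bcol_def lefts_eq[OF \<gamma>])
next
  case False
  then have "k \<notin> lefts \<gamma>" using upper_facts(1)[OF \<gamma> u, of k] by auto
  then have "mate \<gamma> k = k" if "k \<notin> rights \<gamma>" using that unfolding lefts_eq[OF \<gamma>] rights_eq[OF \<gamma>] by simp
  then show ?thesis using False \<open>k \<notin> lefts \<gamma>\<close> by (simp add: bcol_def)
qed

lemma bcol_le: "is_clan p q \<gamma> \<Longrightarrow> upper \<gamma> = {1..p} \<Longrightarrow> bcol p \<gamma> k \<le> p"
  using upper_facts[of p q \<gamma> k] by (auto simp: bcol_def)

text \<open>With increasing mates the columns, read from left to right, send their pipes to ever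
  higher rows. So only one colouring contributes: the column of a right end \<open>m\<close> is
  blank exactly above row \<open>mate \<gamma> m\<close>, and the column of a sign is blank
  throughout.\<close>

lemma transfer_poly_sorted:
  assumes \<gamma>: "is_clan p q \<gamma>" and u: "upper \<gamma> = {1..p}"
    and srt: "\<And>a b. p < a \<Longrightarrow> a < b \<Longrightarrow> b \<le> p + q \<Longrightarrow> mate \<gamma> a < mate \<gamma> b"
  shows "transfer_poly p q \<gamma> =
    (\<Prod>(a, m)\<in>{(a, m). a \<in> {1..p} \<and> m \<in> {p + 1..p + q} \<and> a < mate \<gamma> m}. Y a - Y m)"
proof -
  define n where "n = p + q"
  note mm = mate_mate[OF \<gamma>]
  \<comment> \<open>The colours to the right of column \<open>j\<close>: row \<open>a\<close> is
    occupied once the column of its mate is among the first \<open>j\<close>.\<close>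
  define st where "st j = (\<lambda>a\<in>{1..p}. if a < mate \<gamma> a \<and> Suc n - j \<le> mate \<gamma> a then Suc p - a else 0)" for j
  define D where "D j = {(a, m). a \<in> {1..p} \<and> m \<in> {Suc n - j..n} \<and> a < mate \<gamma> m}" for j
  have hi: "mate \<gamma> m \<le> m" if "p < m" for m using that in_upper_iff[OF \<gamma>, of m] unfolding u by auto
  have sg: "mate \<gamma> k = k" if "k \<in> pluses \<gamma>" for k using that signs_eq[OF \<gamma>] by blast
  have lo: "a \<le> mate \<gamma> a" if "a \<in> {1..p}" for a
    using that in_upper_iff[OF \<gamma>, of a] sg[of a] unfolding u by auto
  have out: "p < mate \<gamma> a" if "a \<in> {1..p}" "a < mate \<gamma> a" for a
  proof (rule ccontr)
    assume "\<not> p < mate \<gamma> a"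
    then have "mate \<gamma> a \<le> mate \<gamma> (mate \<gamma> a)" using that by (intro lo) auto
    then show False using that mm by simp
  qed
  have dom: "mate \<gamma> a \<le> n" if "a \<in> {1..n}" for a using mate_in_iff[OF \<gamma>, of a] that by (simp add: n_def)
  have stc: "st j \<in> colours p p" for j by (auto simp: st_def colours_def)
  have main: "transfer p (\<lambda>j. Y (Suc n - j)) (\<lambda>j. bcol p \<gamma> (Suc n - j)) j (st j) = (\<Prod>(a, m)\<in>D j. Y a - Y m)"
    if "j \<le> q" for j
    using that
  proof (induction j)
    case 0
    have "st 0 a = 0" if "a \<in> {1..p}" for a
    proof -
      have "mate \<gamma> a \<le> n" using dom[of a] that by (simp add: n_def)
      then show ?thesis using that by (simp add: st_def)
    qed
    then show ?case by (simp add: D_def)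
  next
    case (Suc j)
    define m where "m = n - j"
    have m: "Suc n - Suc j = m" "Suc n - j = Suc m" "p < m" "m \<le> n"
      using Suc.prems by (auto simp: m_def n_def)
    have IH: "transfer p (\<lambda>j. Y (Suc n - j)) (\<lambda>j. bcol p \<gamma> (Suc n - j)) j (st j) = (\<Prod>(a, m)\<in>D j. Y a - Y m)"
      using Suc by simp
    \<comment> \<open>By sortedness a pipe that entered further left leaves in a lower row.\<close>
    have late: "mate \<gamma> m < a" if "a \<in> {1..p}" "a < mate \<gamma> a" "m < mate \<gamma> a" for a
      using srt[of m "mate \<gamma> a"] dom[of a] that m mm by (simp add: n_def)
    have cwm: "column_weight (Y m) p (st (Suc j)) x (bcol p \<gamma> m) =
      (if x = st j then \<Prod>a\<in>{a\<in>{1..p}. a < mate \<gamma> m}. Y a - Y m else 0)" if x: "x \<in> colours p p" for x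
    proof -
      have xe: "x = st j \<longleftrightarrow> (\<forall>r\<in>{1..p}. x r = st j r)"
      proof
        assume "\<forall>r\<in>{1..p}. x r = st j r"
        then show "x = st j" by (intro PiE_ext[OF x[unfolded colours_def] stc[unfolded colours_def]]) blast
      qed simp
      have bm: "bcol p \<gamma> m = Suc p - mate \<gamma> m" using bcol_eq[OF \<gamma> u, of m] m by (simp add: n_def)
      show ?thesis
      proof (cases "mate \<gamma> m = m")
        case True
        have e0: "bcol p \<gamma> m = 0" using bm m True by simp
        have z: "st (Suc j) a = 0" if "a \<in> {1..p}" for a
        proof -
          have "\<not> (a < mate \<gamma> a \<and> m \<le> mate \<gamma> a)"
          proof
            assume A: "a < mate \<gamma> a \<and> m \<le> mate \<gamma> a"
            show False
            proof (cases "mate \<gamma> a = m")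
              case e: True
              then have "a = m" using True mm by metis
              then show False using that m by simp
            next
              case False
              then have "mate \<gamma> m < a" using late[OF that] A by simp
              then show False using True that m by simp
            qed
          qed
          then show ?thesis using that m by (simp add: st_def)
        qed
        have z': "st j a = 0" if "a \<in> {1..p}" for a
          using z[OF that] that m by (auto simp: st_def split: if_splits)
        have "{a\<in>{1..p}. a < mate \<gamma> m} = {1..p}" using True m by auto
        moreover have "(\<forall>r\<in>{1..p}. x r = st j r) \<longleftrightarrow> (\<forall>r\<in>{1..p}. x r = 0)" using z' by simp
        ultimately show ?thesis
          unfolding e0 xe by (simp only:) (rule column_weight_empty, use z in simp)
      next
        case False
        define a where "a = mate \<gamma> m"
        have am: "mate \<gamma> a = m" by (simp add: a_def mm)
        have al: "a < m" using hi[of m] m False by (simp add: a_def)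
        have "a \<in> upper \<gamma>" using in_upper_iff[OF \<gamma>, of a] am al by simp
        then have a: "1 \<le> a" "a \<le> p" unfolding u by auto
        have s1: "st (Suc j) r = 0" if "1 \<le> r" "r < a" for r
        proof -
          have "\<not> (r < mate \<gamma> r \<and> m \<le> mate \<gamma> r)"
          proof
            assume A: "r < mate \<gamma> r \<and> m \<le> mate \<gamma> r"
            have "mate \<gamma> r \<noteq> m" using that am mate_inject[OF \<gamma>, of r a] by auto
            then have "a < r" using late[of r] A that a by (simp add: a_def)
            then show False using that by simp
          qed
          then show ?thesis using that m a by (simp add: st_def)
        qed
        have s2: "st (Suc j) a = Suc p - a" using a am al m by (simp add: st_def)
        have s3: "st (Suc j) r < Suc p - a" if "a < r" "r \<le> p" for r
          using that a by (auto simp: st_def)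
        have sj: "st j r = (if r = a then 0 else st (Suc j) r)" if "r \<in> {1..p}" for r
        proof -
          have "mate \<gamma> r = m \<longleftrightarrow> r = a" using am mate_inject[OF \<gamma>, of r a] by auto
          then have "Suc m \<le> mate \<gamma> r \<longleftrightarrow> m \<le> mate \<gamma> r \<and> r \<noteq> a" by auto
          then show ?thesis using that m by (auto simp: st_def)
        qed
        have bm': "bcol p \<gamma> m = Suc p - a" using bm by (simp add: a_def)
        have "{r\<in>{1..p}. r < mate \<gamma> m} = {1..<a}" using a by (auto simp: a_def)
        moreover have "(\<forall>r\<in>{1..p}. x r = st j r) \<longleftrightarrow> (\<forall>r\<in>{1..p}. x r = (if r = a then 0 else st (Suc j) r))"
          using sj by simp
        ultimately show ?thesis
          unfolding bm' xe using column_weight_top[where a = a and s = "st (Suc j)" and i = p and e = "Suc p - a", OF a s1 s2 _ s3] a by simp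
      qed
    qed
    have "transfer p (\<lambda>j. Y (Suc n - j)) (\<lambda>j. bcol p \<gamma> (Suc n - j)) (Suc j) (st (Suc j)) =
      (\<Sum>x\<in>colours p p. if x = st j then (\<Prod>a\<in>{a\<in>{1..p}. a < mate \<gamma> m}. Y a - Y m) * (\<Prod>(a, m)\<in>D j. Y a - Y m) else 0)"
      unfolding transfer.simps m(1)
      by (rule sum.cong) (simp_all add: cwm IH)
    also have "\<dots> = (\<Prod>a\<in>{a\<in>{1..p}. a < mate \<gamma> m}. Y a - Y m) * (\<Prod>(a, m)\<in>D j. Y a - Y m)"
      using stc by (simp add: sum.delta)
    also have "\<dots> = (\<Prod>(a, m)\<in>(\<lambda>a. (a, m)) ` {a\<in>{1..p}. a < mate \<gamma> m} \<union> D j. Y a - Y m)"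
    proof (subst prod.union_disjoint)
      have "D j \<subseteq> {1..p} \<times> {1..n}" unfolding D_def m(2) by auto
      then show "finite (D j)" by (rule finite_subset) simp
      show "(\<lambda>a. (a, m)) ` {a\<in>{1..p}. a < mate \<gamma> m} \<inter> D j = {}" unfolding D_def m(2) by auto
      show "(\<Prod>a\<in>{a\<in>{1..p}. a < mate \<gamma> m}. Y a - Y m) * (\<Prod>(a, m)\<in>D j. Y a - Y m) =
        (\<Prod>(a, m)\<in>(\<lambda>a. (a, m)) ` {a\<in>{1..p}. a < mate \<gamma> m}. Y a - Y m) * (\<Prod>(a, m)\<in>D j. Y a - Y m)"
        by (subst prod.reindex) (simp_all add: inj_on_def)
    qed simp
    also have "(\<lambda>a. (a, m)) ` {a\<in>{1..p}. a < mate \<gamma> m} \<union> D j = D (Suc j)"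
    proof -
      have "{m..n} = insert m {Suc m..n}" using m(4) by auto
      then show ?thesis unfolding D_def m(1,2) by auto
    qed
    finally show ?case .
  qed
  have "st q = restrict (bcol p \<gamma>) {1..p}"
  proof
    fix a
    show "st q a = restrict (bcol p \<gamma>) {1..p} a"
    proof (cases "a \<in> {1..p}")
      case True
      then have "bcol p \<gamma> a = (if a < mate \<gamma> a then Suc p - a else 0)" using bcol_eq[OF \<gamma> u, of a] by simp
      then show ?thesis using True out[OF True] by (auto simp: st_def n_def)
    qed (simp add: st_def del: atLeastAtMost_iff)
  qed
  moreover have "D q = {(a, m). a \<in> {1..p} \<and> m \<in> {p + 1..p + q} \<and> a < mate \<gamma> m}"
    by (simp add: D_def n_def One_nat_def)
  ultimately show ?thesis using main[of q] unfolding transfer_poly_def n_def by simp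
qed

text \<open>\<open>i\<close> and \<open>Suc i\<close> are neighbouring columns, the larger node on
  the left. The exchange of nodes exchanges their bottom colours, \<open>swap_y\<close> exchanges
  their weight parameters, and an ascent puts the colours into the order that the exchange relation
  asks for.\<close>

lemma transfer_poly_ascent:
  assumes \<gamma>: "is_clan p q \<gamma>" and u: "upper \<gamma> = {1..p}" and i: "p < i" "i < p + q" and asc: "ascent \<gamma> i"
  shows "(Y i - Y (Suc i)) * transfer_poly p q (swap_nodes i \<gamma>) =
    transfer_poly p q \<gamma> - swap_y i (transfer_poly p q \<gamma>)"
proof -
  define n where "n = p + q"
  define g where "g = swap_nodes i \<gamma>"
  have i1: "1 \<le> i" using i by simp
  note mm = mate_mate[OF \<gamma>]
  note sw = swap_nodes_swap[OF \<gamma> i1 i(2) ascent_not_arc[OF \<gamma> asc], folded g_def]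
  have ug: "upper g = {1..p}"
  proof (rule set_eqI)
    fix k
    show "k \<in> upper g \<longleftrightarrow> k \<in> {1..p}"
      unfolding sw(5) simple_refl_image_iff u using i by (cases "k = i"; cases "k = Suc i") auto
  qed
  have hi: "mate \<gamma> m \<le> m" if "p < m" for m using that in_upper_iff[OF \<gamma>, of m] unfolding u by auto
  have bg: "bcol p g k = bcol p \<gamma> (simple_refl i k)" if k: "1 \<le> k" "k \<le> p + q" for k
  proof -
    have sk: "1 \<le> simple_refl i k" "simple_refl i k \<le> p + q" "simple_refl i k \<le> p \<longleftrightarrow> k \<le> p"
      using k i by (cases "k = i"; cases "k = Suc i"; auto)+
    have fx: "simple_refl i a = a" if "a \<le> p" for a using that i by simp
    have fx': "p < simple_refl i a" if "p < a" for a using that i by (cases "a = i"; cases "a = Suc i") auto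
    show ?thesis
    proof (cases "k \<le> p")
      case True
      then have "k < simple_refl i (mate \<gamma> k) \<longleftrightarrow> k < mate \<gamma> k"
        using fx[of "mate \<gamma> k"] fx'[of "mate \<gamma> k"] by (cases "mate \<gamma> k \<le> p") auto
      then show ?thesis
        unfolding bcol_eq[OF sw(1) ug k] bcol_eq[OF \<gamma> u sk(1,2)] sw(2) using True fx[OF True] by simp
    next
      case False
      have "Suc p - simple_refl i a = Suc p - a" for a
        using fx[of a] fx'[of a] by (cases "a \<le> p") auto
      then show ?thesis
        unfolding bcol_eq[OF sw(1) ug k] bcol_eq[OF \<gamma> u sk(1,2)] sw(2) using False sk(3) by simp
    qed
  qed
  define j where "j = n - Suc i"
  have j: "Suc n - Suc j = Suc i" "Suc n - Suc (Suc j) = i" "Suc (Suc j) \<le> q"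
    using i by (auto simp: j_def n_def)
  define U where "U j = Y (Suc n - j)" for j
  define e where "e j = bcol p \<gamma> (Suc n - j)" for j
  define s where "s = restrict (bcol p \<gamma>) {1..p}"
  have s: "s \<in> colours p p" using bcol_le[OF \<gamma> u] by (auto simp: s_def colours_def)
  have tau: "Suc n - simple_refl (Suc j) j' = simple_refl i (Suc n - j')" if "1 \<le> j'" "j' \<le> q" for j'
    using that j i by (cases "j' = Suc j"; cases "j' = Suc (Suc j)") (auto simp: n_def)
  have F: "transfer_poly p q \<gamma> = transfer p U e q s"
    unfolding transfer_poly_def U_def e_def s_def n_def ..
  have G: "transfer_poly p q g = transfer p U (e \<circ> simple_refl (Suc j)) q s"
    unfolding transfer_poly_def
  proof (rule transfer_cong)
    fix j' assume j': "1 \<le> j'" "j' \<le> q"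
    then have "bcol p g (Suc n - j') = bcol p \<gamma> (simple_refl i (Suc n - j'))" by (intro bg) (auto simp: n_def)
    then show "Y (Suc (p + q) - j') = U j' \<and> bcol p g (Suc (p + q) - j') = (e \<circ> simple_refl (Suc j)) j'"
      by (simp add: U_def e_def n_def tau[OF j', unfolded n_def])
  next
    fix r assume r: "1 \<le> r" "r \<le> p"
    then have "bcol p g r = bcol p \<gamma> r" using bg[of r] i by simp
    then show "restrict (bcol p g) {1..p} r = s r" using r by (simp add: s_def)
  qed
  have S: "swap_y i (transfer_poly p q \<gamma>) = transfer p (U \<circ> simple_refl (Suc j)) e q s"
    unfolding F swap_y_transfer[OF i(1)]
    by (rule transfer_cong) (simp_all add: U_def tau)
  have c: "e (Suc j) < e (Suc (Suc j))" "e (Suc (Suc j)) \<le> p"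
  proof -
    have lt: "mate \<gamma> i < mate \<gamma> (Suc i)" and ns: "\<not> (mate \<gamma> i = i \<and> mate \<gamma> (Suc i) = Suc i)"
      using asc by (auto simp: ascent_def)
    \<comment> \<open>A sign at \<open>i\<close> would force a sign at \<open>Suc i\<close>, since
      no node beyond \<open>p\<close> is a left end. So \<open>i\<close> is a right end and has the
      strictly larger colour.\<close>
    have "mate \<gamma> i \<noteq> i"
    proof
      assume "mate \<gamma> i = i"
      then have "mate \<gamma> (Suc i) = Suc i" using lt hi[of "Suc i"] i by simp
      then show False using ns \<open>mate \<gamma> i = i\<close> by simp
    qed
    then have "i \<in> rights \<gamma>" using hi[of i] i unfolding rights_eq[OF \<gamma>] by simp
    then have "mate \<gamma> i \<le> p" using upper_facts(2)[OF \<gamma> u] by blast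
    moreover have "e (Suc j) = Suc p - mate \<gamma> (Suc i)" "e (Suc (Suc j)) = Suc p - mate \<gamma> i"
      unfolding e_def j(1,2) using bcol_eq[OF \<gamma> u, of i] bcol_eq[OF \<gamma> u, of "Suc i"] i by simp_all
    ultimately show "e (Suc j) < e (Suc (Suc j))" using lt by linarith
    show "e (Suc (Suc j)) \<le> p" unfolding e_def by (rule bcol_le[OF \<gamma> u])
  qed
  from transfer_exchange[of e j, OF c s j(3), of U]
  show ?thesis unfolding g_def[symmetric] F[symmetric] G[symmetric] S[symmetric] unfolding U_def j(1,2) .
qed

lemma ev_Phi_transfer_poly:
  assumes "is_clan p q \<gamma>" "upper \<gamma> = {1..p}"
  shows "ev (p + q) id (Phi (p + q) \<gamma>) = transfer_poly p q \<gamma>"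
proof (rule HOL.sym, rule ev_Phi_unique[OF _ _ assms])
  fix \<gamma>
  assume A: "is_clan p q \<gamma>" "upper \<gamma> = {1..p}"
  assume S: "\<And>a b. p < a \<Longrightarrow> a < b \<Longrightarrow> b \<le> p + q \<Longrightarrow> mate \<gamma> a < mate \<gamma> b"
  from A S show "transfer_poly p q \<gamma> =
      (\<Prod>(a, m)\<in>{(a, m). a \<in> {1..p} \<and> m \<in> {p + 1..p + q} \<and> a < mate \<gamma> m}. Y a - Y m)"
    by (rule transfer_poly_sorted)
next
  fix \<gamma> i
  assume A: "is_clan p q \<gamma>" "upper \<gamma> = {1..p}" "p < i" "i < p + q" "ascent \<gamma> i"
  show "(Y i - Y (Suc i)) * transfer_poly p q (swap_nodes i \<gamma>) =
      transfer_poly p q \<gamma> - swap_y i (transfer_poly p q \<gamma>)"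
    by (rule transfer_poly_ascent[OF A])
qed

section \<open>The sum over fragments\<close>

text \<open>By conservation the colours of the vertical edges determine those of the horizontal
  edges, and all colours together determine the tile. So a sum over the colours of vertical edges
  can be a sum over fragments.\<close>

lemma flow_conservation: "flow t n e w s \<Longrightarrow> n + e = w + s"
  by (cases t) (auto simp: flow_def)

lemma flow_unique: "flow t n e w s \<Longrightarrow> flow t' n e w s \<Longrightarrow> t = t'"
  by (cases t; cases t') (auto simp: flow_def)

definition column_flow :: "nat \<Rightarrow> (nat \<Rightarrow> tile) \<Rightarrow> (nat \<Rightarrow> nat) \<Rightarrow> (nat \<Rightarrow> nat) \<Rightarrow> (nat \<Rightarrow> nat) \<Rightarrow> bool" where
  "column_flow i t h s n \<longleftrightarrow> h 0 = 0 \<and>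
     (\<forall>a<i. flow (t a) (h a) (s (Suc a)) (n (Suc a)) (h (Suc a)) \<and> (t a = Cross \<longrightarrow> s (Suc a) < h a))"

lemma column_flow_Suc:
  "column_flow (Suc i) t h s n \<longleftrightarrow> column_flow i t h s n \<and>
    flow (t i) (h i) (s (Suc i)) (n (Suc i)) (h (Suc i)) \<and> (t i = Cross \<longrightarrow> s (Suc i) < h i)"
  by (auto simp: column_flow_def less_Suc_eq)

lemma column_flow_extend:
  assumes "column_flow i t h s n" "flow T (h i) (s (Suc i)) (n (Suc i)) x" "T = Cross \<Longrightarrow> s (Suc i) < h i"
  shows "column_flow (Suc i) (t(i := T)) (h(Suc i := x)) s n"
proof -
  have "column_flow i (t(i := T)) (h(Suc i := x)) s n" using assms(1) by (simp add: column_flow_def)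
  then show ?thesis using assms(2,3) by (simp add: column_flow_Suc)
qed

text \<open>The bottom tile selects one of the two summands of \<open>column_weight\<close>, and the
  other one vanishes.\<close>

lemma column_weight_flow:
  "column_flow i t h s n \<Longrightarrow> column_weight u i s n (h i) = (\<Prod>a<i. if t a = Blank then Y (Suc a) - u else 1)"
proof (induction i)
  case 0
  then show ?case by (simp add: column_flow_def)
next
  case (Suc i)
  have IH: "column_weight u i s n (h i) = (\<Prod>a<i. if t a = Blank then Y (Suc a) - u else 1)"
    by (rule Suc.IH) (use Suc.prems in \<open>simp add: column_flow_Suc\<close>)
  have f: "flow (t i) (h i) (s (Suc i)) (n (Suc i)) (h (Suc i))" "t i = Cross \<longrightarrow> s (Suc i) < h i"
    using Suc.prems by (simp_all add: column_flow_Suc)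
  have "column_weight u (Suc i) s n (h (Suc i)) = (if t i = Blank then Y (Suc i) - u else 1) * column_weight u i s n (h i)"
    using f by (cases "t i") (simp_all add: flow_def swap_weight_def)
  then show ?case unfolding IH by (simp add: mult.commute)
qed

lemma column_weight_nonzero:
  "column_weight u i s n e \<noteq> 0 \<Longrightarrow> \<exists>t h. column_flow i t h s n \<and> h i = e"
proof (induction i arbitrary: e)
  case 0
  then show ?case by (intro exI[of _ "\<lambda>_. Blank"] exI[of _ "\<lambda>_. 0"]) (auto simp: column_flow_def split: if_splits)
next
  case (Suc i)
  define x y where "x = s (Suc i)" and "y = n (Suc i)"
  have ext: ?case if "column_flow i t h s n" "flow T (h i) x y e" "T = Cross \<Longrightarrow> x < h i" for t h T
  proof -
    have "column_flow (Suc i) (t(i := T)) (h(Suc i := e)) s n"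
      by (rule column_flow_extend) (use that in \<open>simp_all add: x_def y_def\<close>)
    moreover have "(h(Suc i := e)) (Suc i) = e" by simp
    ultimately show ?thesis by blast
  qed
  define A where "A = (if x = y then swap_weight u (Suc i) e x * column_weight u i s n e else 0)"
  define B where "B = (if x = e \<and> (x = 0) \<noteq> (y = 0) then column_weight u i s n y else 0)"
  have "A + B \<noteq> 0"
    using Suc.prems unfolding A_def B_def x_def y_def column_weight.simps .
  then have "A \<noteq> 0 \<or> B \<noteq> 0" by fastforce
  moreover have "x = y \<and> swap_weight u (Suc i) e x \<noteq> 0 \<and> column_weight u i s n e \<noteq> 0" if "A \<noteq> 0"
    using that unfolding A_def by (metis mult_zero_left mult_zero_right)
  moreover have "x = e \<and> (x = 0) \<noteq> (y = 0) \<and> column_weight u i s n y \<noteq> 0" if "B \<noteq> 0"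
    using that unfolding B_def by metis
  ultimately consider "x = y" "swap_weight u (Suc i) e x \<noteq> 0" "column_weight u i s n e \<noteq> 0"
    | "x = e" "(x = 0) \<noteq> (y = 0)" "column_weight u i s n y \<noteq> 0"
    by blast
  then show ?case
  proof cases
    case 1
    then obtain t h where th: "column_flow i t h s n" "h i = e" using Suc.IH by blast
    define T where "T = (if e = 0 then (if x = 0 then Blank else Horizontal) else (if x = 0 then Vertical else Cross))"
    have "e \<noteq> 0 \<Longrightarrow> x \<noteq> 0 \<Longrightarrow> x < e" using 1(2) by (simp add: swap_weight_def split: if_splits)
    then have "flow T (h i) x y e" "T = Cross \<Longrightarrow> x < h i"
      using 1(1) th(2) by (auto simp: T_def flow_def split: if_splits)
    with th(1) show ?thesis by (rule ext)
  next
    case 2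
    then obtain t h where th: "column_flow i t h s n" "h i = y" using Suc.IH by blast
    define T where "T = (if y = 0 then ElbowSE else ElbowWN)"
    have "flow T (h i) x y e" "T = Cross \<Longrightarrow> x < h i"
      using 2(1,2) th(2) by (auto simp: T_def flow_def)
    with th(1) show ?thesis by (rule ext)
  qed
qed

text \<open>Conservation, telescoped from the top of the column.\<close>

lemma column_flow_height:
  "column_flow i t h s n \<Longrightarrow> a \<le> i \<Longrightarrow> h a + (\<Sum>r<a. n (Suc r)) = (\<Sum>r<a. s (Suc r))"
proof (induction a)
  case 0
  then show ?case by (simp add: column_flow_def)
next
  case (Suc a)
  have "flow (t a) (h a) (s (Suc a)) (n (Suc a)) (h (Suc a))" using Suc.prems by (simp add: column_flow_def)
  from flow_conservation[OF this] show ?case using Suc by simp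
qed

lemma column_flow_unique:
  assumes "column_flow i t h s n" "column_flow i t' h' s n" "a < i"
  shows "t a = t' a"
proof -
  have e: "h b = h' b" if "b \<le> i" for b
    using column_flow_height[OF assms(1) that] column_flow_height[OF assms(2) that] by simp
  have "flow (t a) (h a) (s (Suc a)) (n (Suc a)) (h (Suc a))" "flow (t' a) (h' a) (s (Suc a)) (n (Suc a)) (h' (Suc a))"
    using assms unfolding column_flow_def by blast+
  then show ?thesis using e[of a] e[of "Suc a"] assms(3) by (auto intro: flow_unique)
qed

subsection \<open>Unrolling the transfer matrices\<close>

definition col_paths :: "nat \<Rightarrow> nat \<Rightarrow> (nat \<Rightarrow> nat) \<Rightarrow> (nat \<Rightarrow> nat \<Rightarrow> nat) set" where
  "col_paths p j s = {v \<in> {..j} \<rightarrow>\<^sub>E colours p p. v j = s \<and> (\<forall>i\<in>{1..p}. v 0 i = 0)}"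

lemma finite_col_paths: "finite (col_paths p j s)"
  unfolding col_paths_def by (rule finite_subset[OF _ finite_PiE[of "{..j}" "\<lambda>_. colours p p"]]) auto

lemma transfer_unroll:
  "s \<in> colours p p \<Longrightarrow> transfer p u e j s =
    (\<Sum>v\<in>col_paths p j s. \<Prod>b<j. column_weight (u (Suc b)) p (v (Suc b)) (v b) (e (Suc b)))"
proof (induction j arbitrary: s)
  case 0
  have "col_paths p 0 s = (if \<forall>i\<in>{1..p}. s i = 0 then {\<lambda>x\<in>{..0}. s} else {})"
  proof (rule set_eqI)
    fix v
    show "v \<in> col_paths p 0 s \<longleftrightarrow> v \<in> (if \<forall>i\<in>{1..p}. s i = 0 then {\<lambda>x\<in>{..0}. s} else {})"
    proof
      assume v: "v \<in> col_paths p 0 s"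
      then have "v \<in> {..0} \<rightarrow>\<^sub>E colours p p" "v 0 = s" "\<forall>i\<in>{1..p}. s i = 0" by (auto simp: col_paths_def)
      moreover from this have "v = (\<lambda>x\<in>{..0}. s)" by (intro ext) (auto simp: PiE_def extensional_def)
      ultimately show "v \<in> (if \<forall>i\<in>{1..p}. s i = 0 then {\<lambda>x\<in>{..0}. s} else {})" by simp
    next
      assume "v \<in> (if \<forall>i\<in>{1..p}. s i = 0 then {\<lambda>x\<in>{..0}. s} else {})"
      then have "\<forall>i\<in>{1..p}. s i = 0" "v = (\<lambda>x\<in>{..0}. s)" by (auto split: if_splits)
      then show "v \<in> col_paths p 0 s" using 0 by (simp add: col_paths_def)
    qed
  qed
  then show ?case by simp
next
  case (Suc j)
  define w where "w v = (\<Prod>b<j. column_weight (u (Suc b)) p (v (Suc b)) (v b) (e (Suc b)))" for v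
  have "transfer p u e (Suc j) s =
    (\<Sum>m\<in>colours p p. \<Sum>v\<in>col_paths p j m. column_weight (u (Suc j)) p s m (e (Suc j)) * w v)"
    unfolding transfer.simps sum_distrib_left[symmetric] w_def by (rule sum.cong) (simp_all add: Suc.IH)
  also have "\<dots> = (\<Sum>(m, v)\<in>Sigma (colours p p) (col_paths p j). column_weight (u (Suc j)) p s m (e (Suc j)) * w v)"
    by (rule sum.Sigma) (simp_all add: finite_col_paths)
  also have "\<dots> = (\<Sum>v\<in>col_paths p (Suc j) s. \<Prod>b<Suc j. column_weight (u (Suc b)) p (v (Suc b)) (v b) (e (Suc b)))"
  proof (rule sum.reindex_bij_witness[where i = "\<lambda>v. (v j, restrict v {..j})" and j = "\<lambda>(m, v). v(Suc j := s)"])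
    fix mv assume mv: "mv \<in> Sigma (colours p p) (col_paths p j)"
    then obtain m v where e: "mv = (m, v)" "m \<in> colours p p" "v \<in> col_paths p j m" by auto
    then have v: "v \<in> {..j} \<rightarrow>\<^sub>E colours p p" "v j = m" "\<forall>i\<in>{1..p}. v 0 i = 0" by (auto simp: col_paths_def)
    have x: "v k = undefined" if "\<not> k \<le> j" for k using v(1) that by (auto simp: PiE_def extensional_def)
    have "restrict (v(Suc j := s)) {..j} = v" by (rule ext) (auto simp: x restrict_def)
    then show "(\<lambda>v. (v j, restrict v {..j})) (case mv of (m, v) \<Rightarrow> v(Suc j := s)) = mv"
      using v(2) e(1) by simp
    have "v(Suc j := s) \<in> {..Suc j} \<rightarrow>\<^sub>E colours p p"
      using v(1) Suc.prems unfolding PiE_def extensional_def Pi_def by (auto simp: le_Suc_eq)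
    then show "(case mv of (m, v) \<Rightarrow> v(Suc j := s)) \<in> col_paths p (Suc j) s"
      using v(3) e(1) by (simp add: col_paths_def)
    have "w (v(Suc j := s)) = w v" unfolding w_def by (rule prod.cong) auto
    then show "(\<Prod>b<Suc j. column_weight (u (Suc b)) p ((case mv of (m, v) \<Rightarrow> v(Suc j := s)) (Suc b))
        ((case mv of (m, v) \<Rightarrow> v(Suc j := s)) b) (e (Suc b))) =
      (case mv of (m, v) \<Rightarrow> column_weight (u (Suc j)) p s m (e (Suc j)) * w v)"
      using v(2) e(1) by (simp add: w_def mult.commute)
  next
    fix v assume "v \<in> col_paths p (Suc j) s"
    then have v: "v \<in> {..Suc j} \<rightarrow>\<^sub>E colours p p" "v (Suc j) = s" "\<forall>i\<in>{1..p}. v 0 i = 0" by (auto simp: col_paths_def)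
    have x: "v k = undefined" if "\<not> k \<le> Suc j" for k using v(1) that by (auto simp: PiE_def extensional_def)
    have "(restrict v {..j})(Suc j := s) = v" using v(2) by (intro ext) (auto simp: x restrict_def)
    then show "(case (v j, restrict v {..j}) of (m, v) \<Rightarrow> v(Suc j := s)) = v" by simp
    have "restrict v {..j} \<in> {..j} \<rightarrow>\<^sub>E colours p p" "v j \<in> colours p p"
      using v(1) by (auto simp: PiE_def Pi_def)
    then show "(v j, restrict v {..j}) \<in> Sigma (colours p p) (col_paths p j)"
      using v(3) by (simp add: col_paths_def)
  qed
  finally show ?case .
qed

text \<open>Sums are compared along a relation that is injective both ways and total on the left,
  while unmatched elements on the right have weight 0. A relation suits the purpose because
  fragments and colourings are only shown to exist for each other.\<close>

lemma sum_matching: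
  fixes g :: "'a \<Rightarrow> xypoly"
  assumes T: "finite T" and ex: "\<And>a. a \<in> S \<Longrightarrow> \<exists>b. R a b" and dom: "\<And>a b. R a b \<Longrightarrow> a \<in> S \<and> b \<in> T"
    and u1: "\<And>a b b'. R a b \<Longrightarrow> R a b' \<Longrightarrow> b = b'" and u2: "\<And>a a' b. R a b \<Longrightarrow> R a' b \<Longrightarrow> a = a'"
    and eq: "\<And>a b. R a b \<Longrightarrow> g a = h b" and z: "\<And>b. b \<in> T \<Longrightarrow> (\<And>a. \<not> R a b) \<Longrightarrow> h b = 0"
  shows "sum g S = sum h T"
proof -
  define f where "f a = (SOME b. R a b)" for a
  have f: "R a (f a)" if "a \<in> S" for a unfolding f_def using ex[OF that] by (rule someI_ex)
  have "inj_on f S" using f u2 by (metis inj_onI)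
  then have "sum h (f ` S) = sum g S" using eq[OF f] by (subst sum.reindex) (auto intro: sum.cong)
  moreover have "sum h (f ` S) = sum h T"
  proof (rule sum.mono_neutral_left[OF T])
    show "f ` S \<subseteq> T" using f dom by blast
    show "\<forall>b\<in>T - f ` S. h b = 0"
    proof
      fix b assume b: "b \<in> T - f ` S"
      have "\<not> R a b" for a using b f dom u1 by (metis DiffD2 imageI)
      then show "h b = 0" using z b by blast
    qed
  qed
  ultimately show ?thesis by simp
qed

text \<open>Every pipe reaches the east border, where the colours are prescribed, so a tiling with
  given border colours has no freedom left.\<close>

lemma flow_col_eq_col:
  assumes \<gamma>: "is_clan p q \<gamma>" and u: "upper \<gamma> = {1..p}"
    and fc: "flow_col p q \<pi> c" and bd: "boundary_col p q \<gamma> c" and ab: "a < p" "b \<le> q"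
  shows "c (VEdge (Suc a) b) = matched_tiling.col p q \<pi> (VEdge (Suc a) b)"
proof -
  interpret M: matched_tiling p q \<pi> by unfold_locales (rule flow_col_matched[OF fc])
  have T: "M.T (VEdge (Suc a) b) \<longleftrightarrow> c (VEdge (Suc a) b) \<noteq> 0"
  proof (cases "b < q")
    case True
    then show ?thesis using M.T_box(1)[OF ab(1) True] flow_col_touch(1)[OF fc ab(1) True] by simp
  next
    case False
    show ?thesis
    proof (cases b)
      case 0
      then show ?thesis using M.T_grid(1)[of "Suc a" 0] fc ab by (auto simp: flow_col_def)
    next
      case (Suc b')
      then have "b' < q" using ab by simp
      then show ?thesis using M.T_box(2)[OF ab(1)] flow_col_touch(2)[OF fc ab(1)] Suc by simp
    qed
  qed
  show ?thesis
  proof (cases "M.T (VEdge (Suc a) b)")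
    case True
    then obtain i where i: "i < p" "(VEdge (Suc a) b, VEdge (Suc i) q) \<in> (box_rel p q \<pi>)\<^sup>*" using M.T_exit by blast
    have "c (VEdge (Suc a) b) = c (VEdge (Suc i) q)"
      using flow_col_conn[OF fc] i(2) M.rtrancl_conn by blast
    also have "\<dots> = bcol p \<gamma> (Suc i)" using bd i(1) by (auto simp: boundary_col_def bedge_simps dest: bspec[of _ _ "Suc i"])
    finally have c: "c (VEdge (Suc a) b) = bcol p \<gamma> (Suc i)" .
    have "Suc i \<notin> rights \<gamma>" using upper_facts(2)[OF \<gamma> u, of "Suc i"] i(1) by auto
    then have "bcol p \<gamma> (Suc i) = p - i" using c True T by (auto simp: bcol_def split: if_splits)
    then show ?thesis using c M.col_eq[OF True i] by simp
  next
    case False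
    then show ?thesis using T M.col_0_iff by simp
  qed
qed

text \<open>Only the colours of vertical edges are recorded, because these are the summation indices
  of the transfer matrices.\<close>

definition colours_of :: "nat \<Rightarrow> nat \<Rightarrow> clan \<Rightarrow> (nat \<times> nat \<Rightarrow> tile) \<Rightarrow> (nat \<Rightarrow> nat \<Rightarrow> nat) \<Rightarrow> bool" where
  "colours_of p q \<gamma> \<pi> v \<longleftrightarrow> \<pi> \<in> ({1..p} \<times> {1..q} \<rightarrow>\<^sub>E UNIV) \<and> v \<in> col_paths p q (restrict (bcol p \<gamma>) {1..p}) \<and>
     (\<exists>c. flow_col p q \<pi> c \<and> boundary_col p q \<gamma> c \<and> ordered p q \<pi> c \<and>
       (\<forall>a<p. \<forall>b\<le>q. c (VEdge (Suc a) b) = v b (Suc a)))"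

lemma colours_of_column_flow:
  assumes "colours_of p q \<gamma> \<pi> v" "b < q"
  shows "\<exists>h. column_flow p (\<lambda>a. \<pi> (Suc a, Suc b)) h (v (Suc b)) (v b) \<and> h p = bcol p \<gamma> (p + q - b)"
proof -
  obtain c where c: "flow_col p q \<pi> c" "boundary_col p q \<gamma> c" "ordered p q \<pi> c"
    "\<And>a b. a < p \<Longrightarrow> b \<le> q \<Longrightarrow> c (VEdge (Suc a) b) = v b (Suc a)"
    using assms(1) unfolding colours_of_def by blast
  have "column_flow p (\<lambda>a. \<pi> (Suc a, Suc b)) (\<lambda>a. c (HEdge a (Suc b))) (v (Suc b)) (v b)"
    unfolding column_flow_def
  proof (intro conjI allI impI)
    show "c (HEdge 0 (Suc b)) = 0" using c(1) assms(2) unfolding flow_col_def by blast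
    fix a assume a: "a < p"
    have v: "v b (Suc a) = c (VEdge (Suc a) b)" "v (Suc b) (Suc a) = c (VEdge (Suc a) (Suc b))"
      using c(4)[OF a, of b] c(4)[OF a, of "Suc b"] assms(2) by simp_all
    show "flow (\<pi> (Suc a, Suc b)) (c (HEdge a (Suc b))) (v (Suc b) (Suc a)) (v b (Suc a)) (c (HEdge (Suc a) (Suc b)))"
      unfolding v using c(1) a assms(2) unfolding flow_col_def by blast
    show "v (Suc b) (Suc a) < c (HEdge a (Suc b))" if "\<pi> (Suc a, Suc b) = Cross"
      unfolding v using c(3) a assms(2) that unfolding ordered_def by blast
  qed
  moreover have "c (HEdge p (Suc b)) = bcol p \<gamma> (p + q - b)"
  proof -
    have "p + q - b \<in> {1..p + q}" using assms(2) by simp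
    then have "c (bedge p q (p + q - b)) = bcol p \<gamma> (p + q - b)" using c(2) unfolding boundary_col_def by blast
    then show ?thesis unfolding bedge_simps(2)[OF assms(2)] .
  qed
  ultimately show ?thesis by blast
qed

lemma PiE_rect_eqI:
  assumes "\<pi> \<in> ({1..p} \<times> {1..q} \<rightarrow>\<^sub>E UNIV)" "\<pi>' \<in> ({1..p} \<times> {1..q} \<rightarrow>\<^sub>E UNIV)"
    and "\<And>a b. a < p \<Longrightarrow> b < q \<Longrightarrow> \<pi> (Suc a, Suc b) = \<pi>' (Suc a, Suc b)"
  shows "\<pi> = \<pi>'"
proof (rule PiE_ext[OF assms(1,2)])
  fix x assume x: "x \<in> {1..p} \<times> {1..q}"
  then obtain i j where ij: "x = (i, j)" "1 \<le> i" "i \<le> p" "1 \<le> j" "j \<le> q" by auto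
  then obtain a b where "i = Suc a" "j = Suc b" by (cases i; cases j) auto
  then show "\<pi> x = \<pi>' x" using assms(3) ij by simp
qed

lemma fragment_weight:
  "(\<Prod>(i, j)\<in>{b \<in> {1..p} \<times> {1..q}. \<pi> b = Blank}. Y i - Y (p + q - j + 1)) =
    (\<Prod>b<q. \<Prod>a<p. if \<pi> (Suc a, Suc b) = Blank then Y (Suc a) - Y (Suc (p + q) - Suc b) else 1)"
proof -
  have "(\<Prod>(i, j)\<in>{b \<in> {1..p} \<times> {1..q}. \<pi> b = Blank}. Y i - Y (p + q - j + 1)) =
    (\<Prod>x\<in>{1..p} \<times> {1..q}. if \<pi> x = Blank then (case x of (i, j) \<Rightarrow> Y i - Y (p + q - j + 1)) else 1)"
    by (subst prod.inter_filter) auto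
  also have "\<dots> = (\<Prod>i\<in>{1..p}. \<Prod>j\<in>{1..q}. if \<pi> (i, j) = Blank then Y i - Y (p + q - j + 1) else 1)"
    unfolding prod.cartesian_product by (rule prod.cong) auto
  also have "\<dots> = (\<Prod>j\<in>{1..q}. \<Prod>i\<in>{1..p}. if \<pi> (i, j) = Blank then Y i - Y (p + q - j + 1) else 1)"
    by (rule prod.swap)
  also have "\<dots> = (\<Prod>b<q. \<Prod>a<p. if \<pi> (Suc a, Suc b) = Blank then Y (Suc a) - Y (p + q - Suc b + 1) else 1)"
    unfolding One_nat_def prod.atLeast1_atMost_eq ..
  also have "\<dots> = (\<Prod>b<q. \<Prod>a<p. if \<pi> (Suc a, Suc b) = Blank then Y (Suc a) - Y (Suc (p + q) - Suc b) else 1)"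
  proof (intro prod.cong refl)
    fix a b assume "b \<in> {..<q}"
    then have "p + q - Suc b + 1 = Suc (p + q) - Suc b" by auto
    then show "(if \<pi> (Suc a, Suc b) = Blank then Y (Suc a) - Y (p + q - Suc b + 1) else 1) =
      (if \<pi> (Suc a, Suc b) = Blank then Y (Suc a) - Y (Suc (p + q) - Suc b) else 1)" by simp
  qed
  finally show ?thesis .
qed

lemma frag_poly_eq_transfer_poly:
  assumes \<gamma>: "is_clan p q \<gamma>" and u: "upper \<gamma> = {1..p}"
  shows "frag_poly p q \<gamma> Y = transfer_poly p q \<gamma>"
proof -
  define s where "s = restrict (bcol p \<gamma>) {1..p}"
  have s: "s \<in> colours p p" using bcol_le[OF \<gamma> u] by (auto simp: s_def colours_def)
  define h where "h v = (\<Prod>b<q. column_weight (Y (Suc (p + q) - Suc b)) p (v (Suc b)) (v b) (bcol p \<gamma> (Suc (p + q) - Suc b)))"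
    for v :: "nat \<Rightarrow> nat \<Rightarrow> nat"
  have "transfer_poly p q \<gamma> = sum h (col_paths p q s)"
    unfolding transfer_poly_def s_def[symmetric] transfer_unroll[OF s] h_def ..
  moreover have "frag_poly p q \<gamma> Y = sum h (col_paths p q s)"
    unfolding frag_poly_def diagram_eq[OF \<gamma> u] fragment_weight
  proof (rule sum_matching[where R = "colours_of p q \<gamma>"])
    show "finite (col_paths p q s)" by (rule finite_col_paths)
    show "\<pi> \<in> bpd_fragments p q \<gamma> \<and> v \<in> col_paths p q s" if "colours_of p q \<gamma> \<pi> v" for \<pi> v
      using that fragment_of_colouring[OF \<gamma> u] unfolding colours_of_def s_def by blast
  next
    fix \<pi> assume \<pi>: "\<pi> \<in> bpd_fragments p q \<gamma>"
    then have \<pi>': "\<pi> \<in> ({1..p} \<times> {1..q} \<rightarrow>\<^sub>E UNIV)" unfolding bpd_fragments_iff[OF \<gamma> u] by blast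
    obtain c where c: "flow_col p q \<pi> c" "boundary_col p q \<gamma> c" "ordered p q \<pi> c"
      using colouring_of_fragment[OF \<gamma> u \<pi>] by blast
    interpret M: matched_tiling p q \<pi> by unfold_locales (rule flow_col_matched[OF c(1)])
    define v where "v = (\<lambda>b\<in>{..q}. \<lambda>i\<in>{1..p}. c (VEdge i b))"
    have cp: "c (VEdge i b) \<le> p" if i: "i \<in> {1..p}" and b: "b \<le> q" for i b
    proof -
      obtain a where a: "i = Suc a" "a < p" using i by (cases i) auto
      have "M.col e \<le> p" for e by (simp add: M.col_def)
      then show ?thesis using flow_col_eq_col[OF \<gamma> u c(1,2) a(2) b] a by simp
    qed
    have v1: "v \<in> {..q} \<rightarrow>\<^sub>E colours p p" unfolding v_def colours_def using cp by auto
    have "c (VEdge i q) = bcol p \<gamma> i" if i: "i \<in> {1..p}" for i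
    proof -
      obtain a where a: "i = Suc a" "a < p" using i by (cases i) auto
      have "i \<in> {1..p + q}" using i by simp
      then have "c (bedge p q i) = bcol p \<gamma> i" using c(2) unfolding boundary_col_def by blast
      then show ?thesis using bedge_simps(1)[OF a(2)] a by simp
    qed
    then have v2: "v q = s" unfolding v_def s_def by (auto simp: restrict_def)
    have "c (VEdge i 0) = 0" if i: "i \<in> {1..p}" for i
    proof -
      obtain a where a: "i = Suc a" "a < p" using i by (cases i) auto
      then show ?thesis using c(1) unfolding flow_col_def by simp
    qed
    then have v3: "\<forall>i\<in>{1..p}. v 0 i = 0" by (simp add: v_def)
    have "colours_of p q \<gamma> \<pi> v" unfolding colours_of_def
      using \<pi>' v1 v2 v3 c by (auto simp: col_paths_def s_def v_def intro!: exI[of _ c])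
    then show "\<exists>v. colours_of p q \<gamma> \<pi> v" by blast
  next
    fix \<pi> v v' assume A: "colours_of p q \<gamma> \<pi> v" "colours_of p q \<gamma> \<pi> v'"
    have val: "v b (Suc a) = matched_tiling.col p q \<pi> (VEdge (Suc a) b)"
      if "colours_of p q \<gamma> \<pi> v" "a < p" "b \<le> q" for v a b
      using that flow_col_eq_col[OF \<gamma> u] unfolding colours_of_def by metis
    have P: "v \<in> {..q} \<rightarrow>\<^sub>E colours p p" "v' \<in> {..q} \<rightarrow>\<^sub>E colours p p"
      using A unfolding colours_of_def col_paths_def by blast+
    show "v = v'"
    proof (rule PiE_ext[OF P])
      fix b assume b: "b \<in> {..q}"
      have "v b \<in> colours p p" "v' b \<in> colours p p" using P b by (auto dest: PiE_mem)
      then show "v b = v' b" unfolding colours_def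
      proof (rule PiE_ext)
        fix i assume "i \<in> {1..p}"
        then obtain a where a: "i = Suc a" "a < p" by (cases i) auto
        then show "v b i = v' b i" using val[OF A(1), of a b] val[OF A(2), of a b] b by simp
      qed
    qed
  next
    fix \<pi> \<pi>' v assume A: "colours_of p q \<gamma> \<pi> v" "colours_of p q \<gamma> \<pi>' v"
    show "\<pi> = \<pi>'"
    proof (rule PiE_rect_eqI)
      show "\<pi> \<in> ({1..p} \<times> {1..q} \<rightarrow>\<^sub>E UNIV)" "\<pi>' \<in> ({1..p} \<times> {1..q} \<rightarrow>\<^sub>E UNIV)"
        using A unfolding colours_of_def by blast+
      fix a b assume ab: "a < p" "b < q"
      obtain h h' where "column_flow p (\<lambda>a. \<pi> (Suc a, Suc b)) h (v (Suc b)) (v b)"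
          "column_flow p (\<lambda>a. \<pi>' (Suc a, Suc b)) h' (v (Suc b)) (v b)"
        using colours_of_column_flow[OF A(1) ab(2)] colours_of_column_flow[OF A(2) ab(2)] by blast
      from column_flow_unique[OF this ab(1)] show "\<pi> (Suc a, Suc b) = \<pi>' (Suc a, Suc b)" .
    qed
  next
    fix \<pi> v assume A: "colours_of p q \<gamma> \<pi> v"
    show "(\<Prod>b<q. \<Prod>a<p. if \<pi> (Suc a, Suc b) = Blank then Y (Suc a) - Y (Suc (p + q) - Suc b) else 1) = h v"
      unfolding h_def
    proof (rule prod.cong[OF refl])
      fix b assume "b \<in> {..<q}"
      then have b: "b < q" by simp
      obtain h where h: "column_flow p (\<lambda>a. \<pi> (Suc a, Suc b)) h (v (Suc b)) (v b)" "h p = bcol p \<gamma> (p + q - b)"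
        using colours_of_column_flow[OF A b] by blast
      from column_weight_flow[OF h(1), of "Y (Suc (p + q) - Suc b)"] h(2)
      show "(\<Prod>a<p. if \<pi> (Suc a, Suc b) = Blank then Y (Suc a) - Y (Suc (p + q) - Suc b) else 1) =
        column_weight (Y (Suc (p + q) - Suc b)) p (v (Suc b)) (v b) (bcol p \<gamma> (Suc (p + q) - Suc b))"
        unfolding diff_Suc_Suc by simp
    qed
  next
    fix v assume v: "v \<in> col_paths p q s" and none: "\<And>\<pi>. \<not> colours_of p q \<gamma> \<pi> v"
    show "h v = 0"
    proof (rule ccontr)
      assume "h v \<noteq> 0"
      \<comment> \<open>All columns have nonzero weight, so each of them can be tiled. Neighbouring
        columns share the colours \<open>v b\<close>, hence the tilings fit together.\<close>
      then have "\<forall>b\<in>{..<q}. \<exists>t h. column_flow p t h (v (Suc b)) (v b) \<and> h p = bcol p \<gamma> (Suc (p + q) - Suc b)"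
        unfolding h_def prod_zero_iff[OF finite_lessThan] using column_weight_nonzero by blast
      then obtain t where "\<forall>b\<in>{..<q}. \<exists>h. column_flow p (t b) h (v (Suc b)) (v b) \<and> h p = bcol p \<gamma> (Suc (p + q) - Suc b)"
        by (rule bchoice[THEN exE])
      then obtain h where th: "\<forall>b\<in>{..<q}. column_flow p (t b) (h b) (v (Suc b)) (v b) \<and> h b p = bcol p \<gamma> (Suc (p + q) - Suc b)"
        by (rule bchoice[THEN exE])
      define \<pi> where "\<pi> = (\<lambda>x\<in>{1..p} \<times> {1..q}. t (snd x - 1) (fst x - 1))"
      define c where "c e = (case e of VEdge i b \<Rightarrow> v b i | HEdge a j \<Rightarrow> h (j - 1) a)" for e
      have \<pi>: "\<pi> (Suc a, Suc b) = t b a" if "a < p" "b < q" for a b using that by (simp add: \<pi>_def One_nat_def)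
      have cf: "column_flow p (t b) (h b) (v (Suc b)) (v b)" "h b p = bcol p \<gamma> (Suc (p + q) - Suc b)" if "b < q" for b
        using th that by simp_all
      have cV: "c (VEdge i b) = v b i" and cH: "c (HEdge a (Suc b)) = h b a" for i a b by (simp_all add: c_def One_nat_def)
      have "flow_col p q \<pi> c"
        unfolding flow_col_def
      proof (intro conjI allI impI)
        fix a b assume ab: "a < p" "b < q"
        show "flow (\<pi> (Suc a, Suc b)) (c (HEdge a (Suc b))) (c (VEdge (Suc a) (Suc b))) (c (VEdge (Suc a) b)) (c (HEdge (Suc a) (Suc b)))"
          unfolding cV cH \<pi>[OF ab] using cf(1)[OF ab(2)] ab(1) unfolding column_flow_def by blast
      next
        fix b assume "b < q"
        then show "c (HEdge 0 (Suc b)) = 0" unfolding cH using cf(1) unfolding column_flow_def by blast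
      next
        fix a assume "a < p"
        then have "Suc a \<in> {1..p}" by simp
        then show "c (VEdge (Suc a) 0) = 0" unfolding cV using v unfolding col_paths_def by blast
      qed
      moreover have "ordered p q \<pi> c"
        unfolding ordered_def
      proof (intro allI impI)
        fix a b assume ab: "a < p" "b < q" and C: "\<pi> (Suc a, Suc b) = Cross"
        show "c (VEdge (Suc a) (Suc b)) < c (HEdge a (Suc b))"
          unfolding cV cH using cf(1)[OF ab(2)] ab(1) C unfolding \<pi>[OF ab] column_flow_def by blast
      qed
      moreover have "boundary_col p q \<gamma> c"
        unfolding boundary_col_def
      proof
        fix k assume k: "k \<in> {1..p + q}"
        show "c (bedge p q k) = bcol p \<gamma> k"
        proof (cases "k \<le> p")
          case True
          have "v q = s" using v by (simp add: col_paths_def)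
          then show ?thesis using True k by (simp add: bedge_def cV s_def)
        next
          case False
          define b where "b = p + q - k"
          have b: "b < q" "k = p + q - b" using False k by (auto simp: b_def)
          show ?thesis unfolding b(2) bedge_simps(2)[OF b(1)] cH cf(2)[OF b(1)] diff_Suc_Suc ..
        qed
      qed
      moreover have "\<pi> \<in> ({1..p} \<times> {1..q} \<rightarrow>\<^sub>E UNIV)" by (simp add: \<pi>_def)
      ultimately have "colours_of p q \<gamma> \<pi> v" unfolding colours_of_def using v cV s_def by auto
      then show False using none by blast
    qed
  qed
  ultimately show ?thesis by simp
qed

section \<open>The expansion\<close>

text \<open>A letter that does not raise the length gives 0, and since no letter raises it by more
  than 1, the deficit is never made up.\<close>

lemma divided_diffs_Phi:
  assumes "is_clan p q \<gamma>" "set is \<subseteq> {1..<p + q}"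
  shows "is_clan p q (foldr s_act is \<gamma>) \<and> clan_length (foldr s_act is \<gamma>) - clan_length \<gamma> \<le> int (length is) \<and>
    foldr divided_diff is (Phi (p + q) \<gamma>) =
      (if clan_length (foldr s_act is \<gamma>) - clan_length \<gamma> = int (length is) then Phi (p + q) (foldr s_act is \<gamma>) else 0)"
  using assms(2)
proof (induction "is")
  case Nil
  then show ?case using assms(1) by simp
next
  case (Cons i "is")
  define \<delta> where "\<delta> = foldr s_act is \<gamma>"
  have i: "1 \<le> i" "i < p + q" using Cons.prems by auto
  have IH: "is_clan p q \<delta>" "clan_length \<delta> - clan_length \<gamma> \<le> int (length is)"
    "foldr divided_diff is (Phi (p + q) \<gamma>) = (if clan_length \<delta> - clan_length \<gamma> = int (length is) then Phi (p + q) \<delta> else 0)"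
    unfolding \<delta>_def using Cons by simp_all
  have le: "clan_length (s_act i \<delta>) \<le> clan_length \<delta> + 1" by (rule clan_length_s_act_le[OF IH(1) i])
  have "foldr divided_diff (i # is) (Phi (p + q) \<gamma>) =
    (if clan_length (s_act i \<delta>) - clan_length \<gamma> = int (length (i # is)) then Phi (p + q) (s_act i \<delta>) else 0)"
    using IH(2) le divided_diff_Phi[OF IH(1) i] by (auto simp: IH(3))
  then show ?case using is_clan_s_act[OF IH(1) i] IH(2) le unfolding foldr.simps o_apply \<delta>_def[symmetric] by simp
qed

theorem theoremB:
  fixes p q n :: nat and \<gamma> :: clan
  assumes "p \<ge> 1" and "q \<ge> 1" and "n = p + q" and "is_clan p q \<gamma>"
  shows "Upsilon p q \<gamma> =
    (\<Sum>w | w permutes {1..n}.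
       (let \<gamma>' = hecke_act n w \<gamma> in
          if v_perm p q \<gamma>' = id \<and> clan_length \<gamma>' - clan_length \<gamma> = int (perm_length n w)
          then frag_poly p q \<gamma>' Y else 0)
       * dschubert n Y w)"
proof -
  note n = assms(3) and \<gamma> = assms(4)
  \<comment> \<open>The staircase bound holds for the matchless product and survives divided
    differences.\<close>
  have "xdeg i (Phi n \<gamma>) \<le> n - i" if "1 \<le> i" "i \<le> n" for i
    unfolding Phi_def using that xdeg_dd_inv_stair[OF pos_permutes[OF \<gamma>]] xdeg_matchless
      pos_upper_subset[OF \<gamma>] n by metis
  from dschubert_interpolation[OF this]
  have "Upsilon p q \<gamma> = (\<Sum>w | w permutes {1..n}. ev n id (dd n w (Phi n \<gamma>)) * dschubert n Y w)"
    unfolding Upsilon_eq_Phi[OF \<gamma>] n .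
  also have "\<dots> = (\<Sum>w | w permutes {1..n}.
       (let \<gamma>' = hecke_act n w \<gamma> in
          if v_perm p q \<gamma>' = id \<and> clan_length \<gamma>' - clan_length \<gamma> = int (perm_length n w)
          then frag_poly p q \<gamma>' Y else 0)
       * dschubert n Y w)"
  proof (rule sum.cong[OF refl])
    fix w assume "w \<in> {w. w permutes {1..n}}"
    then have w: "w permutes {1..n}" by simp
    \<comment> \<open>The word chosen in \<open>hecke_act\<close>. It also computes
      \<open>dd n w\<close>, so the action and the operator run in parallel.\<close>
    define ws where "ws = (SOME is. reduced_word n w is)"
    define \<delta> where "\<delta> = hecke_act n w \<gamma>"
    have ws: "reduced_word n w ws" unfolding ws_def using reduced_word_exists[OF w] by (rule someI_ex)
    have \<delta>: "\<delta> = foldr s_act ws \<gamma>" by (simp add: \<delta>_def hecke_act_def ws_def)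
    have len: "length ws = perm_length n w" and sub: "set ws \<subseteq> {1..<p + q}"
      using ws by (auto simp: reduced_word_def n)
    note D = divided_diffs_Phi[OF \<gamma> sub, folded \<delta> n]
    have "ev n id (dd n w (Phi n \<gamma>)) =
      (if v_perm p q \<delta> = id \<and> clan_length \<delta> - clan_length \<gamma> = int (perm_length n w) then frag_poly p q \<delta> Y else 0)"
    proof (cases "clan_length \<delta> - clan_length \<gamma> = int (perm_length n w)")
      case True
      have cl: "is_clan p q \<delta>" using D by blast
      have e: "dd n w (Phi n \<gamma>) = Phi n \<delta>" unfolding reduced_word_dd[OF ws] using D True len by simp
      show ?thesis
      proof (cases "upper \<delta> = {1..p}")
        case u: True
        then show ?thesis
          using True v_perm_id_iff[OF cl] ev_Phi_transfer_poly[OF cl u] frag_poly_eq_transfer_poly[OF cl u]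
          unfolding e unfolding n by simp
      next
        case False
        then show ?thesis using v_perm_id_iff[OF cl] ev_id_Phi_eq_0[OF cl] unfolding e unfolding n by simp
      qed
    next
      case False
      then have "dd n w (Phi n \<gamma>) = 0" unfolding reduced_word_dd[OF ws] using D len by simp
      then show ?thesis using False by auto
    qed
    then show "ev n id (dd n w (Phi n \<gamma>)) * dschubert n Y w =
      (let \<gamma>' = hecke_act n w \<gamma> in
          if v_perm p q \<gamma>' = id \<and> clan_length \<gamma>' - clan_length \<gamma> = int (perm_length n w)
          then frag_poly p q \<gamma>' Y else 0) * dschubert n Y w"
      by (simp add: \<delta>_def Let_def)
  qed
  finally show ?thesis .
qed

end
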